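(* Let $(X,\mathfrak m,\mathscr E,\mathscr F(X))$ be a locally smoothing strongly local Dirichlet space, let $\lambda\ge 0$ and let $f\in L^1_{\mathrm{loc}}(X,\mathfrak m)$ be locally $\lambda$-shift defective. Then for every $c\ge 0$ and $q>1$ one has $(f-c)_+^{q/2}\in\mathscr F_{\mathrm{loc}}(X)$, and for $q\ge 2$ this function is weakly subharmonic.
   Context: Function spaces are real; inequalities between classes of functions hold $\mathfrak m$-a.e.; $u_+=\max(u,0)$. A strongly local Dirichlet space is a quadruple $(X,\mathfrak m,\mathscr E,\mathscr F(X))$, where $X$ is a locally compact, separable, metrizable space, $\mathfrak m$ is a Radon measure on $X$ with full support, and $\mathscr E$ is a closed, symmetric, nonnegative bilinear form in $L^2(X,\mathfrak m)$ with dense domain $\mathscr F(X)$ such that: (Markov) for all contractions $T:\mathbb R\to\mathbb R$ with $T(0)=0$ and $f\in\mathscr F(X)$ one has $T\circ f\in\mathscr F(X)$ and $\mathscr E(T\circ f,T\circ f)\le\mathscr E(f,f)$; (regular) $\mathscr F(X)\cap C_c(X)$ is dense in $C_c(X)$ w.r.t. $\|\cdot\|_\infty$ and in $\mathscr F(X)$ w.r.t. $\mathscr E_1(u,v)=\mathscr E(u,v)+\int uv\,d\mathfrak m$; (strongly local) $\mathscr E(u,v)=0$ whenever $u,v\in\mathscr F(X)$ and $u$ is constant on the support of $v$. For open $U,V\subset X$, $U\Subset V$ means that $\overline U$ is a compact subset of $X$ with $\overline U\subset V$. $\mathscr F_{\mathrm{loc}}(X)$ is the set of $f\in L^2_{\mathrm{loc}}(X,\mathfrak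 m)$ such that for every open $U\Subset X$ there is $h\in\mathscr F(X)$ with $f=h$ on $U$; $\mathscr F_c(X)$ is the set of elements of $\mathscr F(X)$ with compact $\mathfrak m$-support. $\mathscr E$ extends to $\mathscr F_{\mathrm{loc}}(X)\times\mathscr F_c(X)$ by $\mathscr E(f,\phi):=\mathscr E(h,\phi)$ with $h\in\mathscr F(X)$ equal to $f$ in an open neighbourhood of the support of $\phi$; $\mathscr E_\lambda(u,v):=\mathscr E(u,v)+\lambda\int uv\,d\mathfrak m$. A function $f\in\mathscr F_{\mathrm{loc}}(X)$ is weakly $\lambda$-subharmonic if $\mathscr E_\lambda(f,\phi)\le 0$ for all $0\le\phi\in\mathscr F_c(X)$, and weakly $\lambda$-harmonic if both $f$ and $-f$ are weakly $\lambda$-subharmonic. The prefix $\lambda$ is dropped if $\lambda=0$. $H\ge0$ is the self-adjoint operator in $L^2(X,\mathfrak m)$ induced by $\mathscr E$, and $P_t=e^{-tH}$, extended consistently to a positivity preserving contraction semigroup on all $L^q(X,\mathfrak m)$, $q\in[1,\infty]$. For open $U\subset X$, $\mathscr F(U)$ is the closure of $C_c(U)\cap\mathscr F(X)$ w.r.t. $\mathscr E_1$; then $(U,\mathfrak m,\mathscr E,\mathscr F(U))$ is again a strongly local Dirichlet space, with semigroup denoted $P^U_t$; notions "on $U$" refer to this space. For $f\in\mathscr F(X)\cap L^\infty$ the energy measure $\Gamma(f)$ is defined by $\int\phi\,d\Gamma(f)=\mathscr E(f,\phi f)-\frac12\mathscr E(f^2,\phi)$ for $\phi\in\mathscr F(X)\cap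 C_c(X)$; it extends to $\mathscr F(X)$ and, by locality, to $\mathscr F_{\mathrm{loc}}(X)$. The space is: ultracontractive if $P_t(L^1(X,\mathfrak m))\subset L^\infty(X,\mathfrak m)$ for all $t>0$; doubly Feller if $P_t:C_0(X)\to C_0(X)$ for all $t\ge0$, $P_t:L^\infty(X,\mathfrak m)\to C(X)$ for all $t>0$, and $\lim_{t\to0+}P_tf(x)=f(x)$ for all $f\in C_0(X)$, $x\in X$ ($C_0$ = continuous functions vanishing at infinity); irreducible if every $f\in\mathscr F_{\mathrm{loc}}(X)$ with $\Gamma(f)=0$ is constant. It is locally smoothing if for every open $U\Subset X$: $(U,\mathfrak m,\mathscr E,\mathscr F(U))$ is ultracontractive, and there is an open $U'\subset X$ with $U\subset U'$, $U'\setminus\overline U\ne\emptyset$, such that $(U',\mathfrak m,\mathscr E,\mathscr F(U'))$ is doubly Feller and irreducible. A function $f\in L^1_{\mathrm{loc}}(X,\mathfrak m)$ is locally $\lambda$-shift defective if for every open $U\Subset X$ there is a weakly $\lambda$-harmonic $g\in C_b(U)$ on $U$ with $e^{-t\lambda}P^U_t(f|_U-g)\ge f|_U-g$ for all $t>0$. *)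

theory Defs
  imports "HOL-Analysis.Analysis"
begin

section \<open>Function spaces and measures on an abstract topological space\<close>

text \<open>Elements of $L^q$ are represented by Borel functions rather than by classes modulo
  a.e. equality; accordingly every identity or inequality between them is stated a.e.\<close>

definition L1 :: "'a measure \<Rightarrow> ('a \<Rightarrow> real) set" where
  "L1 M = {f. integrable M f}"

definition L2 :: "'a measure \<Rightarrow> ('a \<Rightarrow> real) set" where
  "L2 M = {f \<in> borel_measurable M. integrable M (\<lambda>x. (f x)\<^sup>2)}"

definition Linf :: "'a measure \<Rightarrow> ('a \<Rightarrow> real) set" where
  "Linf M = {f \<in> borel_measurable M. \<exists>C. AE x in M. \<bar>f x\<bar> \<le> C}"

definition L2_norm2 :: "'a measure \<Rightarrow> ('a \<Rightarrow> real) \<Rightarrow> real" where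
  "L2_norm2 M f = (\<integral>x. (f x)\<^sup>2 \<partial>M)"

definition L1_loc :: "'a topology \<Rightarrow> 'a measure \<Rightarrow> ('a \<Rightarrow> real) set" where
  "L1_loc X M = {f \<in> borel_measurable M. \<forall>K. compactin X K \<longrightarrow> set_integrable M K f}"

definition L2_loc :: "'a topology \<Rightarrow> 'a measure \<Rightarrow> ('a \<Rightarrow> real) set" where
  "L2_loc X M = {f \<in> borel_measurable M. \<forall>K. compactin X K \<longrightarrow> set_integrable M K (\<lambda>x. (f x)\<^sup>2)}"

definition C_all :: "'a topology \<Rightarrow> ('a \<Rightarrow> real) set" where
  "C_all X = {f. continuous_map X euclideanreal f}"

definition C_b :: "'a topology \<Rightarrow> ('a \<Rightarrow> real) set" where
  "C_b X = {f \<in> C_all X. bounded (f ` topspace X)}"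

definition C_0 :: "'a topology \<Rightarrow> ('a \<Rightarrow> real) set" where
  "C_0 X = {f \<in> C_all X. \<forall>\<epsilon>>0. compactin X {x \<in> topspace X. \<bar>f x\<bar> \<ge> \<epsilon>}}"

definition tsupp :: "'a topology \<Rightarrow> ('a \<Rightarrow> real) \<Rightarrow> 'a set" where
  "tsupp X f = X closure_of {x \<in> topspace X. f x \<noteq> 0}"

definition C_c :: "'a topology \<Rightarrow> ('a \<Rightarrow> real) set" where
  "C_c X = {f \<in> C_all X. compactin X (tsupp X f)}"

definition msupp :: "'a topology \<Rightarrow> 'a measure \<Rightarrow> ('a \<Rightarrow> real) \<Rightarrow> 'a set" where
  "msupp X M f = topspace X - \<Union>{V. openin X V \<and> (AE x in M. x \<in> V \<longrightarrow> f x = 0)}"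

definition radon_measure :: "'a topology \<Rightarrow> 'a measure \<Rightarrow> bool" where
  "radon_measure X M \<longleftrightarrow>
     space M = topspace X \<and>
     sets M = sigma_sets (topspace X) {V. openin X V} \<and>
     (\<forall>K. compactin X K \<longrightarrow> emeasure M K < \<infinity>) \<and>
     (\<forall>A\<in>sets M. emeasure M A = (SUP K\<in>{K. compactin X K \<and> K \<subseteq> A}. emeasure M K))"

definition full_support :: "'a topology \<Rightarrow> 'a measure \<Rightarrow> bool" where
  "full_support X M \<longleftrightarrow> (\<forall>V. openin X V \<and> V \<noteq> {} \<longrightarrow> emeasure M V > 0)"

definition rel_compact_open :: "'a topology \<Rightarrow> 'a set \<Rightarrow> bool" where
  "rel_compact_open X U \<longleftrightarrow> openin X U \<and> compactin X (X closure_of U)"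


section \<open>Strongly local Dirichlet spaces\<close>

record 'a form_space =
  Top :: "'a topology"
  Meas :: "'a measure"
  form :: "('a \<Rightarrow> real) \<Rightarrow> ('a \<Rightarrow> real) \<Rightarrow> real"
  dom :: "('a \<Rightarrow> real) set"

definition form1 :: "'a form_space \<Rightarrow> ('a \<Rightarrow> real) \<Rightarrow> ('a \<Rightarrow> real) \<Rightarrow> real" where
  "form1 D u v = form D u v + (\<integral>x. u x * v x \<partial>Meas D)"

text \<open>The second conjunct says that the domain and the form are well defined on classes
  modulo a.e. equality.\<close>

definition nonneg_symmetric_form :: "'a form_space \<Rightarrow> bool" where
  "nonneg_symmetric_form D \<longleftrightarrow>
     dom D \<subseteq> L2 (Meas D) \<and>
     (\<forall>u\<in>dom D. \<forall>u'\<in>borel_measurable (Meas D). (AE x in Meas D. u x = u' x) \<longrightarrow>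
        u' \<in> dom D \<and> (\<forall>v\<in>dom D. form D u' v = form D u v)) \<and>
     (\<forall>u\<in>dom D. \<forall>v\<in>dom D. \<forall>a b. (\<lambda>x. a * u x + b * v x) \<in> dom D \<and>
        (\<forall>w\<in>dom D. form D (\<lambda>x. a * u x + b * v x) w = a * form D u w + b * form D v w)) \<and>
     (\<forall>u\<in>dom D. \<forall>v\<in>dom D. form D u v = form D v u) \<and>
     (\<forall>u\<in>dom D. form D u u \<ge> 0)"

definition densely_defined :: "'a form_space \<Rightarrow> bool" where
  "densely_defined D \<longleftrightarrow>
     (\<forall>f\<in>L2 (Meas D). \<forall>\<epsilon>>0. \<exists>u\<in>dom D. L2_norm2 (Meas D) (\<lambda>x. f x - u x) < \<epsilon>)"

definition closed_form :: "'a form_space \<Rightarrow> bool" where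
  "closed_form D \<longleftrightarrow>
     (\<forall>u. (\<forall>n::nat. u n \<in> dom D) \<and>
        (\<forall>\<epsilon>>0. \<exists>N. \<forall>m\<ge>N. \<forall>n\<ge>N. form1 D (\<lambda>x. u m x - u n x) (\<lambda>x. u m x - u n x) < \<epsilon>) \<longrightarrow>
        (\<exists>v\<in>dom D. (\<lambda>n. form1 D (\<lambda>x. u n x - v x) (\<lambda>x. u n x - v x)) \<longlonglongrightarrow> 0))"

definition markov_form :: "'a form_space \<Rightarrow> bool" where
  "markov_form D \<longleftrightarrow>
     (\<forall>T :: real \<Rightarrow> real. (\<forall>s t. \<bar>T s - T t\<bar> \<le> \<bar>s - t\<bar>) \<and> T 0 = 0 \<longrightarrow>
        (\<forall>f\<in>dom D. T \<circ> f \<in> dom D \<and> form D (T \<circ> f) (T \<circ> f) \<le> form D f f))"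

definition regular_form :: "'a form_space \<Rightarrow> bool" where
  "regular_form D \<longleftrightarrow>
     (\<forall>f\<in>C_c (Top D). \<forall>\<epsilon>>0. \<exists>g\<in>dom D \<inter> C_c (Top D). \<forall>x\<in>topspace (Top D). \<bar>f x - g x\<bar> \<le> \<epsilon>) \<and>
     (\<forall>f\<in>dom D. \<forall>\<epsilon>>0. \<exists>g\<in>dom D \<inter> C_c (Top D).
        form1 D (\<lambda>x. f x - g x) (\<lambda>x. f x - g x) < \<epsilon>)"

definition strongly_local_form :: "'a form_space \<Rightarrow> bool" where
  "strongly_local_form D \<longleftrightarrow>
     (\<forall>u\<in>dom D. \<forall>v\<in>dom D.
        (\<exists>c. AE x in Meas D. x \<in> msupp (Top D) (Meas D) v \<longrightarrow> u x = c) \<longrightarrow> form D u v = 0)"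

definition strongly_local_dirichlet_space :: "'a form_space \<Rightarrow> bool" where
  "strongly_local_dirichlet_space D \<longleftrightarrow>
     locally_compact_space (Top D) \<and> separable_space (Top D) \<and> metrizable_space (Top D) \<and>
     radon_measure (Top D) (Meas D) \<and> full_support (Top D) (Meas D) \<and>
     nonneg_symmetric_form D \<and> densely_defined D \<and> closed_form D \<and>
     markov_form D \<and> regular_form D \<and> strongly_local_form D"

text \<open>The space $(U, m, E, F(U))$ for open $U$. A function on $U$ is given by an arbitrary
  total function of which only the values on $U$ matter; it is identified with its extension
  by zero, on which the original form is evaluated. The functions \<open>\<phi>\<close> below are those of
  $C_c(U) \cap F(X)$, whose $E_1$-closure is $F(U)$.\<close>

definition zero_ext :: "'a set \<Rightarrow> ('a \<Rightarrow> real) \<Rightarrow> 'a \<Rightarrow> real" where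
  "zero_ext U f = (\<lambda>x. if x \<in> U then f x else 0)"

definition restrict_form_space :: "'a form_space \<Rightarrow> 'a set \<Rightarrow> 'a form_space" where
  "restrict_form_space D U = \<lparr>
     Top = subtopology (Top D) U,
     Meas = restrict_space (Meas D) U,
     form = (\<lambda>u v. form D (zero_ext U u) (zero_ext U v)),
     dom = {f. zero_ext U f \<in> dom D \<and>
       (\<forall>\<epsilon>>0. \<exists>\<phi>\<in>dom D \<inter> C_c (Top D). tsupp (Top D) \<phi> \<subseteq> U \<and>
          form1 D (\<lambda>x. zero_ext U f x - \<phi> x) (\<lambda>x. zero_ext U f x - \<phi> x) < \<epsilon>)}\<rparr>"


section \<open>Local domains and weakly subharmonic functions\<close>

definition dom_loc :: "'a form_space \<Rightarrow> ('a \<Rightarrow> real) set" where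
  "dom_loc D = {f \<in> L2_loc (Top D) (Meas D). \<forall>U. rel_compact_open (Top D) U \<longrightarrow>
     (\<exists>h\<in>dom D. AE x in Meas D. x \<in> U \<longrightarrow> f x = h x)}"

definition dom_c :: "'a form_space \<Rightarrow> ('a \<Rightarrow> real) set" where
  "dom_c D = {\<phi> \<in> dom D. compactin (Top D) (msupp (Top D) (Meas D) \<phi>)}"

text \<open>By strong locality the value does not depend on the choice of $h$.\<close>

definition form_loc :: "'a form_space \<Rightarrow> ('a \<Rightarrow> real) \<Rightarrow> ('a \<Rightarrow> real) \<Rightarrow> real" where
  "form_loc D f \<phi> = form D (SOME h. h \<in> dom D \<and>
     (\<exists>V. openin (Top D) V \<and> msupp (Top D) (Meas D) \<phi> \<subseteq> V \<and>
        (AE x in Meas D. x \<in> V \<longrightarrow> f x = h x))) \<phi>"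

definition form_loc_shift :: "'a form_space \<Rightarrow> real \<Rightarrow> ('a \<Rightarrow> real) \<Rightarrow> ('a \<Rightarrow> real) \<Rightarrow> real" where
  "form_loc_shift D lam f \<phi> = form_loc D f \<phi> + lam * (\<integral>x. f x * \<phi> x \<partial>Meas D)"

definition weakly_subharmonic :: "'a form_space \<Rightarrow> real \<Rightarrow> ('a \<Rightarrow> real) \<Rightarrow> bool" where
  "weakly_subharmonic D lam f \<longleftrightarrow> f \<in> dom_loc D \<and>
     (\<forall>\<phi>\<in>dom_c D. (AE x in Meas D. 0 \<le> \<phi> x) \<longrightarrow> form_loc_shift D lam f \<phi> \<le> 0)"

definition weakly_harmonic :: "'a form_space \<Rightarrow> real \<Rightarrow> ('a \<Rightarrow> real) \<Rightarrow> bool" where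
  "weakly_harmonic D lam f \<longleftrightarrow>
     weakly_subharmonic D lam f \<and> weakly_subharmonic D lam (\<lambda>x. - f x)"


section \<open>The heat semigroup\<close>

text \<open>The graph of the self-adjoint operator $H$ induced by the form: $f$ lies in the domain
  of $H$ and $Hf = h$.\<close>

definition form_operator :: "'a form_space \<Rightarrow> ('a \<Rightarrow> real) \<Rightarrow> ('a \<Rightarrow> real) \<Rightarrow> bool" where
  "form_operator D f h \<longleftrightarrow> f \<in> dom D \<and> h \<in> L2 (Meas D) \<and>
     (\<forall>v\<in>dom D. form D f v = (\<integral>x. h x * v x \<partial>Meas D))"

text \<open>Strongly continuous semigroups $P$ of bounded linear operators on $L^2$.\<close>

definition C0_semigroup :: "'a measure \<Rightarrow> (real \<Rightarrow> ('a \<Rightarrow> real) \<Rightarrow> 'a \<Rightarrow> real) \<Rightarrow> bool" where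
  "C0_semigroup M P \<longleftrightarrow>
     (\<forall>t\<ge>0. \<forall>f\<in>L2 M. P t f \<in> L2 M) \<and>
     (\<forall>t\<ge>0. \<forall>f\<in>L2 M. \<forall>g\<in>L2 M. \<forall>a b.
        AE x in M. P t (\<lambda>y. a * f y + b * g y) x = a * P t f x + b * P t g x) \<and>
     (\<forall>t\<ge>0. \<exists>C. \<forall>f\<in>L2 M. L2_norm2 M (P t f) \<le> C * L2_norm2 M f) \<and>
     (\<forall>f\<in>L2 M. AE x in M. P 0 f x = f x) \<and>
     (\<forall>s\<ge>0. \<forall>t\<ge>0. \<forall>f\<in>L2 M. AE x in M. P (s + t) f x = P s (P t f) x) \<and>
     (\<forall>f\<in>L2 M. ((\<lambda>t. L2_norm2 M (\<lambda>x. P t f x - f x)) \<longlongrightarrow> 0) (at_right 0))"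

text \<open>$e^{-tH}$ is the strongly continuous semigroup whose generator is $-H$; it is unique up to
  the choice of representatives.\<close>

definition is_heat_semigroup ::
  "'a form_space \<Rightarrow> (real \<Rightarrow> ('a \<Rightarrow> real) \<Rightarrow> 'a \<Rightarrow> real) \<Rightarrow> bool" where
  "is_heat_semigroup D P \<longleftrightarrow> C0_semigroup (Meas D) P \<and>
     (\<forall>f\<in>L2 (Meas D). \<forall>h\<in>L2 (Meas D).
        ((\<lambda>t. L2_norm2 (Meas D) (\<lambda>x. (P t f x - f x) / t - (- h x))) \<longlongrightarrow> 0) (at_right 0)
        \<longleftrightarrow> form_operator D f h)"

definition heat_L2 :: "'a form_space \<Rightarrow> real \<Rightarrow> ('a \<Rightarrow> real) \<Rightarrow> 'a \<Rightarrow> real" where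
  "heat_L2 D = (SOME P. is_heat_semigroup D P)"

text \<open>The consistent extension to all $L^q$, $1 \le q \le \infty$: for $f \ge 0$, $P_t f$ is the
  a.e. limit of $P_t f_n$ for some (equivalently any) $f_n \in L^2$ with
  $0 \le f_n \uparrow f$ a.e.; then $P_t f = P_t f_+ - P_t f_-$.\<close>

definition heat_nonneg :: "'a form_space \<Rightarrow> real \<Rightarrow> ('a \<Rightarrow> real) \<Rightarrow> 'a \<Rightarrow> real" where
  "heat_nonneg D t f = (SOME u. u \<in> borel_measurable (Meas D) \<and>
     (\<exists>fn :: nat \<Rightarrow> 'a \<Rightarrow> real.
        (\<forall>n. fn n \<in> L2 (Meas D)) \<and>
        (AE x in Meas D. \<forall>n. 0 \<le> fn n x \<and> fn n x \<le> fn (Suc n) x) \<and>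
        (AE x in Meas D. (\<lambda>n. fn n x) \<longlonglongrightarrow> f x) \<and>
        (AE x in Meas D. (\<lambda>n. heat_L2 D t (fn n) x) \<longlonglongrightarrow> u x)))"

definition heat :: "'a form_space \<Rightarrow> real \<Rightarrow> ('a \<Rightarrow> real) \<Rightarrow> 'a \<Rightarrow> real" where
  "heat D t f =
     (\<lambda>x. heat_nonneg D t (\<lambda>y. max (f y) 0) x - heat_nonneg D t (\<lambda>y. max (- f y) 0) x)"


section \<open>Energy measures\<close>

definition energy_measure_bounded :: "'a form_space \<Rightarrow> ('a \<Rightarrow> real) \<Rightarrow> 'a measure" where
  "energy_measure_bounded D f = (THE \<mu>. radon_measure (Top D) \<mu> \<and>
     (\<forall>\<phi>\<in>dom D \<inter> C_c (Top D).
        (\<integral>x. \<phi> x \<partial>\<mu>) = form D f (\<lambda>x. \<phi> x * f x) - 1/2 * form D (\<lambda>x. (f x)\<^sup>2) \<phi>))"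

text \<open>Extension to the whole domain by approximation in the $E_1$-norm.\<close>

definition energy_measure_dom :: "'a form_space \<Rightarrow> ('a \<Rightarrow> real) \<Rightarrow> 'a measure" where
  "energy_measure_dom D f = (THE \<mu>. radon_measure (Top D) \<mu> \<and>
     (\<forall>fn. (\<forall>n::nat. fn n \<in> dom D \<inter> Linf (Meas D)) \<and>
        (\<lambda>n. form1 D (\<lambda>x. fn n x - f x) (\<lambda>x. fn n x - f x)) \<longlonglongrightarrow> 0 \<longrightarrow>
        (\<forall>\<phi>\<in>dom D \<inter> C_c (Top D).
           (\<lambda>n. \<integral>x. \<phi> x \<partial>energy_measure_bounded D (fn n)) \<longlonglongrightarrow> (\<integral>x. \<phi> x \<partial>\<mu>))))"

text \<open>Extension to the local domain by locality.\<close>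

definition energy_measure :: "'a form_space \<Rightarrow> ('a \<Rightarrow> real) \<Rightarrow> 'a measure" where
  "energy_measure D f = (THE \<mu>. radon_measure (Top D) \<mu> \<and>
     (\<forall>U h. rel_compact_open (Top D) U \<and> h \<in> dom D \<and> (AE x in Meas D. x \<in> U \<longrightarrow> f x = h x) \<longrightarrow>
        (\<forall>A\<in>sets \<mu>. A \<subseteq> U \<longrightarrow> emeasure \<mu> A = emeasure (energy_measure_dom D h) A)))"


section \<open>Smoothing properties\<close>

definition ultracontractive :: "'a form_space \<Rightarrow> bool" where
  "ultracontractive D \<longleftrightarrow> (\<forall>t>0. \<forall>f\<in>L1 (Meas D). heat D t f \<in> Linf (Meas D))"

text \<open>Membership of $P_t f$ in a space of continuous functions refers to its continuous
  representative, which is unique on the space because the measure has full support.\<close>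

definition doubly_feller :: "'a form_space \<Rightarrow> bool" where
  "doubly_feller D \<longleftrightarrow>
     (\<forall>f\<in>C_0 (Top D). \<exists>v :: real \<Rightarrow> 'a \<Rightarrow> real.
        (\<forall>t\<ge>0. v t \<in> C_0 (Top D) \<and> (AE x in Meas D. heat D t f x = v t x)) \<and>
        (\<forall>x\<in>topspace (Top D). ((\<lambda>t. v t x) \<longlongrightarrow> f x) (at_right 0))) \<and>
     (\<forall>t>0. \<forall>f\<in>Linf (Meas D). \<exists>v\<in>C_all (Top D). AE x in Meas D. heat D t f x = v x)"

definition irreducible_form :: "'a form_space \<Rightarrow> bool" where
  "irreducible_form D \<longleftrightarrow>
     (\<forall>f\<in>dom_loc D. (\<forall>A\<in>sets (Meas D). emeasure (energy_measure D f) A = 0) \<longrightarrow>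
        (\<exists>c. AE x in Meas D. f x = c))"

definition locally_smoothing :: "'a form_space \<Rightarrow> bool" where
  "locally_smoothing D \<longleftrightarrow> (\<forall>U. rel_compact_open (Top D) U \<longrightarrow>
     ultracontractive (restrict_form_space D U) \<and>
     (\<exists>U'. openin (Top D) U' \<and> U \<subseteq> U' \<and> U' - Top D closure_of U \<noteq> {} \<and>
        doubly_feller (restrict_form_space D U') \<and>
        irreducible_form (restrict_form_space D U')))"

definition locally_shift_defective :: "'a form_space \<Rightarrow> real \<Rightarrow> ('a \<Rightarrow> real) \<Rightarrow> bool" where
  "locally_shift_defective D lam f \<longleftrightarrow> f \<in> L1_loc (Top D) (Meas D) \<and>
     (\<forall>U. rel_compact_open (Top D) U \<longrightarrow>
        (\<exists>g\<in>C_b (subtopology (Top D) U).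
           weakly_harmonic (restrict_form_space D U) lam g \<and>
           (\<forall>t>0. AE x in restrict_space (Meas D) U.
              exp (- t * lam) * heat (restrict_form_space D U) t (\<lambda>y. f y - g y) x \<ge> f x - g x)))"

end

theory Submission
  imports Defs "HOL-Library.Function_Algebras"
begin

text \<open>On a relatively compact open set $U$ write $f = g + h$ with $g$ weakly harmonic and
  $h \le e^{-\lambda t} P_t h$. Ultracontractivity bounds $h_+$ from above; as $h_+$ lies below its
  image under a contraction, it is invariant, hence harmonic, and it vanishes if $\lambda > 0$. The
  truncations $\min(h_-, n)$ are excessive; with a cutoff function $\omega$, the function
  $\min(h_-, n, n \omega)$ lies in the domain and is weakly superharmonic where $\omega = 1$. For
  $n \ge \sup g + \sup h_+$ the bounded weakly subharmonic function
  $w = g + h_+ - \min(h_-, n)$ satisfies $(w - c)_+ = (f - c)_+$ for all $c \ge 0$.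

  Powers of $(w - c)_+$ are controlled by inequalities in two real variables that pass to the form
  through the approximation by resolvents: convexity for $q \ge 2$, and a Caccioppoli estimate with
  a cutoff function for $1 < q < 2$.\<close>

section \<open>Semi-inner products and closed forms\<close>

text \<open>Functions stand for their classes modulo a.e. equality, so the Hilbert space arguments
  are carried out for positive semidefinite products on a subspace, with
  \<open>nrm (x - y) = 0\<close> in place of equality. The heat semigroup is characterised in the
  definitions by strong continuity and its generator, and then chosen. It is therefore constructed
  from resolvents by implicit Euler steps, which hand positivity down to it, and a uniqueness
  theorem identifies the chosen semigroup with the constructed one. The negative part
  \<open>h_-\<close> is merely integrable; truncating it produces bounded functions, and the level
  \<open>n\<close> is harmless because both \<open>f\<close> and its replacement \<open>w\<close>
  are nonpositive where \<open>h_- > n\<close>. The shift by \<open>\<lambda>\<close> disappears in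
  the conclusion because \<open>(w - c)_+\<close> with \<open>c \<ge> 0\<close> lives where
  \<open>w \<ge> 0\<close>, and there the zero order term has the favourable sign. The condition
  \<open>q > 1\<close> comes from the energy of \<open>u^p\<close> with \<open>p = q / 2\<close>:
  the square of the derivative of the power is \<open>p^2 u^(2 p - 2)\<close>, which is integrable
  at zero exactly when \<open>p > 1/2\<close>.\<close>

locale semi_inner =
  fixes V :: "'v::real_vector set" and ip :: "'v \<Rightarrow> 'v \<Rightarrow> real"
  assumes subspace_V: "subspace V"
    and ip_add: "\<And>x y z. x \<in> V \<Longrightarrow> y \<in> V \<Longrightarrow> z \<in> V \<Longrightarrow> ip (x + y) z = ip x z + ip y z"
    and ip_scale: "\<And>c x z. x \<in> V \<Longrightarrow> z \<in> V \<Longrightarrow> ip (c *\<^sub>R x) z = c * ip x z"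
    and ip_commute: "\<And>x y. x \<in> V \<Longrightarrow> y \<in> V \<Longrightarrow> ip x y = ip y x"
    and ip_nonneg: "\<And>x. x \<in> V \<Longrightarrow> 0 \<le> ip x x"
begin

lemma V_closed [simp, intro]:
  "0 \<in> V"
  "x \<in> V \<Longrightarrow> y \<in> V \<Longrightarrow> x + y \<in> V"
  "x \<in> V \<Longrightarrow> y \<in> V \<Longrightarrow> x - y \<in> V"
  "x \<in> V \<Longrightarrow> c *\<^sub>R x \<in> V"
  "x \<in> V \<Longrightarrow> - x \<in> V"
  using subspace_V by (auto simp: subspace_0 subspace_add subspace_diff subspace_scale subspace_neg)

lemma ip_minus: "x \<in> V \<Longrightarrow> z \<in> V \<Longrightarrow> ip (- x) z = - ip x z"
  using ip_scale[of x z "-1"] by simp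

lemma ip_diff: "x \<in> V \<Longrightarrow> y \<in> V \<Longrightarrow> z \<in> V \<Longrightarrow> ip (x - y) z = ip x z - ip y z"
  using ip_add[of x "- y" z] by (simp add: ip_minus)

lemma ip_zero [simp]: "z \<in> V \<Longrightarrow> ip 0 z = 0"
  using ip_scale[of 0 z 0] by simp

lemma ip_add_right: "x \<in> V \<Longrightarrow> y \<in> V \<Longrightarrow> z \<in> V \<Longrightarrow> ip z (x + y) = ip z x + ip z y"
  and ip_scale_right: "x \<in> V \<Longrightarrow> z \<in> V \<Longrightarrow> ip z (c *\<^sub>R x) = c * ip z x"
  and ip_minus_right: "x \<in> V \<Longrightarrow> z \<in> V \<Longrightarrow> ip z (- x) = - ip z x"
  and ip_diff_right: "x \<in> V \<Longrightarrow> y \<in> V \<Longrightarrow> z \<in> V \<Longrightarrow> ip z (x - y) = ip z x - ip z y"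
  and ip_zero_right [simp]: "z \<in> V \<Longrightarrow> ip z 0 = 0"
  using ip_add[of x y z] ip_scale[of x z c] ip_minus[of x z] ip_diff[of x y z] ip_zero[of z]
  by (simp_all add: ip_commute[of z])

lemmas ip_lin = ip_add ip_scale ip_minus ip_diff ip_add_right ip_scale_right ip_minus_right ip_diff_right

lemma ip_add_scale_self:
  "x \<in> V \<Longrightarrow> y \<in> V \<Longrightarrow> ip (x + t *\<^sub>R y) (x + t *\<^sub>R y) = ip x x + 2 * t * ip x y + t\<^sup>2 * ip y y"
  by (simp add: ip_lin ip_commute[of y x] power2_eq_square algebra_simps)

lemma cauchy_schwarz_square:
  assumes "x \<in> V" "y \<in> V"
  shows "(ip x y)\<^sup>2 \<le> ip x x * ip y y"
proof -
  have q: "0 \<le> ip x x - 2 * t * ip x y + t\<^sup>2 * ip y y" for t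
    using ip_nonneg[of "x - t *\<^sub>R y"] assms
    by (simp add: ip_lin ip_commute[of y x] power2_eq_square algebra_simps)
  show ?thesis
  proof (cases "ip y y = 0")
    case True
    have "ip x y = 0"
    proof (rule ccontr)
      assume "ip x y \<noteq> 0"
      \<comment> \<open>For this \<open>t\<close> the expression, affine in \<open>t\<close> because
        \<open>ip y y = 0\<close>, has the value -1.\<close>
      then show False
        using q[of "(ip x x + 1) / (2 * ip x y)"] True by (simp add: field_simps)
    qed
    then show ?thesis using True by simp
  next
    case False
    then have pos: "ip y y > 0" using ip_nonneg[OF assms(2)] by simp
    show ?thesis
      using q[of "ip x y / ip y y"] pos
      by (simp add: field_simps power2_eq_square)
  qed
qed

definition nrm :: "'v \<Rightarrow> real" where
  "nrm x = sqrt (ip x x)"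

lemma nrm_nonneg [simp]: "x \<in> V \<Longrightarrow> 0 \<le> nrm x"
  by (simp add: nrm_def ip_nonneg)

lemma nrm_square: "x \<in> V \<Longrightarrow> (nrm x)\<^sup>2 = ip x x"
  by (simp add: nrm_def ip_nonneg)

lemma cauchy_schwarz:
  assumes "x \<in> V" "y \<in> V"
  shows "\<bar>ip x y\<bar> \<le> nrm x * nrm y"
proof -
  have "\<bar>ip x y\<bar> = sqrt ((ip x y)\<^sup>2)" by simp
  also have "\<dots> \<le> sqrt (ip x x * ip y y)"
    using cauchy_schwarz_square[OF assms] real_sqrt_le_mono by blast
  finally show ?thesis by (simp add: nrm_def real_sqrt_mult)
qed

lemma nrm_scale: "x \<in> V \<Longrightarrow> nrm (c *\<^sub>R x) = \<bar>c\<bar> * nrm x"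
  by (simp add: nrm_def ip_lin real_sqrt_mult flip: power2_eq_square mult.assoc)

lemma nrm_minus [simp]: "x \<in> V \<Longrightarrow> nrm (- x) = nrm x"
  by (simp add: nrm_def ip_lin)

lemma nrm_zero [simp]: "nrm 0 = 0"
  by (simp add: nrm_def)

lemma nrm_triangle:
  assumes "x \<in> V" "y \<in> V"
  shows "nrm (x + y) \<le> nrm x + nrm y"
proof (rule power2_le_imp_le)
  have "(nrm (x + y))\<^sup>2 = (nrm x)\<^sup>2 + 2 * ip x y + (nrm y)\<^sup>2"
    using assms by (simp add: nrm_square ip_lin ip_commute[of y x])
  also have "\<dots> \<le> (nrm x + nrm y)\<^sup>2"
    using cauchy_schwarz[OF assms] by (simp add: power2_sum)
  finally show "(nrm (x + y))\<^sup>2 \<le> (nrm x + nrm y)\<^sup>2" .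
qed (use assms in simp)

lemma nrm_triangle_diff:
  assumes "x \<in> V" "y \<in> V" "z \<in> V"
  shows "nrm (x - z) \<le> nrm (x - y) + nrm (y - z)"
  using nrm_triangle[of "x - y" "y - z"] assms by simp

lemma nrm_diff_commute: "x \<in> V \<Longrightarrow> y \<in> V \<Longrightarrow> nrm (x - y) = nrm (y - x)"
  using nrm_minus[of "x - y"] by simp

lemma nrm_diff_le: "x \<in> V \<Longrightarrow> y \<in> V \<Longrightarrow> nrm (x - y) \<le> nrm x + nrm y"
  using nrm_triangle[of x "- y"] by simp

lemma nrm_le_diff: "x \<in> V \<Longrightarrow> y \<in> V \<Longrightarrow> nrm x \<le> nrm (x - y) + nrm y"
  using nrm_triangle[of "x - y" y] by simp

lemma nrm_rev_triangle: "x \<in> V \<Longrightarrow> y \<in> V \<Longrightarrow> \<bar>nrm x - nrm y\<bar> \<le> nrm (x - y)"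
  using nrm_le_diff[of x y] nrm_le_diff[of y x] nrm_diff_commute[of x y] by simp

text \<open>Written with the midpoint, because the arguments below compare two nearly minimal
  elements of a convex set with their midpoint, which lies in the set again.\<close>

lemma parallelogram:
  "x \<in> V \<Longrightarrow> y \<in> V \<Longrightarrow>
    ip (x - y) (x - y) = 2 * ip x x + 2 * ip y y - 4 * ip ((1/2) *\<^sub>R x + (1/2) *\<^sub>R y) ((1/2) *\<^sub>R x + (1/2) *\<^sub>R y)"
  by (simp add: ip_lin ip_commute[of y x] algebra_simps)

lemma ip_diff_self_le: "x \<in> V \<Longrightarrow> y \<in> V \<Longrightarrow> ip (x - y) (x - y) \<le> 2 * ip x x + 2 * ip y y"
  and ip_add_self_le: "x \<in> V \<Longrightarrow> y \<in> V \<Longrightarrow> ip (x + y) (x + y) \<le> 2 * ip x x + 2 * ip y y"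
  using ip_nonneg[of "x + y"] ip_nonneg[of "x - y"] by (simp_all add: ip_lin ip_commute[of y x])

lemma ip_null: "x \<in> V \<Longrightarrow> y \<in> V \<Longrightarrow> z \<in> V \<Longrightarrow> nrm (x - y) = 0 \<Longrightarrow> ip x z = ip y z"
  using cauchy_schwarz[of "x - y" z] by (simp add: ip_lin)

lemma nrm_null: "x \<in> V \<Longrightarrow> y \<in> V \<Longrightarrow> nrm (x - y) = 0 \<Longrightarrow> nrm x = nrm y"
  using nrm_rev_triangle[of x y] by simp

lemma tendsto_ip:
  assumes "\<And>n. x n \<in> V" "\<And>n. y n \<in> V" "a \<in> V" "b \<in> V"
    and "((\<lambda>n. nrm (x n - a)) \<longlongrightarrow> 0) F" "((\<lambda>n. nrm (y n - b)) \<longlongrightarrow> 0) F"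
  shows "((\<lambda>n. ip (x n) (y n)) \<longlongrightarrow> ip a b) F"
proof -
  have *: "\<bar>ip (x n) (y n) - ip a b\<bar> \<le> nrm (x n - a) * nrm (y n - b) + nrm (x n - a) * nrm b + nrm a * nrm (y n - b)" for n
  proof -
    have "ip (x n) (y n) - ip a b = ip (x n - a) (y n - b) + ip (x n - a) b + ip a (y n - b)"
      using assms(1-4) by (simp add: ip_lin)
    then show ?thesis
      using cauchy_schwarz[of "x n - a" "y n - b"] cauchy_schwarz[of "x n - a" b]
        cauchy_schwarz[of a "y n - b"] assms(1-4) by auto
  qed
  have "((\<lambda>n. nrm (x n - a) * nrm (y n - b) + nrm (x n - a) * nrm b + nrm a * nrm (y n - b)) \<longlongrightarrow> 0 * 0 + 0 * nrm b + nrm a * 0) F"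
    by (intro tendsto_intros assms)
  then have lim0: "((\<lambda>n. nrm (x n - a) * nrm (y n - b) + nrm (x n - a) * nrm b + nrm a * nrm (y n - b)) \<longlongrightarrow> 0) F"
    by simp
  have "((\<lambda>n. ip (x n) (y n) - ip a b) \<longlongrightarrow> 0) F"
    by (rule Lim_null_comparison[OF _ lim0]) (simp add: *)
  then show ?thesis by (simp add: LIM_zero_iff)
qed

lemma nrm_limit_unique:
  assumes "\<And>n. x n \<in> V" "a \<in> V" "b \<in> V" "F \<noteq> bot"
    and "((\<lambda>n. nrm (x n - a)) \<longlongrightarrow> 0) F" "((\<lambda>n. nrm (x n - b)) \<longlongrightarrow> 0) F"
  shows "nrm (a - b) = 0"
proof -
  have "((\<lambda>n. nrm (x n - a) + nrm (x n - b)) \<longlongrightarrow> 0 + 0) F" by (intro tendsto_intros assms)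
  moreover have "nrm (a - b) \<le> nrm (x n - a) + nrm (x n - b)" for n
    using nrm_triangle_diff[of a "x n" b] nrm_diff_commute[of a "x n"] assms by simp
  ultimately have "nrm (a - b) \<le> 0 + 0"
    by (intro tendsto_lowerbound[OF _ _ \<open>F \<noteq> bot\<close>]) (auto simp: assms)
  then show ?thesis using nrm_nonneg[of "a - b"] assms by (intro antisym) auto
qed

end

text \<open>Density of \<open>W\<close> and completeness of \<open>V\<close> are added only in
  \<open>dense_form\<close>, since the form restricted to an open set is used in this locale before
  its domain is known to be dense.\<close>

locale closed_bilinear_form = semi_inner V ip + E: semi_inner W E
  for V :: "'v::real_vector set" and ip and W :: "'v set" and E +
  assumes W_subset: "W \<subseteq> V"
    and W_cong: "\<And>u v. u \<in> W \<Longrightarrow> v \<in> V \<Longrightarrow> nrm (u - v) = 0 \<Longrightarrow> v \<in> W"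
    and E_cong: "\<And>u v w. u \<in> W \<Longrightarrow> v \<in> W \<Longrightarrow> w \<in> W \<Longrightarrow> nrm (u - v) = 0 \<Longrightarrow> E u w = E v w"
    and closed: "\<And>u. (\<And>n::nat. u n \<in> W) \<Longrightarrow>
      (\<And>\<epsilon>. \<epsilon> > 0 \<Longrightarrow> \<exists>N. \<forall>m\<ge>N. \<forall>n\<ge>N. E (u m - u n) (u m - u n) + ip (u m - u n) (u m - u n) < \<epsilon>) \<Longrightarrow>
      \<exists>v\<in>W. (\<lambda>n. E (u n - v) (u n - v) + ip (u n - v) (u n - v)) \<longlonglongrightarrow> 0"
begin

lemma W_V [simp, intro]: "u \<in> W \<Longrightarrow> u \<in> V"
  using W_subset by blast

abbreviation E1 :: "'v \<Rightarrow> real" where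
  "E1 u \<equiv> E u u + ip u u"

lemma E1_tendstoD:
  assumes "\<And>n. u n \<in> W" "v \<in> W" "((\<lambda>n. E1 (u n - v)) \<longlongrightarrow> 0) F"
  shows "((\<lambda>n. nrm (u n - v)) \<longlongrightarrow> 0) F" "((\<lambda>n. E.nrm (u n - v)) \<longlongrightarrow> 0) F"
proof -
  have "((\<lambda>n. ip (u n - v) (u n - v)) \<longlongrightarrow> 0) F"
    by (rule Lim_null_comparison[OF _ assms(3)])
      (use assms in \<open>auto intro!: always_eventually simp: ip_nonneg E.ip_nonneg\<close>)
  then show "((\<lambda>n. nrm (u n - v)) \<longlongrightarrow> 0) F"
    unfolding nrm_def using tendsto_real_sqrt by fastforce
  have "((\<lambda>n. E (u n - v) (u n - v)) \<longlongrightarrow> 0) F"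
    by (rule Lim_null_comparison[OF _ assms(3)])
      (use assms in \<open>auto intro!: always_eventually simp: ip_nonneg E.ip_nonneg\<close>)
  then show "((\<lambda>n. E.nrm (u n - v)) \<longlongrightarrow> 0) F"
    unfolding E.nrm_def using tendsto_real_sqrt by fastforce
qed

text \<open>A substitute for weak compactness: nearly minimal elements of convex sets are Cauchy by
  the parallelogram law.\<close>

lemma convex_approximation:
  assumes A: "A \<subseteq> W" "convex A" and u: "u \<in> V"
    and ex: "\<And>\<epsilon>. \<epsilon> > 0 \<Longrightarrow> \<exists>w\<in>A. nrm (w - u) < \<epsilon> \<and> E w w \<le> C"
  shows "u \<in> W" "\<And>\<epsilon>. \<epsilon> > 0 \<Longrightarrow> \<exists>w\<in>A. E1 (w - u) < \<epsilon>"
proof -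
  define r where "r n = 1 / real (Suc n)" for n
  have r_pos: "r n > 0" for n by (simp add: r_def)
  have r_lim: "r \<longlonglongrightarrow> 0" unfolding r_def using LIMSEQ_inverse_real_of_nat by (simp add: inverse_eq_divide)
  have r_mono: "r m \<le> r n" if "n \<le> m" for m n using that by (simp add: r_def frac_le)
  \<comment> \<open>The sets of elements of \<open>A\<close> within \<open>r n\<close> of
    \<open>u\<close> shrink, so their minimal energies \<open>d n\<close> increase; being bounded by
    \<open>C\<close> they converge, and the midpoint of \<open>w m\<close> and \<open>w n\<close>
    stays in the larger set. This makes the right-hand side of \<open>key\<close> small.\<close>
  define An where "An n = {w \<in> A. nrm (w - u) \<le> r n}" for n
  define d where "d n = Inf ((\<lambda>w. E w w) ` An n)" for n
  have AnW: "w \<in> W" "w \<in> V" if "w \<in> An n" for w n using that A by (auto simp: An_def)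
  have bdd: "bdd_below ((\<lambda>w. E w w) ` An n)" for n
    by (rule bdd_belowI[of _ 0]) (auto simp: E.ip_nonneg AnW)
  have An_ex: "\<exists>w\<in>An n. E w w \<le> C" for n
    using ex[OF r_pos[of n]] by (auto simp: An_def intro: less_imp_le)
  have d_le: "d n \<le> E w w" if "w \<in> An n" for w n
    unfolding d_def by (rule cInf_lower) (use that bdd in auto)
  have An_mono: "An m \<subseteq> An n" if "n \<le> m" for m n
    using r_mono[OF that] by (auto simp: An_def)
  have d_mono: "d n \<le> d m" if "n \<le> m" for m n
    unfolding d_def
    by (rule cInf_superset_mono) (use An_ex[of m] An_mono[OF that] bdd in auto)
  have d_C: "d n \<le> C" for n using An_ex[of n] d_le by force
  obtain dl where dl: "d \<longlonglongrightarrow> dl"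
    using d_mono d_C incseq_convergent[of d C] by (metis incseq_def)
  have d_dl: "d n \<le> dl" for n
    using incseq_le[OF _ dl] d_mono by (auto simp: incseq_def)
  have "\<exists>w\<in>An n. E w w < d n + r n" for n
    using cInf_lessD[of "(\<lambda>w. E w w) ` An n" "d n + r n"] An_ex[of n] r_pos[of n]
    unfolding d_def by auto
  then obtain w where w: "\<And>n. w n \<in> An n" "\<And>n. E (w n) (w n) < d n + r n" by metis
  have wW: "w n \<in> W" "w n \<in> V" for n using AnW[OF w(1)] by auto
  have ipw: "nrm (w n - u) \<le> r n" for n using w(1)[of n] by (simp add: An_def)
  have half: "(1/2) *\<^sub>R w m + (1/2) *\<^sub>R w n \<in> An n" if "n \<le> m" for m n
  proof -
    have mem: "w m \<in> An n" "w n \<in> An n" using An_mono[OF that] w(1) by blast+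
    then have "(1/2) *\<^sub>R w m + (1/2) *\<^sub>R w n \<in> A"
      using convexD[OF A(2), of "w m" "w n" "1/2" "1/2"] by (simp add: An_def)
    moreover have "nrm (((1/2) *\<^sub>R w m + (1/2) *\<^sub>R w n) - u) \<le> r n"
    proof -
      have "((1/2) *\<^sub>R w m + (1/2) *\<^sub>R w n) - u = (1/2) *\<^sub>R (w m - u) + (1/2) *\<^sub>R (w n - u)"
        by (simp add: algebra_simps flip: scaleR_add_left)
      then have "nrm (((1/2) *\<^sub>R w m + (1/2) *\<^sub>R w n) - u) \<le> 1/2 * nrm (w m - u) + 1/2 * nrm (w n - u)"
        using nrm_triangle[of "(1/2) *\<^sub>R (w m - u)" "(1/2) *\<^sub>R (w n - u)"] wW u by (simp add: nrm_scale)
      then show ?thesis using mem by (simp add: An_def)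
    qed
    ultimately show ?thesis by (simp add: An_def)
  qed
  have key: "E1 (w m - w n) \<le> 2 * (dl - d n) + 4 * r n + (2 * r n)\<^sup>2" if "n \<le> m" for m n
  proof -
    have "E (w m - w n) (w m - w n) \<le> 2 * (d m + r m) + 2 * (d n + r n) - 4 * d n"
      using E.parallelogram[OF wW(1) wW(1), of m n] d_le[OF half[OF that]] w(2)[of m] w(2)[of n] by simp
    moreover have "d m \<le> dl" by (rule d_dl)
    moreover have "r m \<le> r n" by (rule r_mono[OF that])
    ultimately have 1: "E (w m - w n) (w m - w n) \<le> 2 * (dl - d n) + 4 * r n" by argo
    have "nrm (w m - w n) \<le> 2 * r n"
      using nrm_triangle_diff[of "w m" u "w n"] nrm_diff_commute[of "w n" u] wW u ipw[of m] ipw[of n] r_mono[OF that] by simp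
    then have "ip (w m - w n) (w m - w n) \<le> (2 * r n)\<^sup>2"
      using wW by (metis nrm_square V_closed(3) nrm_nonneg power_mono)
    then show ?thesis using 1 by simp
  qed
  have keylim: "(\<lambda>n. 2 * (dl - d n) + 4 * r n + (2 * r n)\<^sup>2) \<longlonglongrightarrow> 2 * (dl - dl) + 4 * 0 + (2 * 0)\<^sup>2"
    by (intro tendsto_intros dl r_lim)
  have cauchy: "\<exists>N. \<forall>m\<ge>N. \<forall>n\<ge>N. E1 (w m - w n) < \<epsilon>" if "\<epsilon> > 0" for \<epsilon>
  proof -
    have "\<forall>\<^sub>F n in sequentially. 2 * (dl - d n) + 4 * r n + (2 * r n)\<^sup>2 < \<epsilon>"
      by (rule order_tendstoD(2)[OF keylim]) (use that in simp)
    then obtain N where N: "\<And>n. n \<ge> N \<Longrightarrow> 2 * (dl - d n) + 4 * r n + (2 * r n)\<^sup>2 < \<epsilon>"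
      by (auto simp: eventually_sequentially)
    have sym: "E1 (w m - w n) = E1 (w n - w m)" for m n
      using wW by (simp add: ip_lin E.ip_lin)
    have "E1 (w m - w n) < \<epsilon>" if "m \<ge> N" "n \<ge> N" for m n
    proof (cases "n \<le> m")
      case True then show ?thesis using key[OF True] N[OF that(2)] by linarith
    next
      case False then have "m \<le> n" by simp
      then show ?thesis using key[OF \<open>m \<le> n\<close>] N[OF that(1)] sym[of m n] by linarith
    qed
    then show ?thesis by blast
  qed
  obtain v where v: "v \<in> W" "(\<lambda>n. E1 (w n - v)) \<longlonglongrightarrow> 0"
    using closed[OF wW(1) cauchy] by blast
  have "(\<lambda>n. nrm (w n - u)) \<longlonglongrightarrow> 0"
    by (rule Lim_null_comparison[OF _ r_lim]) (use ipw wW u in auto)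
  with E1_tendstoD(1)[OF wW(1) v] have nul: "nrm (v - u) = 0"
    by (intro nrm_limit_unique[where x = w and F = sequentially]) (use wW v u in auto)
  show uW: "u \<in> W" using W_cong[OF v(1) u nul] .
  \<comment> \<open>\<open>u\<close> and \<open>v\<close> agree only as classes;
    \<open>E_cong\<close> replaces the first argument, and symmetry brings the second one to the
    front.\<close>
  have "E1 (w n - u) = E1 (w n - v)" for n
  proof -
    have nul': "nrm ((w n - u) - (w n - v)) = 0" using nul by simp
    have "E (w n - u) (w n - u) = E (w n - v) (w n - u)"
      by (rule E_cong[OF _ _ _ nul']) (use wW uW v in auto)
    also have "\<dots> = E (w n - u) (w n - v)" by (rule E.ip_commute) (use wW uW v in auto)
    also have "\<dots> = E (w n - v) (w n - v)" by (rule E_cong[OF _ _ _ nul']) (use wW uW v in auto)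
    finally have 1: "E (w n - u) (w n - u) = E (w n - v) (w n - v)" .
    have "nrm (w n - u) = nrm (w n - v)" using nul' nrm_null[of "w n - u" "w n - v"] wW uW v by simp
    then have "ip (w n - u) (w n - u) = ip (w n - v) (w n - v)"
      using nrm_square[of "w n - u"] nrm_square[of "w n - v"] wW uW v by simp
    then show ?thesis using 1 by simp
  qed
  then have lim: "(\<lambda>n. E1 (w n - u)) \<longlonglongrightarrow> 0" using v(2) by simp
  fix \<epsilon> :: real assume "\<epsilon> > 0"
  then have "\<forall>\<^sub>F n in sequentially. E1 (w n - u) < \<epsilon>" by (rule order_tendstoD(2)[OF lim])
  then obtain n where "E1 (w n - u) < \<epsilon>" by (auto simp: eventually_sequentially)
  then show "\<exists>w\<in>A. E1 (w - u) < \<epsilon>" using w(1)[of n] by (auto simp: An_def)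
qed

text \<open>Replaces weak convergence: \<open>E w v \<le> c\<close> cuts a convex set out of
  \<open>W\<close>, and by \<open>convex_approximation\<close> elements of this set come close to
  \<open>u\<close> in the form norm, which preserves the inequality.\<close>

lemma form_le_of_approximation:
  assumes "u \<in> V" "v \<in> W" "\<And>\<epsilon>. \<epsilon> > 0 \<Longrightarrow> \<exists>w\<in>W. nrm (w - u) < \<epsilon> \<and> E w w \<le> C \<and> E w v \<le> c"
  shows "u \<in> W \<and> E u v \<le> c"
proof -
  define A where "A = {w \<in> W. E w v \<le> c}"
  have "convex A"
    unfolding A_def convex_def using assms(2)
    by (auto simp: E.ip_lin intro: convex_bound_le)
  have AW: "A \<subseteq> W" by (auto simp: A_def)
  have ex: "\<exists>w\<in>A. nrm (w - u) < \<epsilon> \<and> E w w \<le> C" if "\<epsilon> > 0" for \<epsilon>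
    using assms(3)[OF that] by (auto simp: A_def)
  note app = convex_approximation[OF AW \<open>convex A\<close> assms(1) ex]
  have "E u v \<le> c + e" if "e > 0" for e
  proof -
    \<comment> \<open>Small enough that the error \<open>E (u - w) v\<close> is at most
      \<open>e\<close> by Cauchy-Schwarz; adding 1 avoids division by zero.\<close>
    define \<epsilon> where "\<epsilon> = (e / (E.nrm v + 1))\<^sup>2"
    have nv: "E.nrm v \<ge> 0" using assms by simp
    have "\<epsilon> > 0" using that nv by (simp add: \<epsilon>_def)
    then obtain w where w: "w \<in> A" "E1 (w - u) < \<epsilon>" using app(2) by blast
    have mem: "w \<in> W" "u \<in> W" using w AW app(1) by auto
    have "(E.nrm (u - w))\<^sup>2 < \<epsilon>"
      using w(2) ip_nonneg[of "w - u"] mem E.nrm_diff_commute[of u w] by (simp add: E.nrm_square)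
    then have "E.nrm (u - w) < e / (E.nrm v + 1)"
      unfolding \<epsilon>_def by (rule power2_less_imp_less) (use that nv in simp)
    then have "E.nrm (u - w) * E.nrm v \<le> e / (E.nrm v + 1) * E.nrm v"
      using nv by (intro mult_right_mono) auto
    also have "\<dots> \<le> e" using nv that by (simp add: field_simps)
    finally have "E (u - w) v \<le> e"
      using E.cauchy_schwarz[of "u - w" v] mem assms by auto
    then show ?thesis using w(1) mem assms by (simp add: A_def E.ip_lin)
  qed
  then show ?thesis using app(1) field_le_epsilon by blast
qed

text \<open>Lower semicontinuity of the energy. Once \<open>u\<close> lies in \<open>W\<close>, the
  approximants pair with \<open>u\<close> to at most \<open>sqrt C * E.nrm u\<close>; in the limit
  \<open>(E.nrm u)\<^sup>2 \<le> sqrt C * E.nrm u\<close>, and division by \<open>E.nrm u\<close>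
  finishes.\<close>

lemma form_closed_of_approximation:
  assumes "u \<in> V" "\<And>\<epsilon>. \<epsilon> > 0 \<Longrightarrow> \<exists>w\<in>W. nrm (w - u) < \<epsilon> \<and> E w w \<le> C"
  shows "u \<in> W" "E u u \<le> C"
proof -
  show uW: "u \<in> W"
    using form_le_of_approximation[of u 0 C 0] assms by auto
  have "E u u \<le> sqrt C * E.nrm u"
  proof (rule form_le_of_approximation[THEN conjunct2, OF assms(1) uW])
    fix \<epsilon> :: real assume "\<epsilon> > 0"
    then obtain w where w: "w \<in> W" "nrm (w - u) < \<epsilon>" "E w w \<le> C" using assms(2) by blast
    have "E w u \<le> E.nrm w * E.nrm u" using E.cauchy_schwarz[of w u] w uW by auto
    also have "\<dots> \<le> sqrt C * E.nrm u"
      using w uW by (intro mult_right_mono) (auto simp: E.nrm_def E.ip_nonneg)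
    finally show "\<exists>w\<in>W. nrm (w - u) < \<epsilon> \<and> E w w \<le> C \<and> E w u \<le> sqrt C * E.nrm u" using w by blast
  qed
  then have "E.nrm u * E.nrm u \<le> sqrt C * E.nrm u"
    using E.nrm_square[OF uW] by (simp add: power2_eq_square)
  then have "E.nrm u \<le> sqrt C \<or> E.nrm u = 0"
    using E.nrm_nonneg[OF uW] by (metis mult_right_le_imp_le order_le_less)
  moreover have "C \<ge> 0"
  proof -
    obtain w where "w \<in> W" "E w w \<le> C" using assms(2)[of 1] by auto
    then show ?thesis using E.ip_nonneg[of w] by linarith
  qed
  ultimately have "(E.nrm u)\<^sup>2 \<le> C"
    using E.nrm_nonneg[OF uW] by (auto simp: real_le_rsqrt sqrt_ge_absD)
  then show "E u u \<le> C" using E.nrm_square[OF uW] by simp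
qed

text \<open>Variational construction: with \<open>?B = ip + a E\<close>, the functional
  \<open>?B v v - 2 ip f v\<close> is bounded below, a minimising sequence is Cauchy by the
  parallelogram law, and the vanishing of the first variation at the limit is the asserted
  equation.\<close>

lemma ex_resolvent:
  assumes f: "f \<in> V" and a: "a > 0"
  shows "\<exists>w\<in>W. \<forall>v\<in>W. ip w v + a * E w v = ip f v"
proof -
  interpret B: semi_inner W "\<lambda>x y. ip x y + a * E x y"
    by unfold_locales
      (use a in \<open>auto simp: ip_lin E.ip_lin E.subspace_V algebra_simps ip_nonneg E.ip_nonneg ip_commute E.ip_commute\<close>)
  let ?B = "\<lambda>x y. ip x y + a * E x y"
  define \<Phi> where "\<Phi> v = ?B v v - 2 * ip f v" for v
  have low: "\<Phi> v \<ge> - ip f f" if "v \<in> W" for v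
  proof -
    have "0 \<le> ip (v - f) (v - f) + a * E v v" using that f a by (simp add: ip_nonneg E.ip_nonneg)
    then show ?thesis using that f by (simp add: \<Phi>_def ip_lin ip_commute[of v f])
  qed
  define m where "m = Inf (\<Phi> ` W)"
  have m_le: "m \<le> \<Phi> v" if "v \<in> W" for v
    unfolding m_def by (rule cInf_lower) (use that low in \<open>auto intro!: bdd_belowI[of _ "- ip f f"]\<close>)
  define r where "r n = 1 / real (Suc n)" for n
  have r_pos: "r n > 0" for n by (simp add: r_def)
  have r_lim: "r \<longlonglongrightarrow> 0" unfolding r_def using LIMSEQ_inverse_real_of_nat by (simp add: inverse_eq_divide)
  have "\<exists>w\<in>W. \<Phi> w < m + r n" for n
    using cInf_lessD[of "\<Phi> ` W" "m + r n"] r_pos[of n] unfolding m_def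
    by (metis E.V_closed(1) empty_iff image_iff less_add_same_cancel1)
  then obtain w where w: "\<And>n. w n \<in> W" "\<And>n. \<Phi> (w n) < m + r n" by metis
  have key: "?B (w k - w n) (w k - w n) \<le> 2 * r k + 2 * r n" for k n
  proof -
    have "ip f ((1/2) *\<^sub>R w k + (1/2) *\<^sub>R w n) = 1/2 * ip f (w k) + 1/2 * ip f (w n)"
      using w(1) f by (simp add: ip_lin)
    then have "?B (w k - w n) (w k - w n) = 2 * \<Phi> (w k) + 2 * \<Phi> (w n) - 4 * \<Phi> ((1/2) *\<^sub>R w k + (1/2) *\<^sub>R w n)"
      using B.parallelogram[OF w(1) w(1), of k n] unfolding \<Phi>_def by argo
    moreover have "m \<le> \<Phi> ((1/2) *\<^sub>R w k + (1/2) *\<^sub>R w n)" by (rule m_le) (use w in auto)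
    ultimately show ?thesis using w(2)[of k] w(2)[of n] by argo
  qed
  have cauchy: "\<exists>N. \<forall>m\<ge>N. \<forall>n\<ge>N. E1 (w m - w n) < \<epsilon>" if "\<epsilon> > 0" for \<epsilon>
  proof -
    \<comment> \<open>The factor \<open>1 + 1 / a\<close> passes from \<open>?B\<close> to
      \<open>E1\<close>, and 4 accounts for the two terms \<open>2 * r k\<close> and
      \<open>2 * r n\<close>.\<close>
    define K where "K = 4 * (1 + 1 / a)"
    have "K > 0" using a by (simp add: K_def add_pos_pos)
    have "\<forall>\<^sub>F n in sequentially. r n < \<epsilon> / K"
      by (rule order_tendstoD(2)[OF r_lim]) (use that \<open>K > 0\<close> in simp)
    then obtain N where N: "\<And>n. n \<ge> N \<Longrightarrow> r n < \<epsilon> / K" by (auto simp: eventually_sequentially)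
    have "E1 (w k - w n) < \<epsilon>" if "k \<ge> N" "n \<ge> N" for k n
    proof -
      have nn: "ip (w k - w n) (w k - w n) \<ge> 0" "E (w k - w n) (w k - w n) \<ge> 0"
        using w by (auto simp: ip_nonneg E.ip_nonneg)
      have "E1 (w k - w n) \<le> (1 + 1 / a) * ?B (w k - w n) (w k - w n)"
        using nn a by (simp add: field_simps)
      also have "\<dots> \<le> (1 + 1 / a) * (2 * r k + 2 * r n)"
        by (intro mult_left_mono key) (use a in simp)
      also have "\<dots> < (1 + 1 / a) * (4 * (\<epsilon> / K))"
        by (intro mult_strict_left_mono) (use N[OF that(1)] N[OF that(2)] a in \<open>auto intro: add_pos_pos\<close>)
      also have "\<dots> = \<epsilon>" using \<open>K > 0\<close> by (simp add: K_def field_simps)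
      finally show ?thesis .
    qed
    then show ?thesis by blast
  qed
  obtain u where u: "u \<in> W" "(\<lambda>n. E1 (w n - u)) \<longlonglongrightarrow> 0"
    using closed[OF w(1) cauchy] by blast
  note lims = E1_tendstoD[OF w(1) u]
  have "ip u v + a * E u v = ip f v" if v: "v \<in> W" for v
  proof -
    define L where "L = ?B u v - ip f v"
    define K where "K = ?B v v"
    have ineq: "2 * t * L + t\<^sup>2 * K \<ge> 0" for t
    proof -
      have step: "2 * t * (?B (w n) v - ip f v) + t\<^sup>2 * K \<ge> - r n" for n
      proof -
        have "ip f (w n + t *\<^sub>R v) = ip f (w n) + t * ip f v"
          using w(1)[of n] v f by (simp add: ip_lin)
        then have "\<Phi> (w n + t *\<^sub>R v) = \<Phi> (w n) + 2 * t * (?B (w n) v - ip f v) + t\<^sup>2 * K"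
          unfolding \<Phi>_def K_def ip_add_scale_self[OF W_V[OF w(1)] W_V[OF v]] E.ip_add_scale_self[OF w(1) v]
          by (simp add: algebra_simps)
        moreover have "m \<le> \<Phi> (w n + t *\<^sub>R v)" by (rule m_le) (use w v in auto)
        ultimately show ?thesis using w(2)[of n] by linarith
      qed
      have lim1: "(\<lambda>n. 2 * t * (?B (w n) v - ip f v) + t\<^sup>2 * K) \<longlonglongrightarrow> 2 * t * (?B u v - ip f v) + t\<^sup>2 * K"
        by (intro tendsto_intros tendsto_ip E.tendsto_ip lims) (use w u v in auto)
      have lim2: "(\<lambda>n. - r n) \<longlonglongrightarrow> - 0" by (intro tendsto_intros r_lim)
      have "- 0 \<le> 2 * t * (?B u v - ip f v) + t\<^sup>2 * K"
        by (rule LIMSEQ_le[OF lim2 lim1]) (use step in blast)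
      then show ?thesis by (simp add: L_def)
    qed
    have "K \<ge> 0" using v a by (simp add: K_def ip_nonneg E.ip_nonneg)
    have "L = 0"
    proof (rule ccontr)
      assume "L \<noteq> 0"
      \<comment> \<open>With \<open>t = - s\<close> the quadratic in \<open>ineq\<close> equals
        \<open>- s^2 (K + 2)\<close>, which is negative.\<close>
      define s where "s = L / (K + 1)"
      have L: "L = s * (K + 1)" "s \<noteq> 0" using \<open>K \<ge> 0\<close> \<open>L \<noteq> 0\<close> by (auto simp: s_def)
      have "2 * (- s) * L + (- s)\<^sup>2 * K = - (s\<^sup>2 * (K + 2))"
        by (simp add: L power2_eq_square algebra_simps)
      also have "\<dots> < 0" using \<open>K \<ge> 0\<close> L(2) by simp
      finally show False using ineq[of "- s"] by linarith
    qed
    then show ?thesis by (simp add: L_def)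
  qed
  then show ?thesis using u(1) by blast
qed

end

section \<open>Resolvents\<close>

context semi_inner
begin

lemma nrm_le_zero_iff [simp]: "x \<in> V \<Longrightarrow> nrm x \<le> 0 \<longleftrightarrow> nrm x = 0"
  using nrm_nonneg[of x] by linarith

text \<open>In \<open>L2\<close> this is a.e. equality of two square integrable functions;
  membership is included so that the relation can be chained without side conditions.\<close>

definition eqv :: "'v \<Rightarrow> 'v \<Rightarrow> bool" (infix "\<doteq>" 50) where
  "x \<doteq> y \<longleftrightarrow> x \<in> V \<and> y \<in> V \<and> nrm (x - y) = 0"

lemma eqvD: "x \<doteq> y \<Longrightarrow> x \<in> V" "x \<doteq> y \<Longrightarrow> y \<in> V" "x \<doteq> y \<Longrightarrow> nrm (x - y) = 0"
  by (auto simp: eqv_def)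

lemma eqv_refl [simp]: "x \<in> V \<Longrightarrow> x \<doteq> x"
  by (simp add: eqv_def)

lemma eqv_sym: "x \<doteq> y \<Longrightarrow> y \<doteq> x"
  by (auto simp: eqv_def nrm_diff_commute)

lemma eqv_trans [trans]: "x \<doteq> y \<Longrightarrow> y \<doteq> z \<Longrightarrow> x \<doteq> z"
  using nrm_triangle_diff[of x y z] nrm_nonneg[of "x - z"] by (auto simp: eqv_def intro: antisym)

lemma eqv_add: "x \<doteq> y \<Longrightarrow> x' \<doteq> y' \<Longrightarrow> x + x' \<doteq> y + y'"
  using nrm_triangle[of "x - y" "x' - y'"] nrm_nonneg[of "x - y + (x' - y')"]
  by (auto simp: eqv_def add_diff_add)

lemma eqv_scale: "x \<doteq> y \<Longrightarrow> c *\<^sub>R x \<doteq> c *\<^sub>R y"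
  by (auto simp: eqv_def nrm_scale simp flip: scaleR_diff_right)

lemma eqv_diff: "x \<doteq> y \<Longrightarrow> x' \<doteq> y' \<Longrightarrow> x - x' \<doteq> y - y'"
  using eqv_add[of x y "- x'" "- y'"] eqv_scale[of x' y' "-1"] by simp

lemma eqv_nrm: "x \<doteq> y \<Longrightarrow> nrm x = nrm y"
  by (auto simp: eqv_def intro: nrm_null)

lemma eqv_ip: "x \<doteq> x' \<Longrightarrow> y \<doteq> y' \<Longrightarrow> ip x y = ip x' y'"
  using ip_null[of x x' y] ip_null[of y y' x'] ip_commute[of x' y] ip_commute[of x' y'] by (auto simp: eqv_def)

lemma eqv_nrm_diff: "x \<doteq> x' \<Longrightarrow> y \<doteq> y' \<Longrightarrow> nrm (x - y) = nrm (x' - y')"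
  by (intro eqv_nrm eqv_diff)

text \<open>Linearity is only asked up to \<open>\<doteq>\<close>, because the operators in question
  are selected by \<open>SOME\<close>, one argument at a time.\<close>

definition contraction :: "('v \<Rightarrow> 'v) \<Rightarrow> bool" where
  "contraction T \<longleftrightarrow> (\<forall>f\<in>V. T f \<in> V \<and> nrm (T f) \<le> nrm f) \<and>
     (\<forall>f\<in>V. \<forall>g\<in>V. \<forall>c d. T (c *\<^sub>R f + d *\<^sub>R g) \<doteq> c *\<^sub>R T f + d *\<^sub>R T g)"

lemma contractionD:
  assumes "contraction T"
  shows "f \<in> V \<Longrightarrow> T f \<in> V" "f \<in> V \<Longrightarrow> nrm (T f) \<le> nrm f"
    "f \<in> V \<Longrightarrow> g \<in> V \<Longrightarrow> T (c *\<^sub>R f + d *\<^sub>R g) \<doteq> c *\<^sub>R T f + d *\<^sub>R T g"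
  using assms by (auto simp: contraction_def)

lemma contraction_sub: "contraction T \<Longrightarrow> f \<in> V \<Longrightarrow> g \<in> V \<Longrightarrow> T (f - g) \<doteq> T f - T g"
  using contractionD(3)[of T f g 1 "-1"] by simp

lemma contraction_add: "contraction T \<Longrightarrow> f \<in> V \<Longrightarrow> g \<in> V \<Longrightarrow> T (f + g) \<doteq> T f + T g"
  using contractionD(3)[of T f g 1 1] by simp

lemma contraction_nrm_diff:
  assumes "contraction T" "f \<in> V" "g \<in> V"
  shows "nrm (T f - T g) \<le> nrm (f - g)"
  using eqv_nrm[OF contraction_sub[OF assms]] contractionD(2)[OF assms(1), of "f - g"] assms by simp

lemma contraction_eqv: "contraction T \<Longrightarrow> f \<doteq> g \<Longrightarrow> T f \<doteq> T g"
  using contraction_nrm_diff[of T f g] nrm_nonneg[of "T f - T g"]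
  by (simp add: eqv_def contractionD(1))

lemma contraction_comp:
  assumes T: "contraction T" and S: "contraction S"
  shows "contraction (\<lambda>f. T (S f))"
  unfolding contraction_def
proof safe
  fix f g c d assume fg: "f \<in> V" "g \<in> V"
  have "T (S (c *\<^sub>R f + d *\<^sub>R g)) \<doteq> T (c *\<^sub>R S f + d *\<^sub>R S g)"
    by (rule contraction_eqv[OF T contractionD(3)[OF S fg]])
  also have "\<dots> \<doteq> c *\<^sub>R T (S f) + d *\<^sub>R T (S g)"
    by (rule contractionD(3)[OF T contractionD(1)[OF S fg(1)] contractionD(1)[OF S fg(2)]])
  finally show "T (S (c *\<^sub>R f + d *\<^sub>R g)) \<doteq> c *\<^sub>R T (S f) + d *\<^sub>R T (S g)" .
next
  fix f assume "f \<in> V"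
  then show "T (S f) \<in> V" "nrm (T (S f)) \<le> nrm f"
    using contractionD(1,2)[OF S, of f] contractionD(1,2)[OF T, of "S f"] by auto
qed

lemma contraction_funpow: "contraction T \<Longrightarrow> contraction (T ^^ n)"
proof (induction n)
  case 0
  show ?case by (simp add: contraction_def)
next
  case (Suc n)
  then show ?case using contraction_comp[of T "T ^^ n"] by (simp add: comp_def)
qed

lemma contraction_limit:
  assumes T: "\<And>n::nat. contraction (T n)"
    and S: "\<And>f. f \<in> V \<Longrightarrow> S f \<in> V" "\<And>f. f \<in> V \<Longrightarrow> (\<lambda>n. nrm (T n f - S f)) \<longlonglongrightarrow> 0"
  shows "contraction S"
  unfolding contraction_def
proof safe
  fix f assume f: "f \<in> V"
  have "(\<lambda>n. nrm (T n f - S f) + nrm f) \<longlonglongrightarrow> 0 + nrm f" by (intro tendsto_intros S f)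
  moreover have "\<forall>n. nrm (S f) \<le> nrm (T n f - S f) + nrm f"
  proof
    fix n show "nrm (S f) \<le> nrm (T n f - S f) + nrm f"
    using nrm_le_diff[of "S f" "T n f"] nrm_diff_commute[of "S f" "T n f"]
      contractionD(1,2)[OF T f, of n] S(1) f by simp
  qed
  ultimately have "nrm (S f) \<le> 0 + nrm f" by (intro LIMSEQ_le_const) auto
  then show "nrm (S f) \<le> nrm f" by simp
next
  fix f g c d assume fg: "f \<in> V" "g \<in> V"
  have TV: "T n f \<in> V" "T n g \<in> V" for n using contractionD(1)[OF T] fg by auto
  have "(\<lambda>n. \<bar>c\<bar> * nrm (T n f - S f) + \<bar>d\<bar> * nrm (T n g - S g)) \<longlonglongrightarrow> \<bar>c\<bar> * 0 + \<bar>d\<bar> * 0"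
    by (intro tendsto_intros S fg)
  then have lim: "(\<lambda>n. \<bar>c\<bar> * nrm (T n f - S f) + \<bar>d\<bar> * nrm (T n g - S g)) \<longlonglongrightarrow> 0" by simp
  have "(\<lambda>n. nrm (T n (c *\<^sub>R f + d *\<^sub>R g) - (c *\<^sub>R S f + d *\<^sub>R S g))) \<longlonglongrightarrow> 0"
  proof (rule Lim_null_comparison[OF _ lim], rule always_eventually, rule allI)
    fix n
    have "nrm (T n (c *\<^sub>R f + d *\<^sub>R g) - (c *\<^sub>R S f + d *\<^sub>R S g))
        = nrm ((c *\<^sub>R T n f + d *\<^sub>R T n g) - (c *\<^sub>R S f + d *\<^sub>R S g))"
      by (intro eqv_nrm_diff contractionD(3) T fg eqv_refl) (use S fg in auto)
    also have "(c *\<^sub>R T n f + d *\<^sub>R T n g) - (c *\<^sub>R S f + d *\<^sub>R S g) = c *\<^sub>R (T n f - S f) + d *\<^sub>R (T n g - S g)"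
      by (simp add: algebra_simps)
    also have "nrm \<dots> \<le> \<bar>c\<bar> * nrm (T n f - S f) + \<bar>d\<bar> * nrm (T n g - S g)"
      using nrm_triangle[of "c *\<^sub>R (T n f - S f)" "d *\<^sub>R (T n g - S g)"] TV S fg by (simp add: nrm_scale)
    finally show "norm (nrm (T n (c *\<^sub>R f + d *\<^sub>R g) - (c *\<^sub>R S f + d *\<^sub>R S g)))
      \<le> \<bar>c\<bar> * nrm (T n f - S f) + \<bar>d\<bar> * nrm (T n g - S g)"
      using TV S fg contractionD(1)[OF T, of "c *\<^sub>R f + d *\<^sub>R g" n] by simp
  qed
  then have "nrm (S (c *\<^sub>R f + d *\<^sub>R g) - (c *\<^sub>R S f + d *\<^sub>R S g)) = 0"
    using S fg by (intro nrm_limit_unique[where x = "\<lambda>n. T n (c *\<^sub>R f + d *\<^sub>R g)" and F = sequentially])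
      (auto intro!: contractionD(1)[OF T])
  then show "S (c *\<^sub>R f + d *\<^sub>R g) \<doteq> c *\<^sub>R S f + d *\<^sub>R S g" using S fg by (simp add: eqv_def)
qed (use S in auto)

end

section \<open>Resolvents and generator of a densely defined closed form\<close>

locale dense_form = closed_bilinear_form +
  assumes complete: "\<And>u. (\<And>n::nat. u n \<in> V) \<Longrightarrow>
      (\<And>\<epsilon>. \<epsilon> > 0 \<Longrightarrow> \<exists>N. \<forall>m\<ge>N. \<forall>n\<ge>N. nrm (u m - u n) < \<epsilon>) \<Longrightarrow>
      \<exists>v\<in>V. (\<lambda>n. nrm (u n - v)) \<longlonglongrightarrow> 0"
  and dense: "\<And>f \<epsilon>. f \<in> V \<Longrightarrow> \<epsilon> > 0 \<Longrightarrow> \<exists>u\<in>W. nrm (f - u) < \<epsilon>"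
begin

text \<open>The graph of the self-adjoint operator \<open>H\<close> of the form, with
  \<open>h\<close> for \<open>H f\<close>. It is kept as a relation, since \<open>h\<close> is
  determined only as a class.\<close>

definition gen :: "'a \<Rightarrow> 'a \<Rightarrow> bool" where
  "gen f h \<longleftrightarrow> f \<in> W \<and> h \<in> V \<and> (\<forall>v\<in>W. E f v = ip h v)"

lemma genD: "gen f h \<Longrightarrow> f \<in> W" "gen f h \<Longrightarrow> f \<in> V" "gen f h \<Longrightarrow> h \<in> V"
    "gen f h \<Longrightarrow> v \<in> W \<Longrightarrow> E f v = ip h v"
  by (auto simp: gen_def)

lemma gen_comb: "gen f h \<Longrightarrow> gen g k \<Longrightarrow> gen (c *\<^sub>R f + d *\<^sub>R g) (c *\<^sub>R h + d *\<^sub>R k)"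
  by (auto simp: gen_def ip_lin E.ip_lin)

lemma gen_diff: "gen f h \<Longrightarrow> gen g k \<Longrightarrow> gen (f - g) (h - k)"
  by (auto simp: gen_def ip_lin E.ip_lin)

lemma gen_cong: "gen f h \<Longrightarrow> f \<doteq> f' \<Longrightarrow> h \<doteq> h' \<Longrightarrow> gen f' h'"
  unfolding gen_def using W_cong[of f f'] E_cong[of f f'] ip_null[of h h']
  by (auto simp: eqv_def)

text \<open>The resolvent \<open>(1 + a H)^(-1)\<close>, normalised as an implicit Euler step of
  length \<open>a\<close>, so that it is a contraction tending to the identity as \<open>a\<close>
  tends to 0.\<close>

definition J :: "real \<Rightarrow> 'a \<Rightarrow> 'a" where
  "J a f = (SOME w. w \<in> W \<and> (\<forall>v\<in>W. ip w v + a * E w v = ip f v))"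

lemma J_props:
  assumes "a > 0" "f \<in> V"
  shows "J a f \<in> W" "v \<in> W \<Longrightarrow> ip (J a f) v + a * E (J a f) v = ip f v"
proof -
  have "J a f \<in> W \<and> (\<forall>v\<in>W. ip (J a f) v + a * E (J a f) v = ip f v)"
    unfolding J_def by (rule someI_ex) (use ex_resolvent[OF assms(2,1)] in blast)
  then show "J a f \<in> W" "v \<in> W \<Longrightarrow> ip (J a f) v + a * E (J a f) v = ip f v" by auto
qed

lemma J_V [simp]: "a > 0 \<Longrightarrow> f \<in> V \<Longrightarrow> J a f \<in> V"
  using J_props(1) by blast

lemma gen_J:
  assumes "a > 0" "f \<in> V"
  shows "gen (J a f) ((1 / a) *\<^sub>R (f - J a f))"
  unfolding gen_def
proof (intro conjI ballI)
  fix v assume v: "v \<in> W"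
  then show "E (J a f) v = ip ((1 / a) *\<^sub>R (f - J a f)) v"
    using J_props(2)[OF assms v] assms v by (simp add: ip_lin field_simps)
qed (use J_props(1)[OF assms] assms in auto)

lemma E_J: "a > 0 \<Longrightarrow> f \<in> V \<Longrightarrow> v \<in> W \<Longrightarrow> E (J a f) v = (1 / a) * ip (f - J a f) v"
  using genD(4)[OF gen_J] by (simp add: ip_lin)

text \<open>Testing the equation for the difference \<open>d\<close> with \<open>d\<close> itself
  gives \<open>ip d d + a * E d d = 0\<close>. Identities between resolvents are proved below by
  exhibiting a pair in the graph and applying this.\<close>

lemma J_unique:
  assumes a: "a > 0" and g: "gen w h" and eq: "w + a *\<^sub>R h \<doteq> f"
  shows "w \<doteq> J a f"
proof -
  have f: "f \<in> V" using eqvD(2)[OF eq] .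
  define d where "d = w - J a f"
  have d: "d \<in> W" using genD(1)[OF g] J_props(1)[OF a f] by (simp add: d_def)
  have "ip (w + a *\<^sub>R h) d = ip f d" using eqv_ip[OF eq, of d d] d by simp
  then have "ip w d + a * E w d = ip f d"
    using genD[OF g] d by (simp add: ip_lin)
  moreover have "ip d d = ip w d - ip (J a f) d" "E d d = E w d - E (J a f) d"
    using ip_diff[of w "J a f" d] E.ip_diff[of w "J a f" d] J_props(1)[OF a f] d genD[OF g] by (auto simp: d_def)
  ultimately have "ip d d + a * E d d = 0"
    using J_props(2)[OF a f d] by (simp only: right_diff_distrib)
  moreover have "ip d d \<ge> 0" "a * E d d \<ge> 0" using d a by (auto simp: ip_nonneg E.ip_nonneg)
  ultimately have "ip d d = 0" by linarith
  then show ?thesis using genD(2)[OF g] f a by (simp add: eqv_def d_def nrm_def)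
qed

lemma contraction_J:
  assumes a: "a > 0"
  shows "contraction (J a)"
  unfolding contraction_def
proof safe
  fix f assume f: "f \<in> V"
  show "J a f \<in> V" using a f by simp
  let ?w = "J a f"
  have "(nrm ?w)\<^sup>2 \<le> ip f ?w"
    using J_props[OF a f] a E.ip_nonneg[of ?w] by (simp add: nrm_square flip: J_props(2)[OF a f])
  also have "\<dots> \<le> nrm f * nrm ?w" using cauchy_schwarz[of f ?w] a f by simp
  finally show "nrm ?w \<le> nrm f"
    using nrm_nonneg[of ?w] nrm_nonneg[OF f] a f
    by (cases "nrm ?w = 0") (auto simp: power2_eq_square mult_le_cancel_right)
next
  fix f g c d assume fg: "f \<in> V" "g \<in> V"
  have "c *\<^sub>R J a f + d *\<^sub>R J a g \<doteq> J a (c *\<^sub>R f + d *\<^sub>R g)"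
  proof (rule J_unique[OF a gen_comb[OF gen_J[OF a fg(1)] gen_J[OF a fg(2)]]])
    show "c *\<^sub>R J a f + d *\<^sub>R J a g + a *\<^sub>R (c *\<^sub>R (1 / a) *\<^sub>R (f - J a f) + d *\<^sub>R (1 / a) *\<^sub>R (g - J a g)) \<doteq> c *\<^sub>R f + d *\<^sub>R g"
      using a fg by (simp add: algebra_simps)
  qed
  then show "J a (c *\<^sub>R f + d *\<^sub>R g) \<doteq> c *\<^sub>R J a f + d *\<^sub>R J a g" by (rule eqv_sym)
qed

lemma J_symmetric: "a > 0 \<Longrightarrow> f \<in> V \<Longrightarrow> g \<in> V \<Longrightarrow> ip (J a f) g = ip f (J a g)"
  using J_props(2)[of a g "J a f"] J_props(2)[of a f "J a g"] J_props(1)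
  by (simp add: ip_commute[of _ g] ip_commute[of "J a g"] E.ip_commute[of "J a g"])

lemma gen_J_comm:
  assumes a: "a > 0" and g: "gen f h"
  shows "gen (J a f) (J a h)" "J a f + a *\<^sub>R J a h \<doteq> f"
proof -
  note m = genD[OF g]
  \<comment> \<open>Since \<open>H y = (h - y) / a\<close>, the function \<open>f - a y\<close> is
    mapped by \<open>H\<close> to \<open>y\<close>; as \<open>(f - a y) + a y = f\<close>, it is
    \<open>J a f\<close>, and both claims follow.\<close>
  define y where "y = J a h"
  have y: "y \<in> V" using a m by (simp add: y_def)
  have "gen (1 *\<^sub>R f + (- a) *\<^sub>R y) (1 *\<^sub>R h + (- a) *\<^sub>R (1 / a) *\<^sub>R (h - y))"
    unfolding y_def by (intro gen_comb g gen_J a m)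
  then have g': "gen (f - a *\<^sub>R y) y" using a by simp
  then have e: "f - a *\<^sub>R y \<doteq> J a f" using J_unique[OF a g', of f] m by simp
  show "gen (J a f) (J a h)"
    using gen_cong[OF g' e] y by (simp add: y_def)
  show "J a f + a *\<^sub>R J a h \<doteq> f"
    using eqv_add[OF eqv_sym[OF e], of "a *\<^sub>R y" "a *\<^sub>R y"] y by (simp add: y_def)
qed

lemma J_commute:
  assumes a: "a > 0" and b: "b > 0" and f: "f \<in> V"
  shows "J a (J b f) \<doteq> J b (J a f)"
proof -
  note g = gen_J[OF b f]
  note Ja = contraction_J[OF a]
  define h where "h = (1 / b) *\<^sub>R (f - J b f)"
  have h: "h \<in> V" using b f by (simp add: h_def)
  have "J a (J b f) + b *\<^sub>R J a h \<doteq> J a (J b f + b *\<^sub>R h)"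
    using contractionD(3)[OF Ja, of "J b f" h 1 b] b f h by (simp add: eqv_sym)
  also have "J b f + b *\<^sub>R h = f" using b by (simp add: h_def)
  finally have "J a (J b f) + b *\<^sub>R J a h \<doteq> J a f" .
  then show ?thesis
    by (rule J_unique[OF b gen_J_comm(1)[OF a g], folded h_def])
qed

text \<open>On the domain of \<open>H^2\<close> the operators \<open>1 + (a + b) H\<close> and
  \<open>(1 + a H) (1 + b H)\<close> differ by \<open>a b H^2\<close>, and resolvents are
  contractions; here \<open>k\<close> is \<open>H^2 f\<close>.\<close>

lemma J_split:
  assumes a: "a > 0" and b: "b > 0" and fh: "gen f h" and hk: "gen h k"
  shows "nrm (J (a + b) f - J a (J b f)) \<le> a * b * nrm k"
proof -
  note Ja = contraction_J[OF a]
  have ab: "a + b > 0" using a b by simp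
  note m = genD[OF fh] genD[OF hk]
  define y y1 y2 where "y = J a (J b f)" and "y1 = J a (J b h)" and "y2 = J a (J b k)"
  have mem: "y \<in> V" "y1 \<in> V" "y2 \<in> V" using a b m by (auto simp: y_def y1_def y2_def)
  have g1: "gen y y1" unfolding y_def y1_def by (intro gen_J_comm a b fh)
  have 1: "y + a *\<^sub>R y1 \<doteq> J b f"
    unfolding y_def y1_def by (intro gen_J_comm(2) gen_J_comm(1) a b fh)
  have 2: "y1 + a *\<^sub>R y2 \<doteq> J b h"
    unfolding y1_def y2_def by (intro gen_J_comm(2) gen_J_comm(1) a b hk)
  have "(y + a *\<^sub>R y1) + b *\<^sub>R (y1 + a *\<^sub>R y2) \<doteq> J b f + b *\<^sub>R J b h"
    by (intro eqv_add eqv_scale 1 2)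
  also have "\<dots> \<doteq> f" by (rule gen_J_comm(2)[OF b fh])
  finally have "((y + a *\<^sub>R y1) + b *\<^sub>R (y1 + a *\<^sub>R y2)) - (a * b) *\<^sub>R y2 \<doteq> f - (a * b) *\<^sub>R y2"
    by (intro eqv_diff) (auto simp: mem)
  then have "y + (a + b) *\<^sub>R y1 \<doteq> f - (a * b) *\<^sub>R y2"
    by (simp add: algebra_simps)
  then have "y \<doteq> J (a + b) (f - (a * b) *\<^sub>R y2)"
    by (rule J_unique[OF ab g1])
  also have "\<dots> \<doteq> J (a + b) f - (a * b) *\<^sub>R J (a + b) y2"
    using contractionD(3)[OF contraction_J[OF ab], of f y2 1 "- (a * b)"] mem m by simp
  finally have "nrm (J (a + b) f - y) = nrm (J (a + b) f - (J (a + b) f - (a * b) *\<^sub>R J (a + b) y2))"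
    using ab m by (intro eqv_nrm_diff) auto
  also have "\<dots> = a * b * nrm (J (a + b) y2)"
    using ab mem a b by (simp add: nrm_scale)
  also have "\<dots> \<le> a * b * nrm k"
    using contractionD(2)[OF contraction_J[OF ab], of y2] mem a b m
      contractionD(2)[OF Ja, of "J b k"] contractionD(2)[OF contraction_J[OF b], of k]
    by (intro mult_left_mono) (auto simp: y2_def)
  finally show ?thesis by (simp add: y_def)
qed

lemma funpow_J_mem [simp]: "a > 0 \<Longrightarrow> f \<in> V \<Longrightarrow> (J a ^^ n) f \<in> V"
  using contractionD(1)[OF contraction_funpow[OF contraction_J]] by blast

lemma gen_funpow_J: "a > 0 \<Longrightarrow> gen f h \<Longrightarrow> gen ((J a ^^ n) f) ((J a ^^ n) h)"
  by (induction n) (auto intro: gen_J_comm)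

lemma funpow_J_symmetric: "a > 0 \<Longrightarrow> f \<in> V \<Longrightarrow> g \<in> V \<Longrightarrow> ip ((J a ^^ n) f) g = ip f ((J a ^^ n) g)"
proof (induction n arbitrary: g)
  case (Suc n)
  have "(J a ^^ Suc n) g = (J a ^^ n) (J a g)" by (simp add: funpow_swap1)
  with Suc show ?case by (simp only: funpow.simps o_apply J_symmetric funpow_J_mem J_V)
qed simp

lemma J_funpow_commute:
  assumes a: "a > 0" and b: "b > 0" and f: "f \<in> V"
  shows "J b ((J a ^^ n) f) \<doteq> (J a ^^ n) (J b f)"
proof (induction n)
  case 0 show ?case using b f by simp
next
  case (Suc n)
  have "J b (J a ((J a ^^ n) f)) \<doteq> J a (J b ((J a ^^ n) f))"
    by (rule J_commute) (use a b f in auto)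
  also have "\<dots> \<doteq> J a ((J a ^^ n) (J b f))"
    by (rule contraction_eqv[OF contraction_J[OF a] Suc])
  finally show ?case by simp
qed

text \<open>Each of the \<open>n\<close> steps contributes at most \<open>a * b * nrm k\<close>,
  because resolvents commute with \<open>H\<close> and contract. Equal step lengths give the
  convergence of the Euler approximants, different ones the semigroup law.\<close>

lemma funpow_J_split:
  assumes a: "a > 0" and b: "b > 0" and fh: "gen f h" and hk: "gen h k"
  shows "nrm ((J (a + b) ^^ n) f - (J a ^^ n) ((J b ^^ n) f)) \<le> real n * (a * b * nrm k)"
proof (induction n)
  case 0 show ?case by simp
next
  case (Suc n)
  have ab: "a + b > 0" using a b by simp
  note C = contraction_J[OF ab]
  note m = genD[OF fh] genD[OF hk]
  define x where "x = (J (a + b) ^^ n) f"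
  define y where "y = (J a ^^ n) ((J b ^^ n) f)"
  have mem: "x \<in> V" "y \<in> V" using a b ab m by (auto simp: x_def y_def)
  have e: "J a (J b y) \<doteq> (J a ^^ Suc n) ((J b ^^ Suc n) f)"
    using contraction_eqv[OF contraction_J[OF a] J_funpow_commute[OF a b, of "(J b ^^ n) f" n]] a b m
    by (simp add: y_def)
  have "nrm (J (a + b) y - J a (J b y)) \<le> a * b * nrm ((J a ^^ n) ((J b ^^ n) k))"
    unfolding y_def
    by (rule J_split[OF a b gen_funpow_J[OF a gen_funpow_J[OF b fh]] gen_funpow_J[OF a gen_funpow_J[OF b hk]]])
  also have "\<dots> \<le> a * b * nrm k"
    using contractionD(2)[OF contraction_funpow[OF contraction_J[OF a]], of "(J b ^^ n) k" n]
      contractionD(2)[OF contraction_funpow[OF contraction_J[OF b]], of k n] a b m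
    by (intro mult_left_mono) auto
  finally have 1: "nrm (J (a + b) y - J a (J b y)) \<le> a * b * nrm k" .
  have "nrm (J (a + b) x - J a (J b y)) \<le> nrm (J (a + b) x - J (a + b) y) + nrm (J (a + b) y - J a (J b y))"
    by (rule nrm_triangle_diff) (use a b ab mem in auto)
  also have "\<dots> \<le> nrm (x - y) + a * b * nrm k"
    using contraction_nrm_diff[OF C mem] 1 by simp
  also have "\<dots> \<le> real (Suc n) * (a * b * nrm k)"
    using Suc by (simp add: x_def y_def algebra_simps)
  also have "nrm (J (a + b) x - J a (J b y)) = nrm ((J (a + b) ^^ Suc n) f - (J a ^^ Suc n) ((J b ^^ Suc n) f))"
    by (intro eqv_nrm_diff e) (use ab mem in \<open>auto simp: x_def\<close>)
  finally show ?case .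
qed

lemma nrm_J_diff:
  assumes a: "a > 0" and g: "gen f h"
  shows "nrm (J a f - f) \<le> a * nrm h"
proof -
  note m = genD[OF g]
  have "nrm (J a f - f) = nrm (J a f - (J a f + a *\<^sub>R J a h))"
    by (intro eqv_nrm_diff eqv_sym[OF gen_J_comm(2)[OF a g]]) (use a m in auto)
  also have "\<dots> = a * nrm (J a h)" using a m by (simp add: nrm_scale)
  also have "\<dots> \<le> a * nrm h" using contractionD(2)[OF contraction_J[OF a] m(3)] a by simp
  finally show ?thesis .
qed

text \<open>Testing the resolvent equation with \<open>f - J a f\<close> gives
  \<open>|f - w|^2 + a E w w = a E w f\<close> for \<open>w = J a f\<close>; both bounds follow with
  \<open>2 E w f \<le> E w w + E f f\<close>.\<close>

lemma J_energy:
  assumes a: "a > 0" and f: "f \<in> W"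
  shows "E (J a f) (J a f) \<le> E f f" "ip (f - J a f) (f - J a f) \<le> a * E f f"
proof -
  define w where "w = J a f"
  have w: "w \<in> W" using J_props(1)[OF a] f by (simp add: w_def)
  have "ip (f - w) (f - w) = a * E w (f - w)"
    using E_J[OF a W_V[OF f], of "f - w"] a f w by (simp add: w_def)
  then have 1: "ip (f - w) (f - w) + a * E w w = a * E w f"
    using w f by (simp add: E.ip_lin algebra_simps)
  have "0 \<le> E (f - w) (f - w)" using w f by (intro E.ip_nonneg) auto
  then have 2: "2 * E w f \<le> E w w + E f f" using w f by (simp add: E.ip_lin E.ip_commute[of f w])
  have 3: "E w w \<le> E w f" using 1 ip_nonneg[of "f - w"] w f a
    by (smt (verit) W_V V_closed(3) mult_less_cancel_left_pos)
  show "E (J a f) (J a f) \<le> E f f" using 2 3 by (simp add: w_def)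
  have "a * E w f \<le> a * E f f" using 2 3 a by simp
  moreover have "a * E w w \<ge> 0" using a w by (simp add: E.ip_nonneg)
  ultimately show "ip (f - J a f) (f - J a f) \<le> a * E f f" using 1 by (simp add: w_def)
qed

lemma J_tendsto:
  assumes f: "f \<in> V" and e: "\<epsilon> > 0"
  shows "\<exists>\<delta>>0. \<forall>a. 0 < a \<and> a < \<delta> \<longrightarrow> nrm (J a f - f) < \<epsilon>"
proof -
  obtain g where g: "g \<in> W" "nrm (f - g) < \<epsilon> / 4" using dense[OF f, of "\<epsilon> / 4"] e by auto
  \<comment> \<open>Chosen so that the bound \<open>a * E g g\<close> of \<open>J_energy\<close> is
    below \<open>(\<epsilon> / 2)\<^sup>2\<close> for \<open>a < \<delta>\<close>.\<close>
  define \<delta> where "\<delta> = (\<epsilon> / 2)\<^sup>2 / (E g g + 1)"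
  have Eg: "E g g \<ge> 0" using g by (simp add: E.ip_nonneg)
  have "\<delta> > 0" using e Eg by (simp add: \<delta>_def)
  moreover have "nrm (J a f - f) < \<epsilon>" if a: "0 < a" "a < \<delta>" for a
  proof -
    have "(nrm (J a g - g))\<^sup>2 = ip (g - J a g) (g - J a g)"
      using nrm_diff_commute[of "J a g" g] nrm_square[of "g - J a g"] g a by simp
    also have "\<dots> \<le> a * E g g" by (rule J_energy(2)[OF a(1) g(1)])
    also have "\<dots> \<le> a * (E g g + 1)" using a by simp
    also have "\<dots> < \<delta> * (E g g + 1)" using a Eg by (intro mult_strict_right_mono) auto
    also have "\<dots> = (\<epsilon> / 2)\<^sup>2" using Eg by (simp add: \<delta>_def)
    finally have 1: "nrm (J a g - g) < \<epsilon> / 2" using e by (intro power2_less_imp_less[of _ "\<epsilon> / 2"]) auto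
    have "nrm (J a f - f) \<le> nrm (J a f - J a g) + nrm (J a g - f)"
      by (rule nrm_triangle_diff) (use a f g in auto)
    also have "nrm (J a g - f) \<le> nrm (J a g - g) + nrm (g - f)"
      by (rule nrm_triangle_diff) (use a f g in auto)
    also have "nrm (J a f - J a g) \<le> nrm (f - g)"
      using contraction_nrm_diff[OF contraction_J[OF a(1)]] f g by auto
    finally show ?thesis using 1 g nrm_diff_commute[of f g] f by simp
  qed
  ultimately show ?thesis by blast
qed

lemma J_at_right: "f \<in> V \<Longrightarrow> ((\<lambda>a. nrm (J a f - f)) \<longlongrightarrow> 0) (at_right 0)"
  unfolding tendsto_iff eventually_at_right_field dist_real_def
  using J_tendsto[of f] by (simp add: abs_of_nonneg) metis

text \<open>Applying the resolvent twice lands in the domain of \<open>H^2\<close>, where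
  \<open>J_split\<close> has a rate; \<open>g\<close>, \<open>h\<close>, \<open>k\<close> are an
  element, its image and its second image under \<open>H\<close>.\<close>

lemma gen2_dense:
  assumes f: "f \<in> V" and e: "\<epsilon> > 0"
  shows "\<exists>g h k. gen g h \<and> gen h k \<and> nrm (f - g) < \<epsilon>"
proof -
  obtain \<delta> where d: "\<delta> > 0" "\<And>a. 0 < a \<Longrightarrow> a < \<delta> \<Longrightarrow> nrm (J a f - f) < \<epsilon> / 2"
    using J_tendsto[OF f, of "\<epsilon> / 2"] e by auto
  define a where "a = \<delta> / 2"
  have a: "a > 0" "a < \<delta>" using d by (auto simp: a_def)
  have Jf: "J a f \<in> V" using a f by simp
  have g1: "gen (J a (J a f)) (J a ((1 / a) *\<^sub>R (f - J a f)))"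
    by (rule gen_J_comm(1)[OF a(1) gen_J[OF a(1) f]])
  have g2: "gen (J a ((1 / a) *\<^sub>R (f - J a f))) ((1 / a) *\<^sub>R ((1 / a) *\<^sub>R (f - J a f) - J a ((1 / a) *\<^sub>R (f - J a f))))"
    by (rule gen_J) (use a f in auto)
  have "nrm (J a (J a f) - f) \<le> nrm (J a (J a f) - J a f) + nrm (J a f - f)"
    by (rule nrm_triangle_diff) (use a f in auto)
  also have "nrm (J a (J a f) - J a f) \<le> nrm (J a f - f)"
    by (rule contraction_nrm_diff[OF contraction_J[OF a(1)] Jf f])
  finally have "nrm (f - J a (J a f)) < \<epsilon>"
    using d(2)[OF a] nrm_diff_commute[of f "J a (J a f)"] a f by simp
  then show ?thesis using g1 g2 by blast
qed

text \<open>Since the domain of the generator is convex, it is dense in the form norm.\<close>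

lemma E_J_tendsto:
  assumes u: "u \<in> W" and v: "v \<in> W"
  shows "((\<lambda>a. E (J a u) v) \<longlongrightarrow> E u v) (at_right 0)"
proof -
  define A where "A = {w. \<exists>h. gen w h}"
  have "convex A" unfolding A_def convex_def using gen_comb by blast
  have AW: "A \<subseteq> W" by (auto simp: A_def gen_def)
  have "\<exists>w\<in>A. nrm (w - v) < \<epsilon> \<and> E w w \<le> E v v" if e: "\<epsilon> > 0" for \<epsilon>
  proof -
    obtain \<delta> where d: "\<delta> > 0" "\<And>a. 0 < a \<Longrightarrow> a < \<delta> \<Longrightarrow> nrm (J a v - v) < \<epsilon>"
      using J_tendsto[OF W_V[OF v] e] by auto
    have "J (\<delta> / 2) v \<in> A" using gen_J[of "\<delta> / 2" v] d v by (auto simp: A_def)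
    then show ?thesis using J_energy(1)[of "\<delta> / 2" v] d(2)[of "\<delta> / 2"] d(1) v by auto
  qed
  note app = convex_approximation(2)[OF AW \<open>convex A\<close> W_V[OF v] this]
  have Eu: "E.nrm u \<ge> 0" using u by simp
  have bound: "E.nrm (J a u) \<le> E.nrm u" if "a > 0" for a
    using J_energy(1)[OF that u] by (simp add: E.nrm_def)
  show ?thesis
    unfolding tendsto_iff
  proof safe
    fix e :: real assume e: "e > 0"
    define \<epsilon> where "\<epsilon> = (e / (4 * (E.nrm u + 1)))\<^sup>2"
    have "\<epsilon> > 0" using e Eu by (simp add: \<epsilon>_def)
    then obtain w h where w: "gen w h" "E1 (w - v) < \<epsilon>" using app A_def by blast
    have wW: "w \<in> W" using genD[OF w(1)] by simp
    have "(E.nrm (v - w))\<^sup>2 < \<epsilon>"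
      using w(2) ip_nonneg[of "w - v"] v wW E.nrm_diff_commute[of v w] by (simp add: E.nrm_square)
    then have near: "E.nrm (v - w) < e / (4 * (E.nrm u + 1))"
      unfolding \<epsilon>_def by (rule power2_less_imp_less) (use e Eu in simp)
    then have "E.nrm u * E.nrm (v - w) \<le> E.nrm u * (e / (4 * (E.nrm u + 1)))"
      using Eu by (intro mult_left_mono) auto
    also have "\<dots> < e / 3" using Eu e by (simp add: field_simps add_nonneg_pos)
    finally have small: "E.nrm u * E.nrm (v - w) < e / 3" .
    \<comment> \<open>For \<open>w\<close> in the domain of \<open>H\<close> the pairing
      \<open>E (J a u) w\<close> is \<open>ip (J a u) h\<close>, which converges already by norm
      convergence; the remainder \<open>v - w\<close> is small in energy, and the energy of
      \<open>J a u\<close> is bounded uniformly in \<open>a\<close>.\<close>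
    have "((\<lambda>a. ip (J a u) h) \<longlongrightarrow> ip u h) (at_right 0)"
    \<comment> \<open>\<open>J a\<close> is specified only for \<open>a > 0\<close>, whereas
      \<open>tendsto_ip\<close> wants membership for every parameter; elsewhere the limit itself is
      inserted.\<close>
    proof (rule Lim_transform_eventually[where f = "\<lambda>a. ip (if a > 0 then J a u else u) h"])
      have "((\<lambda>a. nrm ((if a > 0 then J a u else u) - u)) \<longlongrightarrow> 0) (at_right 0)"
        by (rule Lim_transform_eventually[OF J_at_right[OF W_V[OF u]]])
          (auto simp: eventually_at_right_field intro: exI[of _ 1])
      then show "((\<lambda>a. ip (if a > 0 then J a u else u) h) \<longlongrightarrow> ip u h) (at_right 0)"
        by (intro tendsto_ip) (use u genD[OF w(1)] in auto)
    qed (auto simp: eventually_at_right_field intro: exI[of _ 1])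
    then have "\<forall>\<^sub>F a in at_right 0. dist (ip (J a u) h) (ip u h) < e / 3"
      using e by (intro tendstoD) auto
    then show "\<forall>\<^sub>F a in at_right 0. dist (E (J a u) v) (E u v) < e"
    proof (rule eventually_mono[OF eventually_conj[OF eventually_at_right_less]])
      fix a assume *: "0 < a \<and> dist (ip (J a u) h) (ip u h) < e / 3"
      then have a: "a > 0" by simp
      have Ju: "J a u \<in> W" using J_props(1)[OF a] u by auto
      have "E (J a u) w - E u w = ip (J a u) h - ip u h"
        using genD(4)[OF w(1)] Ju u wW genD[OF w(1)] by (simp add: E.ip_commute[of _ w] ip_commute[of _ h])
      then have 1: "\<bar>E (J a u) w - E u w\<bar> < e / 3" using * by (simp add: dist_real_def)
      have "\<bar>E (J a u) (v - w)\<bar> \<le> E.nrm (J a u) * E.nrm (v - w)"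
        using E.cauchy_schwarz Ju v wW by auto
      also have "\<dots> \<le> E.nrm u * E.nrm (v - w)" using bound[OF a] v wW by (intro mult_right_mono) auto
      finally have 2: "\<bar>E (J a u) (v - w)\<bar> < e / 3" using small by simp
      have "\<bar>E u (v - w)\<bar> < e / 3"
        using E.cauchy_schwarz[of u "v - w"] u v wW small by auto
      then show "dist (E (J a u) v) (E u v) < e"
        using 1 2 unfolding dist_real_def E.ip_diff_right[OF v wW Ju] E.ip_diff_right[OF v wW u] by linarith
    qed
  qed
qed

text \<open>The bounded quantity is the approximating form at \<open>u\<close>; it dominates the
  energy of \<open>J a u\<close>, so the resolvents of \<open>u\<close> approximate it with bounded
  energy.\<close>

lemma mem_domain_of_bounded_energy:
  assumes u: "u \<in> V" and d: "\<delta> > 0"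
    and b: "\<And>a. 0 < a \<Longrightarrow> a < \<delta> \<Longrightarrow> (1 / a) * ip (u - J a u) u \<le> C"
  shows "u \<in> W"
proof (rule form_closed_of_approximation(1)[OF u])
  fix \<epsilon> :: real assume "\<epsilon> > 0"
  then obtain \<eta> where e: "\<eta> > 0" "\<And>a. 0 < a \<Longrightarrow> a < \<eta> \<Longrightarrow> nrm (J a u - u) < \<epsilon>"
    using J_tendsto[OF u, of \<epsilon>] by auto
  define a where "a = min \<delta> \<eta> / 2"
  have a: "a > 0" "a < \<delta>" "a < \<eta>" using d e(1) by (auto simp: a_def)
  have Ju: "J a u \<in> W" using J_props(1)[OF a(1) u] .
  have "E (J a u) (J a u) = (1 / a) * ip (u - J a u) (J a u)"
    by (rule E_J) (use a u Ju in auto)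
  also have "\<dots> \<le> (1 / a) * ip (u - J a u) u"
  proof (rule mult_left_mono)
    show "ip (u - J a u) (J a u) \<le> ip (u - J a u) u"
      using ip_nonneg[of "u - J a u"] u Ju by (simp add: ip_diff_right)
  qed (use a in simp)
  also have "\<dots> \<le> C" using b a by blast
  finally show "\<exists>w\<in>W. nrm (w - u) < \<epsilon> \<and> E w w \<le> C" using e(2)[OF a(1,3)] Ju by blast
qed

end

section \<open>The heat semigroup of a closed form\<close>

context dense_form
begin

text \<open>\<open>2 ^ n\<close> implicit Euler steps for \<open>e^(-t H)\<close>. Dyadic numbers of
  steps make the passage from \<open>n\<close> to \<open>Suc n\<close> a halving of every step,
  which \<open>funpow_J_split\<close> compares.\<close>

definition euler :: "nat \<Rightarrow> real \<Rightarrow> 'a \<Rightarrow> 'a" where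
  "euler n t = J (t / 2 ^ n) ^^ (2 ^ n)"

lemma contraction_euler: "t > 0 \<Longrightarrow> contraction (euler n t)"
  unfolding euler_def by (intro contraction_funpow contraction_J) simp

lemma euler_V [simp]: "t > 0 \<Longrightarrow> f \<in> V \<Longrightarrow> euler n t f \<in> V"
  by (simp add: euler_def)

lemma euler_step:
  assumes t: "t > 0" and fh: "gen f h" and hk: "gen h k"
  shows "nrm (euler n t f - euler (Suc n) t f) \<le> t\<^sup>2 * nrm k * (1 / 2 ^ n - 1 / 2 ^ Suc n)"
proof -
  define b where "b = t / 2 ^ Suc n"
  have b: "b > 0" and bb: "b + b = t / 2 ^ n" and tb: "t / (2 * 2 ^ n) = b" using t by (auto simp: b_def field_simps)
  have "(J b ^^ 2 ^ Suc n) f = (J b ^^ 2 ^ n) ((J b ^^ 2 ^ n) f)"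
    by (simp add: funpow_add mult_2)
  then have "nrm (euler n t f - euler (Suc n) t f) \<le> real (2 ^ n) * (b * b * nrm k)"
    using funpow_J_split[OF b b fh hk, of "2 ^ n"] by (simp add: euler_def bb tb)
  also have "\<dots> = t\<^sup>2 * nrm k * (1 / 2 ^ n) * (1/4)"
    by (simp add: b_def power2_eq_square field_simps flip: power_mult_distrib)
  \<comment> \<open>The factor 1/4 is relaxed to 1/2, since \<open>1 / 2 ^ n - 1 / 2 ^ Suc n\<close>
    is half of \<open>1 / 2 ^ n\<close> and bounds of this shape telescope.\<close>
  also have "\<dots> \<le> t\<^sup>2 * nrm k * (1 / 2 ^ n) * (1/2)"
    using genD[OF hk] by (intro mult_left_mono) auto
  finally show ?thesis by (simp add: algebra_simps)
qed

lemma euler_diff: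
  assumes t: "t > 0" and fh: "gen f h" and hk: "gen h k"
  shows "nrm (euler n t f - euler (n + m) t f) \<le> t\<^sup>2 * nrm k * (1 / 2 ^ n - 1 / 2 ^ (n + m))"
proof (induction m)
  case 0 then show ?case using t genD[OF fh] by simp
next
  case (Suc m)
  have "nrm (euler n t f - euler (n + Suc m) t f)
      \<le> nrm (euler n t f - euler (n + m) t f) + nrm (euler (n + m) t f - euler (Suc (n + m)) t f)"
    using nrm_triangle_diff[of "euler n t f" "euler (n + m) t f" "euler (Suc (n + m)) t f"] t genD[OF fh] by simp
  also have "\<dots> \<le> t\<^sup>2 * nrm k * (1 / 2 ^ n - 1 / 2 ^ (n + m)) + t\<^sup>2 * nrm k * (1 / 2 ^ (n + m) - 1 / 2 ^ Suc (n + m))"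
    by (intro add_mono Suc euler_step[OF t fh hk])
  also have "\<dots> = t\<^sup>2 * nrm k * (1 / 2 ^ n - 1 / 2 ^ (n + Suc m))"
    by (simp add: algebra_simps)
  finally show ?case .
qed

lemma euler_limit:
  assumes t: "t > 0" and f: "f \<in> V"
  shows "\<exists>u\<in>V. (\<lambda>n. nrm (euler n t f - u)) \<longlonglongrightarrow> 0"
proof (rule complete)
  show "euler n t f \<in> V" for n using t f by simp
  fix \<epsilon> :: real assume e: "\<epsilon> > 0"
  obtain g h k where g: "gen g h" "gen h k" "nrm (f - g) < \<epsilon> / 3"
    using gen2_dense[OF f, of "\<epsilon> / 3"] e by auto
  define c where "c = t\<^sup>2 * nrm k"
  have c: "c \<ge> 0" using genD[OF g(2)] by (simp add: c_def)
  have "(\<lambda>n. c * (1 / 2) ^ n) \<longlonglongrightarrow> c * 0" by (intro tendsto_intros LIMSEQ_realpow_zero) auto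
  then have "\<forall>\<^sub>F n in sequentially. c * (1 / 2) ^ n < \<epsilon> / 3"
    by (rule order_tendstoD(2)) (use e in simp)
  then obtain N where N: "\<And>n. n \<ge> N \<Longrightarrow> c * (1 / 2) ^ n < \<epsilon> / 3" by (auto simp: eventually_sequentially)
  have gV: "g \<in> V" using genD[OF g(1)] by simp
  have step: "nrm (euler n t f - euler (n + m) t f) < \<epsilon>" if "n \<ge> N" for m n
  proof -
    have "nrm (euler n t f - euler (n + m) t f) \<le> nrm (euler n t f - euler n t g) + nrm (euler n t g - euler (n + m) t f)"
      by (rule nrm_triangle_diff) (use t f gV in auto)
    also have "nrm (euler n t g - euler (n + m) t f) \<le> nrm (euler n t g - euler (n + m) t g) + nrm (euler (n + m) t g - euler (n + m) t f)"
      by (rule nrm_triangle_diff) (use t f gV in auto)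
    finally have "nrm (euler n t f - euler (n + m) t f) \<le> nrm (f - g) + (nrm (euler n t g - euler (n + m) t g) + nrm (g - f))"
      using contraction_nrm_diff[OF contraction_euler[OF t, of n] f gV] contraction_nrm_diff[OF contraction_euler[OF t, of "n + m"] gV f]
      by linarith
    moreover have "nrm (euler n t g - euler (n + m) t g) < \<epsilon> / 3"
    proof -
      have "nrm (euler n t g - euler (n + m) t g) \<le> c * (1 / 2 ^ n - 1 / 2 ^ (n + m))"
        unfolding c_def by (rule euler_diff[OF t g(1,2)])
      also have "\<dots> \<le> c * (1 / 2) ^ n"
        using c by (intro mult_left_mono) (auto simp: power_one_over)
      finally show ?thesis using N[OF that] by simp
    qed
    ultimately show ?thesis using g(3) nrm_diff_commute[OF f gV] by simp
  qed
  have "nrm (euler m t f - euler n t f) < \<epsilon>" if "m \<ge> N" "n \<ge> N" for m n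
  proof (cases "m \<le> n")
    case True then show ?thesis using step[OF that(1), of "n - m"] by simp
  next
    case False then show ?thesis
      using step[OF that(2), of "m - n"] nrm_diff_commute[of "euler m t f" "euler n t f"] t f by simp
  qed
  then show "\<exists>N. \<forall>m\<ge>N. \<forall>n\<ge>N. nrm (euler m t f - euler n t f) < \<epsilon>" by blast
qed

text \<open>Time 0 is set apart, since the Euler steps would involve \<open>J 0\<close>, about which
  nothing is known. The limit is unique only as a class, hence the choice.\<close>

definition P :: "real \<Rightarrow> 'a \<Rightarrow> 'a" where
  "P t f = (if t = 0 then f else SOME u. u \<in> V \<and> (\<lambda>n. nrm (euler n t f - u)) \<longlonglongrightarrow> 0)"

lemma P_zero [simp]: "P 0 f = f"
  by (simp add: P_def)

lemma euler_tendsto_P: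
  assumes t: "t > 0" and f: "f \<in> V"
  shows "P t f \<in> V" "(\<lambda>n. nrm (euler n t f - P t f)) \<longlonglongrightarrow> 0"
proof -
  have "P t f \<in> V \<and> (\<lambda>n. nrm (euler n t f - P t f)) \<longlonglongrightarrow> 0"
    using t unfolding P_def
    by simp (rule someI_ex, use euler_limit[OF t f] in blast)
  then show "P t f \<in> V" "(\<lambda>n. nrm (euler n t f - P t f)) \<longlonglongrightarrow> 0" by auto
qed

lemma P_V [simp]: "t \<ge> 0 \<Longrightarrow> f \<in> V \<Longrightarrow> P t f \<in> V"
  using euler_tendsto_P(1) by (cases "t = 0") auto

lemma contraction_P:
  assumes "t \<ge> 0"
  shows "contraction (P t)"
proof (cases "t = 0")
  case True
  have "contraction (J 1 ^^ 0)" by (rule contraction_funpow[OF contraction_J]) simp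
  then show ?thesis using True by (simp add: id_def P_def[abs_def])
next
  case False
  then have "t > 0" using assms by simp
  then show ?thesis
    using contraction_limit[of "\<lambda>n. euler n t", OF contraction_euler euler_tendsto_P] by simp
qed

text \<open>Invariance principle: what is stable under resolvents and norm limits is stable under
  the semigroup. It transfers nonnegativity and upper bounds by constants.\<close>

lemma P_closed_set:
  assumes t: "t \<ge> 0" and C: "C \<subseteq> V" "\<And>a f. a > 0 \<Longrightarrow> f \<in> C \<Longrightarrow> J a f \<in> C"
    and lim: "\<And>u v. (\<And>n::nat. u n \<in> C) \<Longrightarrow> v \<in> V \<Longrightarrow> (\<lambda>n. nrm (u n - v)) \<longlonglongrightarrow> 0 \<Longrightarrow> v \<in> C"
    and f: "f \<in> C"
  shows "P t f \<in> C"
proof (cases "t = 0")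
  case False
  then have t: "t > 0" using t by simp
  have "(J a ^^ n) f \<in> C" if "a > 0" for a n
    by (induction n) (use C f that in auto)
  then have "euler n t f \<in> C" for n using t by (simp add: euler_def)
  then show ?thesis by (rule lim[of "\<lambda>n. euler n t f"]) (use euler_tendsto_P[OF t] C f in auto)
qed (use f in simp)

lemma P_symmetric:
  assumes t: "t \<ge> 0" and fg: "f \<in> V" "g \<in> V"
  shows "ip (P t f) g = ip f (P t g)"
proof (cases "t = 0")
  case False
  then have t: "t > 0" using t by simp
  have "ip (euler n t f) g = ip f (euler n t g)" for n
    unfolding euler_def by (rule funpow_J_symmetric) (use t fg in auto)
  moreover have "(\<lambda>n. ip (euler n t f) g) \<longlonglongrightarrow> ip (P t f) g"
    by (intro tendsto_ip euler_tendsto_P) (use t fg in auto)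
  moreover have "(\<lambda>n. ip f (euler n t g)) \<longlonglongrightarrow> ip f (P t g)"
    by (intro tendsto_ip euler_tendsto_P) (use t fg in auto)
  ultimately show ?thesis by (auto intro: LIMSEQ_unique)
qed simp

lemma eqv_on_gen2:
  assumes S: "contraction S" and T: "contraction T"
    and eq: "\<And>f h k. gen f h \<Longrightarrow> gen h k \<Longrightarrow> S f \<doteq> T f"
    and f: "f \<in> V"
  shows "S f \<doteq> T f"
proof -
  have "nrm (S f - T f) \<le> 0 + e" if e: "e > 0" for e
  proof -
    obtain g h k where g: "gen g h" "gen h k" "nrm (f - g) < e / 2"
      using gen2_dense[OF f, of "e / 2"] e by auto
    have gV: "g \<in> V" using genD[OF g(1)] by simp
    note mem = contractionD(1)[OF S f] contractionD(1)[OF T f] contractionD(1)[OF S gV] contractionD(1)[OF T gV]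
    have "nrm (S f - T f) \<le> nrm (S f - S g) + nrm (S g - T f)"
      by (rule nrm_triangle_diff) (use mem in auto)
    also have "nrm (S g - T f) = nrm (T g - T f)"
      by (rule eqv_nrm_diff[OF eq[OF g(1,2)]]) (use mem in auto)
    finally show ?thesis
      using contraction_nrm_diff[OF S f gV] contraction_nrm_diff[OF T gV f] g(3) nrm_diff_commute[OF f gV] by linarith
  qed
  then have "nrm (S f - T f) \<le> 0" using field_le_epsilon by blast
  then show ?thesis using contractionD(1)[OF S f] contractionD(1)[OF T f] by (simp add: eqv_def)
qed

text \<open>The mixed product \<open>x n\<close> of approximants tends to \<open>P s (P t f)\<close>
  by contractivity; on the domain of \<open>H^2\<close> it is within \<open>s t |k| / 2^n\<close> of
  the approximant for \<open>s + t\<close>, and \<open>eqv_on_gen2\<close> extends the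
  identity.\<close>

lemma P_semigroup_pos:
  assumes s: "s > 0" and t: "t > 0" and f: "f \<in> V"
  shows "P (s + t) f \<doteq> P s (P t f)"
proof (rule eqv_on_gen2[where S = "P (s + t)" and T = "\<lambda>f. P s (P t f)", OF _ _ _ f])
  show "contraction (P (s + t))" "contraction (\<lambda>f. P s (P t f))"
    using s t contraction_comp[OF contraction_P[of s] contraction_P[of t]] contraction_P[of "s + t"] by auto
  fix f h k assume fh: "gen f h" and hk: "gen h k"
  note m = genD[OF fh] genD[OF hk]
  have st: "s + t > 0" using s t by simp
  have Pt: "P t f \<in> V" "P s (P t f) \<in> V" "P (s + t) f \<in> V" using s t m by auto
  define x where "x n = euler n s (euler n t f)" for n
  have xV: "x n \<in> V" for n using s t m by (simp add: x_def)
  have "(\<lambda>n. nrm (euler n t f - P t f) + nrm (euler n s (P t f) - P s (P t f))) \<longlonglongrightarrow> 0 + 0"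
    by (intro tendsto_intros euler_tendsto_P) (use s t m in auto)
  then have lim0: "(\<lambda>n. nrm (euler n t f - P t f) + nrm (euler n s (P t f) - P s (P t f))) \<longlonglongrightarrow> 0" by simp
  have 1: "(\<lambda>n. nrm (x n - P s (P t f))) \<longlonglongrightarrow> 0"
  proof (rule Lim_null_comparison[OF _ lim0], rule always_eventually, rule allI)
    fix n
    have "nrm (x n - P s (P t f)) \<le> nrm (x n - euler n s (P t f)) + nrm (euler n s (P t f) - P s (P t f))"
      by (rule nrm_triangle_diff) (use s Pt xV in auto)
    moreover have "nrm (x n - euler n s (P t f)) \<le> nrm (euler n t f - P t f)"
      unfolding x_def by (rule contraction_nrm_diff[OF contraction_euler[OF s]]) (use t m in auto)
    ultimately show "norm (nrm (x n - P s (P t f))) \<le> nrm (euler n t f - P t f) + nrm (euler n s (P t f) - P s (P t f))"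
      using xV Pt by simp
  qed
  have "(\<lambda>n. s * t * nrm k * (1 / 2) ^ n + nrm (euler n (s + t) f - P (s + t) f)) \<longlonglongrightarrow> s * t * nrm k * 0 + 0"
    by (intro tendsto_intros euler_tendsto_P LIMSEQ_realpow_zero) (use st m in auto)
  then have lim0: "(\<lambda>n. s * t * nrm k * (1 / 2) ^ n + nrm (euler n (s + t) f - P (s + t) f)) \<longlonglongrightarrow> 0" by simp
  have 2: "(\<lambda>n. nrm (x n - P (s + t) f)) \<longlonglongrightarrow> 0"
  proof (rule Lim_null_comparison[OF _ lim0], rule always_eventually, rule allI)
    fix n
    have pos: "s / 2 ^ n > 0" "t / 2 ^ n > 0" using s t by auto
    have "nrm (x n - P (s + t) f) \<le> nrm (x n - euler n (s + t) f) + nrm (euler n (s + t) f - P (s + t) f)"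
      by (rule nrm_triangle_diff) (use st Pt xV m in auto)
    moreover have "nrm (euler n (s + t) f - x n) \<le> real (2 ^ n) * (s / 2 ^ n * (t / 2 ^ n) * nrm k)"
      using funpow_J_split[OF pos fh hk, of "2 ^ n"] by (simp add: x_def euler_def add_divide_distrib)
    moreover have "real (2 ^ n) * (s / 2 ^ n * (t / 2 ^ n) * nrm k) = s * t * nrm k * (1 / 2) ^ n"
      by (simp add: field_simps)
    ultimately show "norm (nrm (x n - P (s + t) f)) \<le> s * t * nrm k * (1 / 2) ^ n + nrm (euler n (s + t) f - P (s + t) f)"
      using xV Pt st m nrm_diff_commute[of "euler n (s + t) f" "x n"] by simp
  qed
  show "P (s + t) f \<doteq> P s (P t f)"
    using nrm_limit_unique[OF xV Pt(3,2) _ 2 1] Pt by (simp add: eqv_def)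
qed

lemma P_semigroup: "s \<ge> 0 \<Longrightarrow> t \<ge> 0 \<Longrightarrow> f \<in> V \<Longrightarrow> P (s + t) f \<doteq> P s (P t f)"
  using P_semigroup_pos[of s t f] by (cases "s = 0"; cases "t = 0") auto

lemma nrm_funpow_J_diff:
  assumes a: "a > 0" and g: "gen f h"
  shows "nrm ((J a ^^ n) f - f) \<le> real n * a * nrm h"
proof (induction n)
  case (Suc n)
  note m = genD[OF g]
  have "nrm ((J a ^^ Suc n) f - f) \<le> nrm ((J a ^^ Suc n) f - (J a ^^ n) f) + nrm ((J a ^^ n) f - f)"
    by (rule nrm_triangle_diff) (use a m in auto)
  moreover have "nrm ((J a ^^ Suc n) f - (J a ^^ n) f) \<le> a * nrm ((J a ^^ n) h)"
    using nrm_J_diff[OF a gen_funpow_J[OF a g]] by simp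
  moreover have "a * nrm ((J a ^^ n) h) \<le> a * nrm h"
    using contractionD(2)[OF contraction_funpow[OF contraction_J[OF a]] m(3)] a by simp
  ultimately show ?case using Suc by (simp add: algebra_simps)
qed simp

text \<open>The increments are \<open>- a J^(i+1) h\<close>, so the error is governed by
  \<open>h - J^(i+1) h\<close>. This has a rate only on the domain of \<open>H\<close>, whence the
  auxiliary \<open>h'\<close> with \<open>H h' = k'\<close>.\<close>

lemma funpow_J_generator:
  assumes a: "a > 0" and g: "gen f h" and g': "gen h' k'"
  shows "nrm ((J a ^^ n) f - f + (real n * a) *\<^sub>R h) \<le> real n * a * (2 * nrm (h - h') + real n * a * nrm k')"
proof (induction n)
  case (Suc n)
  note m = genD[OF g] genD[OF g']
  define B where "B i = 2 * nrm (h - h') + real i * a * nrm k'" for i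
  have B0: "B i \<ge> 0" for i using a m by (simp add: B_def)
  let ?x = "(J a ^^ n) f" and ?y = "(J a ^^ Suc n) f" and ?z = "(J a ^^ Suc n) h"
  have mem: "?x \<in> V" "?y \<in> V" "?z \<in> V" using a m by auto
  have 1: "?y + a *\<^sub>R ?z \<doteq> ?x"
    using gen_J_comm(2)[OF a gen_funpow_J[OF a g, of n]] by simp
  have zh: "nrm (h - ?z) \<le> B (Suc n)"
  proof -
    have h'V: "(J a ^^ Suc n) h' \<in> V" using a m by simp
    have "nrm (h - ?z) \<le> nrm (h - h') + nrm (h' - ?z)"
      by (rule nrm_triangle_diff) (use mem m in auto)
    also have "nrm (h' - ?z) \<le> nrm (h' - (J a ^^ Suc n) h') + nrm ((J a ^^ Suc n) h' - ?z)"
      by (rule nrm_triangle_diff) (use mem m h'V in auto)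
    also have "nrm ((J a ^^ Suc n) h' - ?z) \<le> nrm (h' - h)"
      by (rule contraction_nrm_diff[OF contraction_funpow[OF contraction_J[OF a]]]) (use m in auto)
    also have "nrm (h' - (J a ^^ Suc n) h') \<le> real (Suc n) * a * nrm k'"
      using nrm_funpow_J_diff[OF a g', of "Suc n"] nrm_diff_commute[OF _ h'V, of h'] m by simp
    finally show ?thesis using nrm_diff_commute[of h h'] m by (simp add: B_def)
  qed
  have split: "?y - f + (real (Suc n) * a) *\<^sub>R h
      = (?y - ?x + a *\<^sub>R ?z) + ((?x - f + (real n * a) *\<^sub>R h) + a *\<^sub>R (h - ?z))"
    by (simp add: algebra_simps)
  have "nrm (?y - f + (real (Suc n) * a) *\<^sub>R h) \<le> nrm (?y - ?x + a *\<^sub>R ?z) + nrm ((?x - f + (real n * a) *\<^sub>R h) + a *\<^sub>R (h - ?z))"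
    unfolding split by (rule nrm_triangle) (use mem m in auto)
  moreover have "nrm (?y - ?x + a *\<^sub>R ?z) = 0"
    using eqvD(3)[OF 1] by (simp add: algebra_simps)
  moreover have "nrm ((?x - f + (real n * a) *\<^sub>R h) + a *\<^sub>R (h - ?z)) \<le> nrm (?x - f + (real n * a) *\<^sub>R h) + a * nrm (h - ?z)"
    using nrm_triangle[of "?x - f + (real n * a) *\<^sub>R h" "a *\<^sub>R (h - ?z)"] mem m a by (simp add: nrm_scale)
  moreover have "nrm (?x - f + (real n * a) *\<^sub>R h) \<le> real n * a * B n" using Suc by (simp add: B_def)
  moreover have "a * nrm (h - ?z) \<le> a * B (Suc n)" using mult_left_mono[OF zh, of a] a by simp
  ultimately have "nrm (?y - f + (real (Suc n) * a) *\<^sub>R h) \<le> real n * a * B n + a * B (Suc n)"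
    by linarith
  also have "\<dots> \<le> real n * a * B (Suc n) + a * B (Suc n)"
    using a m by (intro add_right_mono mult_left_mono) (auto simp: B_def intro!: mult_right_mono)
  also have "\<dots> = real (Suc n) * a * B (Suc n)" by (simp add: algebra_simps)
  finally show ?case by (simp add: B_def)
qed simp

lemma P_generator_bound:
  assumes t: "t > 0" and g: "gen f h" and g': "gen h' k'"
  shows "nrm (P t f - f + t *\<^sub>R h) \<le> t * (2 * nrm (h - h') + t * nrm k')"
proof -
  note m = genD[OF g] genD[OF g']
  have ta: "real (2 ^ n) * (t / 2 ^ n) = t" for n by simp
  have le: "nrm (euler n t f - f + t *\<^sub>R h) \<le> t * (2 * nrm (h - h') + t * nrm k')" for n
    using funpow_J_generator[OF _ g g', of "t / 2 ^ n" "2 ^ n"] t unfolding ta euler_def by simp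
  have "(\<lambda>n. nrm (euler n t f - P t f) + t * (2 * nrm (h - h') + t * nrm k')) \<longlonglongrightarrow> 0 + t * (2 * nrm (h - h') + t * nrm k')"
    by (intro tendsto_intros euler_tendsto_P) (use t m in auto)
  moreover have "\<forall>n. nrm (P t f - f + t *\<^sub>R h) \<le> nrm (euler n t f - P t f) + t * (2 * nrm (h - h') + t * nrm k')"
  proof
    fix n
    have split: "P t f - f + t *\<^sub>R h = (P t f - euler n t f) + (euler n t f - f + t *\<^sub>R h)" by simp
    have "nrm (P t f - f + t *\<^sub>R h) \<le> nrm (P t f - euler n t f) + nrm (euler n t f - f + t *\<^sub>R h)"
      unfolding split by (rule nrm_triangle) (use t m in auto)
    then show "nrm (P t f - f + t *\<^sub>R h) \<le> nrm (euler n t f - P t f) + t * (2 * nrm (h - h') + t * nrm k')"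
      using le[of n] nrm_diff_commute[of "P t f" "euler n t f"] t m by simp
  qed
  ultimately have "nrm (P t f - f + t *\<^sub>R h) \<le> 0 + t * (2 * nrm (h - h') + t * nrm k')"
    by (intro LIMSEQ_le_const) auto
  then show ?thesis by simp
qed

text \<open>Sign convention: the difference quotient tends to \<open>- h\<close>, because
  \<open>h\<close> stands for \<open>H f\<close> and the generator is \<open>- H\<close>.\<close>

definition diff_quotient_limit :: "(real \<Rightarrow> 'a \<Rightarrow> 'a) \<Rightarrow> 'a \<Rightarrow> 'a \<Rightarrow> bool" where
  "diff_quotient_limit Q f h \<longleftrightarrow> ((\<lambda>t. nrm ((1 / t) *\<^sub>R (Q t f - f) + h)) \<longlongrightarrow> 0) (at_right 0)"

lemma P_generator_imp:
  assumes g: "gen f h"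
  shows "diff_quotient_limit P f h"
  unfolding diff_quotient_limit_def tendsto_iff eventually_at_right_field
proof safe
  fix e :: real assume e: "e > 0"
  note m = genD[OF g]
  \<comment> \<open>The bound \<open>2 * nrm (h - h') + t * nrm k'\<close> is split evenly: the
    choice of \<open>h'\<close> makes the first term less than \<open>e / 2\<close>, and then small
    \<open>t\<close> does the same for the second.\<close>
  obtain h' k' k'' where g': "gen h' k'" "gen k' k''" "nrm (h - h') < e / 4"
    using gen2_dense[OF m(3), of "e / 4"] e by auto
  have k': "nrm k' \<ge> 0" using genD[OF g'(1)] by simp
  define c where "c = nrm k' + 1"
  have c: "c > 0" using k' by (simp add: c_def)
  define \<delta> where "\<delta> = e / 2 / c"
  have "\<delta> > 0" using e c by (simp add: \<delta>_def)
  moreover have "dist (nrm ((1 / t) *\<^sub>R (P t f - f) + h)) 0 < e" if t: "0 < t" "t < \<delta>" for t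
  proof -
    have "(1 / t) *\<^sub>R (P t f - f) + h = (1 / t) *\<^sub>R (P t f - f + t *\<^sub>R h)"
      using t by (simp add: algebra_simps)
    then have "nrm ((1 / t) *\<^sub>R (P t f - f) + h) = 1 / t * nrm (P t f - f + t *\<^sub>R h)"
      using t m by (simp add: nrm_scale)
    also have "\<dots> \<le> 1 / t * (t * (2 * nrm (h - h') + t * nrm k'))"
      by (intro mult_left_mono P_generator_bound g g') (use t in auto)
    also have "\<dots> = 2 * nrm (h - h') + t * nrm k'" using t by simp
    also have "t * nrm k' \<le> t * c" using t by (simp add: c_def)
    also have "t * c < \<delta> * c" using t c by (intro mult_strict_right_mono) auto
    also have "\<delta> * c = e / 2" using c by (simp add: \<delta>_def)
    finally show ?thesis using g'(3) t m by (simp add: dist_real_def)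
  qed
  ultimately show "\<exists>b>0. \<forall>t>0. t < b \<longrightarrow> dist (nrm ((1 / t) *\<^sub>R (P t f - f) + h)) 0 < e" by blast
qed

lemma P_at_right:
  assumes f: "f \<in> V"
  shows "((\<lambda>t. nrm (P t f - f)) \<longlongrightarrow> 0) (at_right 0)"
  unfolding tendsto_iff eventually_at_right_field
proof safe
  fix e :: real assume e: "e > 0"
  obtain g h k where g: "gen g h" "gen h k" "nrm (f - g) < e / 3"
    using gen2_dense[OF f, of "e / 3"] e by auto
  note m = genD[OF g(1)] genD[OF g(2)]
  define c where "c = nrm h + nrm k + 1"
  define \<delta> where "\<delta> = min 1 (e / 3 / c)"
  have k: "c > 0" using m by (simp add: c_def add_nonneg_pos)
  have "\<delta> > 0" using e k by (simp add: \<delta>_def)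
  moreover have "dist (nrm (P t f - f)) 0 < e" if t: "0 < t" "t < \<delta>" for t
  proof -
    have t1: "t \<le> 1" using t by (simp add: \<delta>_def)
    have "P t g - g = (P t g - g + t *\<^sub>R h) - t *\<^sub>R h" by simp
    also have "nrm \<dots> \<le> nrm (P t g - g + t *\<^sub>R h) + t * nrm h"
      using nrm_diff_le[of "P t g - g + t *\<^sub>R h" "t *\<^sub>R h"] t m by (simp add: nrm_scale)
    also have "nrm (P t g - g + t *\<^sub>R h) \<le> t * (t * nrm k)"
      using P_generator_bound[OF t(1) g(1) g(2)] m by simp
    also have "t * (t * nrm k) \<le> t * (1 * nrm k)"
      using t t1 m by (intro mult_left_mono mult_right_mono) auto
    finally have "nrm (P t g - g) \<le> t * c" using t m by (simp add: c_def algebra_simps)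
    also have "\<dots> < \<delta> * c" using t k by (intro mult_strict_right_mono) auto
    also have "\<dots> \<le> e / 3 / c * c"
      using k by (intro mult_right_mono) (auto simp: \<delta>_def)
    also have "\<dots> = e / 3" using k by simp
    finally have 1: "nrm (P t g - g) < e / 3" .
    have "nrm (P t f - f) \<le> nrm (P t f - P t g) + nrm (P t g - f)"
      by (rule nrm_triangle_diff) (use t f m in auto)
    also have "nrm (P t g - f) \<le> nrm (P t g - g) + nrm (g - f)"
      by (rule nrm_triangle_diff) (use t f m in auto)
    also have "nrm (P t f - P t g) \<le> nrm (f - g)"
      by (rule contraction_nrm_diff[OF contraction_P]) (use t f m in auto)
    finally show ?thesis using 1 g(3) nrm_diff_commute[of f g] f m t by (simp add: dist_real_def)
  qed
  ultimately show "\<exists>b>0. \<forall>t>0. t < b \<longrightarrow> dist (nrm (P t f - f)) 0 < e" by blast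
qed

lemma tendsto_ip_at_right:
  assumes "\<And>t. t > 0 \<Longrightarrow> x t \<in> V" "a \<in> V" "b \<in> V" "((\<lambda>t. nrm (x t - a)) \<longlongrightarrow> 0) (at_right (0::real))"
  shows "((\<lambda>t. ip (x t) b) \<longlongrightarrow> ip a b) (at_right 0)"
proof (rule Lim_transform_eventually[where f = "\<lambda>t. ip (if t > 0 then x t else a) b"])
  have "((\<lambda>t. nrm ((if t > 0 then x t else a) - a)) \<longlongrightarrow> 0) (at_right 0)"
    by (rule Lim_transform_eventually[OF assms(4)]) (auto simp: eventually_at_right_field intro: exI[of _ 1])
  then show "((\<lambda>t. ip (if t > 0 then x t else a) b) \<longlongrightarrow> ip a b) (at_right 0)"
    by (intro tendsto_ip) (use assms in auto)
qed (auto simp: eventually_at_right_field intro: exI[of _ 1])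

text \<open>The converse is a maximality argument. With \<open>u = J 1 (f + h)\<close> the
  difference \<open>d = f - u\<close> has right derivative \<open>d\<close> at time 0, while
  contractivity gives \<open>ip (P t d - d) d \<le> 0\<close>; hence \<open>d\<close> vanishes as a
  class.\<close>

lemma P_generator_iff:
  assumes f: "f \<in> V" and h: "h \<in> V"
  shows "diff_quotient_limit P f h \<longleftrightarrow> gen f h"
proof
  assume lim: "diff_quotient_limit P f h"
  define u where "u = J 1 (f + h)"
  define k where "k = f + h - u"
  have g: "gen u k" using gen_J[of 1 "f + h"] f h by (simp add: u_def k_def)
  note m = genD[OF g]
  define d where "d = f - u"
  have d: "d \<in> V" using f m by (simp add: d_def)
  have "((\<lambda>t. nrm ((1 / t) *\<^sub>R (P t f - f) + h) + nrm ((1 / t) *\<^sub>R (P t u - u) + k)) \<longlongrightarrow> 0 + 0) (at_right 0)"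
    using lim P_generator_imp[OF g] unfolding diff_quotient_limit_def by (intro tendsto_intros)
  then have lim0: "((\<lambda>t. nrm ((1 / t) *\<^sub>R (P t f - f) + h) + nrm ((1 / t) *\<^sub>R (P t u - u) + k)) \<longlongrightarrow> 0) (at_right 0)"
    by simp
  have "((\<lambda>t. nrm ((1 / t) *\<^sub>R (P t d - d) - d)) \<longlongrightarrow> 0) (at_right 0)"
  proof (rule Lim_null_comparison[OF _ lim0], rule eventually_mono[OF eventually_at_right_less])
    fix t :: real assume t: "t > 0"
    have "(1 / t) *\<^sub>R (P t d - d) - d \<doteq> (1 / t) *\<^sub>R (P t f - P t u - d) - d"
      unfolding d_def by (intro eqv_diff eqv_scale contraction_sub[OF contraction_P]) (use t f m in auto)
    also have "(1 / t) *\<^sub>R (P t f - P t u - d) - d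
        = ((1 / t) *\<^sub>R (P t f - f) + h) - ((1 / t) *\<^sub>R (P t u - u) + k)"
      by (simp add: d_def k_def algebra_simps)
    finally have "nrm ((1 / t) *\<^sub>R (P t d - d) - d) = nrm (((1 / t) *\<^sub>R (P t f - f) + h) - ((1 / t) *\<^sub>R (P t u - u) + k))"
      by (rule eqv_nrm)
    also have "\<dots> \<le> nrm ((1 / t) *\<^sub>R (P t f - f) + h) + nrm ((1 / t) *\<^sub>R (P t u - u) + k)"
      by (rule nrm_diff_le) (use t f h m in auto)
    finally show "norm (nrm ((1 / t) *\<^sub>R (P t d - d) - d)) \<le> nrm ((1 / t) *\<^sub>R (P t f - f) + h) + nrm ((1 / t) *\<^sub>R (P t u - u) + k)"
      using t d by simp
  qed
  then have "((\<lambda>t. ip ((1 / t) *\<^sub>R (P t d - d)) d) \<longlongrightarrow> ip d d) (at_right 0)"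
    by (intro tendsto_ip_at_right) (use d in auto)
  moreover have "\<forall>\<^sub>F t in at_right 0. ip ((1 / t) *\<^sub>R (P t d - d)) d \<le> 0"
  proof (rule eventually_mono[OF eventually_at_right_less])
    fix t :: real assume t: "t > 0"
    have "ip (P t d) d \<le> nrm (P t d) * nrm d" using cauchy_schwarz[of "P t d" d] t d by auto
    also have "\<dots> \<le> nrm d * nrm d"
      using contractionD(2)[OF contraction_P d, of t] t d by (intro mult_right_mono) auto
    also have "\<dots> = ip d d" using nrm_square[OF d] by (simp add: power2_eq_square)
    finally show "ip ((1 / t) *\<^sub>R (P t d - d)) d \<le> 0"
      using t d by (simp add: ip_lin divide_nonpos_pos)
  qed
  ultimately have "ip d d \<le> 0" by (intro tendsto_upperbound) auto
  then have "u \<doteq> f"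
    using nrm_square[OF d] f m nrm_diff_commute[of u f] by (auto simp: eqv_def d_def nrm_def ip_nonneg intro: antisym)
  moreover have "k \<doteq> h"
    using eqv_diff[OF _ \<open>u \<doteq> f\<close>, of "f + h" "f + h"] f h by (simp add: k_def)
  ultimately show "gen f h" using gen_cong[OF g] by blast
qed (rule P_generator_imp)

end

subsection \<open>Uniqueness of the heat semigroup\<close>

text \<open>Only one-sided difference estimates are at hand. The set \<open>S\<close> of times at
  which \<open>N\<close> lies below the line of slope \<open>e\<close> is closed, and the hypothesis
  on \<open>N\<close> forbids its supremum to be less than \<open>b\<close>.\<close>

lemma right_derivative_nonpos_imp_le:
  fixes N :: "real \<Rightarrow> real"
  assumes cont: "continuous_on {0..b} N" and b: "0 \<le> b"
    and deriv: "\<And>t e. 0 \<le> t \<Longrightarrow> t < b \<Longrightarrow> e > 0 \<Longrightarrow> \<exists>\<delta>>0. \<forall>s. 0 < s \<and> s < \<delta> \<longrightarrow> N (t + s) \<le> N t + e * s"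
  shows "N b \<le> N 0"
proof -
  have "N b \<le> N 0 + e * b" if e: "e > 0" for e
  proof -
    define S where "S = {t \<in> {0..b}. N t \<le> N 0 + e * t}"
    have S: "0 \<in> S" "bdd_above S" using b by (auto simp: S_def intro: bdd_aboveI[of _ b])
    define c where "c = Sup S"
    have "c \<le> b"
      unfolding c_def by (rule cSup_least) (use S(1) in \<open>auto simp: S_def\<close>)
    then have c: "0 \<le> c" "c \<le> b"
      using cSup_upper[OF S] by (auto simp: c_def)
    have "closed S"
      unfolding S_def
      by (intro continuous_on_closed_Collect_le[OF cont, where g = "\<lambda>t. N 0 + e * t"] continuous_intros closed_atLeastAtMost)
    then have cS: "c \<in> S"
      unfolding c_def using S by (intro closed_contains_Sup) auto
    have "c = b"
    proof (rule ccontr)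
      assume "c \<noteq> b"
      with c have "c < b" by simp
      obtain \<delta> where d: "\<delta> > 0" "\<And>s. 0 < s \<Longrightarrow> s < \<delta> \<Longrightarrow> N (c + s) \<le> N c + e * s"
        using deriv[OF c(1) \<open>c < b\<close> e] by auto
      define s where "s = min \<delta> (b - c) / 2"
      have s: "0 < s" "s < \<delta>" using d(1) \<open>c < b\<close> by (auto simp: s_def)
      have "s \<le> (b - c) / 2" by (simp add: s_def)
      then have "c + s \<le> b" using \<open>c < b\<close> by argo
      have "c + s \<in> S"
        using d(2)[OF s] cS s c \<open>c + s \<le> b\<close> by (simp add: S_def algebra_simps)
      then have "c + s \<le> c" unfolding c_def by (intro cSup_upper S)
      then show False using s by simp
    qed
    then show ?thesis using cS by (simp add: S_def)
  qed
  then have *: "N b \<le> N 0 + e * b" if "e > 0" for e using that .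
  show ?thesis
  proof (rule field_le_epsilon)
    fix e :: real assume e: "e > 0"
    \<comment> \<open>Division by \<open>b + 1\<close> instead of \<open>b\<close>, since
      \<open>b\<close> may be 0.\<close>
    have "N b \<le> N 0 + e / (b + 1) * b" by (rule *) (use e b in simp)
    also have "e / (b + 1) * b \<le> e" using e b by (simp add: field_simps)
    finally show "N b \<le> N 0 + e" by simp
  qed
qed

context dense_form
begin

text \<open>Boundedness is required for each time separately, as in \<open>C0_semigroup\<close>;
  bounds uniform for small times are derived in \<open>heat_sg_locally_bounded\<close>.\<close>

definition heat_sg :: "(real \<Rightarrow> 'a \<Rightarrow> 'a) \<Rightarrow> bool" where
  "heat_sg Q \<longleftrightarrow>
     (\<forall>t\<ge>0. \<forall>f\<in>V. Q t f \<in> V) \<and>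
     (\<forall>t\<ge>0. \<forall>f\<in>V. \<forall>g\<in>V. \<forall>a b. Q t (a *\<^sub>R f + b *\<^sub>R g) \<doteq> a *\<^sub>R Q t f + b *\<^sub>R Q t g) \<and>
     (\<forall>t\<ge>0. \<exists>C. \<forall>f\<in>V. nrm (Q t f) \<le> C * nrm f) \<and>
     (\<forall>f\<in>V. Q 0 f \<doteq> f) \<and>
     (\<forall>s\<ge>0. \<forall>t\<ge>0. \<forall>f\<in>V. Q (s + t) f \<doteq> Q s (Q t f)) \<and>
     (\<forall>f\<in>V. ((\<lambda>t. nrm (Q t f - f)) \<longlongrightarrow> 0) (at_right 0)) \<and>
     (\<forall>f\<in>V. \<forall>h\<in>V. diff_quotient_limit Q f h \<longleftrightarrow> gen f h)"

lemma heat_sg_P: "heat_sg P"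
  unfolding heat_sg_def
proof (intro conjI allI ballI impI)
  fix t :: real assume "t \<ge> 0"
  then show "\<exists>C. \<forall>f\<in>V. nrm (P t f) \<le> C * nrm f"
    using contractionD(2)[OF contraction_P] by (intro exI[of _ 1]) auto
qed (auto intro: contractionD(3)[OF contraction_P] P_semigroup P_at_right simp: P_generator_iff)

lemma heat_sgD:
  assumes "heat_sg Q"
  shows "t \<ge> 0 \<Longrightarrow> f \<in> V \<Longrightarrow> Q t f \<in> V"
    "t \<ge> 0 \<Longrightarrow> f \<in> V \<Longrightarrow> g \<in> V \<Longrightarrow> Q t (a *\<^sub>R f + b *\<^sub>R g) \<doteq> a *\<^sub>R Q t f + b *\<^sub>R Q t g"
    "t \<ge> 0 \<Longrightarrow> \<exists>C. \<forall>f\<in>V. nrm (Q t f) \<le> C * nrm f"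
    "f \<in> V \<Longrightarrow> Q 0 f \<doteq> f"
    "s \<ge> 0 \<Longrightarrow> t \<ge> 0 \<Longrightarrow> f \<in> V \<Longrightarrow> Q (s + t) f \<doteq> Q s (Q t f)"
    "f \<in> V \<Longrightarrow> ((\<lambda>t. nrm (Q t f - f)) \<longlongrightarrow> 0) (at_right 0)"
    "f \<in> V \<Longrightarrow> h \<in> V \<Longrightarrow> diff_quotient_limit Q f h \<longleftrightarrow> gen f h"
  using assms unfolding heat_sg_def by blast+

lemma heat_sg_lin:
  assumes Q: "heat_sg Q" and t: "t \<ge> 0" and f: "f \<in> V" and g: "g \<in> V"
  shows "Q t (f - g) \<doteq> Q t f - Q t g" "Q t (f + g) \<doteq> Q t f + Q t g" "Q t (c *\<^sub>R f) \<doteq> c *\<^sub>R Q t f"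
  using heat_sgD(2)[OF Q t f g, of 1 "-1"] heat_sgD(2)[OF Q t f g, of 1 1] heat_sgD(2)[OF Q t f f, of c 0] by simp_all

lemma heat_sg_bound:
  assumes Q: "heat_sg Q" and t: "t \<ge> 0"
  shows "\<exists>C>0. \<forall>f\<in>V. nrm (Q t f) \<le> C * nrm f"
proof -
  obtain C where C: "\<And>f. f \<in> V \<Longrightarrow> nrm (Q t f) \<le> C * nrm f" using heat_sgD(3)[OF Q t] by blast
  have "nrm (Q t f) \<le> max C 1 * nrm f" if f: "f \<in> V" for f
  proof -
    have "C * nrm f \<le> max C 1 * nrm f" using f by (intro mult_right_mono) auto
    then show ?thesis using C[OF f] by linarith
  qed
  then show ?thesis by (intro exI[of _ "max C 1"]) auto
qed

lemma heat_sg_eqv: "heat_sg Q \<Longrightarrow> t \<ge> 0 \<Longrightarrow> f \<doteq> g \<Longrightarrow> Q t f \<doteq> Q t g"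
proof -
  assume Q: "heat_sg Q" and t: "t \<ge> 0" and e: "f \<doteq> g"
  obtain C where C: "C > 0" "\<And>f. f \<in> V \<Longrightarrow> nrm (Q t f) \<le> C * nrm f"
    using heat_sg_bound[OF Q t] by blast
  note m = eqvD(1,2)[OF e]
  have "nrm (Q t f - Q t g) = nrm (Q t (f - g))"
    using eqv_nrm[OF heat_sg_lin(1)[OF Q t m]] by simp
  also have "\<dots> \<le> C * nrm (f - g)" using C(2) m by simp
  also have "\<dots> = 0" using eqvD(3)[OF e] by simp
  finally show ?thesis using heat_sgD(1)[OF Q t] m by (simp add: eqv_def)
qed

text \<open>The bounded operator \<open>Q t\<close> is applied to the difference quotients of
  \<open>f\<close> and commuted with \<open>Q s\<close>; the generator condition then turns their
  limit into membership in the graph.\<close>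

lemma heat_sg_gen:
  assumes Q: "heat_sg Q" and t: "t \<ge> 0" and g: "gen f h"
  shows "gen (Q t f) (Q t h)"
proof -
  note m = genD[OF g]
  have Qm: "Q t f \<in> V" "Q t h \<in> V" using heat_sgD(1)[OF Q t] m by auto
  obtain C where C: "C > 0" "\<And>f. f \<in> V \<Longrightarrow> nrm (Q t f) \<le> C * nrm f"
    using heat_sg_bound[OF Q t] by blast
  have "diff_quotient_limit Q f h" using heat_sgD(7)[OF Q m(2,3)] g by simp
  then have "((\<lambda>s. C * nrm ((1 / s) *\<^sub>R (Q s f - f) + h)) \<longlongrightarrow> C * 0) (at_right 0)"
    unfolding diff_quotient_limit_def by (intro tendsto_intros)
  then have lim0: "((\<lambda>s. C * nrm ((1 / s) *\<^sub>R (Q s f - f) + h)) \<longlongrightarrow> 0) (at_right 0)" by simp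
  have "diff_quotient_limit Q (Q t f) (Q t h)"
    unfolding diff_quotient_limit_def
  proof (rule Lim_null_comparison[OF _ lim0], rule eventually_mono[OF eventually_at_right_less])
    fix s :: real assume s: "s > 0"
    have Qs: "Q s f \<in> V" "Q s (Q t f) \<in> V" using heat_sgD(1)[OF Q] s m Qm by auto
    have "Q s (Q t f) \<doteq> Q (s + t) f" by (rule eqv_sym[OF heat_sgD(5)[OF Q]]) (use s t m in auto)
    also have "\<dots> \<doteq> Q t (Q s f)" using heat_sgD(5)[OF Q t, of s f] s m by (simp add: add.commute)
    finally have comm: "Q s (Q t f) \<doteq> Q t (Q s f)" .
    have "Q t ((1 / s) *\<^sub>R (Q s f - f) + h) \<doteq> Q t ((1 / s) *\<^sub>R (Q s f - f)) + Q t h"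
      by (rule heat_sg_lin(2)[OF Q t]) (use Qs m in auto)
    also have "\<dots> \<doteq> (1 / s) *\<^sub>R Q t (Q s f - f) + Q t h"
      by (rule eqv_add[OF heat_sg_lin(3)[OF Q t] eqv_refl]) (use Qs m Qm in auto)
    also have "\<dots> \<doteq> (1 / s) *\<^sub>R (Q t (Q s f) - Q t f) + Q t h"
      by (rule eqv_add[OF eqv_scale[OF heat_sg_lin(1)[OF Q t]] eqv_refl]) (use Qs m Qm in auto)
    also have "\<dots> \<doteq> (1 / s) *\<^sub>R (Q s (Q t f) - Q t f) + Q t h"
      by (rule eqv_add[OF eqv_scale[OF eqv_diff[OF eqv_sym[OF comm] eqv_refl]] eqv_refl]) (use Qm in auto)
    finally have "nrm ((1 / s) *\<^sub>R (Q s (Q t f) - Q t f) + Q t h) = nrm (Q t ((1 / s) *\<^sub>R (Q s f - f) + h))"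
      by (rule eqv_nrm[symmetric])
    also have "\<dots> \<le> C * nrm ((1 / s) *\<^sub>R (Q s f - f) + h)"
      by (rule C(2)) (use Qs m in auto)
    finally show "norm (nrm ((1 / s) *\<^sub>R (Q s (Q t f) - Q t f) + Q t h)) \<le> C * nrm ((1 / s) *\<^sub>R (Q s f - f) + h)"
      using Qs Qm by simp
  qed
  then show ?thesis using heat_sgD(7)[OF Q Qm] by simp
qed

text \<open>A gliding hump argument.\<close>

lemma heat_sg_locally_bounded:
  assumes Q: "heat_sg Q"
  shows "\<exists>\<delta>>0. \<exists>C. \<forall>s f. 0 \<le> s \<and> s \<le> \<delta> \<and> f \<in> V \<longrightarrow> nrm (Q s f) \<le> C * nrm f"
proof (rule ccontr)
  assume neg: "\<not> ?thesis"
  \<comment> \<open>The growth \<open>4 ^ n\<close> will beat the step lengths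
    \<open>(1/3) ^ n\<close> chosen below, leaving \<open>(4/3) ^ n\<close>.\<close>
  have "\<exists>s f. 0 \<le> s \<and> s \<le> 1 / real (Suc n) \<and> f \<in> V \<and> nrm (Q s f) > 4 ^ n * nrm f" for n
    using neg by (auto simp: not_le)
  then obtain s f where sf: "\<And>n. 0 \<le> s n" "\<And>n. s n \<le> 1 / real (Suc n)" "\<And>n. f n \<in> V"
      "\<And>n. nrm (Q (s n) (f n)) > 4 ^ n * nrm (f n)" by metis
  define T where "T n = Q (s n)" for n :: nat
  have TV: "T n g \<in> V" if "g \<in> V" for n g using heat_sgD(1)[OF Q sf(1)] that by (simp add: T_def)
  have T_add: "nrm (T n (g + h)) = nrm (T n g + T n h)" "nrm (T n (g - h)) = nrm (T n g - T n h)"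
    if "g \<in> V" "h \<in> V" for n g h
    using heat_sg_lin(1,2)[OF Q sf(1) that] eqv_nrm by (auto simp: T_def)
  have T_scale: "nrm (T n (c *\<^sub>R g)) = \<bar>c\<bar> * nrm (T n g)" if "g \<in> V" for n c g
    using eqv_nrm[OF heat_sg_lin(3)[OF Q sf(1) that that]] nrm_scale[OF TV[OF that]] by (simp add: T_def)
  define N where "N n = Sup ((\<lambda>g. nrm (T n g)) ` {g \<in> V. nrm g \<le> 1})" for n
  have bdd: "bdd_above ((\<lambda>g. nrm (T n g)) ` {g \<in> V. nrm g \<le> 1})" for n
  proof -
    obtain C where C: "C > 0" "\<And>g. g \<in> V \<Longrightarrow> nrm (T n g) \<le> C * nrm g"
      using heat_sg_bound[OF Q sf(1)] unfolding T_def by blast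
    have "nrm (T n g) \<le> C" if "g \<in> V" "nrm g \<le> 1" for g
      using C(2)[OF that(1)] mult_left_mono[OF that(2) less_imp_le[OF C(1)]] by linarith
    then show ?thesis by (auto intro!: bdd_aboveI2)
  qed
  have N_upper: "nrm (T n g) \<le> N n" if "g \<in> V" "nrm g \<le> 1" for n g
    unfolding N_def by (rule cSup_upper[OF _ bdd]) (use that in auto)
  have N_bound: "nrm (T n g) \<le> N n * nrm g" if g: "g \<in> V" for n g
  proof (cases "nrm g = 0")
    case True
    obtain C where "\<And>g. g \<in> V \<Longrightarrow> nrm (T n g) \<le> C * nrm g"
      using heat_sg_bound[OF Q sf(1)] unfolding T_def by blast
    then show ?thesis using True g by force
  next
    case False
    then have pos: "nrm g > 0" using nrm_nonneg[OF g] by linarith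
    have "nrm (T n ((1 / nrm g) *\<^sub>R g)) \<le> N n"
      by (rule N_upper) (use g pos in \<open>auto simp: nrm_scale\<close>)
    then show ?thesis using pos g by (simp add: T_scale field_simps)
  qed
  have N_large: "N n > 4 ^ n" for n
  proof -
    have "4 ^ n * nrm (f n) < N n * nrm (f n)"
      using sf(4)[of n] N_bound[OF sf(3), of n n] by (simp add: T_def)
    then show ?thesis using nrm_nonneg[OF sf(3)[of n]] by (simp add: mult_less_cancel_right)
  qed
  have N_pos: "N n > 0" for n using N_large[of n] zero_less_power[of "4::real" n] by linarith
  have "\<exists>\<xi>\<in>V. nrm \<xi> \<le> (1/3) ^ n \<and> nrm (T n \<xi>) \<ge> 2/3 * (1/3) ^ n * N n" for n
  proof -
    have "2/3 * N n < N n" using N_pos[of n] by simp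
    then obtain g where g: "g \<in> V" "nrm g \<le> 1" "2/3 * N n < nrm (T n g)"
      unfolding N_def using less_cSupD[of "(\<lambda>g. nrm (T n g)) ` {g \<in> V. nrm g \<le> 1}"]
      by (smt (verit, ccfv_threshold) V_closed(1) empty_iff image_iff mem_Collect_eq nrm_zero)
    have "nrm (T n ((1/3) ^ n *\<^sub>R g)) \<ge> (1/3) ^ n * (2/3 * N n)"
      using g by (simp add: T_scale)
    moreover have "nrm ((1/3) ^ n *\<^sub>R g) \<le> (1/3) ^ n"
      using g by (simp add: nrm_scale mult_left_le)
    ultimately show ?thesis using g(1) by (intro bexI[of _ "(1/3) ^ n *\<^sub>R g"]) (auto simp: algebra_simps)
  qed
  then obtain \<xi> where xi: "\<And>n. \<xi> n \<in> V" "\<And>n. nrm (\<xi> n) \<le> (1/3) ^ n"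
      "\<And>n. nrm (T n (\<xi> n)) \<ge> 2/3 * (1/3) ^ n * N n" by metis
  \<comment> \<open>Of the two candidates at least one has an image of norm at least
    \<open>nrm (T n (\<xi> n))\<close>, because twice the image of \<open>\<xi> n\<close> is the
    difference of their images.\<close>
  define x where "x = rec_nat 0 (\<lambda>n y. if nrm (T n (y + \<xi> n)) \<ge> nrm (T n (\<xi> n)) then y + \<xi> n else y - \<xi> n)"
  have x_Suc: "x (Suc n) = (if nrm (T n (x n + \<xi> n)) \<ge> nrm (T n (\<xi> n)) then x n + \<xi> n else x n - \<xi> n)" for n
    by (simp add: x_def)
  have xV: "x n \<in> V" for n
  proof (induction n)
    case 0 show ?case by (simp add: x_def)
  next
    case (Suc n) then show ?case using xi(1) by (simp add: x_Suc)
  qed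
  have hump: "nrm (T n (x (Suc n))) \<ge> 2/3 * (1/3) ^ n * N n" for n
  proof -
    have "2 * nrm (T n (\<xi> n)) = nrm ((T n (x n) + T n (\<xi> n)) - (T n (x n) - T n (\<xi> n)))"
      using nrm_scale[OF TV[OF xi(1)], of 2 n n] by (simp add: scaleR_2)
    also have "\<dots> \<le> nrm (T n (x n) + T n (\<xi> n)) + nrm (T n (x n) - T n (\<xi> n))"
      by (rule nrm_diff_le) (use TV xV xi in auto)
    also have "\<dots> = nrm (T n (x n + \<xi> n)) + nrm (T n (x n - \<xi> n))"
      using T_add xV xi by simp
    finally have "nrm (T n (x (Suc n))) \<ge> nrm (T n (\<xi> n))" by (auto simp: x_Suc)
    then show ?thesis using xi(3)[of n] by simp
  qed
  have x_step: "nrm (x (Suc n) - x n) \<le> (1/3) ^ n" for n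
    using xi(1,2)[of n] by (simp add: x_Suc)
  have x_diff: "nrm (x (n + m) - x n) \<le> 3/2 * ((1/3) ^ n - (1/3) ^ (n + m))" for n m
  proof (induction m)
    case (Suc m)
    have "nrm (x (n + Suc m) - x n) \<le> nrm (x (Suc (n + m)) - x (n + m)) + nrm (x (n + m) - x n)"
      using nrm_triangle_diff[OF xV xV xV, of "Suc (n + m)" n "n + m"] by simp
    also have "\<dots> \<le> (1/3) ^ (n + m) + 3/2 * ((1/3) ^ n - (1/3) ^ (n + m))"
      by (intro add_mono x_step Suc)
    also have "\<dots> = 3/2 * ((1/3) ^ n - (1/3) ^ (n + Suc m))" by (simp add: algebra_simps)
    finally show ?case .
  qed simp
  have x_diff': "nrm (x (n + m) - x n) \<le> 3/2 * (1/3) ^ n" for n m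
  proof -
    have "(1/3::real) ^ (n + m) \<ge> 0" by simp
    then show ?thesis using x_diff[of n m] by (simp only: right_diff_distrib)
  qed
  obtain y where y: "y \<in> V" "(\<lambda>n. nrm (x n - y)) \<longlonglongrightarrow> 0"
  proof -
    have "\<exists>M. \<forall>m\<ge>M. \<forall>n\<ge>M. nrm (x m - x n) < \<epsilon>" if e: "\<epsilon> > 0" for \<epsilon>
    proof -
      have "(\<lambda>n. 3/2 * (1/3) ^ n) \<longlonglongrightarrow> 3/2 * (0::real)" by (intro tendsto_intros LIMSEQ_realpow_zero) auto
      then have "\<forall>\<^sub>F n in sequentially. 3/2 * (1/3) ^ n < \<epsilon>" by (rule order_tendstoD(2)) (use e in simp)
      then obtain M where M: "\<And>n. n \<ge> M \<Longrightarrow> 3/2 * (1/3) ^ n < \<epsilon>" by (auto simp: eventually_sequentially)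
      have "nrm (x m - x n) < \<epsilon>" if "m \<ge> M" "n \<ge> M" for m n
      proof (cases "m \<le> n")
        case True then show ?thesis using x_diff'[of m "n - m"] M[OF that(1)] nrm_diff_commute[OF xV xV, of m n] by simp
      next
        case False then show ?thesis using x_diff'[of n "m - n"] M[OF that(2)] by simp
      qed
      then show ?thesis by blast
    qed
    from complete[OF xV this] show ?thesis using that by blast
  qed
  have near: "nrm (y - x n) \<le> 3/2 * (1/3) ^ n" for n
  proof -
    have "(\<lambda>m. nrm (x (m + n) - y) + 3/2 * (1/3) ^ n) \<longlonglongrightarrow> 0 + 3/2 * (1/3) ^ n"
      by (intro tendsto_intros LIMSEQ_ignore_initial_segment y)
    moreover have "\<forall>m. nrm (y - x n) \<le> nrm (x (m + n) - y) + 3/2 * (1/3) ^ n"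
    proof
      fix m show "nrm (y - x n) \<le> nrm (x (m + n) - y) + 3/2 * (1/3) ^ n"
        using nrm_triangle_diff[OF y(1) xV xV, of n "m + n"] x_diff'[of n m] nrm_diff_commute[OF y(1) xV, of "m + n"]
        by (simp add: add.commute)
    qed
    ultimately have "nrm (y - x n) \<le> 0 + 3/2 * (1/3) ^ n" by (intro LIMSEQ_le_const) auto
    then show ?thesis by simp
  qed
  \<comment> \<open>The steps after the \<open>n\<close>-th one move by at most
    \<open>1/2 * (1/3) ^ n\<close> in total, while the hump is \<open>2/3 * (1/3) ^ n * N n\<close>;
    the difference of the factors is \<open>1/6\<close>.\<close>
  have large: "nrm (T n y) \<ge> 1/6 * (4/3) ^ n" for n
  proof -
    have "2/3 * (1/3) ^ n * N n \<le> nrm (T n (x (Suc n)))" by (rule hump)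
    also have "\<dots> \<le> nrm (T n (x (Suc n)) - T n y) + nrm (T n y)"
      by (rule nrm_le_diff) (use TV xV y in auto)
    also have "nrm (T n (x (Suc n)) - T n y) = nrm (T n (x (Suc n) - y))"
      using T_add xV y by simp
    also have "\<dots> \<le> N n * nrm (x (Suc n) - y)" by (rule N_bound) (use xV y in auto)
    also have "\<dots> \<le> N n * (1/2 * (1/3) ^ n)"
      using near[of "Suc n"] nrm_diff_commute[OF y(1) xV] N_pos[of n] by (intro mult_left_mono) auto
    finally have "1/6 * (1/3) ^ n * N n \<le> nrm (T n y)" by (simp add: algebra_simps)
    moreover have "1/6 * (1/3) ^ n * N n \<ge> 1/6 * (1/3) ^ n * 4 ^ n"
      using N_large[of n] by (intro mult_left_mono) auto
    moreover have "(1/3) ^ n * 4 ^ n = (4/3 :: real) ^ n" by (simp flip: power_mult_distrib)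
    ultimately show ?thesis by simp
  qed
  \<comment> \<open>Strong continuity at 0 bounds \<open>Q r y\<close> for small \<open>r\<close>,
    against the growth in \<open>large\<close> along the times \<open>s n\<close>, which tend to
    0.\<close>
  have small: "\<exists>\<delta>>0. \<forall>r. 0 \<le> r \<and> r < \<delta> \<longrightarrow> nrm (Q r y) \<le> nrm y + 1"
  proof -
    have "\<forall>\<^sub>F r in at_right 0. nrm (Q r y - y) < 1"
      by (rule order_tendstoD(2)[OF heat_sgD(6)[OF Q y(1)]]) simp
    then obtain \<delta> where d: "\<delta> > 0" "\<And>r. 0 < r \<Longrightarrow> r < \<delta> \<Longrightarrow> nrm (Q r y - y) < 1"
      by (auto simp: eventually_at_right_field)
    have "nrm (Q r y) \<le> nrm y + 1" if "0 \<le> r" "r < \<delta>" for r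
    proof (cases "r = 0")
      case True then show ?thesis using eqv_nrm[OF heat_sgD(4)[OF Q y(1)]] by simp
    next
      case False
      then show ?thesis using d(2)[of r] that nrm_le_diff[OF heat_sgD(1)[OF Q that(1) y(1)] y(1)] by simp
    qed
    then show ?thesis using d(1) by blast
  qed
  then obtain \<delta> where d: "\<delta> > 0" "\<And>r. 0 \<le> r \<Longrightarrow> r < \<delta> \<Longrightarrow> nrm (Q r y) \<le> nrm y + 1" by blast
  have "\<forall>\<^sub>F n in sequentially. 1 / real (Suc n) < \<delta>"
    using order_tendstoD(2)[OF LIMSEQ_inverse_real_of_nat d(1)] by (simp add: inverse_eq_divide)
  moreover have "\<forall>\<^sub>F n in sequentially. 6 * (nrm y + 1) < (4/3) ^ n"
  proof -
    obtain n where "6 * (nrm y + 1) < (4/3) ^ n" using real_arch_pow[of "4/3"] by auto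
    then have "6 * (nrm y + 1) < (4/3) ^ m" if "m \<ge> n" for m
      by (rule less_le_trans[OF _ power_increasing[OF that]]) simp
    then show ?thesis by (auto simp: eventually_sequentially)
  qed
  ultimately have "\<forall>\<^sub>F n in sequentially. False"
  proof eventually_elim
    case (elim n)
    have "nrm (Q (s n) y) \<le> nrm y + 1" by (rule d(2)) (use sf(1,2)[of n] elim in auto)
    then show ?case using large[of n] elim by (simp add: T_def)
  qed
  then show False by simp
qed

text \<open>Right continuity at 0 becomes two-sided continuity: with \<open>r = min s t\<close> and
  \<open>u = |s - t|\<close> the difference is \<open>Q r (Q u f - f)\<close> up to sign, and
  \<open>Q r\<close> is bounded uniformly.\<close>

lemma heat_sg_continuous:
  assumes Q: "heat_sg Q" and d: "\<delta> > 0" and C: "\<And>s f. 0 \<le> s \<Longrightarrow> s \<le> \<delta> \<Longrightarrow> f \<in> V \<Longrightarrow> nrm (Q s f) \<le> C * nrm f"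
    and f: "f \<in> V" and t: "0 \<le> t" "t \<le> \<delta>"
  shows "((\<lambda>s. nrm (Q s f - Q t f)) \<longlongrightarrow> 0) (at t within {0..\<delta>})"
proof -
  define K where "K = max C 1"
  have K: "K > 0" "nrm (Q s f) \<le> K * nrm f" if "0 \<le> s" "s \<le> \<delta>" "f \<in> V" for s f
  proof -
    have "C * nrm f \<le> K * nrm f" using that by (intro mult_right_mono) (auto simp: K_def)
    then show "nrm (Q s f) \<le> K * nrm f" using C[OF that] by linarith
  qed (simp add: K_def)
  have K0: "K > 0" by (simp add: K_def)
  have key: "nrm (Q (r + s) f - Q r f) \<le> K * nrm (Q s f - f)" if "0 \<le> r" "r \<le> \<delta>" "0 \<le> s" for r s
  proof -
    have Qs: "Q s f \<in> V" using heat_sgD(1)[OF Q that(3) f] .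
    have "nrm (Q (r + s) f - Q r f) = nrm (Q r (Q s f) - Q r f)"
      by (intro eqv_nrm_diff heat_sgD(5)[OF Q] eqv_refl heat_sgD(1)[OF Q]) (use that f in auto)
    also have "\<dots> = nrm (Q r (Q s f - f))" using eqv_nrm[OF heat_sg_lin(1)[OF Q that(1) Qs f]] by simp
    also have "\<dots> \<le> K * nrm (Q s f - f)" by (rule K(2)) (use that Qs f in auto)
    finally show ?thesis .
  qed
  show ?thesis
    unfolding tendsto_iff eventually_at
  proof safe
    fix e :: real assume e: "e > 0"
    have "\<forall>\<^sub>F s in at_right 0. nrm (Q s f - f) < e / K"
      by (rule order_tendstoD(2)[OF heat_sgD(6)[OF Q f]]) (use e K0 in simp)
    then obtain \<eta> where eta: "\<eta> > 0" "\<And>s. 0 < s \<Longrightarrow> s < \<eta> \<Longrightarrow> nrm (Q s f - f) < e / K"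
      by (auto simp: eventually_at_right_field)
    have "dist (nrm (Q s f - Q t f)) 0 < e" if s: "s \<in> {0..\<delta>}" "s \<noteq> t" "dist s t < \<eta>" for s
    proof -
      have mem: "Q s f \<in> V" "Q t f \<in> V" using heat_sgD(1)[OF Q _ f] s t by auto
      define r where "r = min s t"
      define u where "u = \<bar>s - t\<bar>"
      have u: "0 < u" "u < \<eta>" using s by (auto simp: u_def dist_real_def)
      have "nrm (Q s f - Q t f) = nrm (Q (r + u) f - Q r f)"
        using nrm_diff_commute[OF mem] by (auto simp: r_def u_def min_def abs_if)
      also have "\<dots> \<le> K * nrm (Q u f - f)" by (rule key) (use s t u in \<open>auto simp: r_def\<close>)
      also have "\<dots> < K * (e / K)" using eta(2)[OF u] K0 by (intro mult_strict_left_mono) auto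
      finally show ?thesis using K0 mem by (simp add: dist_real_def)
    qed
    then show "\<exists>d>0. \<forall>s\<in>{0..\<delta>}. s \<noteq> t \<and> dist s t < d \<longrightarrow> dist (nrm (Q s f - Q t f)) 0 < e"
      using eta(1) by blast
  qed
qed

lemma heat_sg_diff_quotient:
  assumes Q: "heat_sg Q" and g: "gen f h" and t: "t \<ge> 0"
  shows "((\<lambda>s. nrm ((1 / s) *\<^sub>R (Q (t + s) f - Q t f) + Q t h)) \<longlongrightarrow> 0) (at_right 0)"
proof -
  have g': "gen (Q t f) (Q t h)" by (rule heat_sg_gen[OF Q t g])
  note m = genD[OF g'] genD[OF g]
  have "diff_quotient_limit Q (Q t f) (Q t h)"
    using heat_sgD(7)[OF Q m(2,3)] g' by simp
  then have "((\<lambda>s. nrm ((1 / s) *\<^sub>R (Q s (Q t f) - Q t f) + Q t h)) \<longlongrightarrow> 0) (at_right 0)"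
    by (simp add: diff_quotient_limit_def)
  then show ?thesis
  proof (rule Lim_transform_eventually, intro eventually_mono[OF eventually_at_right_less])
    fix s :: real assume s: "s > 0"
    have "(1 / s) *\<^sub>R (Q s (Q t f) - Q t f) + Q t h \<doteq> (1 / s) *\<^sub>R (Q (s + t) f - Q t f) + Q t h"
      by (intro eqv_add eqv_scale eqv_diff eqv_refl eqv_sym[OF heat_sgD(5)[OF Q]]) (use s t m in auto)
    then show "nrm ((1 / s) *\<^sub>R (Q s (Q t f) - Q t f) + Q t h) = nrm ((1 / s) *\<^sub>R (Q (t + s) f - Q t f) + Q t h)"
      by (simp add: eqv_nrm add.commute)
  qed
qed

text \<open>The squared norm of the difference of two heat semigroups has nonpositive right
  derivative on the domain of the generator.\<close>

lemma heat_sg_unique_small: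
  assumes Q: "heat_sg Q" and R: "heat_sg R"
  shows "\<exists>\<delta>>0. \<forall>t f h. 0 \<le> t \<and> t \<le> \<delta> \<and> gen f h \<longrightarrow> Q t f \<doteq> R t f"
proof -
  obtain \<delta>1 C1 where 1: "\<delta>1 > 0" "\<And>s f. 0 \<le> s \<Longrightarrow> s \<le> \<delta>1 \<Longrightarrow> f \<in> V \<Longrightarrow> nrm (Q s f) \<le> C1 * nrm f"
    using heat_sg_locally_bounded[OF Q] by blast
  obtain \<delta>2 C2 where 2: "\<delta>2 > 0" "\<And>s f. 0 \<le> s \<Longrightarrow> s \<le> \<delta>2 \<Longrightarrow> f \<in> V \<Longrightarrow> nrm (R s f) \<le> C2 * nrm f"
    using heat_sg_locally_bounded[OF R] by blast
  define \<delta> where "\<delta> = min \<delta>1 \<delta>2"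
  have d: "\<delta> > 0" using 1 2 by (simp add: \<delta>_def)
  have "Q b f \<doteq> R b f" if b: "0 \<le> b" "b \<le> \<delta>" and g: "gen f h" for b f h
  proof -
    have bQ: "nrm (Q s f) \<le> C1 * nrm f" if "0 \<le> s" "s \<le> b" "f \<in> V" for s f
      using 1(2)[OF that(1) _ that(3)] that b by (simp add: \<delta>_def)
    have bR: "nrm (R s f) \<le> C2 * nrm f" if "0 \<le> s" "s \<le> b" "f \<in> V" for s f
      using 2(2)[OF that(1) _ that(3)] that b by (simp add: \<delta>_def)
    note m = genD[OF g]
    define y where "y t = Q t f - R t f" for t
    define z where "z t = Q t h - R t h" for t
    have yz: "gen (y t) (z t)" if "t \<ge> 0" for t
      unfolding y_def z_def by (rule gen_diff[OF heat_sg_gen[OF Q that g] heat_sg_gen[OF R that g]])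
    have yV: "y t \<in> V" "z t \<in> V" if "t \<ge> 0" for t using genD[OF yz[OF that]] by auto
    define N where "N t = ip (y t) (y t)" for t
    have y_cont: "((\<lambda>s. nrm (y s - y t)) \<longlongrightarrow> 0) (at t within {0..b})" if t: "0 \<le> t" "t \<le> b" for t
    proof (cases "b = 0")
      case True
      then have "at t within {0..b} = bot" using t by (simp add: at_within_eq_bot_iff)
      then show ?thesis by simp
    next
      case False
      then have bp: "b > 0" using b by simp
      have "((\<lambda>s. nrm (Q s f - Q t f) + nrm (R s f - R t f)) \<longlongrightarrow> 0 + 0) (at t within {0..b})"
        by (intro tendsto_intros heat_sg_continuous[OF Q bp bQ] heat_sg_continuous[OF R bp bR] m t)
      then have lim0: "((\<lambda>s. nrm (Q s f - Q t f) + nrm (R s f - R t f)) \<longlongrightarrow> 0) (at t within {0..b})" by simp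
      show ?thesis
      proof (rule Lim_null_comparison[OF _ lim0])
        show "\<forall>\<^sub>F s in at t within {0..b}. norm (nrm (y s - y t)) \<le> nrm (Q s f - Q t f) + nrm (R s f - R t f)"
          unfolding eventually_at_filter
        proof (rule always_eventually, safe)
          fix s assume s: "s \<in> {0..b}"
          have mem: "Q s f \<in> V" "Q t f \<in> V" "R s f \<in> V" "R t f \<in> V"
            using heat_sgD(1)[OF Q] heat_sgD(1)[OF R] s t m by auto
          have "y s - y t = (Q s f - Q t f) - (R s f - R t f)" by (simp add: y_def algebra_simps)
          then show "norm (nrm (y s - y t)) \<le> nrm (Q s f - Q t f) + nrm (R s f - R t f)"
            using nrm_diff_le[of "Q s f - Q t f" "R s f - R t f"] mem by simp
        qed
      qed
    qed
    have "continuous_on {0..b} N"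
      unfolding continuous_on_def
    proof
      fix t assume "t \<in> {0..b}"
      then have t: "0 \<le> t" "t \<le> b" by auto
      \<comment> \<open>Outside the interval the value at \<open>t\<close> is inserted, because
        \<open>y\<close> is known to lie in the space only for nonnegative times.\<close>
      have lim: "((\<lambda>s. nrm ((if s \<in> {0..b} then y s else y t) - y t)) \<longlongrightarrow> 0) (at t within {0..b})"
        by (rule Lim_transform_eventually[OF y_cont[OF t]]) (auto simp: eventually_at_filter)
      have "((\<lambda>s. ip (if s \<in> {0..b} then y s else y t) (if s \<in> {0..b} then y s else y t)) \<longlongrightarrow> ip (y t) (y t)) (at t within {0..b})"
        by (intro tendsto_ip lim) (use yV t in auto)
      then show "(N \<longlongrightarrow> N t) (at t within {0..b})"
        unfolding N_def by (rule Lim_transform_eventually) (auto simp: eventually_at_filter)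
    qed
    moreover have "\<exists>\<delta>>0. \<forall>s. 0 < s \<and> s < \<delta> \<longrightarrow> N (t + s) \<le> N t + e * s" if t: "0 \<le> t" "t < b" and e: "e > 0" for t e
    proof -
      define D where "D s = (1 / s) *\<^sub>R (y (t + s) - y t)" for s
      have DV: "D s \<in> V" if "s > 0" for s using yV t that by (simp add: D_def)
      have "((\<lambda>s. nrm ((1 / s) *\<^sub>R (Q (t + s) f - Q t f) + Q t h) + nrm ((1 / s) *\<^sub>R (R (t + s) f - R t f) + R t h)) \<longlongrightarrow> 0 + 0) (at_right 0)"
        by (intro tendsto_intros heat_sg_diff_quotient Q R g t)
      then have lim0: "((\<lambda>s. nrm ((1 / s) *\<^sub>R (Q (t + s) f - Q t f) + Q t h) + nrm ((1 / s) *\<^sub>R (R (t + s) f - R t f) + R t h)) \<longlongrightarrow> 0) (at_right 0)"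
        by simp
      have Dlim: "((\<lambda>s. nrm (D s - (- z t))) \<longlongrightarrow> 0) (at_right 0)"
      proof (rule Lim_null_comparison[OF _ lim0], rule eventually_mono[OF eventually_at_right_less])
        fix s :: real assume s: "s > 0"
        have mem: "Q (t + s) f \<in> V" "Q t f \<in> V" "R (t + s) f \<in> V" "R t f \<in> V" "Q t h \<in> V" "R t h \<in> V"
          using heat_sgD(1)[OF Q] heat_sgD(1)[OF R] s t m by auto
        have split: "D s - (- z t) = ((1 / s) *\<^sub>R (Q (t + s) f - Q t f) + Q t h) - ((1 / s) *\<^sub>R (R (t + s) f - R t f) + R t h)"
          by (simp add: D_def y_def z_def algebra_simps)
        have "nrm (D s - (- z t)) \<le> nrm ((1 / s) *\<^sub>R (Q (t + s) f - Q t f) + Q t h) + nrm ((1 / s) *\<^sub>R (R (t + s) f - R t f) + R t h)"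
          unfolding split by (rule nrm_diff_le) (use mem in auto)
        then show "norm (nrm (D s - (- z t))) \<le> nrm ((1 / s) *\<^sub>R (Q (t + s) f - Q t f) + Q t h) + nrm ((1 / s) *\<^sub>R (R (t + s) f - R t f) + R t h)"
          using DV[OF s] yV t by simp
      qed
      have lim1: "((\<lambda>s. ip (D s) (y t)) \<longlongrightarrow> ip (- z t) (y t)) (at_right 0)"
        by (rule tendsto_ip_at_right[OF DV _ _ Dlim]) (use yV t in auto)
      define D' where "D' s = (if s > 0 then D s else - z t)" for s
      have D'lim: "((\<lambda>s. nrm (D' s - (- z t))) \<longlongrightarrow> 0) (at_right 0)"
        by (rule Lim_transform_eventually[OF Dlim]) (auto simp: D'_def eventually_at_right_field intro: exI[of _ 1])
      have "((\<lambda>s. ip (D' s) (D' s)) \<longlongrightarrow> ip (- z t) (- z t)) (at_right 0)"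
        by (intro tendsto_ip D'lim) (use DV yV t in \<open>auto simp: D'_def\<close>)
      then have "((\<lambda>s. ip (D s) (D s)) \<longlongrightarrow> ip (- z t) (- z t)) (at_right 0)"
        by (rule Lim_transform_eventually) (auto simp: D'_def eventually_at_right_field intro: exI[of _ 1])
      then have lim2: "((\<lambda>s. 2 * ip (D s) (y t) + s * ip (D s) (D s)) \<longlongrightarrow> 2 * ip (- z t) (y t) + 0 * ip (- z t) (- z t)) (at_right 0)"
        by (intro tendsto_intros lim1) auto
      \<comment> \<open>\<open>z t\<close> is \<open>H\<close> applied to \<open>y t\<close>, so
        this pairing is \<open>- E (y t) (y t)\<close>: the sign that keeps two solutions from
        separating.\<close>
      have "ip (- z t) (y t) \<le> 0"
        using genD[OF yz[OF t(1)]] E.ip_nonneg[of "y t"] by (simp add: ip_minus)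
      then have "\<forall>\<^sub>F s in at_right 0. 2 * ip (D s) (y t) + s * ip (D s) (D s) < e"
        by (intro order_tendstoD(2)[OF lim2]) (use e in auto)
      then obtain \<eta> where eta: "\<eta> > 0" "\<And>s. 0 < s \<Longrightarrow> s < \<eta> \<Longrightarrow> 2 * ip (D s) (y t) + s * ip (D s) (D s) < e"
        by (auto simp: eventually_at_right_field)
      have "N (t + s) \<le> N t + e * s" if s: "0 < s" "s < \<eta>" for s
      proof -
        have "y (t + s) = y t + s *\<^sub>R D s" using s by (simp add: D_def)
        then have "N (t + s) = N t + 2 * s * ip (y t) (D s) + s\<^sup>2 * ip (D s) (D s)"
          using ip_add_scale_self[of "y t" "D s" s] yV t DV s by (simp add: N_def)
        also have "\<dots> = N t + s * (2 * ip (D s) (y t) + s * ip (D s) (D s))"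
          using ip_commute[of "y t" "D s"] yV t DV s by (simp add: algebra_simps power2_eq_square)
        also have "\<dots> \<le> N t + s * e" using eta(2)[OF s] s by simp
        finally show ?thesis by (simp add: mult.commute)
      qed
      then show ?thesis using eta(1) by blast
    qed
    ultimately have "N b \<le> N 0" by (rule right_derivative_nonpos_imp_le[OF _ b(1)])
    moreover have "N 0 = 0"
    proof -
      have "Q 0 f \<doteq> R 0 f" using eqv_trans[OF heat_sgD(4)[OF Q m(2)] eqv_sym[OF heat_sgD(4)[OF R m(2)]]] .
      then show ?thesis using nrm_square[OF yV(1), of 0] eqvD(3) by (simp add: N_def y_def)
    qed
    ultimately show ?thesis
      using ip_nonneg[OF yV(1)[OF b(1)]] heat_sgD(1)[OF Q b(1) m(2)] heat_sgD(1)[OF R b(1) m(2)]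
      by (simp add: N_def y_def eqv_def nrm_def)
  qed
  then show ?thesis using d by blast
qed

theorem heat_sg_unique:
  assumes Q: "heat_sg Q" and t: "t \<ge> 0" and f: "f \<in> V"
  shows "Q t f \<doteq> P t f"
proof -
  obtain \<delta> where d: "\<delta> > 0" "\<And>t f h. 0 \<le> t \<Longrightarrow> t \<le> \<delta> \<Longrightarrow> gen f h \<Longrightarrow> Q t f \<doteq> P t f"
    using heat_sg_unique_small[OF Q heat_sg_P] by blast
  have 1: "Q t f \<doteq> P t f" if t: "0 \<le> t" "t \<le> \<delta>" and f: "f \<in> V" for t f
  proof -
    obtain C where C: "C > 0" "\<And>f. f \<in> V \<Longrightarrow> nrm (Q t f) \<le> C * nrm f"
      using heat_sg_bound[OF Q t(1)] by blast
    have "nrm (Q t f - P t f) \<le> 0 + e" if e: "e > 0" for e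
    proof -
      obtain g h k where g: "gen g h" "nrm (f - g) < e / (C + 1)"
        using gen2_dense[OF f, of "e / (C + 1)"] e C by auto
      have gV: "g \<in> V" using genD[OF g(1)] by simp
      note mem = heat_sgD(1)[OF Q t(1) f] heat_sgD(1)[OF Q t(1) gV] P_V[OF t(1) f] P_V[OF t(1) gV]
      have "nrm (Q t f - P t f) \<le> nrm (Q t f - Q t g) + nrm (Q t g - P t f)"
        by (rule nrm_triangle_diff) (use mem in auto)
      also have "nrm (Q t g - P t f) = nrm (P t g - P t f)"
        by (rule eqv_nrm_diff[OF d(2)[OF t g(1)]]) (use mem in auto)
      also have "nrm (P t g - P t f) \<le> nrm (f - g)"
        using contraction_nrm_diff[OF contraction_P[OF t(1)] gV f] nrm_diff_commute[OF f gV] by simp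
      also have "nrm (Q t f - Q t g) = nrm (Q t (f - g))"
        using eqv_nrm[OF heat_sg_lin(1)[OF Q t(1) f gV]] by simp
      also have "\<dots> \<le> C * nrm (f - g)" using C(2) f gV by simp
      finally have "nrm (Q t f - P t f) \<le> (C + 1) * nrm (f - g)" by (simp add: algebra_simps)
      also have "\<dots> \<le> (C + 1) * (e / (C + 1))" using g(2) C by (intro mult_left_mono) auto
      finally show ?thesis using C by simp
    qed
    then have "nrm (Q t f - P t f) \<le> 0" using field_le_epsilon by blast
    then show ?thesis using heat_sgD(1)[OF Q t(1) f] P_V[OF t(1) f] by (simp add: eqv_def)
  qed
  \<comment> \<open>\<open>Suc n\<close> steps of length \<open>r \<le> \<delta>\<close> reach
    \<open>t\<close>; the successor keeps the denominator positive when
    \<open>n = 0\<close>.\<close>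
  obtain n :: nat where n: "t / \<delta> \<le> real n" using real_arch_simple by blast
  define r where "r = t / real (Suc n)"
  have "t \<le> real n * \<delta>" using n d(1) by (simp add: field_simps)
  also have "\<dots> \<le> real (Suc n) * \<delta>" using d(1) by simp
  finally have r: "0 \<le> r" "r \<le> \<delta>" using t by (auto simp: r_def field_simps)
  have "Q (real k * r) f \<doteq> P (real k * r) f" for k
  proof (induction k)
    case 0 show ?case using heat_sgD(4)[OF Q f] by simp
  next
    case (Suc k)
    have kr: "real k * r \<ge> 0" using r by simp
    have "Q (r + real k * r) f \<doteq> Q r (Q (real k * r) f)" by (rule heat_sgD(5)[OF Q r(1) kr f])
    also have "\<dots> \<doteq> Q r (P (real k * r) f)" by (rule heat_sg_eqv[OF Q r(1) Suc])
    also have "\<dots> \<doteq> P r (P (real k * r) f)" by (rule 1[OF r]) (use kr f in auto)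
    also have "\<dots> \<doteq> P (r + real k * r) f" by (rule eqv_sym[OF P_semigroup[OF r(1) kr f]])
    finally show ?case by (simp add: algebra_simps)
  qed
  from this[of "Suc n"] show ?thesis by (simp add: r_def)
qed

end

section \<open>Square integrable functions\<close>

text \<open>Addition comes from the imported pointwise algebra; with pointwise scalars the abstract
  theory applies to functions themselves rather than to a quotient type.\<close>

instantiation "fun" :: (type, real_vector) real_vector
begin

definition scaleR_fun :: "real \<Rightarrow> ('a \<Rightarrow> 'b) \<Rightarrow> 'a \<Rightarrow> 'b" where
  "scaleR_fun c f = (\<lambda>x. c *\<^sub>R f x)"

instance
  by standard (auto simp: scaleR_fun_def fun_eq_iff scaleR_add_left scaleR_add_right)

end

lemma scaleR_fun_apply [simp]: "(c *\<^sub>R f) x = c *\<^sub>R f x"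
  by (simp add: scaleR_fun_def)

lemma lin_comb_eq: "(\<lambda>x. a * u x + b * v x) = a *\<^sub>R u + b *\<^sub>R (v :: 'a \<Rightarrow> real)"
  by (simp add: fun_eq_iff)

lemma L2_I: "f \<in> borel_measurable M \<Longrightarrow> integrable M (\<lambda>x. (f x)\<^sup>2) \<Longrightarrow> f \<in> L2 M"
  by (simp add: L2_def)

lemma L2_D [dest]: "f \<in> L2 M \<Longrightarrow> f \<in> borel_measurable M" "f \<in> L2 M \<Longrightarrow> integrable M (\<lambda>x. (f x)\<^sup>2)"
  by (auto simp: L2_def)

lemma L2_measurable [measurable_dest]: "f \<in> L2 M \<Longrightarrow> f \<in> borel_measurable M"
  by (simp add: L2_def)

lemma L2_integrable_mult:
  assumes "f \<in> L2 M" "g \<in> L2 M"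
  shows "integrable M (\<lambda>x. f x * g x)"
proof (rule Bochner_Integration.integrable_bound)
  show "integrable M (\<lambda>x. (f x)\<^sup>2 + (g x)\<^sup>2)" using assms by auto
  show "AE x in M. norm (f x * g x) \<le> norm ((f x)\<^sup>2 + (g x)\<^sup>2)"
  proof (rule AE_I2)
    fix x
    have "2 * (\<bar>f x\<bar> * \<bar>g x\<bar>) \<le> (f x)\<^sup>2 + (g x)\<^sup>2"
      using zero_le_power2[of "\<bar>f x\<bar> - \<bar>g x\<bar>"] by (simp add: power2_diff)
    moreover have "0 \<le> \<bar>f x\<bar> * \<bar>g x\<bar>" by simp
    ultimately have "\<bar>f x\<bar> * \<bar>g x\<bar> \<le> (f x)\<^sup>2 + (g x)\<^sup>2" by linarith
    then show "norm (f x * g x) \<le> norm ((f x)\<^sup>2 + (g x)\<^sup>2)" by (simp add: abs_mult)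
  qed
qed (use assms in measurable)

lemma L2_bound:
  assumes "g \<in> L2 M" "f \<in> borel_measurable M" "AE x in M. \<bar>f x\<bar> \<le> \<bar>g x\<bar>"
  shows "f \<in> L2 M"
proof (rule L2_I[OF assms(2)])
  show "integrable M (\<lambda>x. (f x)\<^sup>2)"
    by (rule Bochner_Integration.integrable_bound[OF L2_D(2)[OF assms(1)]])
      (use assms in \<open>auto simp: abs_le_square_iff\<close>)
qed

lemma L2_add: "f \<in> L2 M \<Longrightarrow> g \<in> L2 M \<Longrightarrow> f + g \<in> L2 M"
proof (rule L2_I)
  assume fg: "f \<in> L2 M" "g \<in> L2 M"
  show "f + g \<in> borel_measurable M" using fg unfolding plus_fun_def by measurable
  have "(\<lambda>x. ((f + g) x)\<^sup>2) = (\<lambda>x. (f x)\<^sup>2 + 2 * (f x * g x) + (g x)\<^sup>2)"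
    by (simp add: fun_eq_iff power2_sum)
  then show "integrable M (\<lambda>x. ((f + g) x)\<^sup>2)"
    using L2_integrable_mult[OF fg] fg by (auto intro!: Bochner_Integration.integrable_add)
qed

lemma L2_scale: "f \<in> L2 M \<Longrightarrow> c *\<^sub>R f \<in> L2 M"
  unfolding L2_def scaleR_fun_def by (auto simp: power_mult_distrib)

lemma L2_zero: "0 \<in> L2 M"
  by (auto intro: L2_I simp: zero_fun_def)

lemma subspace_L2: "subspace (L2 M)"
  by (auto simp: subspace_def L2_add L2_scale L2_zero)

definition l2_ip :: "'a measure \<Rightarrow> ('a \<Rightarrow> real) \<Rightarrow> ('a \<Rightarrow> real) \<Rightarrow> real" where
  "l2_ip M f g = (\<integral>x. f x * g x \<partial>M)"

interpretation L2: semi_inner "L2 M" "l2_ip M" for M :: "'a measure"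
proof
  fix x y z :: "'a \<Rightarrow> real" assume "x \<in> L2 M" "y \<in> L2 M" "z \<in> L2 M"
  then show "l2_ip M (x + y) z = l2_ip M x z + l2_ip M y z"
    by (simp add: l2_ip_def distrib_right L2_integrable_mult)
next
  fix c and x z :: "'a \<Rightarrow> real"
  show "l2_ip M (c *\<^sub>R x) z = c * l2_ip M x z" by (simp add: l2_ip_def mult.assoc)
  show "l2_ip M x z = l2_ip M z x" by (simp add: l2_ip_def mult.commute)
qed (auto simp: subspace_L2 l2_ip_def)

lemma L2_norm2_eq: "L2_norm2 M f = (L2.nrm M f)\<^sup>2"
  by (simp add: L2_norm2_def L2.nrm_def l2_ip_def power2_eq_square)

lemma L2_nrm_zero_iff:
  assumes "f \<in> L2 M"
  shows "L2.nrm M f = 0 \<longleftrightarrow> (AE x in M. f x = 0)"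
proof -
  have "L2.nrm M f = 0 \<longleftrightarrow> (\<integral>x. (f x)\<^sup>2 \<partial>M) = 0"
    by (simp add: L2.nrm_def l2_ip_def power2_eq_square)
  also have "\<dots> \<longleftrightarrow> (AE x in M. (f x)\<^sup>2 = 0)"
    by (rule integral_nonneg_eq_0_iff_AE) (use assms in auto)
  finally show ?thesis by simp
qed

lemma L2_eqv_iff: "L2.eqv M f g \<longleftrightarrow> f \<in> L2 M \<and> g \<in> L2 M \<and> (AE x in M. f x = g x)"
  using L2_nrm_zero_iff[of "f - g" M] by (auto simp: L2.eqv_def)

lemma L2_nrm_mono:
  assumes "g \<in> L2 M" "f \<in> borel_measurable M" "AE x in M. \<bar>f x\<bar> \<le> \<bar>g x\<bar>"
  shows "L2.nrm M f \<le> L2.nrm M g"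
  unfolding L2.nrm_def l2_ip_def real_sqrt_le_iff
proof (rule integral_mono_AE)
  have "f \<in> L2 M" by (rule L2_bound[OF assms])
  then show "integrable M (\<lambda>x. f x * f x)" by (intro L2_integrable_mult)
  show "integrable M (\<lambda>x. g x * g x)" using assms(1) by (intro L2_integrable_mult)
  show "AE x in M. f x * f x \<le> g x * g x"
    using assms(3) by eventually_elim (simp add: abs_le_square_iff flip: power2_eq_square)
qed

text \<open>The positive part of \<open>v - w\<close> is dominated by \<open>|u n - v|\<close> for
  every \<open>n\<close>, so its norm is 0; the argument avoids a.e. convergent
  subsequences.\<close>

lemma L2_limit_le:
  assumes u: "\<And>n::nat. u n \<in> L2 M" and v: "v \<in> L2 M" and w: "w \<in> borel_measurable M"
    and lim: "(\<lambda>n. L2.nrm M (u n - v)) \<longlonglongrightarrow> 0"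
    and le: "\<And>n. AE x in M. u n x \<le> w x"
  shows "AE x in M. v x \<le> w x"
proof -
  define p where "p x = max (v x - w x) 0" for x
  have pm: "p \<in> borel_measurable M" using L2_measurable[OF v] w unfolding p_def by measurable
  have ple: "AE x in M. \<bar>p x\<bar> \<le> \<bar>(u n - v) x\<bar>" for n
    using le[of n] by eventually_elim (auto simp: p_def)
  have uv: "u n - v \<in> L2 M" for n using u v by (rule L2.V_closed)
  have p: "p \<in> L2 M" by (rule L2_bound[OF uv pm ple])
  have "L2.nrm M p \<le> L2.nrm M (u n - v)" for n
    by (rule L2_nrm_mono[OF uv pm ple])
  then have "L2.nrm M p \<le> 0" by (intro LIMSEQ_le_const[OF lim]) auto
  then have "AE x in M. p x = 0" using L2_nrm_zero_iff[OF p] L2.nrm_nonneg[OF p] by simp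
  then show ?thesis by eventually_elim (simp add: p_def max_def split: if_splits)
qed

lemma L2_limit_ge:
  assumes u: "\<And>n::nat. u n \<in> L2 M" and v: "v \<in> L2 M" and w: "w \<in> borel_measurable M"
    and lim: "(\<lambda>n. L2.nrm M (u n - v)) \<longlonglongrightarrow> 0"
    and le: "\<And>n. AE x in M. w x \<le> u n x"
  shows "AE x in M. w x \<le> v x"
proof -
  have "AE x in M. (- v) x \<le> - w x"
  proof (rule L2_limit_le[where u = "\<lambda>n. - u n" and v = "- v" and w = "\<lambda>x. - w x"])
    show "- u n \<in> L2 M" "- v \<in> L2 M" for n using u v by (auto intro: L2.V_closed)
    have "- u n - - v = - (u n - v)" for n by simp
    then show "(\<lambda>n. L2.nrm M (- u n - - v)) \<longlonglongrightarrow> 0" using lim u v by (simp only: L2.nrm_minus L2.V_closed)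
    show "(\<lambda>x. - w x) \<in> borel_measurable M" using w by simp
    show "AE x in M. (- u n) x \<le> - w x" for n using le[of n] by eventually_elim simp
  qed
  then show ?thesis by eventually_elim simp
qed

lemma L2_dominated_convergence:
  assumes g: "g \<in> L2 M" and u: "\<And>n::nat. u n \<in> borel_measurable M" and v: "v \<in> borel_measurable M"
    and le: "\<And>n. AE x in M. \<bar>u n x\<bar> \<le> g x" and lim: "AE x in M. (\<lambda>n. u n x) \<longlonglongrightarrow> v x"
  shows "v \<in> L2 M" "\<And>n. u n \<in> L2 M" "(\<lambda>n. L2.nrm M (u n - v)) \<longlonglongrightarrow> 0"
proof -
  have AEall: "AE x in M. \<forall>n. \<bar>u n x\<bar> \<le> g x" using le by (simp add: AE_all_countable)
  have vle: "AE x in M. \<bar>v x\<bar> \<le> g x"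
    using AEall lim
  proof eventually_elim
    case (elim x)
    have "(\<lambda>n. \<bar>u n x\<bar>) \<longlonglongrightarrow> \<bar>v x\<bar>" by (intro tendsto_intros elim)
    then show ?case by (rule LIMSEQ_le_const2) (use elim in auto)
  qed
  show vL: "v \<in> L2 M" by (rule L2_bound[OF g v]) (use vle in \<open>eventually_elim, simp\<close>)
  show uL: "u n \<in> L2 M" for n by (rule L2_bound[OF g u]) (use le[of n] in \<open>eventually_elim, simp\<close>)
  have "(\<lambda>n. \<integral>x. (u n x - v x)\<^sup>2 \<partial>M) \<longlonglongrightarrow> (\<integral>x. 0 \<partial>M)"
  proof (rule integral_dominated_convergence[where w = "\<lambda>x. 4 * (g x)\<^sup>2"])
    show "AE x in M. (\<lambda>n. (u n x - v x)\<^sup>2) \<longlonglongrightarrow> 0"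
      using lim by eventually_elim (auto intro!: tendsto_eq_intros)
    show "AE x in M. norm ((u n x - v x)\<^sup>2) \<le> 4 * (g x)\<^sup>2" for n
      using le[of n] vle
    proof eventually_elim
      case (elim x)
      have "\<bar>u n x - v x\<bar> \<le> 2 * g x" using elim by linarith
      then have "(u n x - v x)\<^sup>2 \<le> (2 * g x)\<^sup>2" by (metis abs_ge_zero order_trans power2_abs power_mono)
      then show ?case by (simp add: power_mult_distrib)
    qed
  qed (use g u v in auto)
  then have "(\<lambda>n. sqrt (\<integral>x. (u n x - v x)\<^sup>2 \<partial>M)) \<longlonglongrightarrow> sqrt 0" by (intro tendsto_intros) simp
  then show "(\<lambda>n. L2.nrm M (u n - v)) \<longlonglongrightarrow> 0"
    by (simp add: L2.nrm_def l2_ip_def power2_eq_square)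
qed

section \<open>Constants and completeness over finite measures\<close>

context finite_measure
begin

lemma L2_const: "(\<lambda>x. c) \<in> L2 M"
  by (rule L2_I) auto

lemma bounded_L2: "f \<in> borel_measurable M \<Longrightarrow> AE x in M. \<bar>f x\<bar> \<le> C \<Longrightarrow> f \<in> L2 M"
  by (rule L2_bound[OF L2_const[of C]]) auto

lemma L2_integrable: "f \<in> L2 M \<Longrightarrow> integrable M f"
  using L2_integrable_mult[OF _ L2_const[of 1]] by simp

text \<open>Finiteness of the measure turns the Cauchy property in \<open>L2\<close> into one in
  \<open>L1\<close>, which yields an a.e. convergent subsequence; Fatou's lemma along it bounds the
  distance from \<open>u n\<close> to the limit.\<close>

lemma L2_complete:
  assumes u: "\<And>n::nat. u n \<in> L2 M"
    and cauchy: "\<And>\<epsilon>. \<epsilon> > 0 \<Longrightarrow> \<exists>N. \<forall>m\<ge>N. \<forall>n\<ge>N. L2.nrm M (u m - u n) < \<epsilon>"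
  shows "\<exists>v\<in>L2 M. (\<lambda>n. L2.nrm M (u n - v)) \<longlonglongrightarrow> 0"
proof -
  \<comment> \<open>Adding 1 makes \<open>K\<close> positive even for the zero measure.\<close>
  define K where "K = L2.nrm M (\<lambda>x. 1) + 1"
  have K: "K > 0" using L2.nrm_nonneg[OF L2_const[of 1]] by (simp add: K_def)
  have L1: "(\<integral>x. norm (u m x - u n x) \<partial>M) \<le> K * L2.nrm M (u m - u n)" for m n
  proof -
    define d where "d x = \<bar>u m x - u n x\<bar>" for x
    have mem: "u m - u n \<in> L2 M" using u by auto
    have dm: "d \<in> borel_measurable M" using u unfolding d_def by measurable
    have dle: "AE x in M. \<bar>d x\<bar> \<le> \<bar>(u m - u n) x\<bar>" by (simp add: d_def)
    have d: "d \<in> L2 M" "L2.nrm M d \<le> L2.nrm M (u m - u n)"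
      by (rule L2_bound[OF mem dm dle], rule L2_nrm_mono[OF mem dm dle])
    have "(\<integral>x. norm (u m x - u n x) \<partial>M) = l2_ip M d (\<lambda>x. 1)" by (simp add: l2_ip_def d_def)
    also have "\<dots> \<le> L2.nrm M d * L2.nrm M (\<lambda>x. 1)"
      using L2.cauchy_schwarz[OF d(1) L2_const[of 1]] by simp
    also have "\<dots> \<le> L2.nrm M (u m - u n) * K"
      using d(2) mem L2.nrm_nonneg[OF L2_const[of 1]] by (intro mult_mono) (auto simp: K_def)
    finally show ?thesis by (simp add: mult.commute)
  qed
  obtain r where r: "strict_mono r" "AE x in M. Cauchy (\<lambda>i. u (r i) x)"
  proof (rule cauchy_L1_AE_cauchy_subseq[of M u])
    show "integrable M (u n)" for n using L2_integrable[OF u] .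
    fix e :: real assume e: "e > 0"
    then obtain N where N: "\<And>m n. m \<ge> N \<Longrightarrow> n \<ge> N \<Longrightarrow> L2.nrm M (u m - u n) < e / K"
      using cauchy[of "e / K"] K by auto
    have "(\<integral>x. norm (u i x - u j x) \<partial>M) < e" if "i \<ge> N" "j \<ge> N" for i j
      using L1[of i j] N[OF that] K by (simp add: field_simps)
    then show "\<exists>N. \<forall>i\<ge>N. \<forall>j\<ge>N. (\<integral>x. norm (u i x - u j x) \<partial>M) < e" by blast
  qed blast
  define v where "v x = lim (\<lambda>i. u (r i) x)" for x
  have [measurable]: "u n \<in> borel_measurable M" for n using u by auto
  have [measurable]: "v \<in> borel_measurable M" unfolding v_def by measurable
  have lim: "AE x in M. (\<lambda>i. u (r i) x) \<longlonglongrightarrow> v x"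
    using r(2) by eventually_elim (simp add: v_def Cauchy_convergent_iff convergent_LIMSEQ_iff)
  have fatou: "(\<integral>\<^sup>+x. ennreal ((u n x - v x)\<^sup>2) \<partial>M) \<le> ennreal (\<epsilon>\<^sup>2)"
    if N: "\<And>m. m \<ge> n \<Longrightarrow> L2.nrm M (u n - u m) \<le> \<epsilon>" and e: "\<epsilon> \<ge> 0" for n \<epsilon>
  proof -
    have "(\<integral>\<^sup>+x. ennreal ((u n x - v x)\<^sup>2) \<partial>M) = (\<integral>\<^sup>+x. liminf (\<lambda>i. ennreal ((u n x - u (r i) x)\<^sup>2)) \<partial>M)"
    proof (rule nn_integral_cong_AE)
      show "AE x in M. ennreal ((u n x - v x)\<^sup>2) = liminf (\<lambda>i. ennreal ((u n x - u (r i) x)\<^sup>2))"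
        using lim
      proof eventually_elim
        case (elim x)
        have "(\<lambda>i. ennreal ((u n x - u (r i) x)\<^sup>2)) \<longlonglongrightarrow> ennreal ((u n x - v x)\<^sup>2)"
          by (intro tendsto_intros elim)
        then show ?case by (intro lim_imp_Liminf[symmetric]) auto
      qed
    qed
    also have "\<dots> \<le> liminf (\<lambda>i. \<integral>\<^sup>+x. ennreal ((u n x - u (r i) x)\<^sup>2) \<partial>M)"
      by (rule nn_integral_liminf) measurable
    also have "\<dots> \<le> ennreal (\<epsilon>\<^sup>2)"
    proof (rule Liminf_le)
      have "(\<integral>\<^sup>+x. ennreal ((u n x - u (r i) x)\<^sup>2) \<partial>M) \<le> ennreal (\<epsilon>\<^sup>2)" if "i \<ge> n" for i
      proof -
        have mem: "u n - u (r i) \<in> L2 M" using u by auto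
        have "(\<integral>\<^sup>+x. ennreal ((u n x - u (r i) x)\<^sup>2) \<partial>M) = ennreal (\<integral>x. (u n x - u (r i) x)\<^sup>2 \<partial>M)"
          using L2_D(2)[OF mem] by (intro nn_integral_eq_integral) auto
        also have "(\<integral>x. (u n x - u (r i) x)\<^sup>2 \<partial>M) = (L2.nrm M (u n - u (r i)))\<^sup>2"
          using L2.nrm_square[OF mem] by (simp add: l2_ip_def power2_eq_square)
        also have "\<dots> \<le> \<epsilon>\<^sup>2"
          using N[of "r i"] that seq_suble[OF r(1), of i] mem by (intro power_mono) auto
        finally show ?thesis by (simp add: ennreal_leI)
      qed
      then show "\<forall>\<^sub>F i in sequentially. (\<integral>\<^sup>+x. ennreal ((u n x - u (r i) x)\<^sup>2) \<partial>M) \<le> ennreal (\<epsilon>\<^sup>2)"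
        by (auto simp: eventually_sequentially)
    qed auto
    finally show ?thesis .
  qed
  have diff: "u n - v \<in> L2 M \<and> L2.nrm M (u n - v) \<le> \<epsilon>"
    if N: "\<And>m. m \<ge> n \<Longrightarrow> L2.nrm M (u n - u m) \<le> \<epsilon>" and e: "\<epsilon> \<ge> 0" for n \<epsilon>
  proof
    have int: "integrable M (\<lambda>x. (u n x - v x)\<^sup>2)"
      using fatou[OF N e] by (intro integrableI_bounded) (auto simp: le_less_trans[OF _ ennreal_less_top])
    show mem: "u n - v \<in> L2 M" by (rule L2_I) (use int in \<open>simp_all add: fun_diff_def\<close>)
    have "ennreal ((L2.nrm M (u n - v))\<^sup>2) = (\<integral>\<^sup>+x. ennreal ((u n x - v x)\<^sup>2) \<partial>M)"
      using nn_integral_eq_integral[OF int] L2.nrm_square[OF mem] by (simp add: l2_ip_def power2_eq_square)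
    also have "\<dots> \<le> ennreal (\<epsilon>\<^sup>2)" by (rule fatou[OF N e])
    finally have "(L2.nrm M (u n - v))\<^sup>2 \<le> \<epsilon>\<^sup>2" by simp
    then show "L2.nrm M (u n - v) \<le> \<epsilon>" using e by (rule power2_le_imp_le)
  qed
  have ev: "\<exists>N. \<forall>n\<ge>N. u n - v \<in> L2 M \<and> L2.nrm M (u n - v) \<le> \<epsilon>" if e: "\<epsilon> > 0" for \<epsilon>
  proof -
    obtain N where N: "\<And>m n. m \<ge> N \<Longrightarrow> n \<ge> N \<Longrightarrow> L2.nrm M (u m - u n) < \<epsilon>" using cauchy[OF e] by blast
    have "u n - v \<in> L2 M \<and> L2.nrm M (u n - v) \<le> \<epsilon>" if n: "n \<ge> N" for n
    proof (rule diff)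
      show "L2.nrm M (u n - u m) \<le> \<epsilon>" if "m \<ge> n" for m
        using N[of n m] n that by (simp add: less_imp_le)
    qed (use e in simp)
    then show ?thesis by blast
  qed
  obtain N where "u N - v \<in> L2 M" using ev[of 1] by auto
  from L2.V_closed(3)[OF u this, of N] have v: "v \<in> L2 M" by simp
  have "(\<lambda>n. L2.nrm M (u n - v)) \<longlonglongrightarrow> 0"
    unfolding tendsto_iff eventually_sequentially
  proof safe
    fix e :: real assume e: "e > 0"
    then obtain N where "\<And>n. n \<ge> N \<Longrightarrow> L2.nrm M (u n - v) \<le> e / 2" using ev[of "e / 2"] by auto
    then have "dist (L2.nrm M (u n - v)) 0 < e" if "n \<ge> N" for n
      using that e L2.nrm_nonneg[of "u n - v" M] u v by (fastforce simp: dist_real_def)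
    then show "\<exists>N. \<forall>n\<ge>N. dist (L2.nrm M (u n - v)) 0 < e" by blast
  qed
  with v show ?thesis by blast
qed

end

section \<open>Dirichlet forms over finite measures\<close>

lemma form1_eq: "form1 D u v = form D u v + l2_ip (Meas D) u v"
  by (simp add: form1_def l2_ip_def)

lemma semi_inner_form:
  assumes "nonneg_symmetric_form D" "dom D \<noteq> {}"
  shows "semi_inner (dom D) (form D)"
proof -
  have lin: "a *\<^sub>R u + b *\<^sub>R v \<in> dom D"
      "w \<in> dom D \<Longrightarrow> form D (a *\<^sub>R u + b *\<^sub>R v) w = a * form D u w + b * form D v w"
    if "u \<in> dom D" "v \<in> dom D" for a b u v w
    using assms(1) that unfolding nonneg_symmetric_form_def lin_comb_eq by blast+
  have "subspace (dom D)"
    unfolding subspace_def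
  proof (intro conjI allI ballI)
    show "0 \<in> dom D" using assms(2) lin(1)[of _ _ 0 0] by auto
    show "x + y \<in> dom D" if "x \<in> dom D" "y \<in> dom D" for x y using lin(1)[OF that, of 1 1] by simp
    show "c *\<^sub>R x \<in> dom D" if "x \<in> dom D" for c x using lin(1)[OF that that, of c 0] by simp
  qed
  moreover have "\<And>u v. u \<in> dom D \<Longrightarrow> v \<in> dom D \<Longrightarrow> form D u v = form D v u"
    "\<And>u. u \<in> dom D \<Longrightarrow> form D u u \<ge> 0"
    using assms(1) unfolding nonneg_symmetric_form_def by blast+
  ultimately show ?thesis
  proof unfold_locales
    fix x y z assume "x \<in> dom D" "y \<in> dom D" "z \<in> dom D"
    then show "form D (x + y) z = form D x z + form D y z" using lin(2)[of x y z 1 1] by simp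
  next
    fix c x z assume "x \<in> dom D" "z \<in> dom D"
    then show "form D (c *\<^sub>R x) z = c * form D x z" using lin(2)[of x x z c 0] by simp
  qed blast+
qed

lemma closed_bilinear_form_space:
  assumes nns: "nonneg_symmetric_form D" and ne: "dom D \<noteq> {}" and cl: "closed_form D"
  shows "closed_bilinear_form (L2 (Meas D)) (l2_ip (Meas D)) (dom D) (form D)"
proof -
  let ?M = "Meas D"
  have sub: "dom D \<subseteq> L2 ?M" using nns unfolding nonneg_symmetric_form_def by blast
  have "semi_inner (dom D) (form D)" by (rule semi_inner_form[OF nns ne])
  then show ?thesis
    unfolding closed_bilinear_form_def closed_bilinear_form_axioms_def
  proof (intro conjI allI impI L2.semi_inner_axioms sub)
    fix u assume "\<forall>n::nat. u n \<in> dom D"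
      "\<forall>\<epsilon>>0. \<exists>N. \<forall>m\<ge>N. \<forall>n\<ge>N. form D (u m - u n) (u m - u n) + l2_ip ?M (u m - u n) (u m - u n) < \<epsilon>"
    then show "\<exists>v\<in>dom D. (\<lambda>n. form D (u n - v) (u n - v) + l2_ip ?M (u n - v) (u n - v)) \<longlonglongrightarrow> 0"
      using cl[unfolded closed_form_def form1_eq, THEN spec, of u] unfolding fun_diff_def by simp
  next
    fix u v assume uv: "u \<in> dom D" "v \<in> L2 ?M" "L2.nrm ?M (u - v) = 0"
    then have "AE x in ?M. u x = v x" using sub L2_nrm_zero_iff[of "u - v" ?M] by auto
    then show "v \<in> dom D" using uv nns unfolding nonneg_symmetric_form_def by blast
  next
    fix u v w assume uv: "u \<in> dom D" "v \<in> dom D" "w \<in> dom D" "L2.nrm ?M (u - v) = 0"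
    then have "AE x in ?M. u x = v x" "v \<in> borel_measurable ?M"
      using sub L2_nrm_zero_iff[of "u - v" ?M] by auto
    then show "form D u w = form D v w" using uv nns unfolding nonneg_symmetric_form_def by metis
  qed
qed

lemma densely_defined_nonempty: "densely_defined D \<Longrightarrow> dom D \<noteq> {}"
  using L2_zero[of "Meas D"] unfolding densely_defined_def by (metis empty_iff zero_less_one)

lemma markov_form_comp:
  assumes "markov_form D" "\<And>s t. \<bar>T s - T t\<bar> \<le> \<bar>s - t\<bar>" "T 0 = 0" "u \<in> dom D"
  shows "(\<lambda>x. T (u x)) \<in> dom D" "form D (\<lambda>x. T (u x)) (\<lambda>x. T (u x)) \<le> form D u u"
  using assms unfolding markov_form_def comp_def by blast+

text \<open>The setting of the restricted forms on relatively compact open sets. The finite measure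
  places constants and bounded functions in \<open>L2\<close>, and \<open>L2\<close> in
  \<open>L1\<close>.\<close>

locale finite_markov_form =
  fixes D :: "'a form_space"
  assumes nonneg_symmetric: "nonneg_symmetric_form D"
    and densely: "densely_defined D"
    and closed_D: "closed_form D"
    and markov: "markov_form D"
    and finite: "finite_measure (Meas D)"
begin

abbreviation "M \<equiv> Meas D"

sublocale finite_measure M by (rule finite)

sublocale dense_form "L2 M" "l2_ip M" "dom D" "form D"
  unfolding dense_form_def dense_form_axioms_def
proof (intro conjI allI impI)
  show "closed_bilinear_form (L2 M) (l2_ip M) (dom D) (form D)"
    by (rule closed_bilinear_form_space[OF nonneg_symmetric densely_defined_nonempty[OF densely] closed_D])
  fix u :: "nat \<Rightarrow> 'a \<Rightarrow> real"
  assume "\<forall>n. u n \<in> L2 M" "\<forall>\<epsilon>>0. \<exists>N. \<forall>m\<ge>N. \<forall>n\<ge>N. L2.nrm M (u m - u n) < \<epsilon>"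
  then show "\<exists>v\<in>L2 M. (\<lambda>n. L2.nrm M (u n - v)) \<longlonglongrightarrow> 0" by (intro L2_complete) auto
next
  fix f and \<epsilon> :: real assume f: "f \<in> L2 M" and e: "\<epsilon> > 0"
  then obtain u where u: "u \<in> dom D" "L2_norm2 M (f - u) < \<epsilon>\<^sup>2"
    using densely unfolding densely_defined_def fun_diff_def by (meson zero_less_power)
  have "(L2.nrm M (f - u))\<^sup>2 < \<epsilon>\<^sup>2" using u(2) by (simp add: L2_norm2_eq)
  then have "L2.nrm M (f - u) < \<epsilon>" by (rule power2_less_imp_less) (use e in simp)
  then show "\<exists>u\<in>dom D. L2.nrm M (f - u) < \<epsilon>" using u(1) by blast
qed

end

context finite_markov_form
begin

notation eqv (infix "\<doteq>" 50)

lemma eqv_AE: "f \<doteq> g \<longleftrightarrow> f \<in> L2 M \<and> g \<in> L2 M \<and> (AE x in M. f x = g x)"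
  by (rule L2_eqv_iff)

lemma dom_cong: "u \<in> dom D \<Longrightarrow> v \<in> borel_measurable M \<Longrightarrow> AE x in M. u x = v x \<Longrightarrow> v \<in> dom D"
  using nonneg_symmetric unfolding nonneg_symmetric_form_def by blast

lemma form_cong: "u \<in> dom D \<Longrightarrow> v \<in> dom D \<Longrightarrow> w \<in> dom D \<Longrightarrow> AE x in M. u x = v x \<Longrightarrow> form D u w = form D v w"
  using E_cong[of u v w] L2.eqvD(3)[where x = u and y = v and M = M] eqv_AE[of u v] by auto

lemma gen_iff: "gen f h \<longleftrightarrow> form_operator D f h"
  by (auto simp: gen_def form_operator_def l2_ip_def)

lemma tendsto_square_iff: "((\<lambda>t. (g t)\<^sup>2) \<longlongrightarrow> (0::real)) F \<longleftrightarrow> (g \<longlongrightarrow> 0) F"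
proof
  assume "((\<lambda>t. (g t)\<^sup>2) \<longlongrightarrow> 0) F"
  then have "((\<lambda>t. sqrt ((g t)\<^sup>2)) \<longlongrightarrow> sqrt 0) F" by (rule tendsto_real_sqrt)
  then show "(g \<longlongrightarrow> 0) F" by (simp add: tendsto_rabs_zero_iff)
next
  assume "(g \<longlongrightarrow> 0) F"
  then show "((\<lambda>t. (g t)\<^sup>2) \<longlongrightarrow> 0) F" by (auto intro!: tendsto_eq_intros)
qed

lemma diff_quotient_limit_iff:
  "((\<lambda>t. L2_norm2 M (\<lambda>x. (Q t f x - f x) / t - (- h x))) \<longlongrightarrow> 0) (at_right 0) \<longleftrightarrow> diff_quotient_limit Q f h"
proof -
  have "(\<lambda>x. (Q t f x - f x) / t - (- h x)) = (1 / t) *\<^sub>R (Q t f - f) + h" for t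
    by (simp add: fun_eq_iff)
  then show ?thesis by (simp add: diff_quotient_limit_def L2_norm2_eq tendsto_square_iff)
qed

lemma is_heat_semigroup_iff: "is_heat_semigroup D Q \<longleftrightarrow> heat_sg Q"
proof -
  have bound: "(\<exists>C. \<forall>f\<in>L2 M. L2_norm2 M (Q t f) \<le> C * L2_norm2 M f) \<longleftrightarrow> (\<exists>C. \<forall>f\<in>L2 M. nrm (Q t f) \<le> C * nrm f)"
    if cl: "\<forall>f\<in>L2 M. Q t f \<in> L2 M" for t
  proof
    assume "\<exists>C. \<forall>f\<in>L2 M. L2_norm2 M (Q t f) \<le> C * L2_norm2 M f"
    then obtain C where C: "\<And>f. f \<in> L2 M \<Longrightarrow> (nrm (Q t f))\<^sup>2 \<le> C * (nrm f)\<^sup>2" by (auto simp: L2_norm2_eq)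
    \<comment> \<open>The given constant may be negative, hence \<open>max C 0\<close> under the
      root.\<close>
    have "nrm (Q t f) \<le> sqrt (max C 0) * nrm f" if f: "f \<in> L2 M" for f
    proof -
      have "C * (nrm f)\<^sup>2 \<le> max C 0 * (nrm f)\<^sup>2" by (intro mult_right_mono) auto
      then have "(nrm (Q t f))\<^sup>2 \<le> (sqrt (max C 0) * nrm f)\<^sup>2"
        using C[OF f] by (simp add: power_mult_distrib)
      then show ?thesis by (rule power2_le_imp_le) (use f in simp)
    qed
    then show "\<exists>C. \<forall>f\<in>L2 M. nrm (Q t f) \<le> C * nrm f" by blast
  next
    assume "\<exists>C. \<forall>f\<in>L2 M. nrm (Q t f) \<le> C * nrm f"
    then obtain C where C: "\<And>f. f \<in> L2 M \<Longrightarrow> nrm (Q t f) \<le> C * nrm f" by blast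
    have "(nrm (Q t f))\<^sup>2 \<le> C\<^sup>2 * (nrm f)\<^sup>2" if f: "f \<in> L2 M" for f
      using power_mono[OF C[OF f], of 2] cl f by (simp add: power_mult_distrib)
    then show "\<exists>C. \<forall>f\<in>L2 M. L2_norm2 M (Q t f) \<le> C * L2_norm2 M f" by (auto simp: L2_norm2_eq)
  qed
  have AE_iff: "(AE x in M. u x = v x) \<longleftrightarrow> u \<doteq> v" if "u \<in> L2 M" "v \<in> L2 M" for u v
    using that by (simp add: eqv_AE)
  show ?thesis
  \<comment> \<open>A.e. equality and \<open>\<doteq>\<close> coincide only on \<open>L2\<close>; if
    \<open>Q\<close> leaves \<open>L2\<close>, both sides are false.\<close>
  proof (cases "\<forall>t\<ge>0. \<forall>f\<in>L2 M. Q t f \<in> L2 M")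
    case True
    then have mem: "t \<ge> 0 \<Longrightarrow> f \<in> L2 M \<Longrightarrow> Q t f \<in> L2 M" for t f by blast
    have 1: "(AE x in M. Q t (\<lambda>y. a * f y + b * g y) x = a * Q t f x + b * Q t g x) \<longleftrightarrow>
        Q t (a *\<^sub>R f + b *\<^sub>R g) \<doteq> a *\<^sub>R Q t f + b *\<^sub>R Q t g" if "t \<ge> 0" "f \<in> L2 M" "g \<in> L2 M" for t f g a b
      using AE_iff[of "Q t (a *\<^sub>R f + b *\<^sub>R g)" "a *\<^sub>R Q t f + b *\<^sub>R Q t g"] mem[OF that(1)] that
      by (simp add: lin_comb_eq)
    have 2: "(AE x in M. Q 0 f x = f x) \<longleftrightarrow> Q 0 f \<doteq> f" if "f \<in> L2 M" for f
      using AE_iff mem that by simp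
    have 3: "(AE x in M. Q (s + t) f x = Q s (Q t f) x) \<longleftrightarrow> Q (s + t) f \<doteq> Q s (Q t f)"
      if "s \<ge> 0" "t \<ge> 0" "f \<in> L2 M" for s t f
      using AE_iff mem that by simp
    have 4: "((\<lambda>t. L2_norm2 M (\<lambda>x. Q t f x - f x)) \<longlongrightarrow> 0) (at_right 0) \<longleftrightarrow> ((\<lambda>t. nrm (Q t f - f)) \<longlongrightarrow> 0) (at_right 0)" for f
      by (simp add: L2_norm2_eq tendsto_square_iff fun_diff_def)
    show ?thesis
      unfolding is_heat_semigroup_def C0_semigroup_def heat_sg_def diff_quotient_limit_iff gen_iff
      using True by (auto simp: 1 2 3 4 bound)
  next
    case False
    then show ?thesis unfolding is_heat_semigroup_def C0_semigroup_def heat_sg_def by blast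
  qed
qed

text \<open>\<open>heat_L2\<close> is defined by a choice. The constructed \<open>P\<close> shows
  that the choice has a candidate, and uniqueness identifies the chosen semigroup with
  \<open>P\<close> up to null sets.\<close>

lemma heat_L2_AE:
  assumes t: "t \<ge> 0" and f: "f \<in> L2 M"
  shows "heat_L2 D t f \<in> L2 M" "AE x in M. heat_L2 D t f x = P t f x"
proof -
  have "is_heat_semigroup D (heat_L2 D)"
    unfolding heat_L2_def by (rule someI[of _ P]) (simp add: is_heat_semigroup_iff heat_sg_P)
  then have "heat_L2 D t f \<doteq> P t f"
    using heat_sg_unique[OF _ t f] by (simp add: is_heat_semigroup_iff)
  then show "heat_L2 D t f \<in> L2 M" "AE x in M. heat_L2 D t f x = P t f x" by (auto simp: eqv_AE)
qed

subsection \<open>Positivity\<close>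

lemmas markov_comp = markov_form_comp[OF markov]

text \<open>\<open>J a f\<close> minimises \<open>|v - f|^2 + a E v v\<close>. Composition with
  \<open>T\<close> moves the values no farther from \<open>f\<close> and does not raise the energy,
  so it gives another minimiser, and the minimiser is unique as a class. Applied to
  \<open>max s 0\<close> and \<open>min s c\<close>.\<close>

lemma J_clamp:
  assumes a: "a > 0" and f: "f \<in> L2 M"
    and T: "\<And>s t. \<bar>T s - T t\<bar> \<le> \<bar>s - t :: real\<bar>" "T 0 = 0"
    and Tf: "AE x in M. \<forall>s. \<bar>T s - f x\<bar> \<le> \<bar>s - f x\<bar>"
  shows "AE x in M. J a f x = T (J a f x)"
proof -
  define u where "u = J a f"
  define v where "v = (\<lambda>x. T (u x))"
  have u: "u \<in> dom D" using J_props(1)[OF a f] by (simp add: u_def)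
  have v: "v \<in> dom D" "form D v v \<le> form D u u" unfolding v_def by (rule markov_comp[OF T u])+
  have vf: "l2_ip M (v - f) (v - f) \<le> l2_ip M (u - f) (u - f)"
  proof -
    have "nrm (v - f) \<le> nrm (u - f)"
    proof (rule L2_nrm_mono)
      show "u - f \<in> L2 M" using u f by auto
      have "v - f \<in> L2 M" using v f by auto
      then show "v - f \<in> borel_measurable M" by (rule L2_measurable)
      show "AE x in M. \<bar>(v - f) x\<bar> \<le> \<bar>(u - f) x\<bar>" using Tf by eventually_elim (simp add: v_def)
    qed
    then show ?thesis unfolding L2.nrm_def by simp
  qed
  have eq: "l2_ip M u (v - u) + a * form D u (v - u) = l2_ip M f (v - u)"
    unfolding u_def by (rule J_props(2)[OF a f]) (use u v in \<open>auto simp: u_def\<close>)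
  have e1: "l2_ip M (v - f) (v - f) = l2_ip M (u - f) (u - f) + 2 * l2_ip M (u - f) (v - u) + l2_ip M (v - u) (v - u)"
    using L2.ip_add_scale_self[where x = "u - f" and y = "v - u" and t = 1 and M = M] u v f by simp
  have e2: "form D v v = form D u u + 2 * form D u (v - u) + form D (v - u) (v - u)"
    using E.ip_add_scale_self[of u "v - u" 1] u v by simp
  have "l2_ip M (u - f) (v - u) = - a * form D u (v - u)"
    using eq u v f by (simp add: L2.ip_diff)
  then have "l2_ip M (v - u) (v - u) \<le> 2 * (a * form D u (v - u))" using e1 vf by simp
  also have "\<dots> = a * (form D v v - form D u u - form D (v - u) (v - u))" by (simp add: e2)
  also have "\<dots> \<le> 0"
    using v(2) E.ip_nonneg[of "v - u"] u v a by (intro mult_nonneg_nonpos) auto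
  finally have "nrm (v - u) = 0" using L2.ip_nonneg[of "v - u" M] u v by (simp add: L2.nrm_def)
  then have "AE x in M. (v - u) x = 0" using L2_nrm_zero_iff[of "v - u" M] u v by auto
  then show ?thesis by eventually_elim (simp add: v_def u_def)
qed

lemma J_nonneg:
  assumes a: "a > 0" and f: "f \<in> L2 M" and nn: "AE x in M. 0 \<le> f x"
  shows "AE x in M. 0 \<le> J a f x"
proof -
  have "AE x in M. J a f x = max (J a f x) 0"
    by (rule J_clamp[OF a f]) (use nn in \<open>auto elim!: eventually_mono\<close>)
  then show ?thesis by eventually_elim simp
qed

lemma J_le_const:
  assumes a: "a > 0" and f: "f \<in> L2 M" and le: "AE x in M. f x \<le> c" and c: "c \<ge> 0"
  shows "AE x in M. J a f x \<le> c"
proof -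
  have "AE x in M. J a f x = min (J a f x) c"
    by (rule J_clamp[OF a f]) (use le c in \<open>auto elim!: eventually_mono\<close>)
  then show ?thesis by eventually_elim simp
qed

lemma P_nonneg:
  assumes t: "t \<ge> 0" and f: "f \<in> L2 M" and nn: "AE x in M. 0 \<le> f x"
  shows "AE x in M. 0 \<le> P t f x"
proof -
  have "P t f \<in> {f \<in> L2 M. AE x in M. 0 \<le> f x}"
  proof (rule P_closed_set[OF t])
    show "J a g \<in> {f \<in> L2 M. AE x in M. 0 \<le> f x}" if "a > 0" "g \<in> {f \<in> L2 M. AE x in M. 0 \<le> f x}" for a g
      using J_nonneg[OF that(1)] that by simp
    fix u v assume "\<And>n::nat. u n \<in> {f \<in> L2 M. AE x in M. 0 \<le> f x}" "v \<in> L2 M" "(\<lambda>n. nrm (u n - v)) \<longlonglongrightarrow> 0"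
    then show "v \<in> {f \<in> L2 M. AE x in M. 0 \<le> f x}"
      using L2_limit_ge[of u M v "\<lambda>x. 0"] by simp
  qed (use f nn in auto)
  then show ?thesis by simp
qed

lemma P_le_const:
  assumes t: "t \<ge> 0" and f: "f \<in> L2 M" and le: "AE x in M. f x \<le> c" and c: "c \<ge> 0"
  shows "AE x in M. P t f x \<le> c"
proof -
  have "P t f \<in> {f \<in> L2 M. AE x in M. f x \<le> c}"
  proof (rule P_closed_set[OF t])
    show "J a g \<in> {f \<in> L2 M. AE x in M. f x \<le> c}" if "a > 0" "g \<in> {f \<in> L2 M. AE x in M. f x \<le> c}" for a g
      using J_le_const[OF that(1) _ _ c] that by simp
    fix u v assume "\<And>n::nat. u n \<in> {f \<in> L2 M. AE x in M. f x \<le> c}" "v \<in> L2 M" "(\<lambda>n. nrm (u n - v)) \<longlonglongrightarrow> 0"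
    then show "v \<in> {f \<in> L2 M. AE x in M. f x \<le> c}"
      using L2_limit_le[of u M v "\<lambda>x. c"] by simp
  qed (use f le in auto)
  then show ?thesis by simp
qed

lemma contraction_AE:
  assumes "contraction T" "f \<in> L2 M" "g \<in> L2 M"
  shows "AE x in M. T (f - g) x = T f x - T g x"
  using L2.contraction_sub[OF assms] by (simp add: eqv_AE)

lemma positive_mono:
  assumes "contraction T" and "f \<in> L2 M" "g \<in> L2 M" "AE x in M. f x \<le> g x"
    and pos: "\<And>h. h \<in> L2 M \<Longrightarrow> AE x in M. 0 \<le> h x \<Longrightarrow> AE x in M. 0 \<le> T h x"
  shows "AE x in M. T f x \<le> T g x"
proof -
  have "AE x in M. 0 \<le> T (g - f) x" by (rule pos) (use assms in auto)
  with contraction_AE[OF assms(1,3,2)] show ?thesis by eventually_elim simp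
qed

lemma P_mono:
  assumes "t \<ge> 0" "f \<in> L2 M" "g \<in> L2 M" "AE x in M. f x \<le> g x"
  shows "AE x in M. P t f x \<le> P t g x"
  by (rule positive_mono[OF contraction_P[OF assms(1)] assms(2-4)]) (rule P_nonneg[OF assms(1)])

lemma J_mono:
  assumes "a > 0" "f \<in> L2 M" "g \<in> L2 M" "AE x in M. f x \<le> g x"
  shows "AE x in M. J a f x \<le> J a g x"
  by (rule positive_mono[OF contraction_J[OF assms(1)] assms(2-4)]) (rule J_nonneg[OF assms(1)])

subsection \<open>The heat semigroup on integrable functions\<close>

definition heat_approx :: "real \<Rightarrow> ('a \<Rightarrow> real) \<Rightarrow> (nat \<Rightarrow> 'a \<Rightarrow> real) \<Rightarrow> ('a \<Rightarrow> real) \<Rightarrow> bool" where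
  "heat_approx t f fn u \<longleftrightarrow> (\<forall>n. fn n \<in> L2 M) \<and>
     (AE x in M. \<forall>n. 0 \<le> fn n x \<and> fn n x \<le> fn (Suc n) x) \<and>
     (AE x in M. (\<lambda>n. fn n x) \<longlonglongrightarrow> f x) \<and>
     (AE x in M. (\<lambda>n. heat_L2 D t (fn n) x) \<longlonglongrightarrow> u x)"

text \<open>The truncations \<open>min f n\<close> increase to \<open>f\<close>. Their images
  increase too, and by symmetry and \<open>P t 1 \<le> 1\<close> have integrals bounded by that of
  \<open>f\<close>, so monotone convergence makes the limit finite a.e.\<close>

lemma heat_approx_exists:
  assumes t: "t \<ge> 0" and f: "integrable M f" and nn: "\<And>x. 0 \<le> f x"
  shows "\<exists>u\<in>borel_measurable M. \<exists>fn. heat_approx t f fn u"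
proof -
  have fm[measurable]: "f \<in> borel_measurable M" using f by auto
  define fn where "fn n x = min (f x) (real n)" for n x
  have fnL: "fn n \<in> L2 M" for n
    unfolding fn_def by (rule bounded_L2[where C = "real n"]) (use nn in auto)
  have mono: "fn n x \<le> fn (Suc n) x" "0 \<le> fn n x" for n x using nn by (auto simp: fn_def)
  define g where "g n = heat_L2 D t (fn n)" for n
  have gL: "g n \<in> L2 M" for n using heat_L2_AE(1)[OF t fnL] by (simp add: g_def)
  have [measurable]: "g n \<in> borel_measurable M" for n using gL by auto
  have gP: "AE x in M. g n x = P t (fn n) x" for n using heat_L2_AE(2)[OF t fnL] by (simp add: g_def)
  have g0: "AE x in M. 0 \<le> g n x" for n
    using gP[of n] P_nonneg[OF t fnL, of n] mono by (auto elim: AE_mp)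
  have gmono: "AE x in M. g n x \<le> g (Suc n) x" for n
    using gP[of n] gP[of "Suc n"] P_mono[OF t fnL fnL, of n "Suc n"] mono by (auto elim!: AE_mp)
  have one: "(\<lambda>x. 1) \<in> L2 M" by (rule L2_const)
  have gint: "(\<integral>\<^sup>+x. ennreal (g n x) \<partial>M) \<le> ennreal (\<integral>x. f x \<partial>M)" for n
  proof -
    have "(\<integral>\<^sup>+x. ennreal (g n x) \<partial>M) = ennreal (\<integral>x. g n x \<partial>M)"
      by (rule nn_integral_eq_integral[OF L2_integrable[OF gL] g0])
    also have "(\<integral>x. g n x \<partial>M) = (\<integral>x. P t (fn n) x * 1 \<partial>M)"
      using gP[of n] P_V[OF t fnL, of n] by (intro integral_cong_AE) auto
    also have "\<dots> = l2_ip M (P t (fn n)) (\<lambda>x. 1)" by (rule l2_ip_def[symmetric])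
    also have "\<dots> = l2_ip M (fn n) (P t (\<lambda>x. 1))" by (rule P_symmetric[OF t fnL one])
    also have "\<dots> = (\<integral>x. fn n x * P t (\<lambda>x. 1) x \<partial>M)" by (rule l2_ip_def)
    also have "\<dots> \<le> (\<integral>x. f x \<partial>M)"
    proof (rule integral_mono_AE[OF L2_integrable_mult[OF fnL P_V[OF t one]] f])
      have "AE x in M. P t (\<lambda>x. 1) x \<le> 1" by (rule P_le_const[OF t one]) auto
      moreover have "AE x in M. 0 \<le> P t (\<lambda>x. 1) x" by (rule P_nonneg[OF t one]) auto
      ultimately show "AE x in M. fn n x * P t (\<lambda>x. 1) x \<le> f x"
      proof eventually_elim
        case (elim x)
        have "fn n x * P t (\<lambda>x. 1) x \<le> fn n x * 1" using elim mono(2)[of n x] by (intro mult_left_mono) auto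
        then show ?case by (simp add: fn_def)
      qed
    qed
    finally show ?thesis by (simp add: ennreal_leI)
  qed
  have "(\<integral>\<^sup>+x. (SUP n. ennreal (g n x)) \<partial>M) = (SUP n. \<integral>\<^sup>+x. ennreal (g n x) \<partial>M)"
  proof (rule nn_integral_monotone_convergence_SUP_AE)
    show "AE x in M. ennreal (g n x) \<le> ennreal (g (Suc n) x)" for n
      using gmono[of n] by eventually_elim (rule ennreal_leI)
  qed measurable
  also have "\<dots> \<le> ennreal (\<integral>x. f x \<partial>M)" by (rule SUP_least) (rule gint)
  also have "\<dots> < \<infinity>" by simp
  finally have "AE x in M. (SUP n. ennreal (g n x)) \<noteq> \<infinity>"
    by (intro nn_integral_noteq_infinite) auto
  moreover have "AE x in M. \<forall>n. 0 \<le> g n x \<and> g n x \<le> g (Suc n) x"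
    using g0 gmono by (simp add: AE_all_countable)
  ultimately have conv: "AE x in M. convergent (\<lambda>n. g n x)"
  proof eventually_elim
    case (elim x)
    then obtain c where c: "(SUP n. ennreal (g n x)) = ennreal c" "c \<ge> 0"
      by (cases "SUP n. ennreal (g n x)") auto
    have "g n x \<le> c" for n
    proof -
      have "ennreal (g n x) \<le> ennreal c" using c(1) by (metis SUP_upper UNIV_I)
      then show ?thesis using c(2) by (simp add: ennreal_le_iff)
    qed
    moreover have "incseq (\<lambda>n. g n x)" using elim by (auto intro: incseq_SucI)
    ultimately show ?case by (metis incseq_convergent convergent_def)
  qed
  define u where "u x = lim (\<lambda>n. g n x)" for x
  have "u \<in> borel_measurable M" unfolding u_def by measurable
  moreover have "heat_approx t f fn u"
    unfolding heat_approx_def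
  proof (intro conjI allI fnL)
    show "AE x in M. \<forall>n. 0 \<le> fn n x \<and> fn n x \<le> fn (Suc n) x" using mono by simp
    have "(\<lambda>n. fn n x) \<longlonglongrightarrow> f x" for x
    proof (rule tendsto_eventually)
      obtain N :: nat where "f x \<le> real N" using real_arch_simple by blast
      then show "\<forall>\<^sub>F n in sequentially. fn n x = f x"
        by (auto simp: eventually_sequentially fn_def min_def intro!: exI[of _ N])
    qed
    then show "AE x in M. (\<lambda>n. fn n x) \<longlonglongrightarrow> f x" by simp
    show "AE x in M. (\<lambda>n. heat_L2 D t (fn n) x) \<longlonglongrightarrow> u x"
      using conv by eventually_elim (simp add: u_def g_def convergent_LIMSEQ_iff)
  qed
  ultimately show ?thesis by blast
qed

lemma heat_nonneg_approx:
  assumes t: "t \<ge> 0" and f: "integrable M f" and nn: "\<And>x. 0 \<le> f x"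
  obtains fn where "heat_nonneg D t f \<in> borel_measurable M" "heat_approx t f fn (heat_nonneg D t f)"
proof -
  define Q where "Q u \<longleftrightarrow> u \<in> borel_measurable M \<and> (\<exists>fn. heat_approx t f fn u)" for u
  have "heat_nonneg D t f = (SOME u. Q u)" unfolding heat_nonneg_def Q_def heat_approx_def ..
  moreover have "\<exists>u. Q u" using heat_approx_exists[OF assms] by (auto simp: Q_def)
  ultimately have "Q (heat_nonneg D t f)" using someI_ex[of Q] by simp
  then have "heat_nonneg D t f \<in> borel_measurable M \<and> (\<exists>fn. heat_approx t f fn (heat_nonneg D t f))"
    by (simp add: Q_def)
  then show ?thesis using that by blast
qed

lemma heat_approx_upper:
  assumes t: "t \<ge> 0" and ap: "heat_approx t f fn u"
  shows "AE x in M. P t (fn n) x \<le> u x"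
proof -
  have fnL: "fn n \<in> L2 M" for n using ap by (simp add: heat_approx_def)
  have mono: "AE x in M. fn n x \<le> fn (Suc n) x" for n
    using ap unfolding heat_approx_def by (auto elim: eventually_mono)
  have "AE x in M. \<forall>n. P t (fn n) x \<le> P t (fn (Suc n)) x"
    unfolding AE_all_countable using P_mono[OF t fnL fnL mono] by blast
  moreover have "AE x in M. \<forall>n. heat_L2 D t (fn n) x = P t (fn n) x"
    unfolding AE_all_countable using heat_L2_AE(2)[OF t fnL] by blast
  moreover have "AE x in M. (\<lambda>n. heat_L2 D t (fn n) x) \<longlonglongrightarrow> u x" using ap by (simp add: heat_approx_def)
  ultimately show ?thesis
  proof eventually_elim
    case (elim x)
    then have "(\<lambda>n. P t (fn n) x) \<longlonglongrightarrow> u x" by simp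
    moreover have "incseq (\<lambda>n. P t (fn n) x)" using elim by (auto intro: incseq_SucI)
    ultimately show ?case by (rule incseq_le[rotated])
  qed
qed

text \<open>The sequence behind \<open>heat_nonneg\<close> is unknown. Its minimum with
  \<open>y\<close> is dominated by \<open>|y|\<close> and tends to \<open>y\<close> in
  \<open>L2\<close>, so the comparison passes to the limit through the continuity of
  \<open>P t\<close>.\<close>

lemma heat_nonneg_ge:
  assumes t: "t \<ge> 0" and f: "integrable M f" and nn: "\<And>x. 0 \<le> f x"
    and y: "y \<in> L2 M" and le: "AE x in M. y x \<le> f x"
  shows "AE x in M. P t y x \<le> heat_nonneg D t f x"
proof -
  obtain fn where um: "heat_nonneg D t f \<in> borel_measurable M" and ap: "heat_approx t f fn (heat_nonneg D t f)"
    by (rule heat_nonneg_approx[OF t f nn])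
  have fnL: "fn n \<in> L2 M" for n using ap by (simp add: heat_approx_def)
  define yn where "yn n x = min (fn n x) (y x)" for n x
  have [measurable]: "fn n \<in> borel_measurable M" "y \<in> borel_measurable M" for n using fnL y by auto
  have ym: "yn n \<in> borel_measurable M" for n unfolding yn_def by measurable
  have absL: "(\<lambda>x. \<bar>y x\<bar>) \<in> L2 M" by (rule L2_bound[OF y]) auto
  have fn0: "AE x in M. \<forall>n. 0 \<le> fn n x"
    using ap unfolding heat_approx_def by (auto elim!: eventually_mono)
  have dom: "AE x in M. \<bar>yn n x\<bar> \<le> \<bar>y x\<bar>" for n
    using fn0
  proof eventually_elim
    case (elim x)
    then have "0 \<le> fn n x" by blast
    then show ?case by (simp add: yn_def min_def abs_if)
  qed
  have lim: "AE x in M. (\<lambda>n. yn n x) \<longlonglongrightarrow> y x"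
  proof -
    have "AE x in M. (\<lambda>n. fn n x) \<longlonglongrightarrow> f x" using ap by (simp add: heat_approx_def)
    with le show ?thesis
    proof eventually_elim
      case (elim x)
      have "(\<lambda>n. min (fn n x) (y x)) \<longlonglongrightarrow> min (f x) (y x)" by (intro tendsto_intros elim)
      then show ?case using elim by (simp add: yn_def min_absorb2)
    qed
  qed
  note dc = L2_dominated_convergence[OF absL ym _ dom lim, simplified]
  have ynL: "yn n \<in> L2 M" for n using dc(2) by simp
  show ?thesis
  proof (rule L2_limit_le[where u = "\<lambda>n. P t (yn n)"])
    show "P t (yn n) \<in> L2 M" for n using t ynL by simp
    show "P t y \<in> L2 M" using t y by simp
    show "(\<lambda>n. L2.nrm M (P t (yn n) - P t y)) \<longlonglongrightarrow> 0"
      by (rule Lim_null_comparison[OF always_eventually dc(3)])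
        (use L2.contraction_nrm_diff[OF contraction_P[OF t] ynL y] t ynL y in auto)
    show "AE x in M. P t (yn n) x \<le> heat_nonneg D t f x" for n
    proof -
      have "AE x in M. P t (yn n) x \<le> P t (fn n) x" by (rule P_mono[OF t ynL fnL]) (simp add: yn_def)
      with heat_approx_upper[OF t ap, of n] show ?thesis by eventually_elim simp
    qed
  qed (rule um)
qed

lemma heat_nonneg_L2:
  assumes t: "t \<ge> 0" and f: "f \<in> L2 M" and nn: "\<And>x. 0 \<le> f x"
  shows "AE x in M. heat_nonneg D t f x = P t f x"
proof -
  have fi: "integrable M f" by (rule L2_integrable[OF f])
  obtain fn where ap: "heat_approx t f fn (heat_nonneg D t f)"
    by (rule heat_nonneg_approx[OF t fi nn])
  have fnL: "fn n \<in> L2 M" for n using ap by (simp add: heat_approx_def)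
  have fnf: "AE x in M. fn n x \<le> f x" for n
  proof -
    have "AE x in M. \<forall>n. fn n x \<le> fn (Suc n) x" "AE x in M. (\<lambda>n. fn n x) \<longlonglongrightarrow> f x"
      using ap unfolding heat_approx_def by (auto elim!: eventually_mono)
    then show ?thesis
    proof eventually_elim
      case (elim x)
      have "incseq (\<lambda>n. fn n x)" using elim by (auto intro: incseq_SucI)
      then show ?case using incseq_le elim(2) by blast
    qed
  qed
  have "AE x in M. \<forall>n. P t (fn n) x \<le> P t f x"
    unfolding AE_all_countable using P_mono[OF t fnL f fnf] by blast
  moreover have "AE x in M. \<forall>n. heat_L2 D t (fn n) x = P t (fn n) x"
    unfolding AE_all_countable using heat_L2_AE(2)[OF t fnL] by blast
  moreover have "AE x in M. (\<lambda>n. heat_L2 D t (fn n) x) \<longlonglongrightarrow> heat_nonneg D t f x" using ap by (simp add: heat_approx_def)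
  ultimately have "AE x in M. heat_nonneg D t f x \<le> P t f x"
  proof eventually_elim
    case (elim x)
    then show ?case by (intro LIMSEQ_le_const2[OF elim(3)]) auto
  qed
  moreover have "AE x in M. P t f x \<le> heat_nonneg D t f x"
    by (rule heat_nonneg_ge[OF t fi nn f]) simp
  ultimately show ?thesis by eventually_elim simp
qed

end

section \<open>Excessive functions\<close>

lemma l2_ip_nonneg: "AE x in M. 0 \<le> f x * g x \<Longrightarrow> 0 \<le> l2_ip M f g"
  unfolding l2_ip_def by (rule integral_nonneg_AE)

lemma l2_ip_mono:
  "f \<in> L2 M \<Longrightarrow> g \<in> L2 M \<Longrightarrow> f' \<in> L2 M \<Longrightarrow> g' \<in> L2 M \<Longrightarrow> AE x in M. f x * g x \<le> f' x * g' x \<Longrightarrow>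
    l2_ip M f g \<le> l2_ip M f' g'"
  unfolding l2_ip_def by (rule integral_mono_AE) (auto intro: L2_integrable_mult)

context finite_markov_form
begin

lemma dom_L2: "u \<in> dom D \<Longrightarrow> u \<in> L2 M"
  by (rule W_V)

lemma dom_measurable: "u \<in> dom D \<Longrightarrow> u \<in> borel_measurable M"
  by (intro L2_measurable dom_L2)

text \<open>The square of \<open>nrm (T p - p)\<close> expands to
  \<open>|T p|^2 - 2 ip (T p) p + |p|^2\<close>, which is at most 0 here.\<close>

lemma contraction_fixed_point:
  assumes T: "contraction T" and p: "p \<in> L2 M" and le: "l2_ip M p p \<le> l2_ip M (T p) p"
  shows "T p \<doteq> p"
proof -
  have Tp: "T p \<in> L2 M" by (rule L2.contractionD(1)[OF T p])
  have "(nrm (T p))\<^sup>2 \<le> (nrm p)\<^sup>2"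
    using L2.contractionD(2)[OF T p] Tp by (intro power_mono) auto
  then have "l2_ip M (T p) (T p) \<le> l2_ip M p p" by (simp add: L2.nrm_square p Tp)
  then have "l2_ip M (T p - p) (T p - p) \<le> 0"
    using le p Tp L2.ip_commute[OF p Tp] by (simp add: L2.ip_lin)
  then have "nrm (T p - p) = 0" using L2.ip_nonneg[of "T p - p" M] p Tp by (simp add: L2.nrm_def)
  then show ?thesis using p Tp by (simp add: L2.eqv_def)
qed

text \<open>\<open>k\<close> is merely integrable, so its excessiveness is expressed by testing all
  square integrable \<open>y\<close> below it. \<open>p\<close> is bounded, hence square integrable,
  and turns out to be a fixed point of the semigroup.\<close>

lemma shift_defective_parts:
  assumes h: "integrable M h" and lam: "lam \<ge> 0" and ultra: "heat D 1 h \<in> Linf M"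
    and defect: "\<And>t. t > 0 \<Longrightarrow> AE x in M. h x \<le> exp (- t * lam) * heat D t h x"
  defines "p \<equiv> \<lambda>x. max (h x) 0" and "k \<equiv> \<lambda>x. max (- h x) 0"
  shows "\<exists>C. AE x in M. p x \<le> C" "p \<in> dom D" "\<And>v. v \<in> dom D \<Longrightarrow> form D p v = 0"
    "lam > 0 \<Longrightarrow> AE x in M. p x = 0"
    "\<And>t y. t > 0 \<Longrightarrow> y \<in> L2 M \<Longrightarrow> AE x in M. y x \<le> k x \<Longrightarrow> AE x in M. exp (- t * lam) * P t y x \<le> k x"
proof -
  have hm: "h \<in> borel_measurable M" using h by auto
  have pk: "p \<in> borel_measurable M" "k \<in> borel_measurable M"
    using hm unfolding p_def k_def by measurable
  have pi: "integrable M p" "integrable M k" unfolding p_def k_def using h by auto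
  have nn: "0 \<le> p x" "0 \<le> k x" for x by (auto simp: p_def k_def)
  have heat: "heat D t h x = heat_nonneg D t p x - heat_nonneg D t k x" for t x
    by (simp add: heat_def p_def k_def)
  have k_nonneg: "AE x in M. 0 \<le> heat_nonneg D t k x" if "t > 0" for t
  proof -
    have "AE x in M. P t 0 x \<le> heat_nonneg D t k x"
      by (rule heat_nonneg_ge) (use that pi nn in auto)
    moreover have "AE x in M. 0 \<le> P t 0 x" by (rule P_nonneg) (use that in auto)
    ultimately show ?thesis by eventually_elim simp
  qed
  obtain C where C: "AE x in M. \<bar>heat D 1 h x\<bar> \<le> C" using ultra by (auto simp: Linf_def)
  have pC: "AE x in M. p x \<le> max C 0"
    using C defect[of 1, simplified]
  proof eventually_elim
    case (elim x)
    have "exp (- lam) * heat D 1 h x \<le> exp (- lam) * max C 0"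
      using elim(1) by (intro mult_left_mono) auto
    also have "\<dots> \<le> 1 * max C 0" using lam by (intro mult_right_mono) auto
    finally show ?case using elim(2) by (simp add: p_def)
  qed
  then show "\<exists>C. AE x in M. p x \<le> C" by blast
  have pL: "p \<in> L2 M" by (rule bounded_L2[OF pk(1)]) (use pC nn in auto)
  have hp: "AE x in M. heat_nonneg D t p x = P t p x" if "t > 0" for t
    by (rule heat_nonneg_L2) (use that pL nn in auto)
  \<comment> \<open>As \<open>heat_nonneg D t k\<close> is nonnegative, dropping it enlarges the
    right-hand side of \<open>defect\<close>; this side is then nonnegative, so it dominates the
    positive part as well.\<close>
  have below: "AE x in M. p x \<le> exp (- t * lam) * P t p x" if t: "t > 0" for t
  proof -
    have "AE x in M. 0 \<le> P t p x" by (rule P_nonneg) (use t pL nn in auto)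
    with hp[OF t] defect[OF t] k_nonneg[OF t] show ?thesis
    proof eventually_elim
      case (elim x)
      have "exp (- t * lam) * heat D t h x \<le> exp (- t * lam) * P t p x"
        using elim by (intro mult_left_mono) (auto simp: heat)
      moreover have "0 \<le> exp (- t * lam) * P t p x" using elim by simp
      moreover have "p x = max (h x) 0" by (simp add: p_def)
      ultimately show ?case using elim(2) by linarith
    qed
  qed
  have invariant: "P t p \<doteq> p" if t: "t > 0" for t
  proof (rule contraction_fixed_point[OF contraction_P pL])
    show "l2_ip M p p \<le> l2_ip M (P t p) p"
    proof (rule l2_ip_mono)
      have "AE x in M. 0 \<le> P t p x" by (rule P_nonneg) (use t pL nn in auto)
      with below[OF t] show "AE x in M. p x * p x \<le> P t p x * p x"
      proof eventually_elim
        case (elim x)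
        have "exp (- t * lam) * P t p x \<le> 1 * P t p x"
          using elim t lam by (intro mult_right_mono) auto
        then show ?case using elim nn[of x] by (intro mult_right_mono) auto
      qed
    qed (use t pL in auto)
  qed (use t in simp)
  have AEinv: "AE x in M. P t p x = p x" if "t > 0" for t
    using invariant[OF that] by (simp add: eqv_AE)
  \<comment> \<open>A fixed point has vanishing difference quotients, so it lies in the domain of
    \<open>H\<close> with \<open>H p = 0\<close>.\<close>
  have "diff_quotient_limit P p 0"
    unfolding diff_quotient_limit_def
  proof (rule Lim_transform_eventually[OF tendsto_const])
    show "\<forall>\<^sub>F t in at_right 0. 0 = nrm ((1 / t) *\<^sub>R (P t p - p) + 0)"
    proof (rule eventually_mono[OF eventually_at_right_less])
      fix t :: real assume t: "t > 0"
      then show "0 = nrm ((1 / t) *\<^sub>R (P t p - p) + 0)"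
        using L2.eqvD[OF invariant[OF t]] by (simp add: L2.nrm_scale)
    qed
  qed
  then have gen0: "gen p 0" using P_generator_iff[OF pL, of 0] by simp
  show pW: "p \<in> dom D" using genD(1)[OF gen0] .
  show "form D p v = 0" if "v \<in> dom D" for v using genD(4)[OF gen0 that] that dom_L2 by simp
  show p0: "AE x in M. p x = 0" if "lam > 0"
    using below[of 1, simplified] AEinv[of 1, simplified]
  proof eventually_elim
    case (elim x)
    then have "p x * (1 - exp (- lam)) \<le> 0" by (simp add: algebra_simps)
    moreover have "1 - exp (- lam) > 0" using that by simp
    ultimately have "p x \<le> 0" by (simp add: mult_le_0_iff)
    then show ?case using nn[of x] by simp
  qed
  show "AE x in M. exp (- t * lam) * P t y x \<le> k x"
    if t: "t > 0" and y: "y \<in> L2 M" and le: "AE x in M. y x \<le> k x" for t y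
  proof -
    have 1: "AE x in M. P t y x \<le> heat_nonneg D t k x"
      by (rule heat_nonneg_ge) (use t pi nn y le in auto)
    \<comment> \<open>For \<open>lam > 0\<close> both sides vanish; for \<open>lam = 0\<close> this
      is invariance. Subtracting it from \<open>defect\<close> leaves an inequality for
      \<open>k\<close> alone.\<close>
    have 2: "AE x in M. exp (- t * lam) * P t p x = p x"
    proof (cases "lam > 0")
      case True
      from AEinv[OF t] p0[OF True] show ?thesis by eventually_elim simp
    next
      case False
      then show ?thesis using AEinv[OF t] lam by simp
    qed
    from 1 2 hp[OF t] defect[OF t] show ?thesis
    proof eventually_elim
      case (elim x)
      have "h x = p x - k x" by (simp add: p_def k_def)
      moreover have "exp (- t * lam) * heat D t h x = p x - exp (- t * lam) * heat_nonneg D t k x"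
        using elim by (simp add: heat algebra_simps)
      ultimately have "exp (- t * lam) * heat_nonneg D t k x \<le> k x" using elim by simp
      moreover have "exp (- t * lam) * P t y x \<le> exp (- t * lam) * heat_nonneg D t k x"
        using elim by simp
      ultimately show ?case by linarith
    qed
  qed
qed

definition excessive :: "real \<Rightarrow> ('a \<Rightarrow> real) \<Rightarrow> bool" where
  "excessive lam s \<longleftrightarrow> s \<in> L2 M \<and> (\<forall>t>0. AE x in M. exp (- t * lam) * P t s x \<le> s x)"

text \<open>If the negative part \<open>z\<close> of the difference were nonzero, pairing with it would contradict
  the positivity of the semigroup in the limit \<open>t \<rightarrow> 0\<close>.\<close>

lemma excessive_resolvent:
  assumes ex: "excessive lam s" and lam: "lam \<ge> 0" and a: "a > 0" "a * lam < 1"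
  shows "AE x in M. (1 - a * lam) * J a s x \<le> s x"
proof -
  have s: "s \<in> L2 M" using ex by (simp add: excessive_def)
  define c where "c = 1 - a * lam"
  have c: "c > 0" using a by (simp add: c_def)
  define y where "y = c *\<^sub>R J a s"
  define g where "g = c *\<^sub>R ((1 / a) *\<^sub>R (s - J a s))"
  have y: "y \<in> L2 M" using a s by (auto simp: y_def)
  have g: "g \<in> L2 M" using a s by (auto simp: g_def)
  have genJ: "gen (J a s) ((1 / a) *\<^sub>R (s - J a s))" by (rule gen_J[OF a(1) s])
  have gen: "gen y g"
    using gen_comb[OF genJ genJ, of c 0] by (simp add: y_def g_def)
  have gy: "g + lam *\<^sub>R y = (c / a) *\<^sub>R (s - y)"
    using a by (simp add: fun_eq_iff g_def y_def c_def field_simps)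
  define z where "z = s - y"
  have z: "z \<in> L2 M" using s y by (auto simp: z_def)
  define m where "m = (\<lambda>x. max (- z x) 0)"
  define q where "q = (\<lambda>x. max (z x) 0)"
  have mq: "m \<in> L2 M" "q \<in> L2 M"
    unfolding m_def q_def using L2_measurable[OF z] by (auto intro!: L2_bound[OF z])
  have z_split: "z = q - m" by (auto simp: fun_eq_iff q_def m_def)
  have zm: "l2_ip M z m = - l2_ip M m m"
    by (simp add: l2_ip_def z_split flip: Bochner_Integration.integral_minus)
      (rule Bochner_Integration.integral_cong, auto simp: q_def m_def max_def)
  define e where "e t = exp (- t * lam)" for t
  have lower: "l2_ip M (s - e t *\<^sub>R P t s) m \<ge> 0" if t: "t > 0" for t
  proof (rule l2_ip_nonneg)
    have "AE x in M. e t * P t s x \<le> s x" using ex t by (simp add: excessive_def e_def)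
    then show "AE x in M. 0 \<le> (s - e t *\<^sub>R P t s) x * m x" by eventually_elim (simp add: m_def)
  qed
  \<comment> \<open>Since \<open>z = q - m\<close>, the part coming from \<open>q\<close> has a good
    sign by positivity, and the part coming from \<open>m\<close> is controlled by contractivity and
    \<open>e t \<le> 1\<close>.\<close>
  have upper: "l2_ip M (z - e t *\<^sub>R P t z) m \<le> 0" if t: "t > 0" for t
  proof -
    have e1: "0 < e t" "e t \<le> 1" using t lam by (auto simp: e_def)
    have Pm: "P t m \<in> L2 M" "P t q \<in> L2 M" "P t z \<in> L2 M" using t mq z by auto
    have "l2_ip M (P t z) m = l2_ip M (P t q - P t m) m"
      using L2.eqv_ip[OF L2.contraction_sub[OF contraction_P mq(2,1)] L2.eqv_refl[OF mq(1)], of t] t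
      by (simp add: z_split)
    moreover have "l2_ip M (P t q) m \<ge> 0"
    proof -
      have "AE x in M. 0 \<le> P t q x" by (rule P_nonneg) (use t mq in \<open>auto simp: q_def\<close>)
      then show ?thesis
        by (intro l2_ip_nonneg) (auto elim!: eventually_mono simp: m_def)
    qed
    moreover have "l2_ip M (P t m) m \<le> l2_ip M m m"
    proof -
      have "l2_ip M (P t m) m \<le> nrm (P t m) * nrm m" using L2.cauchy_schwarz[OF Pm(1) mq(1)] by simp
      also have "\<dots> \<le> nrm m * nrm m"
        using L2.contractionD(2)[OF contraction_P mq(1), of t] t mq by (intro mult_right_mono) auto
      finally show ?thesis using L2.nrm_square[OF mq(1)] by (simp add: power2_eq_square)
    qed
    ultimately have "l2_ip M (P t z) m \<ge> - l2_ip M m m" using Pm mq by (simp add: L2.ip_lin)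
    then have "e t * l2_ip M (P t z) m \<ge> e t * (- l2_ip M m m)" using e1 by (intro mult_left_mono) auto
    moreover have "e t * l2_ip M m m \<le> 1 * l2_ip M m m"
      using e1 mq by (intro mult_right_mono) (auto simp: L2.ip_nonneg)
    ultimately show ?thesis using zm z Pm mq by (simp add: L2.ip_lin)
  qed
  have le0: "(1 / t) * l2_ip M (y - e t *\<^sub>R P t y) m \<ge> 0" if t: "t > 0" for t
  proof -
    have "P t z \<doteq> P t s - P t y" unfolding z_def by (rule L2.contraction_sub[OF contraction_P s y]) (use t in simp)
    then have 1: "l2_ip M (z - e t *\<^sub>R P t z) m = l2_ip M (z - e t *\<^sub>R (P t s - P t y)) m"
      by (intro L2.eqv_ip L2.eqv_diff L2.eqv_scale L2.eqv_refl z mq)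
    have 2: "z - e t *\<^sub>R (P t s - P t y) = (s - e t *\<^sub>R P t s) - (y - e t *\<^sub>R P t y)"
      by (simp add: z_def algebra_simps)
    have "l2_ip M ((s - e t *\<^sub>R P t s) - (y - e t *\<^sub>R P t y)) m = l2_ip M (s - e t *\<^sub>R P t s) m - l2_ip M (y - e t *\<^sub>R P t y) m"
      by (rule L2.ip_diff) (use s y mq t in auto)
    then have "l2_ip M (y - e t *\<^sub>R P t y) m \<ge> 0"
      using upper[OF t] lower[OF t] unfolding 1 2 by linarith
    then show ?thesis using t by simp
  qed
  have "((\<lambda>t. (1 / t) * l2_ip M (y - e t *\<^sub>R P t y) m) \<longlongrightarrow> l2_ip M (g + lam *\<^sub>R y) m) (at_right 0)"
  proof (rule Lim_transform_eventually)
    have "((\<lambda>t. nrm ((1 / t) *\<^sub>R (P t y - y) - (- g))) \<longlongrightarrow> 0) (at_right 0)"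
      using P_generator_imp[OF gen] by (simp add: diff_quotient_limit_def)
    then have 1: "((\<lambda>t. l2_ip M ((1 / t) *\<^sub>R (P t y - y)) m) \<longlongrightarrow> l2_ip M (- g) m) (at_right 0)"
      by (intro tendsto_ip_at_right) (use y g mq in auto)
    have 2: "((\<lambda>t. l2_ip M (P t y) m) \<longlongrightarrow> l2_ip M y m) (at_right 0)"
      by (intro tendsto_ip_at_right P_at_right) (use y mq in auto)
    have "((\<lambda>t. exp (- t * lam)) has_real_derivative - lam) (at 0)"
      by (auto intro!: derivative_eq_intros)
    then have "((\<lambda>t. (exp (- t * lam) - 1) / t) \<longlongrightarrow> - lam) (at 0)"
      by (simp add: has_field_derivative_iff)
    then have 3: "((\<lambda>t. (e t - 1) / t) \<longlongrightarrow> - lam) (at_right 0)"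
      unfolding e_def by (rule tendsto_mono[rotated]) (simp add: at_le)
    have "((\<lambda>t. - l2_ip M ((1 / t) *\<^sub>R (P t y - y)) m - (e t - 1) / t * l2_ip M (P t y) m) \<longlongrightarrow> - l2_ip M (- g) m - (- lam) * l2_ip M y m) (at_right 0)"
      by (intro tendsto_intros 1 2 3)
    then show "((\<lambda>t. - l2_ip M ((1 / t) *\<^sub>R (P t y - y)) m - (e t - 1) / t * l2_ip M (P t y) m) \<longlongrightarrow> l2_ip M (g + lam *\<^sub>R y) m) (at_right 0)"
      using g y mq by (simp add: L2.ip_lin)
    show "\<forall>\<^sub>F t in at_right 0. - l2_ip M ((1 / t) *\<^sub>R (P t y - y)) m - (e t - 1) / t * l2_ip M (P t y) m
        = (1 / t) * l2_ip M (y - e t *\<^sub>R P t y) m"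
    proof (rule eventually_mono[OF eventually_at_right_less])
      fix t :: real assume t: "t > 0"
      have "P t y \<in> L2 M" using t y by simp
      then show "- l2_ip M ((1 / t) *\<^sub>R (P t y - y)) m - (e t - 1) / t * l2_ip M (P t y) m
          = (1 / t) * l2_ip M (y - e t *\<^sub>R P t y) m"
        using t y mq by (simp add: L2.ip_lin field_simps)
    qed
  qed
  \<comment> \<open>The limit is the pairing of \<open>(H + lam) y\<close> with \<open>m\<close>,
    which \<open>gy\<close> and \<open>zm\<close> turn into a negative multiple of
    \<open>l2_ip M m m\<close>.\<close>
  then have "0 \<le> l2_ip M (g + lam *\<^sub>R y) m"
    by (rule tendsto_lowerbound)
      (auto intro!: eventually_mono[OF eventually_at_right_less] simp: le0 simp del: times_divide_eq_left)
  also have "g + lam *\<^sub>R y = (c / a) *\<^sub>R z" by (simp add: gy z_def)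
  also have "l2_ip M \<dots> m = - (c / a) * l2_ip M m m" using z mq zm by (simp add: L2.ip_lin)
  finally have neg: "0 \<le> - (c / a) * l2_ip M m m" .
  have "c / a > 0" using c a by simp
  then have "l2_ip M m m \<le> 0"
    using neg by (metis linorder_not_less mult_minus_left mult_pos_pos neg_0_le_iff_le)
  then have "nrm m = 0" using L2.ip_nonneg[OF mq(1)] by (simp add: L2.nrm_def)
  then have "AE x in M. m x = 0" using L2_nrm_zero_iff[OF mq(1)] by simp
  then show ?thesis
    by eventually_elim (auto simp: m_def z_def y_def c_def max_def split: if_splits)
qed

text \<open>Where \<open>u\<close> differs from \<open>v\<close> it equals \<open>s\<close>, and
  there \<open>u - S a u \<ge> 0\<close> by excessiveness, while \<open>v - u \<ge> 0\<close>
  everywhere. So the approximating forms at \<open>u\<close> are bounded by those at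
  \<open>v\<close>, and \<open>u\<close> has finite energy. A test function living where
  \<open>s \<le> v\<close> only sees \<open>u = s\<close>, which gives the sign in the second
  claim.\<close>

lemma excessive_min:
  assumes ex: "excessive lam s" and lam: "lam \<ge> 0" and v: "v \<in> dom D"
  defines "u \<equiv> \<lambda>x. min (s x) (v x)"
  shows "u \<in> dom D"
    "\<And>\<phi>. \<phi> \<in> dom D \<Longrightarrow> AE x in M. 0 \<le> \<phi> x \<Longrightarrow> AE x in M. \<phi> x \<noteq> 0 \<longrightarrow> s x \<le> v x \<Longrightarrow>
      0 \<le> form D u \<phi> + lam * l2_ip M u \<phi>"
proof -
  have s: "s \<in> L2 M" using ex by (simp add: excessive_def)
  have vL: "v \<in> L2 M" by (rule dom_L2[OF v])
  have uL: "u \<in> L2 M"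
  proof (rule L2_bound)
    show "(\<lambda>x. \<bar>s x\<bar>) + (\<lambda>x. \<bar>v x\<bar>) \<in> L2 M"
      by (intro L2_add L2_bound[OF s] L2_bound[OF vL]) (use s vL in auto)
    show "u \<in> borel_measurable M" unfolding u_def using L2_measurable[OF s] L2_measurable[OF vL] by measurable
    show "AE x in M. \<bar>u x\<bar> \<le> \<bar>((\<lambda>x. \<bar>s x\<bar>) + (\<lambda>x. \<bar>v x\<bar>)) x\<bar>" by (auto simp: u_def)
  qed
  have us: "AE x in M. u x \<le> s x" by (simp add: u_def)
  \<comment> \<open>Guarantees \<open>a * lam < 1\<close> for \<open>0 < a < \<delta>\<close>, also
    when \<open>lam = 0\<close>.\<close>
  define \<delta> where "\<delta> = 1 / (lam + 1)"
  have \<delta>: "\<delta> > 0" using lam by (simp add: \<delta>_def)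
  have small: "a * lam < 1" if "0 < a" "a < \<delta>" for a
  proof -
    have "a * (lam + 1) < 1" using that lam by (simp add: \<delta>_def field_simps)
    then show ?thesis using that by (simp add: algebra_simps)
  qed
  define S where "S a w = (1 - a * lam) *\<^sub>R J a w" for a w
  have SV: "S a w \<in> L2 M" if "a > 0" "w \<in> L2 M" for a w using that by (auto simp: S_def)
  have Sus: "AE x in M. S a u x \<le> s x" if a: "0 < a" "a < \<delta>" for a
  proof -
    have "AE x in M. J a u x \<le> J a s x" by (rule J_mono[OF a(1) uL s us])
    with excessive_resolvent[OF ex lam a(1) small[OF a]] show ?thesis
    proof eventually_elim
      case (elim x)
      have "(1 - a * lam) * J a u x \<le> (1 - a * lam) * J a s x"
        using elim small[OF a] by (intro mult_left_mono) auto
      then show ?case using elim by (simp add: S_def)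
    qed
  qed
  \<comment> \<open>An approximating form of \<open>form D + lam * l2_ip M\<close>, as
    \<open>q_eq\<close> shows.\<close>
  define q where "q a w w' = (1 / a) * l2_ip M (w - S a w) w'" for a w w'
  have q_eq: "q a w w' = (1 / a) * l2_ip M (w - J a w) w' + lam * l2_ip M (J a w) w'"
    if "a > 0" "w \<in> L2 M" "w' \<in> L2 M" for a w w'
    using that by (simp add: q_def S_def L2.ip_lin field_simps)
  have q_lin: "q a (w + w1) w' = q a w w' + q a w1 w'" "q a w' (w + w1) = q a w' w + q a w' w1" "q a w w1 = q a w1 w"
    if a: "a > 0" and m: "w \<in> L2 M" "w1 \<in> L2 M" "w' \<in> L2 M" for a w w1 w'
  proof -
    have sym: "q a x y = q a y x" if "x \<in> L2 M" "y \<in> L2 M" for x y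
      using J_symmetric[OF a that] that a L2.ip_commute[of x M y] L2.ip_commute[of "J a y" M x]
      by (simp add: q_def S_def L2.ip_lin)
    then show "q a w w1 = q a w1 w" using m by simp
    show add: "q a w' (w + w1) = q a w' w + q a w' w1"
      using m a SV[OF a m(3)] by (simp add: q_def L2.ip_lin algebra_simps add_divide_distrib)
    show "q a (w + w1) w' = q a w w' + q a w1 w'"
      using add sym m by (metis L2.V_closed(2))
  qed
  have q_nonneg: "q a w w \<ge> 0" if a: "0 < a" "a < \<delta>" and w: "w \<in> L2 M" for a w
  proof -
    have "l2_ip M (J a w) w \<le> nrm (J a w) * nrm w" using L2.cauchy_schwarz[of "J a w" M w] a w by simp
    also have "\<dots> \<le> nrm w * nrm w"
      using L2.contractionD(2)[OF contraction_J w] a w by (intro mult_right_mono) auto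
    finally have "l2_ip M (J a w) w \<le> l2_ip M w w" using L2.nrm_square[OF w] by (simp add: power2_eq_square)
    then have "(1 - a * lam) * l2_ip M (J a w) w \<le> (1 - a * lam) * l2_ip M w w"
      using small[OF a] by (intro mult_left_mono) auto
    also have "\<dots> \<le> 1 * l2_ip M w w" using a lam w by (intro mult_right_mono) (auto simp: L2.ip_nonneg)
    finally show ?thesis using a w by (simp add: q_def S_def L2.ip_lin)
  qed
  have J_ip: "l2_ip M (J a w) w \<ge> 0" if a: "a > 0" and w: "w \<in> L2 M" for a w
  proof -
    note Jw = J_props(1)[OF a w]
    have "0 \<le> a * form D (J a w) (J a w)" using a E.ip_nonneg[OF Jw] by simp
    then show ?thesis
      using J_props(2)[OF a w Jw] L2.ip_nonneg[OF dom_L2[OF Jw]] L2.ip_commute[OF w dom_L2[OF Jw]] by linarith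
  qed
  have cross: "q a u (v - u) \<ge> 0" if a: "0 < a" "a < \<delta>" for a
  proof -
    have "l2_ip M (u - S a u) (v - u) \<ge> 0"
    proof (rule l2_ip_nonneg)
      show "AE x in M. 0 \<le> (u - S a u) x * (v - u) x"
        using Sus[OF a] by eventually_elim (auto simp: u_def min_def)
    qed
    then show ?thesis using a by (simp add: q_def)
  qed
  have uW: "u \<in> dom D"
  proof (rule mem_domain_of_bounded_energy[OF uL \<delta>])
    fix a :: real assume a: "0 < a" "a < \<delta>"
    have vu: "v - u \<in> L2 M" using vL uL by auto
    define d where "d = v - u"
    have d: "d \<in> L2 M" "u + d = v" using vu by (auto simp: d_def)
    have "q a v v = q a u v + q a d v"
      using q_lin(1)[OF a(1) uL d(1) vL] by (simp only: d(2))
    moreover have "q a u v = q a u u + q a u d" "q a d v = q a d u + q a d d"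
      using q_lin(2)[OF a(1) uL d(1) uL] q_lin(2)[OF a(1) uL d(1) d(1)] by (simp_all only: d(2))
    moreover have "q a d u = q a u d" by (rule q_lin(3)[OF a(1) d(1) uL uL])
    ultimately have "q a v v = q a u u + 2 * q a u (v - u) + q a (v - u) (v - u)"
      unfolding d_def by linarith
    then have "q a u u \<le> q a v v" using cross[OF a] q_nonneg[OF a vu] by linarith
    moreover have "q a v v \<le> form D v v + lam * l2_ip M v v"
    proof -
      have Jv: "J a v \<in> dom D" by (rule J_props(1)[OF a(1) vL])
      have "(1 / a) * l2_ip M (v - J a v) v = form D (J a v) v" by (rule E_J[OF a(1) vL v, symmetric])
      moreover have "2 * form D (J a v) v \<le> form D (J a v) (J a v) + form D v v"
        using E.ip_nonneg[of "J a v - v"] Jv v E.ip_commute[of v "J a v"] by (simp add: E.ip_lin)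
      moreover have "l2_ip M (J a v) v \<le> l2_ip M v v"
      proof -
        have "l2_ip M (J a v) v \<le> nrm (J a v) * nrm v" using L2.cauchy_schwarz[of "J a v" M v] a vL by simp
        also have "\<dots> \<le> nrm v * nrm v"
          using L2.contractionD(2)[OF contraction_J vL] a vL by (intro mult_right_mono) auto
        finally show ?thesis using L2.nrm_square[OF vL] by (simp add: power2_eq_square)
      qed
      ultimately show ?thesis
        using J_energy(1)[OF a(1) v] q_eq[OF a(1) vL vL] mult_left_mono[OF _ lam] by smt
    qed
    moreover have "q a u u \<ge> (1 / a) * l2_ip M (u - J a u) u"
      using q_eq[OF a(1) uL uL] J_ip[OF a(1) uL] lam by simp
    ultimately show "(1 / a) * l2_ip M (u - J a u) u \<le> form D v v + lam * l2_ip M v v" by linarith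
  qed
  then show "u \<in> dom D" .
  show "0 \<le> form D u \<phi> + lam * l2_ip M u \<phi>"
    if \<phi>: "\<phi> \<in> dom D" "AE x in M. 0 \<le> \<phi> x" "AE x in M. \<phi> x \<noteq> 0 \<longrightarrow> s x \<le> v x" for \<phi>
  proof (rule tendsto_lowerbound)
    have \<phi>L: "\<phi> \<in> L2 M" by (rule dom_L2[OF \<phi>(1)])
    have "((\<lambda>a. l2_ip M (J a u) \<phi>) \<longlongrightarrow> l2_ip M u \<phi>) (at_right 0)"
      by (intro tendsto_ip_at_right J_at_right) (use uL \<phi>L in auto)
    then show "((\<lambda>a. form D (J a u) \<phi> + lam * l2_ip M (J a u) \<phi>) \<longlongrightarrow> form D u \<phi> + lam * l2_ip M u \<phi>) (at_right 0)"
      by (intro tendsto_intros E_J_tendsto uW \<phi>)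
    have "0 \<le> form D (J a u) \<phi> + lam * l2_ip M (J a u) \<phi>" if a: "0 < a" "a < \<delta>" for a
    proof -
      have "l2_ip M (u - S a u) \<phi> \<ge> 0"
      proof (rule l2_ip_nonneg)
        show "AE x in M. 0 \<le> (u - S a u) x * \<phi> x"
          using Sus[OF a] \<phi>(2,3) by eventually_elim (auto simp: u_def min_def)
      qed
      then have "q a u \<phi> \<ge> 0" using a by (simp add: q_def)
      then show ?thesis using q_eq[OF a(1) uL \<phi>L] E_J[OF a(1) uL \<phi>(1)] by simp
    qed
    then show "\<forall>\<^sub>F a in at_right 0. 0 \<le> form D (J a u) \<phi> + lam * l2_ip M (J a u) \<phi>"
      using \<delta> by (auto simp: eventually_at_right_field)
  qed simp
qed

end

section \<open>Calculus for bounded functions in the domain\<close>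

text \<open>\<open>min u v = (u + v - |u - v|) / 2\<close>; the contraction property bounds the
  energy of the last term, and the parallelogram law does the rest.\<close>

lemma markov_form_min:
  assumes nns: "nonneg_symmetric_form D" and mk: "markov_form D" and u: "u \<in> dom D" and v: "v \<in> dom D"
  shows "(\<lambda>x. min (u x) (v x)) \<in> dom D"
    "form D (\<lambda>x. min (u x) (v x)) (\<lambda>x. min (u x) (v x)) \<le> 2 * form D u u + 2 * form D v v"
proof -
  interpret E: semi_inner "dom D" "form D" by (rule semi_inner_form[OF nns]) (use u in auto)
  define w where "w = (\<lambda>x. \<bar>(u - v) x\<bar>)"
  have uv: "u - v \<in> dom D" "u + v \<in> dom D" using u v by auto
  have w: "w \<in> dom D" "form D w w \<le> form D (u - v) (u - v)"
    unfolding w_def by (rule markov_form_comp[OF mk _ _ uv(1)]; simp)+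
  have eq: "(\<lambda>x. min (u x) (v x)) = (1/2) *\<^sub>R ((u + v) - w)"
    by (auto simp: fun_eq_iff w_def min_def)
  show "(\<lambda>x. min (u x) (v x)) \<in> dom D" unfolding eq using uv w by auto
  have "form D ((u + v) - w) ((u + v) - w) \<le> 2 * form D (u + v) (u + v) + 2 * form D w w"
    by (rule E.ip_diff_self_le) (use uv w in auto)
  moreover have "form D (u + v) (u + v) + form D (u - v) (u - v) = 2 * form D u u + 2 * form D v v"
    using u v E.ip_commute[OF u v] by (simp add: E.ip_lin)
  moreover have "form D ((1/2) *\<^sub>R ((u + v) - w)) ((1/2) *\<^sub>R ((u + v) - w)) = (1/4) * form D ((u + v) - w) ((u + v) - w)"
    using uv w by (simp add: E.ip_scale E.ip_scale_right del: scaleR_right_diff_distrib)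
  moreover have "form D u u \<ge> 0" "form D v v \<ge> 0" using u v by (auto intro: E.ip_nonneg)
  ultimately show "form D (\<lambda>x. min (u x) (v x)) (\<lambda>x. min (u x) (v x)) \<le> 2 * form D u u + 2 * form D v v"
    using w(2) unfolding eq by linarith
qed

context finite_markov_form
begin

text \<open>\<open>T\<close> is Lipschitz only on the range of \<open>u\<close>. Clamping to
  \<open>[-N, N]\<close> and dividing by \<open>L\<close> makes it a contraction on the whole line,
  and after multiplication by \<open>L\<close> the result agrees with \<open>T (u x)\<close>
  a.e.\<close>

lemma dom_comp_lipschitz:
  assumes u: "u \<in> dom D" and N: "AE x in M. \<bar>u x\<bar> \<le> N" "N \<ge> 0" and L: "L > 0"
    and T: "\<And>s t. \<bar>s\<bar> \<le> N \<Longrightarrow> \<bar>t\<bar> \<le> N \<Longrightarrow> \<bar>T s - T t\<bar> \<le> L * \<bar>s - t :: real\<bar>" "T 0 = 0"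
    and Tm: "T \<in> borel_measurable borel"
  shows "(\<lambda>x. T (u x)) \<in> dom D" "form D (\<lambda>x. T (u x)) (\<lambda>x. T (u x)) \<le> L\<^sup>2 * form D u u"
proof -
  define c where "c s = max (- N) (min N s)" for s
  have c: "\<bar>c s\<bar> \<le> N" "\<bar>c s - c t\<bar> \<le> \<bar>s - t\<bar>" "c 0 = 0" for s t
    using N(2) by (auto simp: c_def)
  define S where "S s = T (c s) / L" for s
  have S: "\<bar>S s - S t\<bar> \<le> \<bar>s - t\<bar>" for s t
  proof -
    have "\<bar>T (c s) - T (c t)\<bar> \<le> L * \<bar>c s - c t\<bar>" by (intro T(1) c)
    also have "\<dots> \<le> L * \<bar>s - t\<bar>" using c L by (intro mult_left_mono) auto
    finally show ?thesis using L by (simp add: S_def field_simps flip: diff_divide_distrib)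
  qed
  have S0: "S 0 = 0" by (simp add: S_def c T)
  note Su = markov_comp[of S, OF S S0 u]
  define w where "w = L *\<^sub>R (\<lambda>x. S (u x))"
  have w: "w \<in> dom D" using Su(1) by (auto simp: w_def)
  have eq: "AE x in M. w x = T (u x)"
    using N(1) by eventually_elim (use L in \<open>auto simp: w_def S_def c_def\<close>)
  have meas: "(\<lambda>x. T (u x)) \<in> borel_measurable M"
    using measurable_compose[OF dom_measurable[OF u] Tm] .
  show Tu: "(\<lambda>x. T (u x)) \<in> dom D" by (rule dom_cong[OF w meas eq])
  have "form D (\<lambda>x. T (u x)) (\<lambda>x. T (u x)) = form D w w"
    using form_cong[OF w Tu w eq] form_cong[OF w Tu Tu eq] E.ip_commute[OF w Tu] by simp
  also have "\<dots> = L\<^sup>2 * form D (\<lambda>x. S (u x)) (\<lambda>x. S (u x))"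
    using Su(1) by (simp add: w_def E.ip_scale E.ip_scale_right power2_eq_square)
  also have "\<dots> \<le> L\<^sup>2 * form D u u" using Su(2) by (intro mult_left_mono) auto
  finally show "form D (\<lambda>x. T (u x)) (\<lambda>x. T (u x)) \<le> L\<^sup>2 * form D u u" .
qed

text \<open>Polarisation: squares of bounded elements lie in the domain because squaring is
  Lipschitz on bounded sets.\<close>

lemma dom_mult:
  assumes u: "u \<in> dom D" "AE x in M. \<bar>u x\<bar> \<le> N" and v: "v \<in> dom D" "AE x in M. \<bar>v x\<bar> \<le> N"
  shows "(\<lambda>x. u x * v x) \<in> dom D"
proof -
  define N' where "N' = 2 * max N 1"
  have sq: "(\<lambda>x. (w x)\<^sup>2) \<in> dom D" if w: "w \<in> dom D" "AE x in M. \<bar>w x\<bar> \<le> N'" for w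
  proof (rule dom_comp_lipschitz(1)[OF w, where L = "2 * N'"])
    fix s t assume st: "\<bar>s\<bar> \<le> N'" "\<bar>t\<bar> \<le> N'"
    have "\<bar>s\<^sup>2 - t\<^sup>2\<bar> = \<bar>s + t\<bar> * \<bar>s - t\<bar>"
      by (simp add: power2_eq_square square_diff_square_factored abs_mult)
    also have "\<dots> \<le> 2 * N' * \<bar>s - t\<bar>" using st by (intro mult_right_mono) auto
    finally show "\<bar>s\<^sup>2 - t\<^sup>2\<bar> \<le> 2 * N' * \<bar>s - t\<bar>" .
  qed (auto simp: N'_def)
  have bd: "AE x in M. \<bar>(u + v) x\<bar> \<le> N'" "AE x in M. \<bar>(u - v) x\<bar> \<le> N'"
    using u(2) v(2) by (eventually_elim, simp add: N'_def)+
  have "(\<lambda>x. ((u + v) x)\<^sup>2) \<in> dom D" "(\<lambda>x. ((u - v) x)\<^sup>2) \<in> dom D"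
    by (rule sq[OF E.V_closed(2)[OF u(1) v(1)] bd(1)], rule sq[OF E.V_closed(3)[OF u(1) v(1)] bd(2)])
  then have "(1/4) *\<^sub>R ((\<lambda>x. ((u + v) x)\<^sup>2) - (\<lambda>x. ((u - v) x)\<^sup>2)) \<in> dom D" by (intro E.V_closed)
  moreover have "(1/4) *\<^sub>R ((\<lambda>x. ((u + v) x)\<^sup>2) - (\<lambda>x. ((u - v) x)\<^sup>2)) = (\<lambda>x. u x * v x)"
    by (simp add: fun_eq_iff power2_sum power2_diff)
  ultimately show ?thesis by simp
qed

lemma contraction_sum_AE:
  assumes T: "contraction T" and K: "finite K" and f: "\<And>k. k \<in> K \<Longrightarrow> f k \<in> L2 M"
  shows "(\<lambda>x. \<Sum>k\<in>K. f k x) \<in> L2 M" "AE x in M. T (\<lambda>x. \<Sum>k\<in>K. f k x) x = (\<Sum>k\<in>K. T (f k) x)"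
proof -
  have "(\<lambda>x. \<Sum>k\<in>K. f k x) \<in> L2 M \<and> (AE x in M. T (\<lambda>x. \<Sum>k\<in>K. f k x) x = (\<Sum>k\<in>K. T (f k) x))"
    using K f
  proof (induction K)
    case empty
    have "T (0 - 0) \<doteq> T 0 - T 0" by (rule L2.contraction_sub[OF T]) auto
    then show ?case by (auto simp: eqv_AE zero_fun_def L2_const)
  next
    case (insert k K)
    define g where "g x = (\<Sum>k\<in>K. f k x)" for x
    have g: "g \<in> L2 M" "AE x in M. T g x = (\<Sum>k\<in>K. T (f k) x)"
      using insert by (auto simp: g_def[abs_def])
    have fk: "f k \<in> L2 M" using insert by auto
    have eq: "(\<lambda>x. \<Sum>k\<in>insert k K. f k x) = f k + g" using insert by (simp add: fun_eq_iff g_def)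
    have "T (f k + g) \<doteq> T (f k) + T g" by (rule L2.contraction_add[OF T fk g(1)])
    then have "AE x in M. T (f k + g) x = T (f k) x + T g x" by (simp add: eqv_AE)
    with g(2) have "AE x in M. T (f k + g) x = (\<Sum>k\<in>insert k K. T (f k) x)"
      by eventually_elim (use insert in simp)
    then show ?case unfolding eq using fk g(1) by auto
  qed
  then show "(\<lambda>x. \<Sum>k\<in>K. f k x) \<in> L2 M" "AE x in M. T (\<lambda>x. \<Sum>k\<in>K. f k x) x = (\<Sum>k\<in>K. T (f k) x)" by auto
qed

text \<open>The resolvents behave like integral operators with a symmetric subprobability kernel, but no
  kernel is needed: for fixed \<open>\<eta>\<close> the pointwise inequality in the second variable is integrated,
  and then \<open>\<eta>\<close> is replaced by \<open>\<xi> x\<close>, first along a countable dense set.\<close>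

lemma two_point_resolvent:
  fixes \<xi> :: "'a \<Rightarrow> 'b :: {metric_space, second_countable_topology}" and \<alpha> \<beta> :: "'k \<Rightarrow> 'b \<Rightarrow> real"
  assumes a: "a > 0" and K: "finite K" and S: "closed S" "\<And>x. \<xi> x \<in> S"
    and cont: "\<And>k. k \<in> K \<Longrightarrow> continuous_on S (\<alpha> k)" "\<And>k. k \<in> K \<Longrightarrow> continuous_on S (\<beta> k)"
    and L2: "\<And>k. k \<in> K \<Longrightarrow> (\<lambda>x. \<alpha> k (\<xi> x)) \<in> L2 M" "\<And>k. k \<in> K \<Longrightarrow> (\<lambda>x. \<beta> k (\<xi> x)) \<in> L2 M"
      "\<And>k. k \<in> K \<Longrightarrow> (\<lambda>x. \<alpha> k (\<xi> x) * \<beta> k (\<xi> x)) \<in> L2 M"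
    and two: "\<And>\<eta> \<zeta>. \<eta> \<in> S \<Longrightarrow> \<zeta> \<in> S \<Longrightarrow> 0 \<le> (\<Sum>k\<in>K. (\<alpha> k \<eta> - \<alpha> k \<zeta>) * (\<beta> k \<eta> - \<beta> k \<zeta>))"
    and kill: "\<And>\<eta>. \<eta> \<in> S \<Longrightarrow> 0 \<le> (\<Sum>k\<in>K. \<alpha> k \<eta> * \<beta> k \<eta>)"
  shows "0 \<le> (\<Sum>k\<in>K. l2_ip M ((\<lambda>x. \<alpha> k (\<xi> x)) - J a (\<lambda>x. \<alpha> k (\<xi> x))) (\<lambda>x. \<beta> k (\<xi> x)))"
proof -
  define A where "A k x = \<alpha> k (\<xi> x)" for k x
  define B where "B k x = \<beta> k (\<xi> x)" for k x
  define AB where "AB k x = \<alpha> k (\<xi> x) * \<beta> k (\<xi> x)" for k x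
  define I where "I = (\<lambda>x :: 'a. 1 :: real)"
  have mem: "A k \<in> L2 M" "B k \<in> L2 M" "AB k \<in> L2 M" if "k \<in> K" for k
    using L2[OF that] by (simp_all add: A_def[abs_def] B_def[abs_def] AB_def[abs_def])
  have I: "I \<in> L2 M" unfolding I_def by (rule L2_const)
  note Jc = contraction_J[OF a]
  have Jmem: "J a (A k) \<in> L2 M" "J a (B k) \<in> L2 M" "J a (AB k) \<in> L2 M" "J a I \<in> L2 M" if "k \<in> K" for k
    using a mem[OF that] I by auto
  \<comment> \<open>The resolvent applied to the two-point sum in its second variable, with
    \<open>\<eta>\<close> frozen and expanded by linearity.\<close>
  define F where "F \<eta> x = (\<Sum>k\<in>K. \<alpha> k \<eta> * \<beta> k \<eta> * J a I x - \<alpha> k \<eta> * J a (B k) x - \<beta> k \<eta> * J a (A k) x + J a (AB k) x)" for \<eta> x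
  have F_nonneg: "AE x in M. 0 \<le> F \<eta> x" if \<eta>: "\<eta> \<in> S" for \<eta>
  proof -
    define g where "g k = ((\<alpha> k \<eta> * \<beta> k \<eta>) *\<^sub>R I - \<alpha> k \<eta> *\<^sub>R B k) + (AB k - \<beta> k \<eta> *\<^sub>R A k)" for k
    have g: "g k \<in> L2 M" if "k \<in> K" for k using mem[OF that] I by (auto simp: g_def)
    have g_eq: "(\<Sum>k\<in>K. g k x) = (\<Sum>k\<in>K. (\<alpha> k \<eta> - \<alpha> k (\<xi> x)) * (\<beta> k \<eta> - \<beta> k (\<xi> x)))" for x
      by (rule sum.cong) (auto simp: g_def I_def A_def B_def AB_def algebra_simps)
    have "AE x in M. 0 \<le> J a (\<lambda>x. \<Sum>k\<in>K. g k x) x"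
      by (rule J_nonneg[OF a contraction_sum_AE(1)[OF Jc K g]]) (use two[OF \<eta> S(2)] in \<open>auto simp: g_eq\<close>)
    moreover have "AE x in M. J a (\<lambda>x. \<Sum>k\<in>K. g k x) x = (\<Sum>k\<in>K. J a (g k) x)"
      by (rule contraction_sum_AE(2)[OF Jc K g])
    moreover have "AE x in M. \<forall>k\<in>K. J a (g k) x
        = \<alpha> k \<eta> * \<beta> k \<eta> * J a I x - \<alpha> k \<eta> * J a (B k) x - \<beta> k \<eta> * J a (A k) x + J a (AB k) x"
    proof (rule AE_finite_allI[OF K])
      fix k assume k: "k \<in> K"
      have 1: "J a ((\<alpha> k \<eta> * \<beta> k \<eta>) *\<^sub>R I + (- \<alpha> k \<eta>) *\<^sub>R B k) \<doteq> (\<alpha> k \<eta> * \<beta> k \<eta>) *\<^sub>R J a I + (- \<alpha> k \<eta>) *\<^sub>R J a (B k)"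
        by (rule L2.contractionD(3)[OF Jc I mem(2)[OF k]])
      have 2: "J a (1 *\<^sub>R AB k + (- \<beta> k \<eta>) *\<^sub>R A k) \<doteq> 1 *\<^sub>R J a (AB k) + (- \<beta> k \<eta>) *\<^sub>R J a (A k)"
        by (rule L2.contractionD(3)[OF Jc mem(3,1)[OF k]])
      have 3: "J a (g k) \<doteq> J a ((\<alpha> k \<eta> * \<beta> k \<eta>) *\<^sub>R I - \<alpha> k \<eta> *\<^sub>R B k) + J a (AB k - \<beta> k \<eta> *\<^sub>R A k)"
        unfolding g_def by (rule L2.contraction_add[OF Jc]) (use mem[OF k] I in auto)
      show "AE x in M. J a (g k) x
        = \<alpha> k \<eta> * \<beta> k \<eta> * J a I x - \<alpha> k \<eta> * J a (B k) x - \<beta> k \<eta> * J a (A k) x + J a (AB k) x"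
        using 1[unfolded eqv_AE, THEN conjunct2, THEN conjunct2] 2[unfolded eqv_AE, THEN conjunct2, THEN conjunct2]
          3[unfolded eqv_AE, THEN conjunct2, THEN conjunct2]
        by eventually_elim simp
    qed
    ultimately show ?thesis
      by eventually_elim (simp add: F_def)
  qed
  obtain C where C: "countable C" "C \<subseteq> S" "S \<subseteq> closure C" using separable by blast
  have "AE x in M. \<forall>\<eta>\<in>C. 0 \<le> F \<eta> x"
    using F_nonneg C(2) by (subst AE_ball_countable[OF C(1)]) auto
  then have diag: "AE x in M. 0 \<le> F (\<xi> x) x"
  proof eventually_elim
    case (elim x)
    have "closure C = S" using C S(1) by (simp add: closure_minimal subset_antisym)
    moreover have "continuous_on S (\<lambda>\<eta>. F \<eta> x)"
      unfolding F_def by (intro continuous_intros cont)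
    ultimately show ?case
      using continuous_ge_on_closure[of C "\<lambda>\<eta>. F \<eta> x" "\<xi> x" 0] elim S(2) by auto
  qed
  have int: "integrable M (\<lambda>x. AB k x * J a I x)" "integrable M (\<lambda>x. A k x * J a (B k) x)"
      "integrable M (\<lambda>x. B k x * J a (A k) x)" "integrable M (\<lambda>x. J a (AB k) x)"
      "integrable M (\<lambda>x. A k x * B k x)" if "k \<in> K" for k
    using mem[OF that] Jmem[OF that] by (auto intro: L2_integrable_mult L2_integrable)
  have JI1: "(\<integral>x. J a (AB k) x \<partial>M) = l2_ip M (AB k) (J a I)" if k: "k \<in> K" for k
    using J_symmetric[OF a mem(3)[OF k] I] by (simp add: I_def l2_ip_def[of M "J a (AB k)"])
  have Fx: "F (\<xi> x) x = (\<Sum>k\<in>K. AB k x * J a I x - A k x * J a (B k) x - B k x * J a (A k) x + J a (AB k) x)" for x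
    by (simp add: F_def A_def B_def AB_def)
  have "0 \<le> (\<integral>x. F (\<xi> x) x \<partial>M)" by (rule integral_nonneg_AE[OF diag])
  also have "(\<integral>x. F (\<xi> x) x \<partial>M) = (\<integral>x. (\<Sum>k\<in>K. AB k x * J a I x - A k x * J a (B k) x - B k x * J a (A k) x + J a (AB k) x) \<partial>M)"
    unfolding Fx ..
  also have "(\<integral>x. (\<Sum>k\<in>K. AB k x * J a I x - A k x * J a (B k) x - B k x * J a (A k) x + J a (AB k) x) \<partial>M)
      = (\<Sum>k\<in>K. \<integral>x. (AB k x * J a I x - A k x * J a (B k) x - B k x * J a (A k) x + J a (AB k) x) \<partial>M)"
    by (rule Bochner_Integration.integral_sum) (use int in auto)
  also have "\<dots> = (\<Sum>k\<in>K. l2_ip M (AB k) (J a I) - l2_ip M (A k) (J a (B k)) - l2_ip M (B k) (J a (A k)) + l2_ip M (AB k) (J a I))"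
    using int JI1 by (intro sum.cong) (simp_all add: l2_ip_def[of M "AB _" "J a I"] l2_ip_def[of M "A _" "J a (B _)"] l2_ip_def[of M "B _" "J a (A _)"])
  also have "\<dots> = (\<Sum>k\<in>K. 2 * (l2_ip M (AB k) (J a I) - l2_ip M (J a (A k)) (B k)))"
  proof (rule sum.cong)
    fix k assume k: "k \<in> K"
    show "l2_ip M (AB k) (J a I) - l2_ip M (A k) (J a (B k)) - l2_ip M (B k) (J a (A k)) + l2_ip M (AB k) (J a I)
        = 2 * (l2_ip M (AB k) (J a I) - l2_ip M (J a (A k)) (B k))"
      using J_symmetric[OF a mem(1,2)[OF k]] L2.ip_commute[OF mem(2)[OF k] Jmem(1)[OF k]] by simp
  qed simp
  finally have 1: "0 \<le> (\<Sum>k\<in>K. l2_ip M (AB k) (J a I) - l2_ip M (J a (A k)) (B k))"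
    unfolding sum_distrib_left[symmetric] by simp
  \<comment> \<open>The defect \<open>1 - J a I\<close> is the killing part; it is weighted by the
    sum in \<open>kill\<close>.\<close>
  have J1: "AE x in M. J a I x \<le> 1" by (rule J_le_const[OF a I]) (auto simp: I_def)
  have "0 \<le> (\<integral>x. (\<Sum>k\<in>K. AB k x) * (1 - J a I x) \<partial>M)"
  proof (rule integral_nonneg_AE)
    show "AE x in M. 0 \<le> (\<Sum>k\<in>K. AB k x) * (1 - J a I x)"
      using J1 by eventually_elim (use kill[OF S(2)] in \<open>auto simp: AB_def intro: mult_nonneg_nonneg\<close>)
  qed
  also have "(\<integral>x. (\<Sum>k\<in>K. AB k x) * (1 - J a I x) \<partial>M) = (\<integral>x. (\<Sum>k\<in>K. A k x * B k x - AB k x * J a I x) \<partial>M)"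
    by (intro Bochner_Integration.integral_cong)
      (simp_all add: sum_distrib_right sum_subtractf right_diff_distrib A_def B_def AB_def)
  also have "\<dots> = (\<Sum>k\<in>K. \<integral>x. (A k x * B k x - AB k x * J a I x) \<partial>M)"
    by (rule Bochner_Integration.integral_sum) (use int in auto)
  also have "\<dots> = (\<Sum>k\<in>K. l2_ip M (A k) (B k) - l2_ip M (AB k) (J a I))"
    using int by (intro sum.cong) (simp_all add: l2_ip_def[of M "A _" "B _"] l2_ip_def[of M "AB _" "J a I"])
  finally have 2: "0 \<le> (\<Sum>k\<in>K. l2_ip M (A k) (B k) - l2_ip M (AB k) (J a I))" .
  \<comment> \<open>Beurling-Deny splitting of the approximating form into the killing part and half
    of the double integral over pairs of points.\<close>
  have "(\<Sum>k\<in>K. l2_ip M (A k - J a (A k)) (B k))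
      = (\<Sum>k\<in>K. l2_ip M (A k) (B k) - l2_ip M (AB k) (J a I)) + (\<Sum>k\<in>K. l2_ip M (AB k) (J a I) - l2_ip M (J a (A k)) (B k))"
    unfolding sum.distrib[symmetric] using mem Jmem by (intro sum.cong) (auto simp: L2.ip_diff)
  then show ?thesis using 1 2 unfolding A_def[abs_def] B_def[abs_def] by simp
qed

text \<open>Reduces an inequality between energies of functions of \<open>\<xi>\<close> to one at
  pairs of points and one at single points, the latter for the killing part of the approximating
  forms. Multiplication by \<open>1 / a\<close> and the limit \<open>a \<rightarrow> 0\<close> pass
  from resolvents to the form.\<close>

lemma two_point_energy:
  fixes \<xi> :: "'a \<Rightarrow> 'b :: {metric_space, second_countable_topology}" and \<alpha> \<beta> :: "'k \<Rightarrow> 'b \<Rightarrow> real"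
  assumes K: "finite K" and S: "closed S" "\<And>x. \<xi> x \<in> S"
    and cont: "\<And>k. k \<in> K \<Longrightarrow> continuous_on S (\<alpha> k)" "\<And>k. k \<in> K \<Longrightarrow> continuous_on S (\<beta> k)"
    and dom: "\<And>k. k \<in> K \<Longrightarrow> (\<lambda>x. \<alpha> k (\<xi> x)) \<in> dom D" "\<And>k. k \<in> K \<Longrightarrow> (\<lambda>x. \<beta> k (\<xi> x)) \<in> dom D"
      "\<And>k. k \<in> K \<Longrightarrow> (\<lambda>x. \<alpha> k (\<xi> x) * \<beta> k (\<xi> x)) \<in> L2 M"
    and two: "\<And>\<eta> \<zeta>. \<eta> \<in> S \<Longrightarrow> \<zeta> \<in> S \<Longrightarrow> 0 \<le> (\<Sum>k\<in>K. (\<alpha> k \<eta> - \<alpha> k \<zeta>) * (\<beta> k \<eta> - \<beta> k \<zeta>))"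
    and kill: "\<And>\<eta>. \<eta> \<in> S \<Longrightarrow> 0 \<le> (\<Sum>k\<in>K. \<alpha> k \<eta> * \<beta> k \<eta>)"
  shows "0 \<le> (\<Sum>k\<in>K. form D (\<lambda>x. \<alpha> k (\<xi> x)) (\<lambda>x. \<beta> k (\<xi> x)))"
proof (rule tendsto_lowerbound)
  show "((\<lambda>a. \<Sum>k\<in>K. form D (J a (\<lambda>x. \<alpha> k (\<xi> x))) (\<lambda>x. \<beta> k (\<xi> x))) \<longlongrightarrow>
      (\<Sum>k\<in>K. form D (\<lambda>x. \<alpha> k (\<xi> x)) (\<lambda>x. \<beta> k (\<xi> x)))) (at_right 0)"
    by (intro tendsto_sum E_J_tendsto dom)
  show "\<forall>\<^sub>F a in at_right 0. 0 \<le> (\<Sum>k\<in>K. form D (J a (\<lambda>x. \<alpha> k (\<xi> x))) (\<lambda>x. \<beta> k (\<xi> x)))"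
  proof (rule eventually_mono[OF eventually_at_right_less])
    fix a :: real assume a: "a > 0"
    have "(\<Sum>k\<in>K. form D (J a (\<lambda>x. \<alpha> k (\<xi> x))) (\<lambda>x. \<beta> k (\<xi> x)))
        = (1 / a) * (\<Sum>k\<in>K. l2_ip M ((\<lambda>x. \<alpha> k (\<xi> x)) - J a (\<lambda>x. \<alpha> k (\<xi> x))) (\<lambda>x. \<beta> k (\<xi> x)))"
      unfolding sum_distrib_left by (rule sum.cong[OF refl], rule E_J[OF a]) (use dom dom_L2 in auto)
    also have "\<dots> \<ge> 0"
      by (intro mult_nonneg_nonneg two_point_resolvent[OF a K S cont _ _ dom(3) two kill])
        (use a dom dom_L2 in auto)
    finally show "0 \<le> (\<Sum>k\<in>K. form D (J a (\<lambda>x. \<alpha> k (\<xi> x))) (\<lambda>x. \<beta> k (\<xi> x)))" .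
  qed
qed simp

text \<open>The chain rule for convex \<open>\<Phi>\<close>, as an inequality. For the pairs
  \<open>(u, \<Phi>'(u) \<phi>)\<close> and \<open>(- \<Phi>(u), \<phi>)\<close> the two-point sum
  consists of the tangent inequality at either point, weighted by the value of \<open>\<phi>\<close>
  there. \<open>R\<close> allows \<open>\<Phi>\<close> to be regular on a half line only.\<close>

lemma form_convex_le:
  fixes \<Phi> \<Phi>' :: "real \<Rightarrow> real"
  assumes u: "u \<in> dom D" "AE x in M. \<bar>u x\<bar> \<le> N" and R: "closed R" "0 \<in> R" "\<And>x. u x \<in> R"
    and \<phi>: "\<phi> \<in> dom D" "AE x in M. \<bar>\<phi> x\<bar> \<le> N" "AE x in M. 0 \<le> \<phi> x"
    and cont: "continuous_on R \<Phi>" "continuous_on R \<Phi>'" "\<Phi>' \<in> borel_measurable borel" and \<Phi>0: "\<Phi> 0 = 0"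
    and bnd: "AE x in M. \<bar>\<Phi> (u x)\<bar> \<le> N" "AE x in M. \<bar>\<Phi>' (u x)\<bar> \<le> N"
    and tangent: "\<And>s t. s \<in> R \<Longrightarrow> t \<in> R \<Longrightarrow> \<Phi> s - \<Phi> t \<le> \<Phi>' s * (s - t)"
    and dom: "(\<lambda>x. \<Phi> (u x)) \<in> dom D" "(\<lambda>x. \<Phi>' (u x) * \<phi> x) \<in> dom D"
  shows "form D (\<lambda>x. \<Phi> (u x)) \<phi> \<le> form D u (\<lambda>x. \<Phi>' (u x) * \<phi> x)"
proof -
  \<comment> \<open>\<open>\<phi>\<close> is nonnegative only a.e., but
    \<open>two_point_energy\<close> needs \<open>\<xi> x \<in> S\<close> at every point.\<close>
  define \<psi> where "\<psi> x = max (\<phi> x) 0" for x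
  have \<psi>: "AE x in M. \<phi> x = \<psi> x" using \<phi>(3) by eventually_elim (simp add: \<psi>_def)
  have \<psi>m: "\<psi> \<in> borel_measurable M" using dom_measurable[OF \<phi>(1)] unfolding \<psi>_def by measurable
  have \<psi>d: "\<psi> \<in> dom D" by (rule dom_cong[OF \<phi>(1) \<psi>m \<psi>])
  have um: "u \<in> borel_measurable M" by (rule dom_measurable[OF u(1)])
  have \<Phi>'m: "(\<lambda>x. \<Phi>' (u x) * \<psi> x) \<in> borel_measurable M"
    using measurable_compose[OF um cont(3)] \<psi>m by measurable
  have eq2: "AE x in M. \<Phi>' (u x) * \<phi> x = \<Phi>' (u x) * \<psi> x" using \<psi> by eventually_elim simp
  have d2: "(\<lambda>x. \<Phi>' (u x) * \<psi> x) \<in> dom D" by (rule dom_cong[OF dom(2) \<Phi>'m eq2])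
  define K where "K = {0::nat, 1}"
  define \<alpha> where "\<alpha> k \<eta> = (if k = 0 then fst \<eta> else - \<Phi> (fst \<eta>))" for k :: nat and \<eta> :: "real \<times> real"
  define \<beta> where "\<beta> k \<eta> = (if k = 0 then \<Phi>' (fst \<eta>) * snd \<eta> else snd \<eta>)" for k :: nat and \<eta> :: "real \<times> real"
  define S where "S = R \<times> {0::real..}"
  define \<xi> where "\<xi> x = (u x, \<psi> x)" for x
  have "0 \<le> (\<Sum>k\<in>K. form D (\<lambda>x. \<alpha> k (\<xi> x)) (\<lambda>x. \<beta> k (\<xi> x)))"
  proof (rule two_point_energy)
    show "closed S" unfolding S_def by (intro closed_Times R(1) closed_atLeast)
    show "\<xi> x \<in> S" for x by (simp add: \<xi>_def S_def \<psi>_def R(3))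
    have fstR: "fst ` S \<subseteq> R" by (auto simp: S_def)
    show "continuous_on S (\<alpha> k)" for k
      unfolding \<alpha>_def by (cases "k = 0") (auto intro!: continuous_intros continuous_on_compose2[OF cont(1) _ fstR])
    show "continuous_on S (\<beta> k)" for k
      unfolding \<beta>_def by (cases "k = 0") (auto intro!: continuous_intros continuous_on_compose2[OF cont(2) _ fstR])
    have neg: "(\<lambda>x. - \<Phi> (u x)) \<in> dom D" using E.V_closed(5)[OF dom(1)] by (simp add: fun_Compl_def)
    show "(\<lambda>x. \<alpha> k (\<xi> x)) \<in> dom D" for k
      by (cases "k = 0") (use u neg in \<open>simp_all add: \<alpha>_def \<xi>_def\<close>)
    show "(\<lambda>x. \<beta> k (\<xi> x)) \<in> dom D" for k
      by (cases "k = 0") (use d2 \<psi>d in \<open>simp_all add: \<beta>_def \<xi>_def\<close>)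
    show "(\<lambda>x. \<alpha> k (\<xi> x) * \<beta> k (\<xi> x)) \<in> L2 M" for k
    proof (rule bounded_L2)
      show "(\<lambda>x. \<alpha> k (\<xi> x) * \<beta> k (\<xi> x)) \<in> borel_measurable M"
        by (cases "k = 0") (use um \<Phi>'m \<psi>m dom_measurable[OF dom(1)] in \<open>simp_all add: \<alpha>_def \<beta>_def \<xi>_def\<close>)
      show "AE x in M. \<bar>\<alpha> k (\<xi> x) * \<beta> k (\<xi> x)\<bar> \<le> max (N * (N * N)) (N * N)"
        using u(2) \<phi>(2) \<psi> bnd
      proof eventually_elim
        case (elim x)
        then have n: "\<bar>u x\<bar> \<le> N" "\<bar>\<psi> x\<bar> \<le> N" "N \<ge> 0" by auto
        have "\<bar>u x * (\<Phi>' (u x) * \<psi> x)\<bar> \<le> N * (N * N)"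
          unfolding abs_mult using n elim by (intro mult_mono) auto
        moreover have "\<bar>\<Phi> (u x) * \<psi> x\<bar> \<le> N * N"
          unfolding abs_mult using n elim by (intro mult_mono) auto
        ultimately show ?case by (auto simp: \<alpha>_def \<beta>_def \<xi>_def)
      qed
    qed
    fix \<eta> \<zeta> assume \<eta>: "\<eta> \<in> S"
    obtain s p where sp: "\<eta> = (s, p)" by (cases \<eta>)
    have p: "p \<ge> 0" "s \<in> R" using \<eta> by (auto simp: sp S_def)
    have "p * \<Phi> s \<le> p * (\<Phi>' s * s)" using tangent[OF p(2) R(2)] p by (intro mult_left_mono) (simp_all add: \<Phi>0)
    then show "0 \<le> (\<Sum>k\<in>K. \<alpha> k \<eta> * \<beta> k \<eta>)" by (simp add: K_def \<alpha>_def \<beta>_def sp algebra_simps)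
    assume \<zeta>: "\<zeta> \<in> S"
    obtain t r where tr: "\<zeta> = (t, r)" by (cases \<zeta>)
    have r: "r \<ge> 0" "t \<in> R" using \<zeta> by (auto simp: tr S_def)
    have "0 \<le> p * (\<Phi>' s * (s - t) - (\<Phi> s - \<Phi> t)) + r * (\<Phi>' t * (t - s) - (\<Phi> t - \<Phi> s))"
      using tangent[OF p(2) r(2)] tangent[OF r(2) p(2)] p r by (intro add_nonneg_nonneg mult_nonneg_nonneg) auto
    then show "0 \<le> (\<Sum>k\<in>K. (\<alpha> k \<eta> - \<alpha> k \<zeta>) * (\<beta> k \<eta> - \<beta> k \<zeta>))"
      by (simp add: K_def \<alpha>_def \<beta>_def sp tr algebra_simps)
  qed (simp add: K_def)
  also have "\<dots> = form D u (\<lambda>x. \<Phi>' (u x) * \<psi> x) + form D (- (\<lambda>x. \<Phi> (u x))) \<psi>"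
    by (simp add: K_def \<alpha>_def \<beta>_def \<xi>_def fun_Compl_def)
  also have "\<dots> = form D u (\<lambda>x. \<Phi>' (u x) * \<phi> x) - form D (\<lambda>x. \<Phi> (u x)) \<phi>"
    using form_cong[OF dom(2) d2 u(1) eq2] form_cong[OF \<phi>(1) \<psi>d dom(1) \<psi>]
      E.ip_commute[OF u(1) d2] E.ip_commute[OF u(1) dom(2)] E.ip_commute[OF dom(1) \<psi>d] E.ip_commute[OF dom(1) \<phi>(1)]
    by (simp add: E.ip_minus dom \<psi>d)
  finally show ?thesis by simp
qed

end

section \<open>Powers of subharmonic functions\<close>

lemma powr_mvt:
  fixes a b :: real
  assumes "0 < b" "b < a"
  obtains \<zeta> where "b < \<zeta>" "\<zeta> < a" "a powr q - b powr q = (a - b) * (q * \<zeta> powr (q - 1))"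
proof -
  have "\<exists>\<zeta>. b < \<zeta> \<and> \<zeta> < a \<and> a powr q - b powr q = (a - b) * (q * \<zeta> powr (q - 1))"
    by (rule MVT2[OF assms(2)]) (use assms in \<open>auto intro!: derivative_eq_intros simp: powr_diff\<close>)
  then show ?thesis using that by blast
qed

text \<open>\<open>\<zeta> powr (q - 1)\<close> increases or decreases according to the sign of
  \<open>q - 1\<close>, so it is bounded by the larger of its values at the endpoints
  \<open>m\<close> and \<open>R\<close>.\<close>

lemma powr_lipschitz:
  fixes a b :: real
  assumes "0 < m" "m \<le> a" "a \<le> R" "m \<le> b" "b \<le> R"
  shows "\<bar>a powr q - b powr q\<bar> \<le> \<bar>q\<bar> * max (m powr (q - 1)) (R powr (q - 1)) * \<bar>a - b\<bar>"
proof -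
  have *: "\<bar>a powr q - b powr q\<bar> \<le> \<bar>q\<bar> * max (m powr (q - 1)) (R powr (q - 1)) * \<bar>a - b\<bar>"
    if ab: "m \<le> b" "b < a" "a \<le> R" for a b :: real
  proof -
    obtain \<zeta> where z: "b < \<zeta>" "\<zeta> < a" "a powr q - b powr q = (a - b) * (q * \<zeta> powr (q - 1))"
      using powr_mvt[of b a q] assms(1) ab by auto
    have "\<zeta> powr (q - 1) \<le> max (m powr (q - 1)) (R powr (q - 1))"
    proof (cases "q \<ge> 1")
      case True
      then have "\<zeta> powr (q - 1) \<le> R powr (q - 1)" using z ab assms(1) by (intro powr_mono2) auto
      then show ?thesis by simp
    next
      case False
      then have "\<zeta> powr (q - 1) \<le> m powr (q - 1)" using z ab assms(1) by (intro powr_mono2') auto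
      then show ?thesis by simp
    qed
    then have "\<bar>a - b\<bar> * (\<bar>q\<bar> * \<zeta> powr (q - 1)) \<le> \<bar>a - b\<bar> * (\<bar>q\<bar> * max (m powr (q - 1)) (R powr (q - 1)))"
      by (intro mult_left_mono) auto
    then show ?thesis using z(3) by (simp add: abs_mult mult_ac)
  qed
  consider "a < b" | "a = b" | "b < a" by linarith
  then show ?thesis
  proof cases
    case 1 then show ?thesis using *[of a b] assms by (simp add: abs_minus_commute)
  next
    case 3 then show ?thesis using *[of b a] assms by simp
  qed simp
qed

lemma powr_lipschitz_ge1:
  fixes a b :: real
  assumes "0 \<le> a" "a \<le> R" "0 \<le> b" "b \<le> R" "q \<ge> 1"
  shows "\<bar>a powr q - b powr q\<bar> \<le> q * R powr (q - 1) * \<bar>a - b\<bar>"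
proof -
  have *: "\<bar>a powr q - b powr q\<bar> \<le> q * R powr (q - 1) * \<bar>a - b\<bar>" if ab: "0 \<le> b" "b < a" "a \<le> R" for a b :: real
  proof (cases "b = 0")
    case True
    have "a powr q = a * a powr (q - 1)" using ab by (simp add: powr_diff)
    also have "\<dots> \<le> a * R powr (q - 1)" using ab assms by (intro mult_left_mono powr_mono2) auto
    also have "\<dots> = 1 * (a * R powr (q - 1))" by simp
    also have "\<dots> \<le> q * (a * R powr (q - 1))" using assms(5) ab by (intro mult_right_mono) auto
    finally show ?thesis using True ab by (simp add: mult_ac)
  next
    case False
    then obtain \<zeta> where z: "b < \<zeta>" "\<zeta> < a" "a powr q - b powr q = (a - b) * (q * \<zeta> powr (q - 1))"
      using powr_mvt[of b a q] ab by auto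
    have "\<zeta> powr (q - 1) \<le> R powr (q - 1)" using z ab assms by (intro powr_mono2) auto
    then have "(a - b) * (q * \<zeta> powr (q - 1)) \<le> (a - b) * (q * R powr (q - 1))"
      using ab assms by (intro mult_left_mono) auto
    moreover have "(a - b) * (q * \<zeta> powr (q - 1)) \<ge> 0" using ab assms by simp
    ultimately show ?thesis using z(3) ab by (simp add: mult_ac)
  qed
  consider "a < b" | "a = b" | "b < a" by linarith
  then show ?thesis
  proof cases
    case 1 then show ?thesis using *[of a b] assms by (simp add: abs_minus_commute)
  next
    case 3 then show ?thesis using *[of b a] assms by simp
  qed simp
qed

lemma powr_tangent:
  fixes a b :: real
  assumes "0 < a" "0 < b" "p \<ge> 1"
  shows "a powr p - b powr p \<le> p * a powr (p - 1) * (a - b)"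
proof -
  consider "a < b" | "a = b" | "b < a" by linarith
  then show ?thesis
  proof cases
    case 1
    then obtain \<zeta> where z: "a < \<zeta>" "\<zeta> < b" "b powr p - a powr p = (b - a) * (p * \<zeta> powr (p - 1))"
      using powr_mvt[of a b p] assms by auto
    have "a powr (p - 1) \<le> \<zeta> powr (p - 1)" using z assms by (intro powr_mono2) auto
    then have "(b - a) * (p * a powr (p - 1)) \<le> (b - a) * (p * \<zeta> powr (p - 1))"
      using 1 assms by (intro mult_left_mono) auto
    then show ?thesis using z(3) by (simp add: algebra_simps)
  next
    case 3
    then obtain \<zeta> where z: "b < \<zeta>" "\<zeta> < a" "a powr p - b powr p = (a - b) * (p * \<zeta> powr (p - 1))"
      using powr_mvt[of b a p] assms by auto
    have "\<zeta> powr (p - 1) \<le> a powr (p - 1)" using z assms by (intro powr_mono2) auto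
    then have "(a - b) * (p * \<zeta> powr (p - 1)) \<le> (a - b) * (p * a powr (p - 1))"
      using 3 assms by (intro mult_left_mono) auto
    then show ?thesis using z(3) by (simp add: algebra_simps)
  qed simp
qed

lemma powr_diff_lower:
  fixes a b :: real
  assumes "0 < b" "b \<le> a" "a \<le> R" "0 \<le> p" "p \<le> 1"
  shows "p * R powr (p - 1) * (a - b) \<le> a powr p - b powr p"
proof (cases "a = b")
  case False
  then obtain \<zeta> where z: "b < \<zeta>" "\<zeta> < a" "a powr p - b powr p = (a - b) * (p * \<zeta> powr (p - 1))"
    using powr_mvt[of b a p] assms by auto
  have "R powr (p - 1) \<le> \<zeta> powr (p - 1)" using z assms by (intro powr_mono2') auto
  then have "(a - b) * (p * R powr (p - 1)) \<le> (a - b) * (p * \<zeta> powr (p - 1))"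
    using assms by (intro mult_left_mono) auto
  then show ?thesis using z(3) by (simp add: mult_ac)
qed simp

text \<open>The Cauchy-Schwarz inequality for the integral of \<open>p t powr (p - 1)\<close> over \<open>[b, a]\<close>.\<close>

lemma powr_square_diff:
  fixes a b :: real
  assumes b: "0 < b" "b \<le> a" and p: "1/2 < p"
  shows "(a powr p - b powr p)\<^sup>2 \<le> (a - b) * (p\<^sup>2 / (2 * p - 1) * (a powr (2 * p - 1) - b powr (2 * p - 1)))"
proof (cases "a = b")
  case False
  then have ab: "b < a" using b by simp
  define r where "r = 2 * p - 1"
  have r: "r > 0" using p by (simp add: r_def)
  define k where "k = (a powr p - b powr p) / (a - b)"
  \<comment> \<open>The derivative of \<open>H\<close> is \<open>(p s^(p - 1) - k)^2\<close>. With
    \<open>k\<close> the mean slope, \<open>H b \<le> H a\<close> becomes the claim divided by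
    \<open>a - b\<close>.\<close>
  define H where "H s = p\<^sup>2 / r * s powr r - 2 * k * s powr p + k\<^sup>2 * s" for s
  have "H b \<le> H a"
  proof (rule DERIV_nonneg_imp_nondecreasing[OF b(2)])
    fix s assume s: "b \<le> s" "s \<le> a"
    then have sp: "s > 0" using b by simp
    have "(s powr (p - 1))\<^sup>2 = s powr (r - 1)"
      using sp by (simp add: r_def power2_eq_square flip: powr_add)
    then have sq: "p\<^sup>2 * s powr (r - 1) - 2 * k * (p * s powr (p - 1)) + k\<^sup>2 = (p * s powr (p - 1) - k)\<^sup>2"
      by (simp add: power2_diff power_mult_distrib algebra_simps)
    have "(H has_real_derivative (p\<^sup>2 / r * (r * s powr (r - 1)) - 2 * k * (p * s powr (p - 1)) + k\<^sup>2)) (at s)"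
      unfolding H_def using sp by (auto intro!: derivative_eq_intros simp: powr_diff mult_ac)
    moreover have "p\<^sup>2 / r * (r * s powr (r - 1)) - 2 * k * (p * s powr (p - 1)) + k\<^sup>2 = (p * s powr (p - 1) - k)\<^sup>2"
      using r sq by simp
    ultimately show "\<exists>y. (H has_real_derivative y) (at s) \<and> 0 \<le> y" by (metis zero_le_power2)
  qed
  then have "2 * k * (a powr p - b powr p) - k\<^sup>2 * (a - b) \<le> p\<^sup>2 / r * (a powr r - b powr r)"
    by (simp add: H_def algebra_simps diff_divide_distrib)
  moreover have kd: "a powr p - b powr p = k * (a - b)" using ab by (simp add: k_def)
  ultimately have "k\<^sup>2 * (a - b) \<le> p\<^sup>2 / r * (a powr r - b powr r)"
    by (simp add: kd power2_eq_square algebra_simps)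
  then have "(a - b) * (k\<^sup>2 * (a - b)) \<le> (a - b) * (p\<^sup>2 / r * (a powr r - b powr r))"
    using ab by (intro mult_left_mono) auto
  then show ?thesis unfolding kd r_def by (simp add: power2_eq_square mult_ac)
qed simp

text \<open>Discrete form of the Caccioppoli argument: \<open>\<sigma>\<close> and
  \<open>\<tau>\<close> are cutoff values at two points, \<open>\<Psi>\<close> is the function whose
  energy is sought and \<open>\<Theta>\<close> stands for a primitive of the square of its
  derivative. \<open>sq\<close> replaces the chain rule, and \<open>low\<close> bounds the part of
  the test function that meets the increment of the cutoff.\<close>

lemma caccioppoli_two_point:
  fixes \<sigma> \<tau> a b :: real
  assumes \<Psi>: "\<And>s. s \<in> I \<Longrightarrow> 0 \<le> \<Psi> s" "\<And>s. s \<in> I \<Longrightarrow> \<Psi> s \<le> P"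
    and sq: "\<And>s t. s \<in> I \<Longrightarrow> t \<in> I \<Longrightarrow> t \<le> s \<Longrightarrow> (\<Psi> s - \<Psi> t)\<^sup>2 \<le> (s - t) * (\<Theta> s - \<Theta> t)"
    and low: "\<And>s t. s \<in> I \<Longrightarrow> t \<in> I \<Longrightarrow> t \<le> s \<Longrightarrow> (s - t) * \<Theta> t \<le> \<kappa> * (\<Psi> s - \<Psi> t)"
    and \<Theta>: "\<And>s. s \<in> I \<Longrightarrow> 0 \<le> \<Theta> s" and \<kappa>: "\<kappa> > 0"
    and st: "0 \<le> \<sigma>" "0 \<le> \<tau>" and ab: "a \<in> I" "b \<in> I"
  shows "(\<sigma> * \<Psi> a - \<tau> * \<Psi> b)\<^sup>2 \<le> 4 * ((a - b) * (\<sigma>\<^sup>2 * \<Theta> a - \<tau>\<^sup>2 * \<Theta> b)) + (8 * \<kappa>\<^sup>2 + 4 * \<kappa> * P + 2 * P\<^sup>2) * (\<sigma> - \<tau>)\<^sup>2"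
proof -
  have *: "(\<sigma> * \<Psi> a - \<tau> * \<Psi> b)\<^sup>2 \<le> 4 * ((a - b) * (\<sigma>\<^sup>2 * \<Theta> a - \<tau>\<^sup>2 * \<Theta> b)) + (8 * \<kappa>\<^sup>2 + 4 * \<kappa> * P + 2 * P\<^sup>2) * (\<sigma> - \<tau>)\<^sup>2"
    if ba: "b \<le> a" and ab: "a \<in> I" "b \<in> I" and st: "0 \<le> \<sigma>" "0 \<le> \<tau>" for a b \<sigma> \<tau> :: real
  proof -
    define d where "d = \<Psi> a - \<Psi> b"
    define e where "e = \<bar>\<sigma> - \<tau>\<bar>"
    have e: "e \<ge> 0" "e\<^sup>2 = (\<sigma> - \<tau>)\<^sup>2" "\<sigma> + \<tau> \<le> 2 * \<sigma> + e" by (auto simp: e_def)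
    have d2: "d\<^sup>2 \<le> (a - b) * (\<Theta> a - \<Theta> b)" unfolding d_def by (rule sq[OF ab ba])
    have dl: "(a - b) * \<Theta> b \<le> \<kappa> * d" unfolding d_def by (rule low[OF ab ba])
    have "0 \<le> \<kappa> * d" using dl \<Theta>[OF ab(2)] ba by (meson diff_ge_0_iff_ge mult_nonneg_nonneg order_trans)
    then have d0: "0 \<le> d" using \<kappa> by (simp add: zero_le_mult_iff)
    have dP: "d \<le> P" using \<Psi>[OF ab(1)] \<Psi>[OF ab(2)] by (simp add: d_def)
    have P0: "0 \<le> P" using d0 dP by simp
    define X where "X = (a - b) * (\<sigma>\<^sup>2 * \<Theta> a - \<tau>\<^sup>2 * \<Theta> b)"
    \<comment> \<open>The first term carries the energy; the second is the cross term with the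
      cutoff difference, to be absorbed.\<close>
    have X: "X = \<sigma>\<^sup>2 * ((a - b) * (\<Theta> a - \<Theta> b)) + (\<sigma> - \<tau>) * (\<sigma> + \<tau>) * ((a - b) * \<Theta> b)"
      by (simp add: X_def power2_eq_square algebra_simps)
    have "\<sigma>\<^sup>2 * d\<^sup>2 \<le> \<sigma>\<^sup>2 * ((a - b) * (\<Theta> a - \<Theta> b))" by (intro mult_left_mono d2) simp
    moreover have "- (e * (\<sigma> + \<tau>) * (\<kappa> * d)) \<le> (\<sigma> - \<tau>) * (\<sigma> + \<tau>) * ((a - b) * \<Theta> b)"
    proof -
      have nn: "0 \<le> (a - b) * \<Theta> b" using \<Theta>[OF ab(2)] ba by simp
      have "e * (\<sigma> + \<tau>) * ((a - b) * \<Theta> b) \<le> e * (\<sigma> + \<tau>) * (\<kappa> * d)"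
        using e st by (intro mult_left_mono dl) auto
      moreover have "- (e * (\<sigma> + \<tau>) * ((a - b) * \<Theta> b)) \<le> (\<sigma> - \<tau>) * (\<sigma> + \<tau>) * ((a - b) * \<Theta> b)"
      proof -
        have "- e \<le> \<sigma> - \<tau>" by (simp add: e_def)
        then have "- e * ((\<sigma> + \<tau>) * ((a - b) * \<Theta> b)) \<le> (\<sigma> - \<tau>) * ((\<sigma> + \<tau>) * ((a - b) * \<Theta> b))"
          using nn st by (intro mult_right_mono) auto
        then show ?thesis by (simp add: mult.assoc)
      qed
      ultimately show ?thesis by linarith
    qed
    moreover have "e * (\<sigma> + \<tau>) * (\<kappa> * d) \<le> e * (2 * \<sigma> + e) * (\<kappa> * d)"
      using e d0 \<kappa> by (intro mult_right_mono mult_left_mono) auto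
    moreover have "e * (2 * \<sigma> + e) * (\<kappa> * d) = 2 * (\<sigma> * d) * (\<kappa> * e) + e\<^sup>2 * (\<kappa> * d)"
      by (simp add: power2_eq_square algebra_simps)
    \<comment> \<open>Young's inequality, with the weight that spends only half of
      \<open>\<sigma>\<^sup>2 * d\<^sup>2\<close>.\<close>
    moreover have "2 * (\<sigma> * d) * (\<kappa> * e) \<le> 1/2 * (\<sigma>\<^sup>2 * d\<^sup>2) + 2 * (\<kappa>\<^sup>2 * e\<^sup>2)"
    proof -
      have "0 \<le> (\<sigma> * d - 2 * (\<kappa> * e))\<^sup>2" by simp
      then show ?thesis by (simp add: power2_diff power_mult_distrib)
    qed
    moreover have "e\<^sup>2 * (\<kappa> * d) \<le> e\<^sup>2 * (\<kappa> * P)" using dP \<kappa> by (intro mult_left_mono) auto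
    ultimately have XX: "1/2 * (\<sigma>\<^sup>2 * d\<^sup>2) - (2 * (\<kappa>\<^sup>2 * e\<^sup>2) + e\<^sup>2 * (\<kappa> * P)) \<le> X"
      unfolding X by linarith
    have "\<sigma> * \<Psi> a - \<tau> * \<Psi> b = \<sigma> * d + (\<sigma> - \<tau>) * \<Psi> b" by (simp add: d_def algebra_simps)
    then have "(\<sigma> * \<Psi> a - \<tau> * \<Psi> b)\<^sup>2 = (\<sigma> * d + (\<sigma> - \<tau>) * \<Psi> b)\<^sup>2" by simp
    also have "\<dots> \<le> 2 * (\<sigma> * d)\<^sup>2 + 2 * ((\<sigma> - \<tau>) * \<Psi> b)\<^sup>2"
    proof -
      have "0 \<le> (\<sigma> * d - (\<sigma> - \<tau>) * \<Psi> b)\<^sup>2" by simp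
      then show ?thesis by (simp only: power2_diff power2_sum)
    qed
    also have "\<dots> \<le> 2 * (\<sigma>\<^sup>2 * d\<^sup>2) + 2 * (e\<^sup>2 * P\<^sup>2)"
    proof -
      have "(\<Psi> b)\<^sup>2 \<le> P\<^sup>2" using \<Psi>[OF ab(2)] by (intro power_mono) auto
      then have "e\<^sup>2 * (\<Psi> b)\<^sup>2 \<le> e\<^sup>2 * P\<^sup>2" by (intro mult_left_mono) auto
      then show ?thesis using e(2) by (simp add: power_mult_distrib)
    qed
    \<comment> \<open>Four times \<open>XX\<close> covers
      \<open>2 * (\<sigma>\<^sup>2 * d\<^sup>2)\<close>, which produces the factors 8 and 4 of the
      constant; the factor 2 stems from the square of the sum.\<close>
    finally have "(\<sigma> * \<Psi> a - \<tau> * \<Psi> b)\<^sup>2 \<le> 4 * X + (8 * (\<kappa>\<^sup>2 * e\<^sup>2) + 4 * (e\<^sup>2 * (\<kappa> * P)) + 2 * (e\<^sup>2 * P\<^sup>2))"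
      using XX by linarith
    also have "8 * (\<kappa>\<^sup>2 * e\<^sup>2) + 4 * (e\<^sup>2 * (\<kappa> * P)) + 2 * (e\<^sup>2 * P\<^sup>2) = (8 * \<kappa>\<^sup>2 + 4 * \<kappa> * P + 2 * P\<^sup>2) * (\<sigma> - \<tau>)\<^sup>2"
      unfolding e(2)[symmetric] by (simp add: algebra_simps)
    finally show ?thesis by (simp add: X_def)
  qed
  show ?thesis
  proof (cases "b \<le> a")
    case True then show ?thesis using * ab st by blast
  next
    case False
    then have "(\<tau> * \<Psi> b - \<sigma> * \<Psi> a)\<^sup>2 \<le> 4 * ((b - a) * (\<tau>\<^sup>2 * \<Theta> b - \<sigma>\<^sup>2 * \<Theta> a)) + (8 * \<kappa>\<^sup>2 + 4 * \<kappa> * P + 2 * P\<^sup>2) * (\<tau> - \<sigma>)\<^sup>2"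
      using *[of a b \<tau> \<sigma>] ab st by simp
    moreover have "(\<tau> * \<Psi> b - \<sigma> * \<Psi> a)\<^sup>2 = (\<sigma> * \<Psi> a - \<tau> * \<Psi> b)\<^sup>2" "(\<tau> - \<sigma>)\<^sup>2 = (\<sigma> - \<tau>)\<^sup>2"
      by (simp_all add: power2_commute)
    moreover have "(b - a) * (\<tau>\<^sup>2 * \<Theta> b - \<sigma>\<^sup>2 * \<Theta> a) = (a - b) * (\<sigma>\<^sup>2 * \<Theta> a - \<tau>\<^sup>2 * \<Theta> b)"
      by (simp add: algebra_simps)
    ultimately show ?thesis by simp
  qed
qed

section \<open>Positive parts and powers in the form domain\<close>

context finite_markov_form
begin

lemma nrm_uniform:
  assumes "f \<in> borel_measurable M" "AE x in M. \<bar>f x\<bar> \<le> e"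
  shows "f \<in> L2 M" "nrm f \<le> \<bar>e\<bar> * nrm (\<lambda>x. 1)"
proof -
  have le: "AE x in M. \<bar>f x\<bar> \<le> \<bar>(e *\<^sub>R (\<lambda>x. 1 :: real)) x\<bar>" using assms(2) by eventually_elim simp
  have c: "e *\<^sub>R (\<lambda>x. 1) \<in> L2 M" using L2_const[of 1] by (rule L2.V_closed(4))
  show "f \<in> L2 M" by (rule L2_bound[OF c assms(1) le])
  show "nrm f \<le> \<bar>e\<bar> * nrm (\<lambda>x. 1)"
    using L2_nrm_mono[OF c assms(1) le] unfolding L2.nrm_scale[OF L2_const[of 1]] .
qed

lemma form_le_of_limit:
  assumes u: "\<And>n::nat. u n \<in> dom D" "\<And>n. form D (u n) (u n) \<le> C" "\<And>n. form D (u n) v \<le> c"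
    and F: "F \<in> L2 M" and v: "v \<in> dom D" and lim: "(\<lambda>n. nrm (u n - F)) \<longlonglongrightarrow> 0"
  shows "F \<in> dom D" "form D F v \<le> c"
proof -
  have "F \<in> dom D \<and> form D F v \<le> c"
  proof (rule form_le_of_approximation[OF F v])
    fix \<epsilon> :: real assume "\<epsilon> > 0"
    then have "\<forall>\<^sub>F n in sequentially. nrm (u n - F) < \<epsilon>" by (rule order_tendstoD(2)[OF lim])
    then obtain n where "nrm (u n - F) < \<epsilon>" by (auto simp: eventually_sequentially)
    then show "\<exists>w\<in>dom D. nrm (w - F) < \<epsilon> \<and> form D w w \<le> C \<and> form D w v \<le> c" using u by blast
  qed
  then show "F \<in> dom D" "form D F v \<le> c" by auto
qed

text \<open>Vanishing outside \<open>K\<close> is meant a.e., so that truncations and nonnegative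
  products in the domain stay in the class without any reference to supports.\<close>

definition tests :: "'a set \<Rightarrow> ('a \<Rightarrow> real) set" where
  "tests K = {\<phi> \<in> dom D. (AE x in M. 0 \<le> \<phi> x) \<and> (AE x in M. x \<notin> K \<longrightarrow> \<phi> x = 0)}"

text \<open>Products such as \<open>\<Phi>' (u x) * \<phi> x\<close> are known to lie in the domain
  only for bounded factors. The truncations \<open>min (\<phi> x) n\<close> have energy at most that
  of \<open>\<phi>\<close> and tend to it in \<open>L2\<close>, so bounded tests suffice.\<close>

lemma tests_unbounded:
  assumes F: "F \<in> dom D"
    and b: "\<And>\<phi> N. \<phi> \<in> tests K \<Longrightarrow> AE x in M. \<bar>\<phi> x\<bar> \<le> N \<Longrightarrow> form D F \<phi> \<le> 0"
    and \<phi>: "\<phi> \<in> tests K"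
  shows "form D F \<phi> \<le> 0"
proof -
  have \<phi>d: "\<phi> \<in> dom D" and \<phi>0: "AE x in M. 0 \<le> \<phi> x" and \<phi>K: "AE x in M. x \<notin> K \<longrightarrow> \<phi> x = 0"
    using \<phi> by (auto simp: tests_def)
  define w where "w n x = min (\<phi> x) (real n)" for n x
  have w: "w n \<in> dom D" "form D (w n) (w n) \<le> form D \<phi> \<phi>" for n
    unfolding w_def by (rule markov_comp[OF _ _ \<phi>d]; auto)+
  have "AE x in M. \<bar>w n x\<bar> \<le> real n" for n
    using \<phi>0 by eventually_elim (simp add: w_def)
  moreover have "w n \<in> tests K" for n
  proof -
    have "AE x in M. 0 \<le> w n x" using \<phi>0 by eventually_elim (simp add: w_def)
    moreover have "AE x in M. x \<notin> K \<longrightarrow> w n x = 0" using \<phi>K by eventually_elim (simp add: w_def)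
    ultimately show ?thesis using w(1) by (simp add: tests_def)
  qed
  ultimately have "form D F (w n) \<le> 0" for n using b by blast
  then have wF: "form D (w n) F \<le> 0" for n using E.ip_commute[OF F w(1)] by simp
  have "(\<lambda>n. nrm (w n - \<phi>)) \<longlonglongrightarrow> 0"
  proof (rule L2_dominated_convergence(3))
    show "(\<lambda>x. \<bar>\<phi> x\<bar>) \<in> L2 M" by (rule L2_bound[OF dom_L2[OF \<phi>d]]) (use dom_measurable[OF \<phi>d] in auto)
    show "AE x in M. \<bar>w n x\<bar> \<le> \<bar>\<phi> x\<bar>" for n by (auto simp: w_def)
    have "(\<lambda>n. w n x) \<longlonglongrightarrow> \<phi> x" for x
    proof (rule tendsto_eventually)
      obtain N :: nat where "\<phi> x \<le> real N" using real_arch_simple by blast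
      then show "\<forall>\<^sub>F n in sequentially. w n x = \<phi> x"
        by (auto simp: eventually_sequentially w_def min_def intro!: exI[of _ N])
    qed
    then show "AE x in M. (\<lambda>n. w n x) \<longlonglongrightarrow> \<phi> x" by simp
  qed (use w \<phi>d dom_measurable in auto)
  then have "form D \<phi> F \<le> 0" by (rule form_le_of_limit(2)[OF w wF dom_L2[OF \<phi>d] F])
  then show ?thesis using E.ip_commute[OF F \<phi>d] by simp
qed

lemma pos_part_subharmonic:
  assumes u: "u \<in> dom D" "AE x in M. \<bar>u x\<bar> \<le> N" and lam: "lam \<ge> 0" and c: "c \<ge> 0"
    and sub: "\<And>\<phi>. \<phi> \<in> tests K \<Longrightarrow> form D u \<phi> + lam * l2_ip M u \<phi> \<le> 0"
  defines "w \<equiv> \<lambda>x. max (u x - c) 0"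
  shows "w \<in> dom D" "\<And>\<phi>. \<phi> \<in> tests K \<Longrightarrow> form D w \<phi> \<le> 0"
proof -
  have cd: "\<bar>max (s - c) 0 - max (t - c) 0\<bar> \<le> \<bar>s - t\<bar>" for s t :: real by auto
  show wd: "w \<in> dom D" unfolding w_def by (rule markov_comp(1)[OF cd _ u(1)]) (use c in simp)
  have um: "u \<in> borel_measurable M" by (rule dom_measurable[OF u(1)])
  show "form D w \<phi> \<le> 0" if \<phi>: "\<phi> \<in> tests K" for \<phi>
  proof (rule tests_unbounded[OF wd _ \<phi>])
    fix \<phi> N' assume \<phi>: "\<phi> \<in> tests K" and N': "AE x in M. \<bar>\<phi> x\<bar> \<le> N'"
    have \<phi>d: "\<phi> \<in> dom D" and \<phi>0: "AE x in M. 0 \<le> \<phi> x" and \<phi>K: "AE x in M. x \<notin> K \<longrightarrow> \<phi> x = 0"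
      using \<phi> by (auto simp: tests_def)
    define r where "r s = max (s - c) 0" for s
    \<comment> \<open>This is \<open>r^2 / (r + e)\<close>, a convex approximation of
      \<open>r\<close> with error at most \<open>e\<close>; its derivative \<open>\<Phi>'\<close>
      vanishes for \<open>s \<le> c\<close>, so that the tests
      \<open>\<Phi>' e (u x) * \<phi> x\<close> live where \<open>u x \<ge> c\<close>.\<close>
    define \<Phi> where "\<Phi> e s = r s - e + e\<^sup>2 / (r s + e)" for e s :: real
    define \<Phi>' where "\<Phi>' e s = 1 - (e / (r s + e))\<^sup>2" for e s :: real
    define e where "e n = 1 / real (Suc n)" for n
    have e: "e n > 0" for n by (simp add: e_def)
    have e_lim: "e \<longlonglongrightarrow> 0" unfolding e_def using LIMSEQ_inverse_real_of_nat by (simp add: inverse_eq_divide)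
    have r0: "r s \<ge> 0" "r 0 = 0" for s using c by (auto simp: r_def)
    \<comment> \<open>The chord slope of \<open>\<Phi> e\<close> as a function of \<open>r\<close>,
      in terms of the fractions \<open>e / (r + e)\<close> in \<open>[0, 1]\<close>; contractivity
      and the tangent inequality are read off from it.\<close>
    have r_diff: "\<Phi> e s - \<Phi> e t = (r s - r t) * (1 - (e / (r s + e)) * (e / (r t + e)))" if "e > 0" for e s t
    proof -
      define A where "A = r s + e"
      define B where "B = r t + e"
      have "A > 0" "B > 0" using r0(1)[of s] r0(1)[of t] that by (auto simp: A_def B_def)
      then have "e\<^sup>2 / A - e\<^sup>2 / B = - ((A - B) * ((e / A) * (e / B)))"
        by (simp add: divide_simps power2_eq_square algebra_simps)
      then have "e\<^sup>2 / (r s + e) - e\<^sup>2 / (r t + e) = - ((r s - r t) * ((e / (r s + e)) * (e / (r t + e))))"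
        by (simp add: A_def B_def)
      then show ?thesis by (simp add: \<Phi>_def algebra_simps)
    qed
    have frac: "0 \<le> e / (r s + e)" "e / (r s + e) \<le> 1" "e / (r s + e) > 0" if "e > 0" for e s
      using r0(1)[of s] that by (auto simp: add_nonneg_pos)
    have \<Phi>_lip: "\<bar>\<Phi> e s - \<Phi> e t\<bar> \<le> \<bar>s - t\<bar>" if "e > 0" for e s t
    proof -
      have "0 \<le> (e / (r s + e)) * (e / (r t + e))" "(e / (r s + e)) * (e / (r t + e)) \<le> 1"
        by (rule mult_nonneg_nonneg mult_le_one frac[OF that])+
      then have "\<bar>1 - (e / (r s + e)) * (e / (r t + e))\<bar> \<le> 1" by linarith
      then have "\<bar>\<Phi> e s - \<Phi> e t\<bar> \<le> \<bar>r s - r t\<bar> * 1"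
        unfolding r_diff[OF that] abs_mult by (intro mult_left_mono) auto
      also have "\<dots> \<le> \<bar>s - t\<bar>" using cd by (simp add: r_def)
      finally show ?thesis .
    qed
    have \<Phi>0: "\<Phi> e 0 = 0" "\<Phi>' e 0 = 0" if "e > 0" for e
      using that by (auto simp: \<Phi>_def \<Phi>'_def r0 power2_eq_square)
    have \<Phi>'_lip: "\<bar>\<Phi>' e s - \<Phi>' e t\<bar> \<le> 2 / e * \<bar>s - t\<bar>" if ep: "e > 0" for e s t
    proof -
      define x where "x = e / (r s + e)"
      define y where "y = e / (r t + e)"
      have xy: "0 \<le> x" "x \<le> 1" "0 \<le> y" "y \<le> 1" using frac[OF ep] by (auto simp: x_def y_def)
      define A where "A = r s + e"
      define B where "B = r t + e"
      have "A > 0" "B > 0" using r0(1)[of s] r0(1)[of t] ep by (auto simp: A_def B_def)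
      then have "e / B - e / A = (A - B) / e * ((e / A) * (e / B))"
        using ep by (simp add: divide_simps) (simp add: algebra_simps)
      then have "y - x = (r s - r t) / e * (x * y)"
        by (simp add: x_def y_def A_def B_def)
      then have "\<bar>y - x\<bar> = \<bar>r s - r t\<bar> / e * (x * y)" using ep xy by (simp add: abs_mult)
      also have "\<dots> \<le> \<bar>r s - r t\<bar> / e * 1" using ep xy by (intro mult_left_mono mult_le_one) auto
      also have "\<dots> \<le> \<bar>s - t\<bar> / e" using cd[of s t] ep by (simp add: r_def divide_right_mono)
      finally have yx: "\<bar>y - x\<bar> \<le> \<bar>s - t\<bar> / e" .
      have "\<Phi>' e s - \<Phi>' e t = (y - x) * (y + x)" by (simp add: \<Phi>'_def x_def y_def power2_eq_square algebra_simps)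
      then have "\<bar>\<Phi>' e s - \<Phi>' e t\<bar> = \<bar>y - x\<bar> * (y + x)" using xy by (simp add: abs_mult)
      also have "\<dots> \<le> \<bar>s - t\<bar> / e * 2" using yx xy ep by (intro mult_mono) auto
      finally show ?thesis by (simp add: mult_ac)
    qed
    have \<Phi>'_01: "0 \<le> \<Phi>' e s" "\<Phi>' e s \<le> 1" if "e > 0" for e s
      using power_mono[OF frac(2)[OF that] frac(1)[OF that], of s 2] by (auto simp: \<Phi>'_def)
    have r_cont: "continuous_on UNIV r" unfolding r_def by (intro continuous_intros)
    have \<Phi>'_cont: "continuous_on UNIV (\<Phi>' e)" if "e > 0" for e
    proof -
      have "r s + e \<noteq> 0" for s using r0(1)[of s] that by linarith
      then show ?thesis unfolding \<Phi>'_def by (intro continuous_intros r_cont) auto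
    qed
    have \<Phi>_cont: "continuous_on UNIV (\<Phi> e)" if "e > 0" for e
    proof -
      have "r s + e \<noteq> 0" for s using r0(1)[of s] that by linarith
      then show ?thesis unfolding \<Phi>_def by (intro continuous_intros r_cont) auto
    qed
    have \<Phi>d: "(\<lambda>x. \<Phi> (e n) (u x)) \<in> dom D" "form D (\<lambda>x. \<Phi> (e n) (u x)) (\<lambda>x. \<Phi> (e n) (u x)) \<le> form D u u" for n
      by (rule markov_comp[OF \<Phi>_lip[OF e] _ u(1)]; simp add: \<Phi>0 e)+
    define N'' where "N'' = max (max N N') 1"
    have bu: "AE x in M. \<bar>u x\<bar> \<le> N''" "AE x in M. \<bar>\<phi> x\<bar> \<le> N''"
      using u(2) N' by (eventually_elim, simp add: N''_def)+
    have \<Phi>'d: "(\<lambda>x. \<Phi>' (e n) (u x)) \<in> dom D" for n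
      by (rule dom_comp_lipschitz(1)[OF u(1) bu(1), where L = "2 / e n"])
        (use e[of n] \<Phi>'_lip[OF e] \<Phi>0[OF e] borel_measurable_continuous_onI[OF \<Phi>'_cont[OF e]] in \<open>auto simp: N''_def\<close>)
    have b': "AE x in M. \<bar>\<Phi>' (e n) (u x)\<bar> \<le> N''" for n
      using \<Phi>'_01[OF e] by (auto simp: N''_def abs_of_nonneg intro!: AE_I2 max.coboundedI2)
    have prod: "(\<lambda>x. \<Phi>' (e n) (u x) * \<phi> x) \<in> dom D" for n
      by (rule dom_mult[OF \<Phi>'d b' \<phi>d bu(2)])
    have prod_test: "(\<lambda>x. \<Phi>' (e n) (u x) * \<phi> x) \<in> tests K" for n
    proof -
      have "AE x in M. 0 \<le> \<Phi>' (e n) (u x) * \<phi> x"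
        using \<phi>0 by eventually_elim (simp add: \<Phi>'_01(1)[OF e])
      moreover have "AE x in M. x \<notin> K \<longrightarrow> \<Phi>' (e n) (u x) * \<phi> x = 0"
        using \<phi>K by eventually_elim simp
      ultimately show ?thesis using prod by (simp add: tests_def)
    qed
    have "form D (\<lambda>x. \<Phi> (e n) (u x)) \<phi> \<le> form D u (\<lambda>x. \<Phi>' (e n) (u x) * \<phi> x)" for n
    proof (rule form_convex_le[OF u(1) bu(1), where R = UNIV])
      show "AE x in M. \<bar>\<Phi> (e n) (u x)\<bar> \<le> N''"
        using bu(1)
      proof eventually_elim
        case (elim x)
        then show ?case using \<Phi>_lip[OF e, of n "u x" 0] \<Phi>0[OF e] by simp
      qed
      fix s t :: real
      define x where "x = e n / (r s + e n)"
      define y where "y = e n / (r t + e n)"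
      have xy: "0 < x" "x \<le> 1" "0 < y" "y \<le> 1" using frac[OF e] by (auto simp: x_def y_def)
      have "\<Phi> (e n) s - \<Phi> (e n) t \<le> \<Phi>' (e n) s * (r s - r t)"
      proof -
        have "0 \<le> (r s - r t) * (x * (y - x))"
        proof (cases "r t \<le> r s")
          case True
          then have "x \<le> y" unfolding x_def y_def using r0(1)[of t] e[of n] by (intro divide_left_mono) auto
          then show ?thesis using True xy by simp
        next
          case False
          then have "y \<le> x" unfolding x_def y_def using r0(1)[of s] e[of n] by (intro divide_left_mono) auto
          then show ?thesis using False xy by (intro mult_nonpos_nonpos mult_nonneg_nonpos) auto
        qed
        then show ?thesis
          unfolding r_diff[OF e] \<Phi>'_def x_def[symmetric] y_def[symmetric] by (simp add: power2_eq_square algebra_simps)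
      qed
      also have "\<dots> \<le> \<Phi>' (e n) s * (s - t)"
      proof (cases "s \<ge> c")
        case True
        then have "r s - r t \<le> s - t" by (simp add: r_def)
        then show ?thesis using \<Phi>'_01(1)[OF e] by (intro mult_left_mono) auto
      next
        case False
        then have "\<Phi>' (e n) s = 0" using \<Phi>0(2)[OF e] r0 by (simp add: \<Phi>'_def r_def)
        then show ?thesis by simp
      qed
      finally show "\<Phi> (e n) s - \<Phi> (e n) t \<le> \<Phi>' (e n) s * (s - t)" .
    qed (use \<phi>d bu \<phi>0 \<Phi>_cont[OF e] \<Phi>'_cont[OF e] \<Phi>0[OF e] b' \<Phi>d prod borel_measurable_continuous_onI[OF \<Phi>'_cont[OF e]] in auto)
    moreover have "form D u (\<lambda>x. \<Phi>' (e n) (u x) * \<phi> x) \<le> 0" for n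
    proof -
      \<comment> \<open>Here \<open>c \<ge> 0\<close> enters: the test function lives where
        \<open>u \<ge> c\<close>, so the zero order term is nonnegative and may be dropped.\<close>
      have "0 \<le> l2_ip M u (\<lambda>x. \<Phi>' (e n) (u x) * \<phi> x)"
      proof (rule l2_ip_nonneg)
        show "AE x in M. 0 \<le> u x * (\<Phi>' (e n) (u x) * \<phi> x)"
          using \<phi>0
        proof eventually_elim
          case (elim x)
          show ?case
          proof (cases "u x \<ge> c")
            case True
            then show ?thesis using c elim \<Phi>'_01(1)[OF e] by simp
          next
            case False
            then have "\<Phi>' (e n) (u x) = 0" using \<Phi>0(2)[OF e] r0 by (simp add: \<Phi>'_def r_def)
            then show ?thesis by simp
          qed
        qed
      qed
      then have "0 \<le> lam * l2_ip M u (\<lambda>x. \<Phi>' (e n) (u x) * \<phi> x)" using lam by simp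
      then show ?thesis using sub[OF prod_test[of n]] by linarith
    qed
    ultimately have le0: "form D (\<lambda>x. \<Phi> (e n) (u x)) \<phi> \<le> 0" for n by (rule order_trans)
    have "(\<lambda>n. \<bar>e n\<bar> * nrm (\<lambda>x. 1)) \<longlonglongrightarrow> \<bar>0\<bar> * nrm (\<lambda>x. 1)" by (intro tendsto_intros e_lim)
    then have lim0: "(\<lambda>n. \<bar>e n\<bar> * nrm (\<lambda>x. 1)) \<longlonglongrightarrow> 0" by simp
    have "(\<lambda>n. nrm ((\<lambda>x. \<Phi> (e n) (u x)) - w)) \<longlonglongrightarrow> 0"
    proof (rule Lim_null_comparison[OF always_eventually lim0], rule allI)
      fix n
      have L: "(\<lambda>x. \<Phi> (e n) (u x)) - w \<in> L2 M" using dom_L2[OF \<Phi>d(1)] dom_L2[OF wd] by (rule L2.V_closed)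
      have "nrm ((\<lambda>x. \<Phi> (e n) (u x)) - w) \<le> \<bar>e n\<bar> * nrm (\<lambda>x. 1)"
      proof (rule nrm_uniform(2)[OF L2_measurable[OF L]], rule AE_I2)
        fix x
        define y where "y = e n / (r (u x) + e n)"
        have y: "0 \<le> y" "y \<le> 1" using frac[OF e] by (auto simp: y_def)
        have "((\<lambda>x. \<Phi> (e n) (u x)) - w) x = e n * y - e n"
          by (simp add: \<Phi>_def w_def r_def y_def power2_eq_square)
        moreover have "0 \<le> e n * y" "e n * y \<le> e n * 1"
          using y e[of n] by (auto intro: mult_left_mono simp del: mult_1_right)
        ultimately show "\<bar>((\<lambda>x. \<Phi> (e n) (u x)) - w) x\<bar> \<le> e n" by linarith
      qed
      then show "norm (nrm ((\<lambda>x. \<Phi> (e n) (u x)) - w)) \<le> \<bar>e n\<bar> * nrm (\<lambda>x. 1)" using L by simp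
    qed
    then show "form D w \<phi> \<le> 0" by (rule form_le_of_limit(2)[OF \<Phi>d le0 dom_L2[OF wd] \<phi>d])
  qed
qed

text \<open>Shifting the argument by \<open>e n\<close> keeps it away from 0, where the derivative
  of the power fails to be Lipschitz for \<open>p < 2\<close>. The shifted powers are convex with
  uniformly bounded energy, so the sign passes to the limit.\<close>

lemma power_subharmonic:
  assumes u: "u \<in> dom D" "AE x in M. u x \<le> N" "\<And>x. 0 \<le> u x" and p: "p > 1"
    and sub: "\<And>\<phi>. \<phi> \<in> tests K \<Longrightarrow> form D u \<phi> \<le> 0"
  shows "(\<lambda>x. u x powr p) \<in> dom D" "\<And>\<phi>. \<phi> \<in> tests K \<Longrightarrow> form D (\<lambda>x. u x powr p) \<phi> \<le> 0"
proof -
  define N1 where "N1 = max N 0"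
  have N1: "N1 \<ge> 0" and uN: "AE x in M. \<bar>u x\<bar> \<le> N1"
    using u(2,3) by (auto simp: N1_def elim!: eventually_mono)
  define L where "L = p * (N1 + 1) powr (p - 1)"
  have L: "L > 0" using p N1 by (simp add: L_def)
  have lip: "\<bar>(max s 0 + e) powr p - (max t 0 + e) powr p\<bar> \<le> L * \<bar>s - t\<bar>"
    if "\<bar>s\<bar> \<le> N1" "\<bar>t\<bar> \<le> N1" "0 \<le> e" "e \<le> 1" for s t e
  proof -
    have "\<bar>(max s 0 + e) powr p - (max t 0 + e) powr p\<bar> \<le> L * \<bar>(max s 0 + e) - (max t 0 + e)\<bar>"
      unfolding L_def by (rule powr_lipschitz_ge1) (use that p in auto)
    also have "\<dots> \<le> L * \<bar>s - t\<bar>" using L by (intro mult_left_mono) auto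
    finally show ?thesis .
  qed
  have meas: "(\<lambda>s. (max s 0 + e) powr q - k) \<in> borel_measurable borel" for e q k :: real by measurable
  define F where "F = (\<lambda>x. u x powr p)"
  have "(\<lambda>x. (max (u x) 0 + 0) powr p - 0) \<in> dom D"
    by (rule dom_comp_lipschitz(1)[OF u(1) uN N1 L, where T = "\<lambda>s. (max s 0 + 0) powr p - 0"])
      (use lip[of _ _ 0] p meas in auto)
  moreover have "max (u x) 0 = u x" for x using u(3)[of x] by simp
  ultimately show Fd: "(\<lambda>x. u x powr p) \<in> dom D" by simp
  show "form D (\<lambda>x. u x powr p) \<phi> \<le> 0" if \<phi>: "\<phi> \<in> tests K" for \<phi>
  proof (rule tests_unbounded[OF Fd _ \<phi>])
    fix \<phi> N' assume \<phi>: "\<phi> \<in> tests K" and N': "AE x in M. \<bar>\<phi> x\<bar> \<le> N'"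
    have \<phi>d: "\<phi> \<in> dom D" and \<phi>0: "AE x in M. 0 \<le> \<phi> x" and \<phi>K: "AE x in M. x \<notin> K \<longrightarrow> \<phi> x = 0"
      using \<phi> by (auto simp: tests_def)
    define e where "e n = 1 / real (Suc n)" for n
    have e: "0 < e n" "e n \<le> 1" for n by (auto simp: e_def)
    have e_lim: "e \<longlonglongrightarrow> 0" unfolding e_def using LIMSEQ_inverse_real_of_nat by (simp add: inverse_eq_divide)
    define \<Phi> where "\<Phi> n s = (max s 0 + e n) powr p - e n powr p" for n s
    define \<Phi>' where "\<Phi>' n s = p * (max s 0 + e n) powr (p - 1)" for n s
    have \<Phi>d: "(\<lambda>x. \<Phi> n (u x)) \<in> dom D" "form D (\<lambda>x. \<Phi> n (u x)) (\<lambda>x. \<Phi> n (u x)) \<le> L\<^sup>2 * form D u u" for n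
      unfolding \<Phi>_def
      by (rule dom_comp_lipschitz[OF u(1) uN N1 L]; use lip[of _ _ "e n"] e[of n] meas in simp)+
    define L' where "L' n = p * (\<bar>p - 1\<bar> * max (e n powr (p - 1 - 1)) ((N1 + e n) powr (p - 1 - 1)))" for n
    have L': "L' n > 0" for n
      using e[of n] p by (auto simp: L'_def intro!: mult_pos_pos max.strict_coboundedI1)
    have lip': "\<bar>\<Phi>' n s - \<Phi>' n t\<bar> \<le> L' n * \<bar>s - t\<bar>" if "\<bar>s\<bar> \<le> N1" "\<bar>t\<bar> \<le> N1" for n s t
    proof -
      have "\<bar>(max s 0 + e n) powr (p - 1) - (max t 0 + e n) powr (p - 1)\<bar>
          \<le> \<bar>p - 1\<bar> * max (e n powr (p - 1 - 1)) ((N1 + e n) powr (p - 1 - 1)) * \<bar>(max s 0 + e n) - (max t 0 + e n)\<bar>"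
        by (rule powr_lipschitz) (use that e[of n] in auto)
      also have "\<dots> \<le> \<bar>p - 1\<bar> * max (e n powr (p - 1 - 1)) ((N1 + e n) powr (p - 1 - 1)) * \<bar>s - t\<bar>"
        by (intro mult_left_mono) (auto simp: le_max_iff_disj)
      finally have "p * \<bar>(max s 0 + e n) powr (p - 1) - (max t 0 + e n) powr (p - 1)\<bar> \<le> L' n * \<bar>s - t\<bar>"
        using p by (simp add: L'_def mult.assoc)
      moreover have "\<bar>\<Phi>' n s - \<Phi>' n t\<bar> = p * \<bar>(max s 0 + e n) powr (p - 1) - (max t 0 + e n) powr (p - 1)\<bar>"
        using p by (simp add: \<Phi>'_def abs_mult flip: right_diff_distrib)
      ultimately show ?thesis by simp
    qed
    have meas': "(\<lambda>s. \<Phi>' n s - \<Phi>' n 0) \<in> borel_measurable borel" "\<Phi>' n \<in> borel_measurable borel" for n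
      unfolding \<Phi>'_def by measurable
    have \<Phi>'d: "(\<lambda>x. \<Phi>' n (u x) - \<Phi>' n 0) \<in> dom D" for n
      by (rule dom_comp_lipschitz(1)[OF u(1) uN N1 L', where T = "\<lambda>s. \<Phi>' n s - \<Phi>' n 0"])
        (use lip' meas' in auto)
    have \<Phi>'0: "\<Phi>' n s \<ge> 0" for n s using p by (simp add: \<Phi>'_def)
    show "form D (\<lambda>x. u x powr p) \<phi> \<le> 0"
    proof (rule form_le_of_limit(2)[OF \<Phi>d _ dom_L2[OF Fd] \<phi>d])
      fix n
      define B where "B = Max {N1, N', 1, L * N1, \<Phi>' n 0 + L' n * N1, L' n * N1}"
      have B: "N1 \<le> B" "N' \<le> B" "L * N1 \<le> B" "\<Phi>' n 0 + L' n * N1 \<le> B" "L' n * N1 \<le> B"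
        by (auto simp: B_def)
      have bu: "AE x in M. \<bar>u x\<bar> \<le> B" "AE x in M. \<bar>\<phi> x\<bar> \<le> B"
        using uN N' B by (auto elim!: AE_mp)
      have b1: "AE x in M. \<bar>\<Phi>' n (u x) - \<Phi>' n 0\<bar> \<le> B"
        using uN
      proof eventually_elim
        case (elim x)
        have "\<bar>\<Phi>' n (u x) - \<Phi>' n 0\<bar> \<le> L' n * \<bar>u x - 0\<bar>" by (rule lip') (use elim N1 in auto)
        also have "\<dots> \<le> L' n * N1" using elim L'[of n] by (intro mult_left_mono) auto
        finally show ?case using B by simp
      qed
      have b2: "AE x in M. \<bar>\<Phi>' n (u x)\<bar> \<le> B"
        using uN
      proof eventually_elim
        case (elim x)
        have "\<bar>\<Phi>' n (u x) - \<Phi>' n 0\<bar> \<le> L' n * \<bar>u x - 0\<bar>" by (rule lip') (use elim N1 in auto)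
        also have "\<dots> \<le> L' n * N1" using elim L'[of n] by (intro mult_left_mono) auto
        finally show ?case using B \<Phi>'0[of n "u x"] by linarith
      qed
      have b3: "AE x in M. \<bar>\<Phi> n (u x)\<bar> \<le> B"
        using uN
      proof eventually_elim
        case (elim x)
        have "\<bar>\<Phi> n (u x)\<bar> \<le> L * \<bar>u x - 0\<bar>" using lip[of "u x" 0 "e n"] e[of n] elim N1 by (simp add: \<Phi>_def)
        also have "\<dots> \<le> L * N1" using elim L by (intro mult_left_mono) auto
        finally show ?case using B by simp
      qed
      \<comment> \<open>\<open>\<Phi>' n\<close> does not vanish at 0 and constants need not lie in
        the domain, so the value at 0 is split off and restored as a multiple of
        \<open>\<phi>\<close>.\<close>
      have "(\<lambda>x. (\<Phi>' n (u x) - \<Phi>' n 0) * \<phi> x) \<in> dom D" by (rule dom_mult[OF \<Phi>'d b1 \<phi>d bu(2)])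
      then have "(\<lambda>x. (\<Phi>' n (u x) - \<Phi>' n 0) * \<phi> x) + \<Phi>' n 0 *\<^sub>R \<phi> \<in> dom D" using \<phi>d by (intro E.V_closed)
      moreover have "(\<lambda>x. (\<Phi>' n (u x) - \<Phi>' n 0) * \<phi> x) + \<Phi>' n 0 *\<^sub>R \<phi> = (\<lambda>x. \<Phi>' n (u x) * \<phi> x)"
        by (simp add: fun_eq_iff algebra_simps)
      ultimately have prod: "(\<lambda>x. \<Phi>' n (u x) * \<phi> x) \<in> dom D" by simp
      have "AE x in M. 0 \<le> \<Phi>' n (u x) * \<phi> x" using \<phi>0 by eventually_elim (simp add: \<Phi>'0)
      moreover have "AE x in M. x \<notin> K \<longrightarrow> \<Phi>' n (u x) * \<phi> x = 0" using \<phi>K by eventually_elim simp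
      ultimately have prod_test: "(\<lambda>x. \<Phi>' n (u x) * \<phi> x) \<in> tests K" using prod by (simp add: tests_def)
      have cont: "continuous_on {0..} (\<Phi> n)" "continuous_on {0..} (\<Phi>' n)"
        unfolding \<Phi>_def \<Phi>'_def using e[of n]
        by (auto intro!: continuous_intros simp: add_nonneg_pos less_imp_neq[THEN not_sym])
      have "form D (\<lambda>x. \<Phi> n (u x)) \<phi> \<le> form D u (\<lambda>x. \<Phi>' n (u x) * \<phi> x)"
      proof (rule form_convex_le[OF u(1) bu(1) closed_atLeast _ _ \<phi>d bu(2) \<phi>0 cont meas'(2) _ b3 b2 _ \<Phi>d(1) prod])
        show "\<Phi> n 0 = 0" by (simp add: \<Phi>_def)
        fix s t :: real assume "s \<in> {0..}" "t \<in> {0..}"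
        then show "\<Phi> n s - \<Phi> n t \<le> \<Phi>' n s * (s - t)"
          using powr_tangent[of "s + e n" "t + e n" p] e[of n] p by (simp add: \<Phi>_def \<Phi>'_def)
      qed (use u(3) in auto)
      also have "\<dots> \<le> 0" by (rule sub[OF prod_test])
      finally show "form D (\<lambda>x. \<Phi> n (u x)) \<phi> \<le> 0" .
    next
      \<comment> \<open>One \<open>L * e n\<close> for the shift of the argument, one for the
        subtracted constant \<open>e n powr p\<close>.\<close>
      have "(\<lambda>n. \<bar>2 * L * e n\<bar> * nrm (\<lambda>x. 1)) \<longlonglongrightarrow> \<bar>2 * L * 0\<bar> * nrm (\<lambda>x. 1)" by (intro tendsto_intros e_lim)
      then have lim0: "(\<lambda>n. \<bar>2 * L * e n\<bar> * nrm (\<lambda>x. 1)) \<longlonglongrightarrow> 0" by simp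
      show "(\<lambda>n. nrm ((\<lambda>x. \<Phi> n (u x)) - (\<lambda>x. u x powr p))) \<longlonglongrightarrow> 0"
      proof (rule Lim_null_comparison[OF always_eventually lim0], rule allI)
        fix n
        have Ld: "(\<lambda>x. \<Phi> n (u x)) - (\<lambda>x. u x powr p) \<in> L2 M"
          using dom_L2[OF \<Phi>d(1)] dom_L2[OF Fd] by (rule L2.V_closed)
        have "nrm ((\<lambda>x. \<Phi> n (u x)) - (\<lambda>x. u x powr p)) \<le> \<bar>2 * L * e n\<bar> * nrm (\<lambda>x. 1)"
        proof (rule nrm_uniform(2)[OF L2_measurable[OF Ld]])
          show "AE x in M. \<bar>((\<lambda>x. \<Phi> n (u x)) - (\<lambda>x. u x powr p)) x\<bar> \<le> 2 * L * e n"
            using uN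
          proof eventually_elim
            case (elim x)
            have 1: "\<bar>(u x + e n) powr p - u x powr p\<bar> \<le> L * \<bar>(u x + e n) - u x\<bar>"
              unfolding L_def by (rule powr_lipschitz_ge1) (use elim u(3)[of x] e[of n] p in auto)
            have 2: "\<bar>e n powr p - 0 powr p\<bar> \<le> L * \<bar>e n - 0\<bar>"
              unfolding L_def by (rule powr_lipschitz_ge1) (use e[of n] N1 p in auto)
            have eq: "((\<lambda>x. \<Phi> n (u x)) - (\<lambda>x. u x powr p)) x = ((u x + e n) powr p - u x powr p) - (e n powr p - 0 powr p)"
              using u(3)[of x] by (simp add: \<Phi>_def)
            have "\<bar>((u x + e n) powr p - u x powr p) - (e n powr p - 0 powr p)\<bar>
                \<le> \<bar>(u x + e n) powr p - u x powr p\<bar> + \<bar>e n powr p - 0 powr p\<bar>"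
              by (rule abs_triangle_ineq4)
            also have "\<dots> \<le> L * e n + L * e n"
              using 1 2 e[of n] by (intro add_mono) simp_all
            finally show ?case unfolding eq by simp
          qed
        qed
        then show "norm (nrm ((\<lambda>x. \<Phi> n (u x)) - (\<lambda>x. u x powr p))) \<le> \<bar>2 * L * e n\<bar> * nrm (\<lambda>x. 1)" using Ld by simp
      qed
    qed
  qed
qed

text \<open>Testing with \<open>\<omega>\<^sup>2 u powr (2 p - 1)\<close>; this is where \<open>p > 1/2\<close> enters.\<close>

lemma small_power_cutoff_dom:
  assumes u: "u \<in> dom D" "\<And>x. 0 \<le> u x" "\<And>x. u x \<le> N" and p: "1/2 < p" "p < 1"
    and sub: "\<And>\<phi>. \<phi> \<in> tests K \<Longrightarrow> form D u \<phi> \<le> 0"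
    and \<omega>: "\<omega> \<in> dom D" "\<And>x. 0 \<le> \<omega> x" "\<And>x. \<omega> x \<le> 1" "AE x in M. x \<notin> K \<longrightarrow> \<omega> x = 0"
  shows "(\<lambda>x. \<omega> x * u x powr p) \<in> dom D"
proof -
  have N: "N \<ge> 0" using u(2,3) order_trans by blast
  have uN: "AE x in M. \<bar>u x\<bar> \<le> N" using u by simp
  define r where "r = 2 * p - 1"
  have r: "0 < r" "r < 1" using p by (auto simp: r_def)
  define P where "P = (N + 1) powr p"
  \<comment> \<open>The bound of \<open>\<Theta>\<close> divided by a lower bound for the slope of
    \<open>\<Psi>\<close> on the range of \<open>u\<close>, as \<open>low\<close> demands.\<close>
  define \<kappa> where "\<kappa> = p\<^sup>2 / r * (N + 1) powr r / (p * (N + 1) powr (p - 1))"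
  have \<kappa>: "\<kappa> > 0" using p r N by (simp add: \<kappa>_def)
  define C where "C = 8 * \<kappa>\<^sup>2 + 4 * \<kappa> * P + 2 * P\<^sup>2"
  define e where "e n = 1 / real (Suc n)" for n
  have e: "0 < e n" "e n \<le> 1" for n by (auto simp: e_def)
  have e_lim: "e \<longlonglongrightarrow> 0" unfolding e_def using LIMSEQ_inverse_real_of_nat by (simp add: inverse_eq_divide)
  define \<Psi> where "\<Psi> n s = (max s 0 + e n) powr p - e n powr p" for n s
  \<comment> \<open>Both functions are normalised to vanish at 0, and for positive arguments the
    derivative of \<open>\<Theta> n\<close> is the square of that of
    \<open>\<Psi> n\<close>.\<close>
  define \<Theta> where "\<Theta> n s = p\<^sup>2 / r * ((max s 0 + e n) powr r - e n powr r)" for n s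
  have \<Psi>: "0 \<le> \<Psi> n s" "\<Psi> n s \<le> P" if s: "s \<in> {0..N}" for n s
  proof -
    have "e n powr p \<le> (s + e n) powr p" "(s + e n) powr p \<le> (N + 1) powr p"
      using s e[of n] p by (auto intro!: powr_mono2)
    moreover have "0 \<le> e n powr p" by simp
    ultimately show "0 \<le> \<Psi> n s" "\<Psi> n s \<le> P" using s unfolding \<Psi>_def P_def by (simp_all, linarith)
  qed
  have \<Theta>: "0 \<le> \<Theta> n s" "\<Theta> n s \<le> p\<^sup>2 / r * (N + 1) powr r" if s: "s \<in> {0..N}" for n s
  proof -
    have "e n powr r \<le> (s + e n) powr r" "(s + e n) powr r \<le> (N + 1) powr r" "0 \<le> e n powr r"
      using s e[of n] r by (auto intro!: powr_mono2)
    moreover from this have "(s + e n) powr r - e n powr r \<le> (N + 1) powr r" by linarith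
    then have "p\<^sup>2 / r * ((s + e n) powr r - e n powr r) \<le> p\<^sup>2 / r * (N + 1) powr r"
      using r by (intro mult_left_mono) auto
    ultimately show "0 \<le> \<Theta> n s" "\<Theta> n s \<le> p\<^sup>2 / r * (N + 1) powr r"
      using s r unfolding \<Theta>_def by auto
  qed
  have sq: "(\<Psi> n s - \<Psi> n t)\<^sup>2 \<le> (s - t) * (\<Theta> n s - \<Theta> n t)" if "s \<in> {0..N}" "t \<in> {0..N}" "t \<le> s" for n s t
    using powr_square_diff[of "t + e n" "s + e n" p] that e[of n] p
    by (simp add: \<Psi>_def \<Theta>_def r_def right_diff_distrib)
  have low: "(s - t) * \<Theta> n t \<le> \<kappa> * (\<Psi> n s - \<Psi> n t)" if st: "s \<in> {0..N}" "t \<in> {0..N}" "t \<le> s" for n s t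
  proof -
    have "p * (N + 1) powr (p - 1) * ((s + e n) - (t + e n)) \<le> (s + e n) powr p - (t + e n) powr p"
      by (rule powr_diff_lower) (use st e[of n] p in auto)
    then have "\<kappa> * (p * (N + 1) powr (p - 1) * (s - t)) \<le> \<kappa> * (\<Psi> n s - \<Psi> n t)"
      using \<kappa> st by (intro mult_left_mono) (auto simp: \<Psi>_def)
    moreover have "\<kappa> * (p * (N + 1) powr (p - 1) * (s - t)) = (s - t) * (p\<^sup>2 / r * (N + 1) powr r)"
      using p N by (simp add: \<kappa>_def)
    moreover have "(s - t) * \<Theta> n t \<le> (s - t) * (p\<^sup>2 / r * (N + 1) powr r)"
      using \<Theta>(2)[OF st(2)] st by (intro mult_left_mono) auto
    ultimately show ?thesis by linarith
  qed
  have comp: "(\<lambda>x. (max (u x) 0 + e n) powr q - e n powr q) \<in> dom D" if q: "0 < q" for n q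
  proof (rule dom_comp_lipschitz(1)[OF u(1) uN N])
    let ?L = "\<bar>q\<bar> * max (e n powr (q - 1)) ((N + e n) powr (q - 1))"
    show "?L > 0" using e[of n] q by (auto intro!: mult_pos_pos max.strict_coboundedI1)
    fix s t :: real assume st: "\<bar>s\<bar> \<le> N" "\<bar>t\<bar> \<le> N"
    have "\<bar>(max s 0 + e n) powr q - (max t 0 + e n) powr q\<bar> \<le> ?L * \<bar>(max s 0 + e n) - (max t 0 + e n)\<bar>"
      by (rule powr_lipschitz) (use st e[of n] in auto)
    also have "\<dots> \<le> ?L * \<bar>s - t\<bar>" by (intro mult_left_mono) (auto simp: le_max_iff_disj)
    finally show "\<bar>((max s 0 + e n) powr q - e n powr q) - ((max t 0 + e n) powr q - e n powr q)\<bar> \<le> ?L * \<bar>s - t\<bar>" by simp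
  qed auto
  have \<Psi>d: "(\<lambda>x. \<Psi> n (u x)) \<in> dom D" for n using comp[of p n] p by (simp add: \<Psi>_def)
  have \<Theta>d: "(\<lambda>x. \<Theta> n (u x)) \<in> dom D" for n
    using E.V_closed(4)[OF comp[of r n], of "p\<^sup>2 / r"] r by (simp add: \<Theta>_def scaleR_fun_def)
  have uI: "u x \<in> {0..N}" for x using u by simp
  define B where "B = Max {P, p\<^sup>2 / r * (N + 1) powr r, N, 1}"
  have B: "P \<le> B" "p\<^sup>2 / r * (N + 1) powr r \<le> B" "1 \<le> B" "N \<le> B" by (auto simp: B_def)
  have \<omega>b: "\<bar>\<omega> x\<bar> \<le> 1" for x using \<omega>(2,3)[of x] by simp
  have \<Psi>b: "\<bar>\<Psi> n (u x)\<bar> \<le> B" and \<Theta>b: "\<bar>\<Theta> n (u x)\<bar> \<le> B" for n x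
    using \<Psi>[OF uI, of n x] \<Theta>[OF uI, of n x] B by auto
  have \<omega>B: "\<bar>\<omega> x\<bar> \<le> B" for x using \<omega>b[of x] B(3) by linarith
  have \<omega>\<Psi>: "(\<lambda>x. \<omega> x * \<Psi> n (u x)) \<in> dom D" for n
    by (rule dom_mult[OF \<omega>(1) _ \<Psi>d]) (use \<omega>B \<Psi>b in auto)
  have \<omega>2: "(\<lambda>x. \<omega> x * \<omega> x) \<in> dom D" by (rule dom_mult[OF \<omega>(1) _ \<omega>(1)]) (use \<omega>b in auto)
  have \<omega>2b: "\<bar>\<omega> x * \<omega> x\<bar> \<le> 1" for x unfolding abs_mult using \<omega>b by (intro mult_le_one) auto
  have \<omega>2B: "\<bar>\<omega> x * \<omega> x\<bar> \<le> B" for x using \<omega>2b[of x] B(3) by linarith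
  have \<omega>\<Theta>: "(\<lambda>x. (\<omega> x * \<omega> x) * \<Theta> n (u x)) \<in> dom D" for n
    by (rule dom_mult[OF \<omega>2 _ \<Theta>d]) (use \<omega>2B \<Theta>b in auto)
  have test: "(\<lambda>x. (\<omega> x * \<omega> x) * \<Theta> n (u x)) \<in> tests K" for n
  proof -
    have "AE x in M. x \<notin> K \<longrightarrow> (\<omega> x * \<omega> x) * \<Theta> n (u x) = 0" using \<omega>(4) by eventually_elim simp
    moreover have "0 \<le> (\<omega> x * \<omega> x) * \<Theta> n (u x)" for x using \<Theta>(1)[OF uI] by simp
    ultimately show ?thesis using \<omega>\<Theta> by (simp add: tests_def)
  qed
  have energy: "form D (\<lambda>x. \<omega> x * \<Psi> n (u x)) (\<lambda>x. \<omega> x * \<Psi> n (u x)) \<le> C * form D \<omega> \<omega>" for n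
  proof -
    \<comment> \<open>The three terms of \<open>caccioppoli_two_point\<close>: \<open>4 u\<close>
      against \<open>\<omega>\<^sup>2 \<Theta>(u)\<close>, \<open>C \<omega>\<close> against
      \<open>\<omega>\<close>, and minus the energy of \<open>\<omega> \<Psi>(u)\<close>.\<close>
    define K3 where "K3 = {0::nat, 1, 2}"
    define \<alpha> where "\<alpha> k \<eta> = (if k = 0 then 4 * fst \<eta> else if k = 1 then C * snd \<eta> else - (snd \<eta> * \<Psi> n (fst \<eta>)))"
      for k :: nat and \<eta> :: "real \<times> real"
    define \<beta> where "\<beta> k \<eta> = (if k = 0 then (snd \<eta> * snd \<eta>) * \<Theta> n (fst \<eta>) else if k = 1 then snd \<eta> else snd \<eta> * \<Psi> n (fst \<eta>))"
      for k :: nat and \<eta> :: "real \<times> real"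
    define S where "S = {0..N} \<times> {0..1::real}"
    define \<xi> where "\<xi> x = (u x, \<omega> x)" for x
    have d4: "(\<lambda>x. 4 * u x) \<in> dom D" "(\<lambda>x. C * \<omega> x) \<in> dom D" "(\<lambda>x. - (\<omega> x * \<Psi> n (u x))) \<in> dom D"
      using E.V_closed(4)[OF u(1), of 4] E.V_closed(4)[OF \<omega>(1), of C] E.V_closed(5)[OF \<omega>\<Psi>[of n]]
      by (simp_all add: scaleR_fun_def fun_Compl_def)
    have "0 \<le> (\<Sum>k\<in>K3. form D (\<lambda>x. \<alpha> k (\<xi> x)) (\<lambda>x. \<beta> k (\<xi> x)))"
    proof (rule two_point_energy)
      show "closed S" unfolding S_def by (intro closed_Times closed_atLeastAtMost)
      show "\<xi> x \<in> S" for x using uI \<omega> by (simp add: \<xi>_def S_def)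
      have c: "continuous_on UNIV (\<Psi> n)" "continuous_on UNIV (\<Theta> n)"
        unfolding \<Psi>_def \<Theta>_def using e[of n] r
        by (auto intro!: continuous_intros simp: add_nonneg_pos less_imp_neq[THEN not_sym])
      have cf: "continuous_on S (\<lambda>\<eta>. \<Psi> n (fst \<eta>))" "continuous_on S (\<lambda>\<eta>. \<Theta> n (fst \<eta>))"
        by (rule continuous_on_compose2[OF c(1)] continuous_on_compose2[OF c(2)]; auto intro!: continuous_intros)+
      show "continuous_on S (\<alpha> k)" for k
        unfolding \<alpha>_def by (cases "k = 0"; cases "k = 1") (auto intro!: continuous_intros cf)
      show "continuous_on S (\<beta> k)" for k
        unfolding \<beta>_def by (cases "k = 0"; cases "k = 1") (auto intro!: continuous_intros cf)
      show dA: "(\<lambda>x. \<alpha> k (\<xi> x)) \<in> dom D" for k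
        by (cases "k = 0"; cases "k = 1") (use d4 in \<open>simp_all add: \<alpha>_def \<xi>_def\<close>)
      show dB: "(\<lambda>x. \<beta> k (\<xi> x)) \<in> dom D" for k
        by (cases "k = 0"; cases "k = 1") (use \<omega> \<omega>\<Theta> \<omega>\<Psi> in \<open>simp_all add: \<beta>_def \<xi>_def\<close>)
      show "(\<lambda>x. \<alpha> k (\<xi> x) * \<beta> k (\<xi> x)) \<in> L2 M" for k
      proof (rule bounded_L2)
        show "(\<lambda>x. \<alpha> k (\<xi> x) * \<beta> k (\<xi> x)) \<in> borel_measurable M"
          using dom_measurable[OF dA] dom_measurable[OF dB] by measurable
        have "\<bar>\<alpha> k (\<xi> x)\<bar> \<le> 4 * B + \<bar>C\<bar> + B \<and> \<bar>\<beta> k (\<xi> x)\<bar> \<le> B + 1 + B" for x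
        proof -
          have 1: "\<bar>4 * u x\<bar> \<le> 4 * B" using u(2,3)[of x] B(4) by simp
          have 2: "\<bar>C * \<omega> x\<bar> \<le> \<bar>C\<bar>" unfolding abs_mult using \<omega>b by (simp add: mult_left_le)
          have 3: "\<bar>\<omega> x * \<Psi> n (u x)\<bar> \<le> 1 * B" unfolding abs_mult using \<omega>b \<Psi>b by (intro mult_mono) auto
          have 4: "\<bar>\<omega> x * \<omega> x * \<Theta> n (u x)\<bar> \<le> 1 * B"
            unfolding abs_mult[of "\<omega> x * \<omega> x"] using \<omega>2b \<Theta>b by (intro mult_mono) auto
          show ?thesis
            using 1 2 3 4 \<omega>b[of x] B(3) unfolding \<alpha>_def \<beta>_def \<xi>_def by (auto simp del: abs_mult)
        qed
        then have "\<bar>\<alpha> k (\<xi> x)\<bar> * \<bar>\<beta> k (\<xi> x)\<bar> \<le> (4 * B + \<bar>C\<bar> + B) * (B + 1 + B)" for x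
          using B(3) by (intro mult_mono) auto
        then show "AE x in M. \<bar>\<alpha> k (\<xi> x) * \<beta> k (\<xi> x)\<bar> \<le> (4 * B + \<bar>C\<bar> + B) * (B + 1 + B)"
          by (simp add: abs_mult)
      qed
      have two: "(\<sigma> * \<Psi> n a - \<tau> * \<Psi> n b)\<^sup>2 \<le> 4 * ((a - b) * (\<sigma>\<^sup>2 * \<Theta> n a - \<tau>\<^sup>2 * \<Theta> n b)) + C * (\<sigma> - \<tau>)\<^sup>2"
        if "0 \<le> \<sigma>" "0 \<le> \<tau>" "a \<in> {0..N}" "b \<in> {0..N}" for \<sigma> \<tau> a b
        unfolding C_def by (rule caccioppoli_two_point[OF \<Psi> sq low \<Theta>(1) \<kappa> that])
      fix \<eta> \<zeta> assume \<eta>: "\<eta> \<in> S"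
      obtain a \<sigma> where \<eta>': "\<eta> = (a, \<sigma>)" by (cases \<eta>)
      have a: "a \<in> {0..N}" "0 \<le> \<sigma>" using \<eta> by (auto simp: \<eta>' S_def)
      \<comment> \<open>The killing inequality is the two-point inequality against the point
        \<open>(0, 0)\<close>, at which \<open>\<Psi>\<close> and \<open>\<Theta>\<close>
        vanish.\<close>
      show "0 \<le> (\<Sum>k\<in>K3. \<alpha> k \<eta> * \<beta> k \<eta>)"
        using two[OF a(2) order_refl a(1), of 0] N
        by (simp add: K3_def \<alpha>_def \<beta>_def \<eta>' \<Psi>_def[of n 0] \<Theta>_def[of n 0] power2_eq_square algebra_simps)
      assume \<zeta>: "\<zeta> \<in> S"
      obtain b \<tau> where \<zeta>': "\<zeta> = (b, \<tau>)" by (cases \<zeta>)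
      have b: "b \<in> {0..N}" "0 \<le> \<tau>" using \<zeta> by (auto simp: \<zeta>' S_def)
      show "0 \<le> (\<Sum>k\<in>K3. (\<alpha> k \<eta> - \<alpha> k \<zeta>) * (\<beta> k \<eta> - \<beta> k \<zeta>))"
        using two[OF a(2) b(2) a(1) b(1)]
        by (simp add: K3_def \<alpha>_def \<beta>_def \<eta>' \<zeta>' power2_eq_square algebra_simps)
    qed (simp add: K3_def)
    also have "\<dots> = form D (4 *\<^sub>R u) (\<lambda>x. (\<omega> x * \<omega> x) * \<Theta> n (u x)) + form D (C *\<^sub>R \<omega>) \<omega>
        + form D (- (\<lambda>x. \<omega> x * \<Psi> n (u x))) (\<lambda>x. \<omega> x * \<Psi> n (u x))"
      by (simp add: K3_def \<alpha>_def \<beta>_def \<xi>_def scaleR_fun_def fun_Compl_def)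
    also have "\<dots> = 4 * form D u (\<lambda>x. (\<omega> x * \<omega> x) * \<Theta> n (u x)) + C * form D \<omega> \<omega>
        - form D (\<lambda>x. \<omega> x * \<Psi> n (u x)) (\<lambda>x. \<omega> x * \<Psi> n (u x))"
      using u(1) \<omega>(1) \<omega>\<Theta> \<omega>\<Psi> by (simp add: E.ip_scale E.ip_minus)
    finally show ?thesis using sub[OF test[of n]] by linarith
  qed
  have um: "u \<in> borel_measurable M" "\<omega> \<in> borel_measurable M" using dom_measurable u(1) \<omega>(1) by auto
  have lim: "(\<lambda>n. nrm ((\<lambda>x. \<omega> x * \<Psi> n (u x)) - (\<lambda>x. \<omega> x * u x powr p))) \<longlonglongrightarrow> 0"
    and FL: "(\<lambda>x. \<omega> x * u x powr p) \<in> L2 M"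
  proof -
    have m1: "(\<lambda>x. \<omega> x * \<Psi> n (u x)) \<in> borel_measurable M" for n using dom_measurable[OF \<omega>\<Psi>] .
    have m2: "(\<lambda>x. \<omega> x * u x powr p) \<in> borel_measurable M" using um by measurable
    have bd: "AE x in M. \<bar>\<omega> x * \<Psi> n (u x)\<bar> \<le> 1 * B" for n
      unfolding abs_mult using \<omega>b \<Psi>b by (intro AE_I2 mult_mono) auto
    have "(\<lambda>n. \<omega> x * \<Psi> n (u x)) \<longlonglongrightarrow> \<omega> x * u x powr p" for x
    proof -
      have "(\<lambda>n. (u x + e n) powr p - e n powr p) \<longlonglongrightarrow> (u x + 0) powr p - 0 powr p"
        using e_lim p u(2)[of x] less_imp_le[OF e(1)]
        by (intro tendsto_diff tendsto_powr2 tendsto_add tendsto_const always_eventually) auto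
      then have "(\<lambda>n. \<Psi> n (u x)) \<longlonglongrightarrow> u x powr p" using u(2)[of x] p by (simp add: \<Psi>_def)
      then show ?thesis by (intro tendsto_mult tendsto_const)
    qed
    then have AElim: "AE x in M. (\<lambda>n. \<omega> x * \<Psi> n (u x)) \<longlonglongrightarrow> \<omega> x * u x powr p" by simp
    note dc = L2_dominated_convergence[OF L2_const[of "1 * B"] m1 m2 bd AElim]
    show "(\<lambda>n. nrm ((\<lambda>x. \<omega> x * \<Psi> n (u x)) - (\<lambda>x. \<omega> x * u x powr p))) \<longlonglongrightarrow> 0" by (rule dc(3))
    show "(\<lambda>x. \<omega> x * u x powr p) \<in> L2 M" by (rule dc(1))
  qed
  \<comment> \<open>Only membership is wanted, so the pairing is taken with the zero
    function.\<close>
  show ?thesis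
    by (rule form_le_of_limit(1)[OF \<omega>\<Psi> energy _ FL E.V_closed(1) lim, where c = 0]) (use \<omega>\<Psi> in simp)
qed

end

section \<open>Restriction to relatively compact open sets\<close>

lemma compact_open_between:
  assumes X: "locally_compact_space X" "Hausdorff_space X" and K: "compactin X K" and U: "openin X U" "K \<subseteq> U"
  obtains V where "openin X V" "K \<subseteq> V" "compactin X (X closure_of V)" "X closure_of V \<subseteq> U"
proof -
  have "neighbourhood_base_of (\<lambda>C. compactin X C \<and> closedin X C) X"
    using locally_compact_space_neighbourhood_base_closedin[of X] X by blast
  then have "\<forall>x\<in>K. \<exists>A C. openin X A \<and> (compactin X C \<and> closedin X C) \<and> x \<in> A \<and> A \<subseteq> C \<and> C \<subseteq> U"
    using U unfolding neighbourhood_base_of by blast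
  then obtain A C where AC: "\<And>x. x \<in> K \<Longrightarrow> openin X (A x) \<and> compactin X (C x) \<and> closedin X (C x) \<and> x \<in> A x \<and> A x \<subseteq> C x \<and> C x \<subseteq> U"
    by metis
  have "Ball (A ` K) (openin X)" "K \<subseteq> \<Union>(A ` K)" using AC by blast+
  then obtain \<F> where "finite \<F>" "\<F> \<subseteq> A ` K" "K \<subseteq> \<Union>\<F>"
    using K unfolding compactin_def by meson
  then obtain F where F: "finite F" "F \<subseteq> K" "K \<subseteq> (\<Union>x\<in>F. A x)"
    using finite_subset_image[of \<F> A K] by auto
  define V where "V = (\<Union>x\<in>F. A x)"
  define L where "L = (\<Union>x\<in>F. C x)"
  have L: "compactin X L" "closedin X L" "L \<subseteq> U" "V \<subseteq> L"
    unfolding L_def V_def using F AC by (auto intro!: compactin_Union closedin_Union) blast+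
  have cl: "X closure_of V \<subseteq> L" by (rule closure_of_minimal[OF L(4,2)])
  have "openin X V" unfolding V_def using F AC by blast
  moreover have "compactin X (X closure_of V)" by (rule closed_compactin[OF L(1) cl closedin_closure_of])
  ultimately show ?thesis using that[of V] F(3) cl L(3) by (auto simp: V_def)
qed

lemma closed_form_iff:
  "closed_form D \<longleftrightarrow>
     (\<forall>u. (\<forall>n::nat. u n \<in> dom D) \<and>
        (\<forall>\<epsilon>>0. \<exists>N. \<forall>m\<ge>N. \<forall>n\<ge>N. form1 D (u m - u n) (u m - u n) < \<epsilon>) \<longrightarrow>
        (\<exists>v\<in>dom D. (\<lambda>n. form1 D (u n - v) (u n - v)) \<longlonglongrightarrow> 0))"
  unfolding closed_form_def fun_diff_def by (rule refl)

section \<open>Cutoff functions, supports and the core\<close>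

locale sl_dirichlet =
  fixes D :: "'a form_space"
  assumes sld: "strongly_local_dirichlet_space D"
begin

abbreviation "X \<equiv> Top D"
abbreviation "M \<equiv> Meas D"

lemma
  shows lc: "locally_compact_space X" and metrizable: "metrizable_space X" and radon: "radon_measure X M"
    and nns: "nonneg_symmetric_form D" and dns: "densely_defined D" and clD: "closed_form D"
    and mkD: "markov_form D" and reg: "regular_form D" and loc: "strongly_local_form D"
  using sld unfolding strongly_local_dirichlet_space_def by blast+

lemma hausdorff: "Hausdorff_space X"
  by (rule metrizable_imp_Hausdorff_space[OF metrizable])

sublocale E: semi_inner "dom D" "form D"
  by (rule semi_inner_form[OF nns densely_defined_nonempty[OF dns]])

lemma space_M: "space M = topspace X"
  and sets_open: "openin X V \<Longrightarrow> V \<in> sets M"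
  and compact_finite: "compactin X K \<Longrightarrow> emeasure M K < \<infinity>"
  and inner_regular: "A \<in> sets M \<Longrightarrow> emeasure M A = (SUP K\<in>{K. compactin X K \<and> K \<subseteq> A}. emeasure M K)"
  using radon by (auto simp: radon_measure_def)

lemma compact_closed: "compactin X K \<Longrightarrow> closedin X K"
  by (rule compactin_imp_closedin[OF hausdorff])

lemma sets_closed: "closedin X K \<Longrightarrow> K \<in> sets M"
proof -
  assume K: "closedin X K"
  then have "K = space M - (topspace X - K)" using closedin_subset by (auto simp: space_M)
  moreover have "topspace X - K \<in> sets M" using K by (intro sets_open) auto
  ultimately show ?thesis by (metis sets.compl_sets)
qed

lemma dom_sub: "u \<in> dom D \<Longrightarrow> u \<in> L2 M"
  using nns by (auto simp: nonneg_symmetric_form_def)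

lemma dom_congD: "u \<in> dom D \<Longrightarrow> v \<in> borel_measurable M \<Longrightarrow> AE x in M. u x = v x \<Longrightarrow> v \<in> dom D"
  using nns unfolding nonneg_symmetric_form_def by blast

lemma form_congD:
  assumes "u \<in> dom D" "AE x in M. u x = u' x" "u' \<in> borel_measurable M"
    and "v \<in> dom D" "AE x in M. v x = v' x" "v' \<in> borel_measurable M"
  shows "form D u' v' = form D u v"
proof -
  have u': "u' \<in> dom D" and v': "v' \<in> dom D" using assms by (auto intro: dom_congD)
  have "form D u' v' = form D u v'" using nns assms v' unfolding nonneg_symmetric_form_def by blast
  also have "\<dots> = form D v' u" by (rule E.ip_commute[OF assms(1) v'])
  also have "\<dots> = form D v u" using nns assms unfolding nonneg_symmetric_form_def by blast
  also have "\<dots> = form D u v" by (rule E.ip_commute[OF assms(4,1)])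
  finally show ?thesis .
qed

text \<open>Regularity yields only a domain element \<open>g\<close> within 1 of a Urysohn function.
  The latter takes the values 0 and 3, so \<open>g\<close> is at most 1 off \<open>V2\<close> and at
  least 2 on \<open>V1\<close>, and the contraction \<open>T\<close> makes these 0 and 1.\<close>

lemma cutoff:
  assumes K: "compactin X K" and U: "openin X U" "K \<subseteq> U"
  obtains \<omega> V where "\<omega> \<in> dom D \<inter> C_c X" "tsupp X \<omega> \<subseteq> U" "openin X V" "K \<subseteq> V"
    "\<And>x. x \<in> V \<Longrightarrow> \<omega> x = 1" "\<And>x. 0 \<le> \<omega> x" "\<And>x. \<omega> x \<le> 1"
proof -
  obtain V1 where V1: "openin X V1" "K \<subseteq> V1" "compactin X (X closure_of V1)" "X closure_of V1 \<subseteq> U"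
    using compact_open_between[OF lc hausdorff K U] .
  obtain V2 where V2: "openin X V2" "X closure_of V1 \<subseteq> V2" "compactin X (X closure_of V2)" "X closure_of V2 \<subseteq> U"
    using compact_open_between[OF lc hausdorff V1(3) U(1) V1(4)] .
  have "disjnt (X closure_of V1) (topspace X - V2)" using V2 by (auto simp: disjnt_def)
  then obtain f where f: "continuous_map X euclideanreal f" "f ` (topspace X - V2) \<subseteq> {0}" "f ` (X closure_of V1) \<subseteq> {3}"
    using Urysohn_completely_regular_compact_closed_alt[of X "X closure_of V1" "topspace X - V2" 0 3]
      metrizable_imp_completely_regular_space[OF metrizable] V1(3) V2(1) by blast
  have supp: "tsupp X h \<subseteq> X closure_of V2" if "\<And>x. x \<in> topspace X \<Longrightarrow> x \<notin> V2 \<Longrightarrow> h x = 0" for h :: "'a \<Rightarrow> real"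
    unfolding tsupp_def by (rule closure_of_mono) (use that in auto)
  have compact_supp: "compactin X (tsupp X h)" if "tsupp X h \<subseteq> X closure_of V2" for h :: "'a \<Rightarrow> real"
    by (rule closed_compactin[OF V2(3) that]) (simp add: tsupp_def)
  have "tsupp X f \<subseteq> X closure_of V2" by (rule supp) (use f(2) in auto)
  then have "f \<in> C_c X" using f(1) compact_supp by (simp add: C_c_def C_all_def)
  then obtain g where g: "g \<in> dom D \<inter> C_c X" "\<And>x. x \<in> topspace X \<Longrightarrow> \<bar>f x - g x\<bar> \<le> 1"
    using reg unfolding regular_form_def by (metis zero_less_one)
  define T where "T s = max 0 (min (s - 1) 1)" for s :: real
  define \<omega> where "\<omega> = (\<lambda>x. T (g x))"
  have "\<omega> \<in> dom D"
    unfolding \<omega>_def by (rule markov_form_comp(1)[OF mkD]) (use g in \<open>auto simp: T_def\<close>)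
  moreover have "continuous_map X euclideanreal \<omega>"
    unfolding \<omega>_def T_def using g(1) by (auto simp: C_c_def C_all_def intro!: continuous_intros)
  moreover have s: "tsupp X \<omega> \<subseteq> X closure_of V2"
  proof (rule supp)
    fix x assume "x \<in> topspace X" "x \<notin> V2"
    then have "\<bar>g x\<bar> \<le> 1" using g(2)[of x] f(2) by auto
    then show "\<omega> x = 0" by (auto simp: \<omega>_def T_def)
  qed
  moreover have "\<omega> x = 1" if x: "x \<in> V1" for x
  proof -
    have "V1 \<subseteq> topspace X" by (rule openin_subset[OF V1(1)])
    then have "x \<in> X closure_of V1" "x \<in> topspace X" using x closure_of_subset[of V1 X] by blast+
    then have "g x \<ge> 2" using g(2)[of x] f(3) by auto
    then show ?thesis by (simp add: \<omega>_def T_def)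
  qed
  ultimately have "\<omega> \<in> dom D \<inter> C_c X" "\<And>x. x \<in> V1 \<Longrightarrow> \<omega> x = 1"
    using compact_supp[OF s] by (simp_all add: C_c_def C_all_def)
  then show ?thesis
    by (rule that[OF _ subset_trans[OF s V2(4)] V1(1,2)]) (simp_all add: \<omega>_def T_def)
qed

text \<open>The complement of the support is a union of possibly uncountably many open sets. A
  compact subset of it on which \<open>\<phi>\<close> has no zero is covered by finitely many of
  them and hence null, and inner regularity does the rest.\<close>

lemma AE_msupp: "\<phi> \<in> borel_measurable M \<Longrightarrow> AE x in M. x \<notin> msupp X M \<phi> \<longrightarrow> \<phi> x = 0"
proof -
  assume \<phi>: "\<phi> \<in> borel_measurable M"
  define \<V> where "\<V> = {V. openin X V \<and> (AE x in M. x \<in> V \<longrightarrow> \<phi> x = 0)}"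
  define Z where "Z = {x \<in> space M. \<phi> x \<noteq> 0} \<inter> \<Union>\<V>"
  have open': "openin X (\<Union>\<V>)" by (rule openin_Union) (simp add: \<V>_def)
  have Z: "Z \<in> sets M" unfolding Z_def using sets_open[OF open'] \<phi> by measurable
  have "emeasure M K = 0" if K: "compactin X K" "K \<subseteq> Z" for K
  proof -
    have "K \<subseteq> \<Union>\<V>" using K(2) by (auto simp: Z_def)
    then obtain \<F> where F: "finite \<F>" "\<F> \<subseteq> \<V>" "K \<subseteq> \<Union>\<F>"
      using compactinD[OF K(1), of \<V>] by (auto simp: \<V>_def)
    have "AE x in M. \<forall>V\<in>\<F>. x \<in> V \<longrightarrow> \<phi> x = 0"
      by (rule AE_finite_allI[OF F(1)]) (use F(2) in \<open>auto simp: \<V>_def\<close>)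
    then have "AE x in M. x \<notin> K"
      by eventually_elim (use F(3) K(2) in \<open>auto simp: Z_def\<close>)
    then show ?thesis
      using AE_iff_null_sets[OF sets_closed[OF compact_closed[OF K(1)]]] by (simp add: null_sets_def)
  qed
  then have "emeasure M Z = 0" unfolding inner_regular[OF Z] by (intro antisym SUP_least) auto
  then have "AE x in M. x \<notin> Z" using AE_iff_null_sets[OF Z] Z by (simp add: null_sets_def)
  moreover have "AE x in M. x \<in> space M" by simp
  ultimately show ?thesis
    by eventually_elim (auto simp: Z_def \<V>_def msupp_def space_M)
qed

abbreviation form_sq :: "('a \<Rightarrow> real) \<Rightarrow> real" where
  "form_sq u \<equiv> form1 D u u"

sublocale E1: semi_inner "dom D" "form1 D"
proof
  fix x y z :: "'a \<Rightarrow> real" and c :: real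
  assume x: "x \<in> dom D" and z: "z \<in> dom D"
  note L = dom_sub[OF x] dom_sub[OF z]
  show "form1 D (c *\<^sub>R x) z = c * form1 D x z"
    using L x z by (simp add: form1_eq E.ip_scale L2.ip_scale algebra_simps)
  assume y: "y \<in> dom D"
  show "form1 D (x + y) z = form1 D x z + form1 D y z"
    using L dom_sub[OF y] x y z by (simp add: form1_eq E.ip_add L2.ip_add)
next
  fix x y assume xy: "x \<in> dom D" "y \<in> dom D"
  show "form1 D x y = form1 D y x"
    using E.ip_commute[OF xy] L2.ip_commute[OF dom_sub[OF xy(1)] dom_sub[OF xy(2)]] by (simp add: form1_eq)
next
  fix x assume x: "x \<in> dom D"
  show "0 \<le> form1 D x x" using E.ip_nonneg[OF x] L2.ip_nonneg[OF dom_sub[OF x]] by (simp add: form1_eq)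
qed (rule E.subspace_V)

lemma form_sq_cong:
  assumes "u \<in> dom D" "AE x in M. u x = u' x" "u' \<in> borel_measurable M"
  shows "form_sq u' = form_sq u"
proof -
  have "l2_ip M u' u' = l2_ip M u u"
    unfolding l2_ip_def using assms dom_sub by (intro integral_cong_AE) (auto intro: L2_measurable)
  then show ?thesis using form_congD[OF assms assms] by (simp add: form1_eq)
qed

lemma regular_approx: "f \<in> dom D \<Longrightarrow> \<epsilon> > 0 \<Longrightarrow> \<exists>g\<in>dom D \<inter> C_c X. form_sq (f - g) < \<epsilon>"
  using reg unfolding regular_form_def fun_diff_def by blast

lemma nrm_le_form_sq:
  assumes d: "d \<in> dom D" and \<epsilon>: "form_sq d < \<epsilon>\<^sup>2" "\<epsilon> > 0"
  shows "L2.nrm M d < \<epsilon>"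
proof (rule power2_less_imp_less)
  show "(L2.nrm M d)\<^sup>2 < \<epsilon>\<^sup>2"
    using \<epsilon>(1) E.ip_nonneg[OF d] L2.nrm_square[OF dom_sub[OF d]] by (simp add: form1_eq)
qed (use \<epsilon> in simp)

definition core :: "'a set \<Rightarrow> ('a \<Rightarrow> real) set" where
  "core U = {\<phi> \<in> dom D \<inter> C_c X. tsupp X \<phi> \<subseteq> U}"

lemma tsupp_subset: "openin X V \<Longrightarrow> x \<in> topspace X \<Longrightarrow> x \<notin> tsupp X \<phi> \<Longrightarrow> \<phi> x = 0"
  unfolding tsupp_def using closure_of_subset[of "{x \<in> topspace X. \<phi> x \<noteq> 0}" X] by blast

lemma core_I:
  assumes \<psi>: "\<psi> \<in> dom D" "continuous_map X euclideanreal \<psi>" and \<phi>: "\<phi> \<in> core U"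
    and z: "\<And>x. x \<in> topspace X \<Longrightarrow> \<phi> x = 0 \<Longrightarrow> \<psi> x = 0"
  shows "\<psi> \<in> core U"
proof -
  have sub: "tsupp X \<psi> \<subseteq> tsupp X \<phi>" unfolding tsupp_def by (rule closure_of_mono) (use z in auto)
  have "compactin X (tsupp X \<psi>)"
    by (rule closed_compactin[OF _ sub]) (use \<phi> in \<open>auto simp: core_def C_c_def tsupp_def\<close>)
  then show ?thesis using \<psi> \<phi> sub by (auto simp: core_def C_c_def C_all_def)
qed

lemma core_comb:
  assumes "\<phi> \<in> core U" "\<psi> \<in> core U"
  shows "a *\<^sub>R \<phi> + b *\<^sub>R \<psi> \<in> core U"
proof -
  have sub: "tsupp X (a *\<^sub>R \<phi> + b *\<^sub>R \<psi>) \<subseteq> tsupp X \<phi> \<union> tsupp X \<psi>"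
    unfolding tsupp_def closure_of_Un[symmetric] by (rule closure_of_mono) auto
  have "compactin X (tsupp X (a *\<^sub>R \<phi> + b *\<^sub>R \<psi>))"
    by (rule closed_compactin[OF compactin_Un sub]) (use assms in \<open>auto simp: core_def C_c_def tsupp_def\<close>)
  moreover have "continuous_map X euclideanreal (\<lambda>x. a * \<phi> x + b * \<psi> x)"
    using assms by (auto simp: core_def C_c_def C_all_def intro!: continuous_intros)
  then have "continuous_map X euclideanreal (a *\<^sub>R \<phi> + b *\<^sub>R \<psi>)" by (simp add: lin_comb_eq)
  ultimately show ?thesis using assms sub by (auto simp: core_def C_c_def C_all_def)
qed

end

section \<open>The form restricted to a relatively compact open set\<close>

locale sl_dirichlet_open = sl_dirichlet D for D :: "'a form_space" +
  fixes U :: "'a set"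
  assumes U: "rel_compact_open X U"
begin

lemma U_open: "openin X U"
  using U by (simp add: rel_compact_open_def)

abbreviation "DU \<equiv> restrict_form_space D U"
abbreviation "MU \<equiv> restrict_space M U"

lemma DU_simps [simp]:
  "Meas DU = MU" "Top DU = subtopology X U" "form DU u v = form D (zero_ext U u) (zero_ext U v)"
  by (simp_all add: restrict_form_space_def)

lemma U_sets: "U \<in> sets M" "U \<inter> space M \<in> sets M" "U \<subseteq> space M"
  using sets_open[OF U_open] openin_subset[OF U_open] by (auto simp: space_M Int_absorb2)

lemma AE_MU: "(AE x in MU. Q x) \<longleftrightarrow> (AE x in M. x \<in> U \<longrightarrow> Q x)"
  by (rule AE_restrict_space_iff[OF U_sets(2)])

lemma zero_ext_eq: "(\<lambda>x. indicator U x *\<^sub>R f x) = zero_ext U f"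
  by (auto simp: zero_ext_def fun_eq_iff)

lemma zero_ext_lin: "zero_ext U (a *\<^sub>R u + b *\<^sub>R v) = a *\<^sub>R zero_ext U u + b *\<^sub>R zero_ext U v"
  "zero_ext U (u - v) = zero_ext U u - zero_ext U v" "zero_ext U 0 = 0"
  by (auto simp: zero_ext_def fun_eq_iff)

lemma measurable_MU: "f \<in> borel_measurable MU \<longleftrightarrow> zero_ext U f \<in> borel_measurable M"
  using borel_measurable_restrict_space_iff[OF U_sets(2), of f] unfolding zero_ext_eq .

lemma L2_MU: "f \<in> L2 MU \<longleftrightarrow> zero_ext U f \<in> L2 M"
proof -
  have "(\<lambda>x. indicator U x *\<^sub>R (f x)\<^sup>2) = (\<lambda>x. (zero_ext U f x)\<^sup>2)" by (auto simp: zero_ext_def fun_eq_iff)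
  then show ?thesis
    using measurable_MU[of f] integrable_restrict_space[OF U_sets(2), of "\<lambda>x. (f x)\<^sup>2"] by (simp add: L2_def)
qed

lemma ip_MU: "l2_ip MU f g = l2_ip M (zero_ext U f) (zero_ext U g)"
  unfolding l2_ip_def integral_restrict_space[OF U_sets(2)]
  by (rule arg_cong[where f = "integral\<^sup>L M"]) (auto simp: zero_ext_def fun_eq_iff)

lemma nrm_MU: "L2.nrm MU f = L2.nrm M (zero_ext U f)"
  by (simp add: L2.nrm_def ip_MU)

lemma finite_MU: "finite_measure MU"
proof (rule finite_measureI)
  have "emeasure M U \<le> emeasure M (X closure_of U)"
    by (rule emeasure_mono[OF closure_of_subset]) (use U_open openin_subset sets_closed in auto)
  also have "\<dots> < \<infinity>" by (rule compact_finite) (use U in \<open>simp add: rel_compact_open_def\<close>)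
  finally show "emeasure MU (space MU) \<noteq> \<infinity>"
    using U_sets by (simp add: space_restrict_space emeasure_restrict_space Int_absorb2)
qed

lemma dom_DU: "f \<in> dom DU \<longleftrightarrow> zero_ext U f \<in> dom D \<and> (\<forall>\<epsilon>>0. \<exists>\<phi>\<in>core U. form_sq (zero_ext U f - \<phi>) < \<epsilon>)"
  by (simp add: restrict_form_space_def core_def fun_diff_def Bex_def conj_assoc)

text \<open>Only a.e., because total functions have arbitrary values outside the space, where the
  extension is 0.\<close>

lemma core_zero_ext: "\<phi> \<in> core U \<Longrightarrow> AE x in M. zero_ext U \<phi> x = \<phi> x"
proof (rule AE_I2)
  fix x assume \<phi>: "\<phi> \<in> core U" and x: "x \<in> space M"
  show "zero_ext U \<phi> x = \<phi> x"
    using tsupp_subset[OF U_open, of x \<phi>] \<phi> x by (auto simp: zero_ext_def core_def space_M)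
qed

lemma zero_ext_measurable: "f \<in> borel_measurable M \<Longrightarrow> zero_ext U f \<in> borel_measurable M"
  using U_sets unfolding zero_ext_eq[symmetric] by measurable

lemma core_dom:
  assumes \<phi>: "\<phi> \<in> core U"
  shows "zero_ext U \<phi> \<in> dom D" "\<phi> \<in> dom DU"
proof -
  have d: "\<phi> \<in> dom D" using \<phi> by (simp add: core_def)
  have AE: "AE x in M. \<phi> x = zero_ext U \<phi> x" using core_zero_ext[OF \<phi>] by eventually_elim simp
  have m: "zero_ext U \<phi> \<in> borel_measurable M" using dom_sub[OF d] by (intro zero_ext_measurable) auto
  show z: "zero_ext U \<phi> \<in> dom D" by (rule dom_congD[OF d m AE])
  have "form_sq (zero_ext U \<phi> - \<phi>) = form_sq 0"
  proof (rule form_sq_cong)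
    show "AE x in M. 0 x = (zero_ext U \<phi> - \<phi>) x" using AE by eventually_elim simp
    show "zero_ext U \<phi> - \<phi> \<in> borel_measurable M" using z d by (intro L2_measurable dom_sub) auto
  qed auto
  then show "\<phi> \<in> dom DU" unfolding dom_DU using z \<phi> by (auto intro!: bexI[of _ \<phi>])
qed

lemma zero_in_core: "0 \<in> core U"
  by (simp add: core_def C_c_def C_all_def tsupp_def zero_fun_def[symmetric] continuous_map_const) (simp add: zero_fun_def)

lemma nonneg_symmetric_DU: "nonneg_symmetric_form DU"
  unfolding nonneg_symmetric_form_def lin_comb_eq
proof (intro conjI ballI allI impI subsetI)
  fix u assume u: "u \<in> dom DU"
  then show "u \<in> L2 (Meas DU)" by (simp add: dom_DU L2_MU dom_sub)
  show "0 \<le> form DU u u" using u by (simp add: dom_DU E.ip_nonneg)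
  fix u' assume u': "u' \<in> borel_measurable (Meas DU)" "AE x in Meas DU. u x = u' x"
  have zu: "zero_ext U u \<in> dom D" using u by (simp add: dom_DU)
  have AE: "AE x in M. zero_ext U u x = zero_ext U u' x"
    using u'(2)[simplified AE_MU DU_simps] by eventually_elim (simp add: zero_ext_def)
  have m: "zero_ext U u' \<in> borel_measurable M" using u'(1) by (simp add: measurable_MU)
  have zu': "zero_ext U u' \<in> dom D" by (rule dom_congD[OF zu m AE])
  show "u' \<in> dom DU"
    unfolding dom_DU
  proof (intro conjI allI impI zu')
    fix \<epsilon> :: real assume "\<epsilon> > 0"
    then obtain \<phi> where \<phi>: "\<phi> \<in> core U" "form_sq (zero_ext U u - \<phi>) < \<epsilon>" using u by (auto simp: dom_DU)
    have \<phi>d: "\<phi> \<in> dom D" using \<phi> by (simp add: core_def)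
    have "form_sq (zero_ext U u' - \<phi>) = form_sq (zero_ext U u - \<phi>)"
    proof (rule form_sq_cong)
      show "AE x in M. (zero_ext U u - \<phi>) x = (zero_ext U u' - \<phi>) x" using AE by eventually_elim simp
      show "zero_ext U u' - \<phi> \<in> borel_measurable M" using zu' \<phi>d by (intro L2_measurable dom_sub) auto
    qed (use zu \<phi>d in auto)
    then show "\<exists>\<phi>\<in>core U. form_sq (zero_ext U u' - \<phi>) < \<epsilon>" using \<phi> by metis
  qed
  fix v assume v: "v \<in> dom DU"
  show "form DU u' v = form DU u v"
    using form_congD[OF zu AE m, of "zero_ext U v" "zero_ext U v"] v dom_sub by (auto simp: dom_DU intro: L2_measurable)
next
  fix u v assume uv: "u \<in> dom DU" "v \<in> dom DU"
  have z: "zero_ext U u \<in> dom D" "zero_ext U v \<in> dom D" using uv by (auto simp: dom_DU)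
  then show "form DU u v = form DU v u" by (simp add: E.ip_commute)
  fix a b :: real
  show "a *\<^sub>R u + b *\<^sub>R v \<in> dom DU"
    unfolding dom_DU
  proof (intro conjI allI impI)
    show "zero_ext U (a *\<^sub>R u + b *\<^sub>R v) \<in> dom D" unfolding zero_ext_lin using z by auto
    fix \<epsilon> :: real assume e: "\<epsilon> > 0"
    \<comment> \<open>Dominates \<open>4 * a\<^sup>2\<close> and \<open>4 * b\<^sup>2\<close> and
      stays positive when both coefficients vanish.\<close>
    define c where "c = 4 * (a\<^sup>2 + 1) * (b\<^sup>2 + 1)"
    have "a\<^sup>2 \<le> (a\<^sup>2 + 1) * (b\<^sup>2 + 1)" "b\<^sup>2 \<le> (a\<^sup>2 + 1) * (b\<^sup>2 + 1)"
      by (auto simp: algebra_simps add_increasing add_increasing2)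
    then have c: "c > 0" "4 * a\<^sup>2 \<le> c" "4 * b\<^sup>2 \<le> c" unfolding c_def mult.assoc by (simp_all only: mult_le_cancel_left_pos zero_less_numeral) (auto intro!: mult_pos_pos add_nonneg_pos)
    obtain \<phi> where \<phi>: "\<phi> \<in> core U" "form_sq (zero_ext U u - \<phi>) < \<epsilon> / c"
      using uv(1) divide_pos_pos[OF e c(1)] unfolding dom_DU by blast
    obtain \<psi> where \<psi>: "\<psi> \<in> core U" "form_sq (zero_ext U v - \<psi>) < \<epsilon> / c"
      using uv(2) divide_pos_pos[OF e c(1)] unfolding dom_DU by blast
    define x where "x = zero_ext U u - \<phi>"
    define y where "y = zero_ext U v - \<psi>"
    have xy: "x \<in> dom D" "y \<in> dom D" using z \<phi> \<psi> by (auto simp: x_def y_def core_def)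
    have eq: "zero_ext U (a *\<^sub>R u + b *\<^sub>R v) - (a *\<^sub>R \<phi> + b *\<^sub>R \<psi>) = a *\<^sub>R x + b *\<^sub>R y"
      by (simp add: zero_ext_lin x_def y_def algebra_simps)
    have "form_sq (a *\<^sub>R x + b *\<^sub>R y) \<le> 2 * form_sq (a *\<^sub>R x) + 2 * form_sq (b *\<^sub>R y)"
      by (rule E1.ip_add_self_le) (use xy in auto)
    also have "\<dots> = (4 * a\<^sup>2) * (form_sq x / 2) + (4 * b\<^sup>2) * (form_sq y / 2)"
      using xy by (simp add: E1.ip_scale E1.ip_scale_right power2_eq_square)
    also have "\<dots> \<le> c * (form_sq x / 2) + c * (form_sq y / 2)"
      using c E1.ip_nonneg[OF xy(1)] E1.ip_nonneg[OF xy(2)] by (intro add_mono mult_right_mono) auto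
    also have "\<dots> < c * (\<epsilon> / c / 2) + c * (\<epsilon> / c / 2)"
      using \<phi>(2) \<psi>(2) c by (intro add_strict_mono mult_strict_left_mono) (auto simp: x_def y_def)
    also have "\<dots> = \<epsilon>" using c by simp
    finally show "\<exists>\<phi>\<in>core U. form_sq (zero_ext U (a *\<^sub>R u + b *\<^sub>R v) - \<phi>) < \<epsilon>"
      unfolding eq[symmetric] using core_comb[OF \<phi>(1) \<psi>(1)] by blast
  qed
  fix w assume w: "w \<in> dom DU"
  then show "form DU (a *\<^sub>R u + b *\<^sub>R v) w = a * form DU u w + b * form DU v w"
    using z by (simp add: zero_ext_lin E.ip_lin dom_DU)
qed

lemma form1_DU: "form1 DU u v = form1 D (zero_ext U u) (zero_ext U v)"
  by (simp add: form1_eq ip_MU)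

lemma closed_DU: "closed_form DU"
  unfolding closed_form_iff
proof (intro allI impI, elim conjE)
  fix u assume u: "\<forall>n::nat. u n \<in> dom DU"
    and cauchy: "\<forall>\<epsilon>>0. \<exists>N. \<forall>m\<ge>N. \<forall>n\<ge>N. form1 DU (u m - u n) (u m - u n) < \<epsilon>"
  define z where "z n = zero_ext U (u n)" for n
  have z: "z n \<in> dom D" for n using u by (simp add: z_def dom_DU)
  have "\<forall>\<epsilon>>0. \<exists>N. \<forall>m\<ge>N. \<forall>n\<ge>N. form_sq (z m - z n) < \<epsilon>"
    using cauchy by (simp add: form1_DU z_def zero_ext_lin)
  then obtain v where v: "v \<in> dom D" "(\<lambda>n. form_sq (z n - v)) \<longlonglongrightarrow> 0"
    using clD[unfolded closed_form_iff, THEN spec, of z] z by blast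
  have vL: "v \<in> L2 M" by (rule dom_sub[OF v(1)])
  have nlim: "(\<lambda>n. L2.nrm M (z n - v)) \<longlonglongrightarrow> 0"
  proof -
    have "(\<lambda>n. l2_ip M (z n - v) (z n - v)) \<longlonglongrightarrow> 0"
    proof (rule Lim_null_comparison[OF always_eventually v(2)], rule allI)
      fix n
      have d: "z n - v \<in> dom D" using z v by auto
      show "norm (l2_ip M (z n - v) (z n - v)) \<le> form_sq (z n - v)"
        using E.ip_nonneg[OF d] L2.ip_nonneg[OF dom_sub[OF d]] by (simp add: form1_eq)
    qed
    then show ?thesis unfolding L2.nrm_def using tendsto_real_sqrt by fastforce
  qed
  \<comment> \<open>The part of the limit off \<open>U\<close>; each \<open>z n\<close> vanishes
    there, so it is dominated by \<open>|z n - v|\<close> and hence null.\<close>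
  define w where "w = v - zero_ext U v"
  have vm: "v \<in> borel_measurable M" "zero_ext U v \<in> borel_measurable M"
    using vL zero_ext_measurable by auto
  have wm: "w \<in> borel_measurable M" using vm unfolding w_def fun_diff_def by measurable
  have wle: "AE x in M. \<bar>w x\<bar> \<le> \<bar>(z n - v) x\<bar>" for n by (auto simp: w_def zero_ext_def z_def)
  have zv: "z n - v \<in> L2 M" for n using z v by (intro dom_sub) auto
  have wL: "w \<in> L2 M" by (rule L2_bound[OF zv wm wle])
  have "L2.nrm M w \<le> L2.nrm M (z n - v)" for n by (rule L2_nrm_mono[OF zv wm wle])
  then have "L2.nrm M w \<le> 0" by (intro LIMSEQ_le_const[OF nlim]) auto
  then have AEv: "AE x in M. v x = zero_ext U v x"
    using L2_nrm_zero_iff[OF wL] L2.nrm_nonneg[OF wL] by (simp add: w_def)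
  have zvd: "zero_ext U v \<in> dom D" by (rule dom_congD[OF v(1) vm(2) AEv])
  have sq: "form_sq (z n - zero_ext U v) = form_sq (z n - v)" for n
  proof (rule form_sq_cong)
    show "AE x in M. (z n - v) x = (z n - zero_ext U v) x" using AEv by eventually_elim simp
    show "z n - zero_ext U v \<in> borel_measurable M" using z zvd by (intro L2_measurable dom_sub) auto
  qed (use z v in auto)
  have lim: "(\<lambda>n. form_sq (z n - zero_ext U v)) \<longlonglongrightarrow> 0" using v(2) by (simp add: sq)
  have "v \<in> dom DU"
    unfolding dom_DU
  proof (intro conjI allI impI zvd)
    fix \<epsilon> :: real assume e: "\<epsilon> > 0"
    have "\<forall>\<^sub>F n in sequentially. form_sq (z n - zero_ext U v) < \<epsilon> / 4"
      by (rule order_tendstoD(2)[OF lim]) (use e in simp)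
    then obtain n where n: "form_sq (z n - zero_ext U v) < \<epsilon> / 4" by (auto simp: eventually_sequentially)
    obtain \<phi> where \<phi>: "\<phi> \<in> core U" "form_sq (z n - \<phi>) < \<epsilon> / 4"
      using u e by (auto simp: dom_DU z_def dest!: spec[of _ n] spec[of _ "\<epsilon> / 4"])
    have \<phi>d: "\<phi> \<in> dom D" using \<phi> by (simp add: core_def)
    have "form_sq ((z n - \<phi>) - (z n - zero_ext U v)) \<le> 2 * form_sq (z n - \<phi>) + 2 * form_sq (z n - zero_ext U v)"
      by (rule E1.ip_diff_self_le) (use z zvd \<phi>d in auto)
    then have "form_sq (zero_ext U v - \<phi>) < \<epsilon>" using n \<phi>(2) by simp
    then show "\<exists>\<phi>\<in>core U. form_sq (zero_ext U v - \<phi>) < \<epsilon>" using \<phi>(1) by blast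
  qed
  moreover have "(\<lambda>n. form1 DU (u n - v) (u n - v)) \<longlonglongrightarrow> 0"
    using lim by (simp add: form1_DU zero_ext_lin z_def)
  ultimately show "\<exists>v\<in>dom DU. (\<lambda>n. form1 DU (u n - v) (u n - v)) \<longlonglongrightarrow> 0" by blast
qed

lemma dom_DU_nonempty: "dom DU \<noteq> {}"
  using core_dom(2)[OF zero_in_core] by blast

lemma closed_bilinear_form_DU: "closed_bilinear_form (L2 MU) (l2_ip MU) (dom DU) (form DU)"
  using closed_bilinear_form_space[OF nonneg_symmetric_DU dom_DU_nonempty closed_DU] by (simp only: DU_simps)

text \<open>Nonlinear operations on the core, such as minima and contractions, give control of the
  energy and convergence in \<open>L2\<close>, but no evident convergence in the form norm; this
  criterion asks for no more.\<close>

lemma dom_DU_of_approximation: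
  assumes u: "u \<in> L2 MU" and ap: "\<And>\<epsilon>. \<epsilon> > 0 \<Longrightarrow> \<exists>w\<in>dom DU. L2.nrm MU (w - u) < \<epsilon> \<and> form D (zero_ext U w) (zero_ext U w) \<le> C"
  shows "u \<in> dom DU"
proof -
  interpret U: closed_bilinear_form "L2 MU" "l2_ip MU" "dom DU" "form DU" by (rule closed_bilinear_form_DU)
  show ?thesis by (rule U.form_closed_of_approximation(1)[OF u]) (use ap in simp)
qed

lemma form_core: "\<phi> \<in> core U \<Longrightarrow> form D (zero_ext U \<phi>) (zero_ext U \<phi>) = form D \<phi> \<phi>"
  using form_congD[of \<phi> "zero_ext U \<phi>" \<phi> "zero_ext U \<phi>"] core_zero_ext[of \<phi>] dom_sub zero_ext_measurable
  by (auto simp: core_def eq_commute)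

lemma nrm_MU_le:
  assumes g: "g \<in> L2 M" and f: "f \<in> borel_measurable MU" and le: "AE x in MU. \<bar>f x\<bar> \<le> \<bar>g x\<bar>"
  shows "f \<in> L2 MU" "L2.nrm MU f \<le> L2.nrm M g"
proof -
  have le': "AE x in M. \<bar>zero_ext U f x\<bar> \<le> \<bar>g x\<bar>"
    using le[unfolded AE_MU] by eventually_elim (simp add: zero_ext_def)
  have m: "zero_ext U f \<in> borel_measurable M" using f by (simp add: measurable_MU)
  show "f \<in> L2 MU" unfolding L2_MU by (rule L2_bound[OF g m le'])
  show "L2.nrm MU f \<le> L2.nrm M g" unfolding nrm_MU by (rule L2_nrm_mono[OF g m le'])
qed

lemma measurable_restrict: "f \<in> borel_measurable M \<Longrightarrow> f \<in> borel_measurable MU"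
  for f :: "'a \<Rightarrow> real" unfolding measurable_MU by (rule zero_ext_measurable)

lemma L2_restrict: "f \<in> L2 M \<Longrightarrow> f \<in> L2 MU"
  by (rule nrm_MU_le(1)[of f f]) (auto intro: measurable_restrict)

text \<open>Regularity approximates \<open>u\<close> by a compactly supported continuous
  \<open>\<phi>\<close>; the minimum of its positive part with \<open>c * \<omega>\<close> lies in
  the core since \<open>\<omega>\<close> does, has controlled energy, and is as close to the target
  as \<open>\<phi>\<close> to \<open>u\<close>.\<close>

lemma min_core_dom:
  assumes u: "u \<in> dom D" "AE x in M. 0 \<le> u x" and \<omega>: "\<omega> \<in> core U" "\<And>x. 0 \<le> \<omega> x" and c: "c \<ge> 0"
  shows "(\<lambda>x. min (u x) (c * \<omega> x)) \<in> dom DU"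
proof -
  have \<omega>d: "\<omega> \<in> dom D" using \<omega> by (simp add: core_def)
  have c\<omega>: "c *\<^sub>R \<omega> \<in> dom D" using \<omega>d by auto
  define F where "F = (\<lambda>x. min (u x) (c * \<omega> x))"
  have Fd: "F \<in> dom D" using markov_form_min(1)[OF nns mkD u(1) c\<omega>] by (simp add: F_def)
  define C where "C = 2 * (2 * form D u u + 2) + 2 * form D (c *\<^sub>R \<omega>) (c *\<^sub>R \<omega>)"
  have "F \<in> dom DU"
  proof (rule dom_DU_of_approximation[where C = C])
    show "F \<in> L2 MU" by (rule L2_restrict[OF dom_sub[OF Fd]])
    fix \<epsilon> :: real assume e: "\<epsilon> > 0"
    then have "min 1 (\<epsilon>\<^sup>2) > 0" by simp
    then obtain \<phi> where \<phi>: "\<phi> \<in> dom D \<inter> C_c X" "form_sq (u - \<phi>) < min 1 (\<epsilon>\<^sup>2)"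
      using regular_approx[OF u(1)] by blast
    have \<phi>d: "\<phi> \<in> dom D" using \<phi> by simp
    have d: "u - \<phi> \<in> dom D" using u \<phi>d by auto
    have E\<phi>: "form D \<phi> \<phi> \<le> 2 * form D u u + 2"
    proof -
      have "form D (u - (u - \<phi>)) (u - (u - \<phi>)) \<le> 2 * form D u u + 2 * form D (u - \<phi>) (u - \<phi>)"
        by (rule E.ip_diff_self_le) (use u d in auto)
      moreover have "form D (u - \<phi>) (u - \<phi>) \<le> 1"
        using \<phi>(2) L2.ip_nonneg[OF dom_sub[OF d]] by (simp add: form1_eq)
      ultimately show ?thesis by simp
    qed
    define \<phi>p where "\<phi>p = (\<lambda>x. max (\<phi> x) 0)"
    have \<phi>p: "\<phi>p \<in> dom D" "form D \<phi>p \<phi>p \<le> form D \<phi> \<phi>"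
      unfolding \<phi>p_def by (rule markov_form_comp[OF mkD _ _ \<phi>d, where T = "\<lambda>s. max s 0"]; auto)+
    define w where "w = (\<lambda>x. min (\<phi>p x) ((c *\<^sub>R \<omega>) x))"
    have wd: "w \<in> dom D" and Ew: "form D w w \<le> 2 * form D \<phi>p \<phi>p + 2 * form D (c *\<^sub>R \<omega>) (c *\<^sub>R \<omega>)"
      unfolding w_def by (rule markov_form_min[OF nns mkD \<phi>p(1) c\<omega>])+
    have wc: "w \<in> core U"
    proof (rule core_I[OF wd _ \<omega>(1)])
      show "continuous_map X euclideanreal w"
        unfolding w_def \<phi>p_def scaleR_fun_def using \<phi>(1) \<omega>(1)
        by (auto simp: core_def C_c_def C_all_def intro!: continuous_intros)
      show "w x = 0" if "\<omega> x = 0" for x using that by (simp add: w_def \<phi>p_def)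
    qed
    have "L2.nrm MU (w - F) \<le> L2.nrm M (u - \<phi>)"
    proof (rule nrm_MU_le(2)[OF dom_sub[OF d]])
      show "w - F \<in> borel_measurable MU" using wd Fd by (intro measurable_restrict L2_measurable dom_sub) auto
      have "AE x in M. \<bar>(w - F) x\<bar> \<le> \<bar>(u - \<phi>) x\<bar>"
        using u(2) by eventually_elim (auto simp: w_def F_def \<phi>p_def)
      then show "AE x in MU. \<bar>(w - F) x\<bar> \<le> \<bar>(u - \<phi>) x\<bar>" unfolding AE_MU by eventually_elim simp
    qed
    also have "L2.nrm M (u - \<phi>) < \<epsilon>" by (rule nrm_le_form_sq[OF d]) (use \<phi>(2) e in auto)
    finally show "\<exists>w\<in>dom DU. L2.nrm MU (w - F) < \<epsilon> \<and> form D (zero_ext U w) (zero_ext U w) \<le> C"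
      using core_dom(2)[OF wc] Ew \<phi>p(2) E\<phi> form_core[OF wc] by (intro bexI[of _ w]) (auto simp: C_def)
  qed
  then show ?thesis by (simp add: F_def)
qed

lemma markov_DU: "markov_form DU"
  unfolding markov_form_def comp_def
proof (intro allI impI ballI)
  fix T :: "real \<Rightarrow> real" and f
  assume T: "(\<forall>s t. \<bar>T s - T t\<bar> \<le> \<bar>s - t\<bar>) \<and> T 0 = 0" and f: "f \<in> dom DU"
  define z where "z = zero_ext U f"
  have z: "z \<in> dom D" using f by (simp add: z_def dom_DU)
  have zT: "zero_ext U (\<lambda>x. T (f x)) = (\<lambda>x. T (z x))" using T by (auto simp: z_def zero_ext_def fun_eq_iff)
  note Tz = markov_form_comp[OF mkD _ _ z, of T]
  have Tzd: "(\<lambda>x. T (z x)) \<in> dom D" using Tz(1) T by blast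
  have "(\<lambda>x. T (f x)) \<in> dom DU"
  proof (rule dom_DU_of_approximation[where C = "2 * form D z z + 2"])
    show "(\<lambda>x. T (f x)) \<in> L2 MU" unfolding L2_MU zT by (rule dom_sub[OF Tzd])
    fix \<epsilon> :: real assume e: "\<epsilon> > 0"
    then have "min 1 (\<epsilon>\<^sup>2) > 0" by simp
    then obtain \<phi> where \<phi>: "\<phi> \<in> core U" "form_sq (z - \<phi>) < min 1 (\<epsilon>\<^sup>2)"
      using f unfolding dom_DU z_def by blast
    have \<phi>d: "\<phi> \<in> dom D" using \<phi> by (simp add: core_def)
    have d: "z - \<phi> \<in> dom D" using z \<phi>d by auto
    define w where "w = (\<lambda>x. T (\<phi> x))"
    have w: "w \<in> dom D" "form D w w \<le> form D \<phi> \<phi>"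
      unfolding w_def by (rule markov_form_comp[OF mkD _ _ \<phi>d]; use T in blast)+
    \<comment> \<open>Contractions are continuous, so composition keeps the approximants in the
      core.\<close>
    have "continuous_on UNIV T"
      unfolding continuous_on_iff dist_real_def using T by (meson le_less_trans)
    then have "continuous_map X euclideanreal w"
      using continuous_map_compose[of X euclideanreal \<phi> euclideanreal T] \<phi>(1)
      by (auto simp: w_def core_def C_c_def C_all_def comp_def)
    then have wc: "w \<in> core U" using core_I[OF w(1) _ \<phi>(1)] T by (simp add: w_def)
    have "form D (z - (z - \<phi>)) (z - (z - \<phi>)) \<le> 2 * form D z z + 2 * form D (z - \<phi>) (z - \<phi>)"
      by (rule E.ip_diff_self_le) (use z d in auto)
    moreover have "form D (z - \<phi>) (z - \<phi>) \<le> 1"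
      using \<phi>(2) L2.ip_nonneg[OF dom_sub[OF d]] by (simp add: form1_eq)
    ultimately have E\<phi>: "form D \<phi> \<phi> \<le> 2 * form D z z + 2" by simp
    have "L2.nrm MU (w - (\<lambda>x. T (f x))) \<le> L2.nrm M (z - \<phi>)"
    proof (rule nrm_MU_le(2)[OF dom_sub[OF d]])
      have "zero_ext U (w - (\<lambda>x. T (f x))) = zero_ext U w - (\<lambda>x. T (z x))" by (simp add: zero_ext_lin zT)
      moreover have "zero_ext U w - (\<lambda>x. T (z x)) \<in> dom D" using core_dom(1)[OF wc] Tzd by auto
      ultimately show "w - (\<lambda>x. T (f x)) \<in> borel_measurable MU"
        unfolding measurable_MU using dom_sub by (metis L2_measurable)
      have "\<bar>T (\<phi> x) - T (f x)\<bar> \<le> \<bar>(z - \<phi>) x\<bar>" if "x \<in> U" for x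
        using T[THEN conjunct1, rule_format, of "\<phi> x" "f x"] that
        by (simp add: z_def zero_ext_def abs_minus_commute[of "\<phi> x" "f x"])
      then show "AE x in MU. \<bar>(w - (\<lambda>x. T (f x))) x\<bar> \<le> \<bar>(z - \<phi>) x\<bar>" unfolding AE_MU by (simp add: w_def)
    qed
    also have "L2.nrm M (z - \<phi>) < \<epsilon>" by (rule nrm_le_form_sq[OF d]) (use \<phi>(2) e in auto)
    finally show "\<exists>w\<in>dom DU. L2.nrm MU (w - (\<lambda>x. T (f x))) < \<epsilon> \<and> form D (zero_ext U w) (zero_ext U w) \<le> 2 * form D z z + 2"
      using core_dom(2)[OF wc] w(2) E\<phi> form_core[OF wc] by (intro bexI[of _ w]) auto
  qed
  then show "(\<lambda>x. T (f x)) \<in> dom DU \<and> form DU (\<lambda>x. T (f x)) (\<lambda>x. T (f x)) \<le> form DU f f"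
    using Tz(2) T zT by (simp add: z_def)
qed

end

lemma (in sl_dirichlet) C_c_bounded:
  assumes "v \<in> C_c X"
  obtains N where "N \<ge> 0" "\<And>x. x \<in> topspace X \<Longrightarrow> \<bar>v x\<bar> \<le> N"
proof -
  have "compactin euclideanreal (v ` tsupp X v)"
    using assms by (intro image_compactin[of X]) (auto simp: C_c_def C_all_def)
  then have "bounded (v ` tsupp X v)" by (simp add: compact_imp_bounded)
  then obtain B where B: "\<And>x. x \<in> tsupp X v \<Longrightarrow> \<bar>v x\<bar> \<le> B" unfolding bounded_iff by auto
  have "\<bar>v x\<bar> \<le> max B 0" if "x \<in> topspace X" for x
    using B[of x] tsupp_subset[OF openin_topspace that, of v] by (cases "x \<in> tsupp X v") auto
  then show ?thesis using that[of "max B 0"] by auto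
qed

context sl_dirichlet_open
begin

lemma truncation_core:
  assumes v: "v \<in> dom D \<inter> C_c X" and \<omega>: "\<omega> \<in> core U" "\<And>x. 0 \<le> \<omega> x" and c: "c \<ge> 0"
  shows "(\<lambda>x. min (max (v x) 0) (c * \<omega> x)) \<in> core U"
proof (rule core_I[OF _ _ \<omega>(1)])
  have vp: "(\<lambda>x. max (v x) 0) \<in> dom D"
    by (rule markov_form_comp(1)[OF mkD, where T = "\<lambda>s. max s 0"]) (use v in auto)
  have "c *\<^sub>R \<omega> \<in> dom D" using \<omega> by (auto simp: core_def)
  from markov_form_min(1)[OF nns mkD vp this]
  show "(\<lambda>x. min (max (v x) 0) (c * \<omega> x)) \<in> dom D" by simp
  show "continuous_map X euclideanreal (\<lambda>x. min (max (v x) 0) (c * \<omega> x))"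
    using v \<omega>(1) by (auto simp: core_def C_c_def C_all_def intro!: continuous_intros)
qed (use \<omega> in auto)

lemma inner_compact:
  assumes "\<delta> > 0"
  obtains K where "compactin X K" "K \<subseteq> U" "measure M (U - K) < \<delta>"
proof -
  have fin: "emeasure M U \<noteq> \<infinity>"
    using finite_measure.emeasure_finite[OF finite_MU, of U] U_sets
    by (simp add: emeasure_restrict_space)
  then have eU: "emeasure M U = ennreal (measure M U)" by (simp add: emeasure_eq_ennreal_measure)
  show ?thesis
  proof (cases "measure M U < \<delta>")
    case True
    then show ?thesis using that[of "{}"] by simp
  next
    case False
    then have "ennreal (measure M U - \<delta>) < emeasure M U" unfolding eU using assms by (simp add: ennreal_less_iff)
    also have "emeasure M U = (SUP K\<in>{K. compactin X K \<and> K \<subseteq> U}. emeasure M K)" by (rule inner_regular[OF U_sets(1)])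
    finally obtain K where K: "compactin X K" "K \<subseteq> U" "ennreal (measure M U - \<delta>) < emeasure M K"
      by (auto simp: less_SUP_iff)
    have Ks: "K \<in> sets M" by (rule sets_closed[OF compact_closed[OF K(1)]])
    have "emeasure M K = ennreal (measure M K)"
      using compact_finite[OF K(1)] by (intro emeasure_eq_ennreal_measure) auto
    then have "measure M U - \<delta> < measure M K" using K(3) False by (simp add: ennreal_less_iff)
    moreover have "measure M (U - K) = measure M U - measure M K"
      by (rule measure_Diff[OF fin U_sets(1) Ks K(2)])
    ultimately show ?thesis using that[OF K(1,2)] by simp
  qed
qed

text \<open>A compactly supported domain element \<open>v\<close> close to the function is pushed
  into \<open>U\<close>: its positive and negative parts are cut down to
  \<open>N * \<omega>\<close>, where \<open>N\<close> bounds \<open>v\<close> and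
  \<open>\<omega> = 1\<close> on a compact \<open>K\<close> filling \<open>U\<close> up to small
  measure. Minima stay in the domain by the Markov property.\<close>

lemma core_approx:
  assumes f: "f \<in> L2 MU" and e: "\<epsilon> > 0"
  shows "\<exists>\<phi>\<in>core U. L2.nrm MU (f - \<phi>) < \<epsilon>"
proof -
  define e3 where "e3 = \<epsilon> / 3"
  have e3: "e3 > 0" using e by (simp add: e3_def)
  define z where "z = zero_ext U f"
  have z: "z \<in> L2 M" using f by (simp add: L2_MU z_def)
  obtain u where u: "u \<in> dom D" "L2_norm2 M (z - u) < e3\<^sup>2"
    using dns z e3 unfolding densely_defined_def fun_diff_def by (meson zero_less_power)
  have uL: "u \<in> L2 M" by (rule dom_sub[OF u(1)])
  have zu: "L2.nrm M (z - u) < e3"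
    using u(2) e3 by (auto simp: L2_norm2_eq intro: power2_less_imp_less)
  obtain v where v: "v \<in> dom D \<inter> C_c X" "form_sq (u - v) < e3\<^sup>2"
    using regular_approx[OF u(1), of "e3\<^sup>2"] e3 by auto
  have vL: "v \<in> L2 M" using v by (auto intro: dom_sub)
  have uv: "L2.nrm M (u - v) < e3" by (rule nrm_le_form_sq[OF _ v(2) e3]) (use u v in auto)
  obtain N where N: "N \<ge> 0" "\<And>x. x \<in> topspace X \<Longrightarrow> \<bar>v x\<bar> \<le> N"
    using C_c_bounded[of v] v by auto
  \<comment> \<open>On \<open>U - K\<close> the error is at most \<open>N\<close>, so its norm is at
    most \<open>N * sqrt \<delta> \<le> e3\<close>.\<close>
  define \<delta> where "\<delta> = (e3 / (N + 1))\<^sup>2"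
  have "\<delta> > 0" using e3 N by (simp add: \<delta>_def)
  then obtain K where K: "compactin X K" "K \<subseteq> U" "measure M (U - K) < \<delta>" using inner_compact by blast
  have Ks: "K \<in> sets M" by (rule sets_closed[OF compact_closed[OF K(1)]])
  obtain \<omega> V where \<omega>: "\<omega> \<in> dom D \<inter> C_c X" "tsupp X \<omega> \<subseteq> U" "openin X V" "K \<subseteq> V"
    "\<And>x. x \<in> V \<Longrightarrow> \<omega> x = 1" "\<And>x. 0 \<le> \<omega> x" "\<And>x. \<omega> x \<le> 1"
    using cutoff[OF K(1) U_open K(2)] by blast
  have \<omega>c: "\<omega> \<in> core U" using \<omega> by (simp add: core_def)
  define a where "a = (\<lambda>x. min (max (v x) 0) (N * \<omega> x))"
  define b where "b = (\<lambda>x. min (max ((- v) x) 0) (N * \<omega> x))"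
  have mv: "- v \<in> dom D \<inter> C_c X"
  proof -
    have "tsupp X (- v) = tsupp X v" by (simp add: tsupp_def)
    moreover have "continuous_map X euclideanreal (\<lambda>x. - v x)"
      using v by (auto simp: C_c_def C_all_def intro!: continuous_intros)
    then have "continuous_map X euclideanreal (- v)" by (simp add: fun_Compl_def)
    ultimately show ?thesis using v by (auto simp: C_c_def C_all_def)
  qed
  have "a \<in> core U" "b \<in> core U"
    unfolding a_def b_def by (rule truncation_core[OF v(1) \<omega>c \<omega>(6) N(1)], rule truncation_core[OF mv \<omega>c \<omega>(6) N(1)])
  from core_comb[OF this, of 1 "-1"] have w: "a - b \<in> core U" by simp
  have wL: "a - b \<in> L2 M" using w by (auto simp: core_def intro: dom_sub)
  define i where "i = (\<lambda>x. indicator (U - K) x :: real)"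
  have UK: "U - K \<in> sets M" using Ks U_sets by auto
  have UKf: "emeasure M (U - K) < \<infinity>"
  proof -
    have "emeasure M (U - K) \<le> emeasure M U" by (rule emeasure_mono) (use U_sets in auto)
    also have "\<dots> = emeasure MU U" using U_sets by (simp add: emeasure_restrict_space)
    also have "\<dots> < \<infinity>" using finite_measure.emeasure_finite[OF finite_MU, of U] by (simp add: top.not_eq_extremum)
    finally show ?thesis .
  qed
  have i2: "(i x)\<^sup>2 = i x" for x by (simp add: i_def indicator_def)
  have iint: "integrable M i" unfolding i_def using UK UKf by simp
  have iL: "i \<in> L2 M" by (rule L2_I) (use iint i2 in auto)
  have ni: "L2.nrm M (N *\<^sub>R i) \<le> e3"
  proof -
    have "(L2.nrm M i)\<^sup>2 = measure M (U - K)"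
      unfolding L2_norm2_eq[symmetric] L2_norm2_def i2 using UK by (simp add: i_def)
    also have "\<dots> \<le> (e3 / (N + 1))\<^sup>2" using K(3) by (simp add: \<delta>_def)
    finally have "L2.nrm M i \<le> e3 / (N + 1)" by (rule power2_le_imp_le) (use e3 N in simp)
    then have "N * L2.nrm M i \<le> N * (e3 / (N + 1))" using N by (intro mult_left_mono)
    also have "\<dots> \<le> e3" using N e3 by (simp add: field_simps)
    finally show ?thesis using N L2.nrm_scale[OF iL, of N] by simp
  qed
  have U': "x \<in> topspace X" if "x \<in> U" for x using that openin_subset[OF U_open] by blast
  have "L2.nrm MU d \<le> L2.nrm M d" if "d \<in> L2 M" for d
    using nrm_MU_le(2)[OF that measurable_restrict[OF L2_measurable[OF that]]] by simp
  then have "L2.nrm MU (z - u) \<le> L2.nrm M (z - u)" "L2.nrm MU (u - v) \<le> L2.nrm M (u - v)"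
    using z uL vL by auto
  moreover have "L2.nrm MU (v - (a - b)) \<le> L2.nrm M (N *\<^sub>R i)"
  proof (rule nrm_MU_le(2))
    show "N *\<^sub>R i \<in> L2 M" using iL by auto
    show "v - (a - b) \<in> borel_measurable MU" using vL wL by (intro measurable_restrict L2_measurable) auto
    have "\<bar>v x - (a x - b x)\<bar> \<le> \<bar>N * i x\<bar>" if x: "x \<in> U" for x
    proof (cases "x \<in> K")
      case True
      then show ?thesis using \<omega>(4,5) N(2)[OF U'[OF x]] by (auto simp: a_def b_def subset_iff)
    next
      case False
      have "0 \<le> N * \<omega> x" using N(1) \<omega>(6) by simp
      then show ?thesis using N(2)[OF U'[OF x]] False x by (auto simp: a_def b_def i_def)
    qed
    then show "AE x in MU. \<bar>(v - (a - b)) x\<bar> \<le> \<bar>(N *\<^sub>R i) x\<bar>" unfolding AE_MU by simp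
  qed
  moreover have r: "z \<in> L2 MU" "u \<in> L2 MU" "v \<in> L2 MU" "a - b \<in> L2 MU"
    using z uL vL wL by (auto intro: L2_restrict)
  ultimately have "L2.nrm MU (z - (a - b)) < \<epsilon>"
    using L2.nrm_triangle_diff[OF r(1,2,4)] L2.nrm_triangle_diff[OF r(2,3,4)] zu uv ni
    unfolding e3_def by linarith
  moreover have "L2.nrm MU (f - (a - b)) = L2.nrm MU (z - (a - b))"
    unfolding nrm_MU zero_ext_lin by (simp add: z_def zero_ext_def cong: if_cong)
  ultimately show ?thesis using w by metis
qed

lemma densely_defined_DU: "densely_defined DU"
  unfolding densely_defined_def
proof (intro ballI allI impI)
  fix f and \<epsilon> :: real assume f: "f \<in> L2 (Meas DU)" and e: "\<epsilon> > 0"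
  obtain \<phi> where \<phi>: "\<phi> \<in> core U" "L2.nrm MU (f - \<phi>) < sqrt \<epsilon>"
    using core_approx[of f "sqrt \<epsilon>"] f e by auto
  have d: "f - \<phi> \<in> L2 MU"
    using f core_dom(2)[OF \<phi>(1)] nonneg_symmetric_DU by (auto simp: nonneg_symmetric_form_def)
  have "L2_norm2 MU (f - \<phi>) < (sqrt \<epsilon>)\<^sup>2"
    unfolding L2_norm2_eq by (rule power_strict_mono[OF \<phi>(2)]) (use d in auto)
  then show "\<exists>u\<in>dom DU. L2_norm2 (Meas DU) (\<lambda>x. f x - u x) < \<epsilon>"
    using core_dom(2)[OF \<phi>(1)] e by (auto simp: fun_diff_def)
qed

lemma finite_markov_DU: "finite_markov_form DU"
  using nonneg_symmetric_DU densely_defined_DU closed_DU markov_DU finite_MU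
  by (simp add: finite_markov_form_def)

sublocale U: finite_markov_form DU
  rewrites "Meas DU = MU"
  by (rule finite_markov_DU) simp

text \<open>Since \<open>\<omega> = 1\<close> on \<open>K\<close>, the minimum of
  \<open>\<phi>\<close> and \<open>n * \<omega>\<close> equals that of \<open>\<phi>\<close> and
  \<open>n\<close> a.e., so its energy is bounded by that of \<open>\<phi>\<close> uniformly in
  \<open>n\<close>, whatever the energy of \<open>n * \<omega>\<close>.\<close>

lemma compact_support_dom:
  assumes \<phi>: "\<phi> \<in> dom D" "AE x in M. 0 \<le> \<phi> x" and K: "compactin X K" "K \<subseteq> U"
    and z: "AE x in M. x \<notin> K \<longrightarrow> \<phi> x = 0"
  shows "\<phi> \<in> dom DU"
proof (rule dom_DU_of_approximation)
  have \<phi>L: "\<phi> \<in> L2 M" by (rule dom_sub[OF \<phi>(1)])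
  show "\<phi> \<in> L2 MU" by (rule L2_restrict[OF \<phi>L])
  obtain \<omega> V where \<omega>: "\<omega> \<in> dom D \<inter> C_c X" "tsupp X \<omega> \<subseteq> U" "openin X V" "K \<subseteq> V"
    "\<And>x. x \<in> V \<Longrightarrow> \<omega> x = 1" "\<And>x. 0 \<le> \<omega> x" "\<And>x. \<omega> x \<le> 1"
    using cutoff[OF K(1) U_open K(2)] by blast
  have \<omega>c: "\<omega> \<in> core U" using \<omega> by (simp add: core_def)
  define w where "w n = (\<lambda>x. min (\<phi> x) (real n * \<omega> x))" for n
  have wU: "w n \<in> dom DU" for n unfolding w_def by (rule min_core_dom[OF \<phi> \<omega>c \<omega>(6)]) simp
  define T where "T n s = min s (real n)" for n s
  have AEw: "AE x in M. T n (\<phi> x) = zero_ext U (w n) x" for n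
    using z \<phi>(2)
  proof eventually_elim
    case (elim x)
    have "\<omega> x = 1" if "x \<in> K" using that \<omega>(4,5) by auto
    then show ?case using elim \<omega>(6)[of x] K(2) by (cases "x \<in> K") (auto simp: T_def w_def zero_ext_def)
  qed
  have T: "(\<lambda>x. T n (\<phi> x)) \<in> dom D" "form D (\<lambda>x. T n (\<phi> x)) (\<lambda>x. T n (\<phi> x)) \<le> form D \<phi> \<phi>" for n
    by (rule markov_form_comp[OF mkD _ _ \<phi>(1)]; auto simp: T_def)+
  have zw: "zero_ext U (w n) \<in> dom D" for n using wU by (simp add: dom_DU)
  have Ew: "form D (zero_ext U (w n)) (zero_ext U (w n)) \<le> form D \<phi> \<phi>" for n
    using form_congD[OF T(1) AEw _ T(1) AEw, of n n] L2_measurable[OF dom_sub[OF zw]] T(2) by simp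
  have lim: "(\<lambda>n. L2.nrm M ((\<lambda>x. T n (\<phi> x)) - \<phi>)) \<longlonglongrightarrow> 0"
  proof (rule L2_dominated_convergence(3)[OF \<phi>L])
    show "AE x in M. \<bar>T n (\<phi> x)\<bar> \<le> \<phi> x" for n using \<phi>(2) by eventually_elim (auto simp: T_def)
    have "(\<lambda>n. T n s) \<longlonglongrightarrow> s" for s
    proof (rule tendsto_eventually)
      obtain N where N: "s \<le> real N" using real_arch_simple by blast
      show "\<forall>\<^sub>F n in sequentially. T n s = s"
        by (rule eventually_sequentiallyI[of N]) (use N in \<open>auto simp: T_def\<close>)
    qed
    then show "AE x in M. (\<lambda>n. T n (\<phi> x)) \<longlonglongrightarrow> \<phi> x" by simp
  qed (use \<phi>L T(1) in \<open>auto intro: L2_measurable dom_sub\<close>)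
  fix \<epsilon> :: real assume "\<epsilon> > 0"
  from order_tendstoD(2)[OF lim this] obtain n where n: "L2.nrm M ((\<lambda>x. T n (\<phi> x)) - \<phi>) < \<epsilon>"
    by (auto simp: eventually_sequentially)
  have "L2.nrm MU (w n - \<phi>) \<le> L2.nrm M ((\<lambda>x. T n (\<phi> x)) - \<phi>)"
  proof (rule nrm_MU_le(2))
    show "(\<lambda>x. T n (\<phi> x)) - \<phi> \<in> L2 M" using T(1) \<phi>L by (auto intro: dom_sub)
    show "w n - \<phi> \<in> borel_measurable MU" using wU \<phi>L U.dom_L2 by (intro L2_measurable) (auto intro: L2_restrict)
    show "AE x in MU. \<bar>(w n - \<phi>) x\<bar> \<le> \<bar>((\<lambda>x. T n (\<phi> x)) - \<phi>) x\<bar>"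
      unfolding AE_MU using AEw[of n] by eventually_elim (auto simp: zero_ext_def)
  qed
  with n Ew show "\<exists>w\<in>dom DU. L2.nrm MU (w - \<phi>) < \<epsilon> \<and> form D (zero_ext U w) (zero_ext U w) \<le> form D \<phi> \<phi>"
    using wU by (meson le_less_trans)
qed


section \<open>Supports and locality in the restricted space\<close>

lemma msupp_DU:
  assumes "x \<in> U" "x \<in> msupp X M (zero_ext U v)"
  shows "x \<in> msupp (subtopology X U) MU v"
proof (rule ccontr)
  assume "x \<notin> msupp (subtopology X U) MU v"
  moreover have "x \<in> topspace (subtopology X U)" using assms U_sets by (auto simp: space_M[symmetric])
  ultimately obtain W where W: "openin (subtopology X U) W" "AE x in MU. x \<in> W \<longrightarrow> v x = 0" "x \<in> W"
    by (auto simp: msupp_def)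
  have "openin X W" using W(1) by (metis openin_trans_full U_open)
  moreover have "AE x in M. x \<in> W \<longrightarrow> zero_ext U v x = 0"
    using W(2)[unfolded AE_MU] by eventually_elim (auto simp: zero_ext_def)
  ultimately have "x \<notin> msupp X M (zero_ext U v)" using W(3) unfolding msupp_def by blast
  then show False using assms by simp
qed

text \<open>Only the constant 0 is transferred: the support of the zero extension can reach outside
  \<open>U\<close>, where the extension of \<open>u\<close> is 0 and need not match another
  constant.\<close>

lemma local_DU:
  assumes u: "u \<in> dom DU" and v: "v \<in> dom DU" and z: "AE x in MU. x \<in> msupp (Top DU) MU v \<longrightarrow> u x = 0"
  shows "form DU u v = 0"
proof -
  have "AE x in M. x \<in> msupp X M (zero_ext U v) \<longrightarrow> zero_ext U u x = 0"
    using z[unfolded AE_MU DU_simps] by eventually_elim (use msupp_DU in \<open>auto simp: zero_ext_def\<close>)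
  then show ?thesis using loc u v unfolding strongly_local_form_def dom_DU DU_simps by blast
qed

lemma msupp_tests:
  assumes K: "compactin X K" "K \<subseteq> U" and z: "AE x in MU. x \<notin> K \<longrightarrow> \<phi> x = 0"
  shows "msupp (subtopology X U) MU \<phi> \<subseteq> K" "compactin (subtopology X U) (msupp (subtopology X U) MU \<phi>)"
proof -
  let ?Y = "subtopology X U"
  have KY: "compactin ?Y K" using K by (simp add: compactin_subtopology)
  have "closedin ?Y K" by (rule closedin_subset_topspace[OF compact_closed[OF K(1)] K(2)])
  then have o: "openin ?Y (topspace ?Y - K)" by blast
  have "AE x in MU. x \<in> topspace ?Y - K \<longrightarrow> \<phi> x = 0" using z by eventually_elim auto
  with o show sub: "msupp ?Y MU \<phi> \<subseteq> K" unfolding msupp_def by blast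
  have "closedin ?Y (msupp ?Y MU \<phi>)" unfolding msupp_def by (intro closedin_diff closedin_topspace openin_Union) auto
  then show "compactin ?Y (msupp ?Y MU \<phi>)" by (rule closed_compactin[OF KY sub])
qed

end

text \<open>The function chosen in \<open>form_loc\<close> and \<open>h\<close> agree near the
  support of \<open>\<phi>\<close>, so locality with the constant 0 annihilates their difference. In
  this form the lemma serves the whole space as well as the restricted one.\<close>

lemma form_loc_eq:
  assumes nns: "nonneg_symmetric_form D"
    and loc: "\<And>u v. u \<in> dom D \<Longrightarrow> v \<in> dom D \<Longrightarrow> AE x in Meas D. x \<in> msupp (Top D) (Meas D) v \<longrightarrow> u x = 0 \<Longrightarrow> form D u v = 0"
    and h: "h \<in> dom D" and \<phi>: "\<phi> \<in> dom D" and V: "openin (Top D) V" "msupp (Top D) (Meas D) \<phi> \<subseteq> V"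
    and eq: "AE x in Meas D. x \<in> V \<longrightarrow> f x = h x"
  shows "form_loc D f \<phi> = form D h \<phi>"
proof -
  define Q where "Q h \<longleftrightarrow> h \<in> dom D \<and> (\<exists>V. openin (Top D) V \<and> msupp (Top D) (Meas D) \<phi> \<subseteq> V \<and>
        (AE x in Meas D. x \<in> V \<longrightarrow> f x = h x))" for h
  define h' where "h' = (SOME h. Q h)"
  have "Q h" using h V eq by (auto simp: Q_def)
  then have "Q h'" unfolding h'_def by (rule someI[of Q])
  then obtain W where h': "h' \<in> dom D" and W: "msupp (Top D) (Meas D) \<phi> \<subseteq> W" "AE x in Meas D. x \<in> W \<longrightarrow> f x = h' x"
    by (auto simp: Q_def)
  interpret E: semi_inner "dom D" "form D" by (rule semi_inner_form[OF nns]) (use h in auto)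
  have "AE x in Meas D. x \<in> msupp (Top D) (Meas D) \<phi> \<longrightarrow> (h' - h) x = 0"
    using eq W(2) by eventually_elim (use V(2) W(1) in auto)
  then have "form D (h' - h) \<phi> = 0" by (intro loc) (use h h' \<phi> in auto)
  then show ?thesis using h h' \<phi> by (simp add: form_loc_def E.ip_lin flip: Q_def h'_def)
qed

text \<open>\<open>g\<close> itself need not lie in the domain; on the neighbourhood
  \<open>V\<close> of \<open>K\<close> it is replaced by \<open>h\<close>. The inequalities for
  \<open>g\<close> and \<open>- g\<close> combine to an equation.\<close>

lemma (in sl_dirichlet_open) harmonic_form:
  assumes g: "weakly_harmonic DU lam g" and V: "openin X V" "V \<subseteq> U" and K: "compactin X K" "K \<subseteq> V"
    and h: "h \<in> dom DU" "AE x in MU. x \<in> V \<longrightarrow> g x = h x" and \<phi>: "\<phi> \<in> U.tests K"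
  shows "form DU h \<phi> + lam * l2_ip MU h \<phi> = 0"
proof -
  let ?Y = "subtopology X U"
  have \<phi>d: "\<phi> \<in> dom DU" and nn: "AE x in MU. 0 \<le> \<phi> x" and z: "AE x in MU. x \<notin> K \<longrightarrow> \<phi> x = 0"
    using \<phi> by (auto simp: U.tests_def)
  have KU: "K \<subseteq> U" using K V by auto
  note ms = msupp_tests[OF K(1) KU z]
  have \<phi>c: "\<phi> \<in> dom_c DU" using \<phi>d ms by (simp add: dom_c_def)
  have oV: "openin (Top DU) V" using V U_open by (simp add: openin_open_subtopology)
  have *: "form_loc_shift DU lam g' \<phi> = form DU h' \<phi> + lam * l2_ip MU h' \<phi>"
    if h': "h' \<in> dom DU" and eq: "AE x in MU. x \<in> V \<longrightarrow> g' x = h' x" and g': "g' \<in> borel_measurable MU" for g' h'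
  proof -
    have "form_loc DU g' \<phi> = form DU h' \<phi>"
    proof (rule form_loc_eq[OF nonneg_symmetric_DU _ h' \<phi>d oV])
      show "form DU u v = 0" if "u \<in> dom DU" "v \<in> dom DU"
        "AE x in Meas DU. x \<in> msupp (Top DU) (Meas DU) v \<longrightarrow> u x = 0" for u v
        by (rule local_DU[OF that(1,2)]) (use that(3) in \<open>simp only: DU_simps\<close>)
      show "msupp (Top DU) (Meas DU) \<phi> \<subseteq> V" using ms(1) K(2) by simp
      show "AE x in Meas DU. x \<in> V \<longrightarrow> g' x = h' x" unfolding DU_simps by (rule eq)
    qed
    moreover have "(\<integral>x. g' x * \<phi> x \<partial>MU) = l2_ip MU h' \<phi>"
      unfolding l2_ip_def
    proof (rule integral_cong_AE)
      show "AE x in MU. g' x * \<phi> x = h' x * \<phi> x"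
        using eq z by eventually_elim (use K(2) in auto)
    qed (use g' U.dom_measurable[OF h'] U.dom_measurable[OF \<phi>d] in measurable)
    ultimately show ?thesis by (simp add: form_loc_shift_def)
  qed
  have gm: "g \<in> borel_measurable MU"
    using g by (simp add: weakly_harmonic_def weakly_subharmonic_def dom_loc_def L2_loc_def)
  have "form_loc_shift DU lam g \<phi> \<le> 0" "form_loc_shift DU lam (\<lambda>x. - g x) \<phi> \<le> 0"
    using g \<phi>c nn unfolding weakly_harmonic_def weakly_subharmonic_def DU_simps by blast+
  moreover have "form_loc_shift DU lam g \<phi> = form DU h \<phi> + lam * l2_ip MU h \<phi>" by (rule *[OF h gm])
  moreover have "form_loc_shift DU lam (\<lambda>x. - g x) \<phi> = form DU (- h) \<phi> + lam * l2_ip MU (- h) \<phi>"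
  proof (rule *)
    show "AE x in MU. x \<in> V \<longrightarrow> - g x = (- h) x" using h(2) by eventually_elim simp
  qed (use h(1) gm in auto)
  moreover have "form DU (- h) \<phi> = - form DU h \<phi>" "l2_ip MU (- h) \<phi> = - l2_ip MU h \<phi>"
    using U.E.ip_minus[OF h(1) \<phi>d] L2.ip_minus[OF U.dom_L2[OF h(1)] U.dom_L2[OF \<phi>d]] by auto
  ultimately show ?thesis by simp
qed

section \<open>Local subsolutions, their powers and the conclusion\<close>

lemma (in sl_dirichlet_open) local_subsolution:
  assumes lam: "lam \<ge> 0" and ultra: "ultracontractive DU" and f: "f \<in> L1_loc X M"
    and g: "g \<in> C_b (subtopology X U)" "weakly_harmonic DU lam g"
    and defect: "\<forall>t>0. AE x in MU. exp (- t * lam) * heat DU t (\<lambda>y. f y - g y) x \<ge> f x - g x"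
    and V: "openin X V" "compactin X (X closure_of V)" "X closure_of V \<subseteq> U"
  shows "\<exists>w\<in>dom DU. \<exists>N. (AE x in MU. \<bar>w x\<bar> \<le> N) \<and>
    (\<forall>c\<ge>0. AE x in MU. x \<in> V \<longrightarrow> max (f x - c) 0 = max (w x - c) 0) \<and>
    (\<forall>K \<phi>. compactin X K \<longrightarrow> K \<subseteq> V \<longrightarrow> \<phi> \<in> U.tests K \<longrightarrow> form DU w \<phi> + lam * l2_ip MU w \<phi> \<le> 0)"
proof -
  have VU: "V \<subseteq> X closure_of V" "V \<subseteq> U"
    using V closure_of_subset[OF openin_subset[OF V(1)]] by auto
  have UX: "U \<subseteq> topspace X" by (rule openin_subset[OF U_open])
  then obtain B where B: "\<And>x. x \<in> U \<Longrightarrow> \<bar>g x\<bar> \<le> B" "B \<ge> 0"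
  proof -
    have "bounded (g ` U)" using g(1) UX by (simp add: C_b_def topspace_subtopology Int_absorb1)
    then obtain b where "\<And>x. x \<in> U \<Longrightarrow> \<bar>g x\<bar> \<le> b" by (auto simp: bounded_iff)
    then show ?thesis using that[of "max b 0"] by fastforce
  qed
  have AEB: "AE x in MU. \<bar>g x\<bar> \<le> B" unfolding AE_MU using B by simp
  have gloc: "g \<in> dom_loc DU" using g(2) by (simp add: weakly_harmonic_def weakly_subharmonic_def)
  have gm: "g \<in> borel_measurable MU" using gloc by (simp add: dom_loc_def L2_loc_def)
  define d where "d = (\<lambda>x. f x - g x)"
  have fm: "f \<in> borel_measurable M" using f by (simp add: L1_loc_def)
  have d_int: "integrable MU d"
  proof -
    have "set_integrable M (X closure_of U) f"
      using f U by (simp add: L1_loc_def rel_compact_open_def)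
    then have "set_integrable M U f"
      by (rule set_integrable_subset) (use U_sets closure_of_subset[OF UX] in auto)
    then have "integrable MU f"
      using integrable_restrict_space[OF U_sets(2), of f] by (simp add: set_integrable_def)
    moreover have "integrable MU g" by (rule U.L2_integrable[OF U.bounded_L2[OF gm AEB]])
    ultimately show ?thesis unfolding d_def by simp
  qed
  have "d \<in> L1 (Meas DU)" unfolding DU_simps using d_int by (simp add: L1_def)
  then have ult: "heat DU 1 d \<in> Linf MU"
    using ultra unfolding ultracontractive_def DU_simps by (meson zero_less_one)
  have def': "AE x in MU. d x \<le> exp (- t * lam) * heat DU t d x" if "t > 0" for t
    using defect that by (simp add: d_def)
  define p where "p = (\<lambda>x. max (d x) 0)"
  define k where "k = (\<lambda>x. max (- d x) 0)"
  have pC: "\<exists>C. AE x in MU. p x \<le> C"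
    unfolding p_def by (rule U.shift_defective_parts(1)[OF d_int lam ult def'])
  have p: "p \<in> dom DU"
    unfolding p_def by (rule U.shift_defective_parts(2)[OF d_int lam ult def'])
  have fp: "form DU p v = 0" if "v \<in> dom DU" for v
    unfolding p_def by (rule U.shift_defective_parts(3)[OF d_int lam ult def' that])
  have p0: "AE x in MU. p x = 0" if "lam > 0"
    unfolding p_def by (rule U.shift_defective_parts(4)[OF d_int lam ult def' that])
  have kP: "AE x in MU. exp (- t * lam) * U.P t y x \<le> k x" if "t > 0" "y \<in> L2 MU" "AE x in MU. y x \<le> k x" for t y
    using that(3) unfolding k_def by (intro U.shift_defective_parts(5)[OF d_int lam ult def'] that(1,2))
  obtain C where C: "AE x in MU. p x \<le> C" "C \<ge> 0"
  proof -
    obtain C where "AE x in MU. p x \<le> C" using pC by blast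
    then have "AE x in MU. p x \<le> max C 0" by eventually_elim simp
    then show ?thesis using that by simp
  qed
  \<comment> \<open>With this level \<open>g + p \<le> n\<close> a.e. on \<open>U\<close>, so
    cutting \<open>k\<close> at \<open>n\<close> changes \<open>f\<close> only where
    \<open>f\<close> is nonpositive.\<close>
  define n where "n = B + C"
  have n: "n \<ge> 0" using B C by (simp add: n_def)
  define s where "s = (\<lambda>x. min (k x) n)"
  have s: "0 \<le> s x" "s x \<le> n" "s x \<le> k x" for x using n by (auto simp: s_def k_def)
  have km: "k \<in> borel_measurable MU" using borel_measurable_integrable[OF d_int] unfolding k_def by measurable
  then have sm: "s \<in> borel_measurable MU" unfolding s_def by measurable
  have sL: "s \<in> L2 MU" by (rule U.bounded_L2[OF sm, of n]) (use s in simp)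
  have ex: "U.excessive lam s"
    unfolding U.excessive_def
  proof (intro conjI allI impI sL)
    fix t :: real assume t: "t > 0"
    have "AE x in MU. exp (- t * lam) * U.P t s x \<le> k x" by (rule kP[OF t sL]) (use s in simp)
    moreover have "AE x in MU. U.P t s x \<le> n" by (rule U.P_le_const[OF _ sL]) (use t s n in auto)
    moreover have "AE x in MU. 0 \<le> U.P t s x" by (rule U.P_nonneg[OF _ sL]) (use t s in auto)
    ultimately show "AE x in MU. exp (- t * lam) * U.P t s x \<le> s x"
    proof eventually_elim
      case (elim x)
      have "exp (- t * lam) * U.P t s x \<le> 1 * U.P t s x"
        using elim(3) t lam by (intro mult_right_mono) auto
      then show ?case using elim by (simp add: s_def)
    qed
  qed
  obtain \<omega> V1 where \<omega>: "\<omega> \<in> dom D \<inter> C_c X" "tsupp X \<omega> \<subseteq> U" "openin X V1" "X closure_of V \<subseteq> V1"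
    "\<And>x. x \<in> V1 \<Longrightarrow> \<omega> x = 1" "\<And>x. 0 \<le> \<omega> x" "\<And>x. \<omega> x \<le> 1"
    using cutoff[OF V(2) U_open V(3)] by blast
  have \<omega>V: "\<omega> x = 1" if "x \<in> V" for x using \<omega>(4,5) VU that by blast
  \<comment> \<open>Equals the bound \<open>n\<close> of \<open>s\<close> on \<open>V\<close>, so
    the minimum with \<open>s\<close> leaves \<open>s\<close> unchanged there, and
    \<open>excessive_min\<close> applies to tests supported in \<open>V\<close>.\<close>
  define v where "v = n *\<^sub>R \<omega>"
  have vd: "v \<in> dom DU" using core_dom(2)[of \<omega>] \<omega> by (auto simp: v_def core_def)
  define m where "m = (\<lambda>x. min (s x) (v x))"
  have md: "m \<in> dom DU"
    and mE: "\<And>\<phi>. \<phi> \<in> dom DU \<Longrightarrow> AE x in MU. 0 \<le> \<phi> x \<Longrightarrow> AE x in MU. \<phi> x \<noteq> 0 \<longrightarrow> s x \<le> v x \<Longrightarrow>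
      0 \<le> form DU m \<phi> + lam * l2_ip MU m \<phi>"
    unfolding m_def by (rule U.excessive_min[OF ex lam vd]; assumption)+
  have m: "0 \<le> m x" "m x \<le> n" for x using s[of x] n \<omega>(6)[of x] by (auto simp: m_def v_def)
  have vV: "v x = n" if "x \<in> V" for x using \<omega>V[OF that] by (simp add: v_def)
  have mV: "m x = s x" if "x \<in> V" for x using vV[OF that] s[of x] by (simp add: m_def)
  have "rel_compact_open (subtopology X U) V"
  proof -
    have "subtopology X U closure_of V = X closure_of V"
      using VU V(3) by (simp add: closure_of_subtopology Int_absorb1 Int_absorb2)
    then show ?thesis
      using V VU U_open by (simp add: rel_compact_open_def compactin_subtopology openin_open_subtopology)
  qed
  then obtain h0 where h0: "h0 \<in> dom DU" "AE x in MU. x \<in> V \<longrightarrow> g x = h0 x"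
    using gloc unfolding dom_loc_def DU_simps by blast
  \<comment> \<open>\<open>h0\<close> equals \<open>g\<close> a.e. on \<open>V\<close> but may be
    unbounded elsewhere; clamping at the bound of \<open>g\<close> preserves this equality.\<close>
  define h where "h = (\<lambda>x. max (- B) (min B (h0 x)))"
  have hd: "h \<in> dom DU"
    unfolding h_def by (rule markov_form_comp(1)[OF markov_DU _ _ h0(1), where T = "\<lambda>s. max (- B) (min B s)"]) (use B in auto)
  have hV: "AE x in MU. x \<in> V \<longrightarrow> g x = h x"
    using h0(2) AEB by eventually_elim (auto simp: h_def)
  define w where "w = h + p - m"
  have wd: "w \<in> dom DU" using hd p md by (auto simp: w_def)
  have wb: "AE x in MU. \<bar>w x\<bar> \<le> B + C + n"
    using C(1)
  proof eventually_elim
    case (elim x)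
    have "\<bar>h x\<bar> \<le> B" using B(2) by (auto simp: h_def)
    then show ?case using elim m[of x] by (auto simp: w_def p_def)
  qed
  have wV: "AE x in MU. x \<in> V \<longrightarrow> max (f x - c) 0 = max (w x - c) 0" if c: "c \<ge> 0" for c
    using hV C(1) AEB
  proof eventually_elim
    case (elim x)
    show ?case
    proof
      assume x: "x \<in> V"
      have w: "w x = g x + p x - s x" using elim x mV[OF x] by (simp add: w_def)
      have f: "f x = g x + p x - k x" by (simp add: p_def k_def d_def)
      show "max (f x - c) 0 = max (w x - c) 0"
      proof (cases "k x \<le> n")
        case True
        then show ?thesis by (simp add: w f s_def)
      next
        case False
        then have "f x \<le> 0" "w x \<le> 0" using elim w f by (auto simp: n_def s_def)
        then show ?thesis using c by simp
      qed
    qed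
  qed
  have wt: "form DU w \<phi> + lam * l2_ip MU w \<phi> \<le> 0" if K: "compactin X K" "K \<subseteq> V" and \<phi>: "\<phi> \<in> U.tests K" for K \<phi>
  proof -
    have \<phi>d: "\<phi> \<in> dom DU" and nn: "AE x in MU. 0 \<le> \<phi> x" and z: "AE x in MU. x \<notin> K \<longrightarrow> \<phi> x = 0"
      using \<phi> by (auto simp: U.tests_def)
    note L = U.dom_L2[OF hd] U.dom_L2[OF p] U.dom_L2[OF md] U.dom_L2[OF \<phi>d]
    have "form DU h \<phi> + lam * l2_ip MU h \<phi> = 0"
      by (rule harmonic_form[OF g(2) V(1) VU(2) K hd hV \<phi>])
    \<comment> \<open>\<open>p\<close> is harmonic for the unshifted form; the shift is harmless
      because \<open>p\<close> vanishes a.e. when \<open>lam > 0\<close>.\<close>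
    moreover have "lam * l2_ip MU p \<phi> = 0"
    proof (cases "lam = 0")
      case False
      then have "AE x in MU. p x * \<phi> x = 0" using p0 lam by (auto elim: eventually_mono)
      then have "l2_ip MU p \<phi> = 0" unfolding l2_ip_def by (rule integral_eq_zero_AE)
      then show ?thesis by simp
    qed simp
    moreover have "0 \<le> form DU m \<phi> + lam * l2_ip MU m \<phi>"
    proof (rule mE[OF \<phi>d nn])
      show "AE x in MU. \<phi> x \<noteq> 0 \<longrightarrow> s x \<le> v x"
        using z by eventually_elim (use K(2) vV s(2) in auto)
    qed
    moreover have "form DU w \<phi> = form DU h \<phi> + form DU p \<phi> - form DU m \<phi>"
      using U.E.ip_diff[of "h + p" m \<phi>] U.E.ip_add[OF hd p \<phi>d] hd p md \<phi>d by (simp add: w_def)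
    moreover have "l2_ip MU w \<phi> = l2_ip MU h \<phi> + l2_ip MU p \<phi> - l2_ip MU m \<phi>"
      using L2.ip_diff[of "h + p" MU m \<phi>] L2.ip_add[OF L(1,2,4)] L by (simp add: w_def)
    moreover from this have "lam * l2_ip MU w \<phi> = lam * l2_ip MU h \<phi> + lam * l2_ip MU p \<phi> - lam * l2_ip MU m \<phi>"
      by (simp add: distrib_left right_diff_distrib)
    ultimately show ?thesis using fp[OF \<phi>d] by linarith
  qed
  show ?thesis by (intro bexI[OF _ wd] exI[of _ "B + C + n"] conjI wb allI impI wV wt)
qed

text \<open>For \<open>q \<ge> 2\<close> the power itself lies in the domain of the restricted form
  and is tested directly. For \<open>q < 2\<close> its product with a cutoff is shown to lie there,
  which suffices for membership, as the cutoff is 1 near \<open>K\<close>.\<close>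

lemma (in sl_dirichlet_open) local_power:
  assumes w: "w \<in> dom DU" "AE x in MU. \<bar>w x\<bar> \<le> N" and lam: "lam \<ge> 0" and c: "c \<ge> 0" and q: "q > 1"
    and wV: "AE x in MU. x \<in> V \<longrightarrow> max (f x - c) 0 = max (w x - c) 0"
    and sub: "\<And>K \<phi>. compactin X K \<Longrightarrow> K \<subseteq> V \<Longrightarrow> \<phi> \<in> U.tests K \<Longrightarrow> form DU w \<phi> + lam * l2_ip MU w \<phi> \<le> 0"
    and V: "openin X V" "V \<subseteq> U" and K: "compactin X K" "K \<subseteq> V"
  shows "\<exists>W h. openin X W \<and> K \<subseteq> W \<and> h \<in> dom D \<and>
    (AE x in M. x \<in> W \<longrightarrow> (max (f x - c) 0) powr (q / 2) = h x) \<and>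
    (q \<ge> 2 \<longrightarrow> (\<forall>\<phi>\<in>dom D. (AE x in M. 0 \<le> \<phi> x) \<longrightarrow> (AE x in M. x \<notin> K \<longrightarrow> \<phi> x = 0) \<longrightarrow> form D h \<phi> \<le> 0))"
proof -
  define u where "u = (\<lambda>x. max (w x - c) 0)"
  have ud: "u \<in> dom DU" and usub: "\<And>K \<phi>. compactin X K \<Longrightarrow> K \<subseteq> V \<Longrightarrow> \<phi> \<in> U.tests K \<Longrightarrow> form DU u \<phi> \<le> 0"
    unfolding u_def
    by (rule U.pos_part_subharmonic(1)[OF w lam c sub[OF compactin_empty empty_subsetI]], assumption)
      (rule U.pos_part_subharmonic(2)[OF w lam c sub])
  have u0: "0 \<le> u x" for x by (simp add: u_def)
  have uN: "AE x in MU. u x \<le> max N 0" using w(2) by eventually_elim (use c in \<open>auto simp: u_def\<close>)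
  have uV: "AE x in MU. x \<in> V \<longrightarrow> max (f x - c) 0 = u x" using wV by (simp add: u_def)
  obtain \<omega> W where \<omega>: "\<omega> \<in> dom D \<inter> C_c X" "tsupp X \<omega> \<subseteq> V" "openin X W" "K \<subseteq> W"
    "\<And>x. x \<in> W \<Longrightarrow> \<omega> x = 1" "\<And>x. 0 \<le> \<omega> x" "\<And>x. \<omega> x \<le> 1"
    using cutoff[OF K(1) V(1) K(2)] by blast
  have "\<exists>h\<in>dom DU. (AE x in MU. x \<in> W \<inter> V \<longrightarrow> u x powr (q / 2) = h x) \<and>
    (q \<ge> 2 \<longrightarrow> (\<forall>\<phi>\<in>U.tests K. form DU h \<phi> \<le> 0))"
  proof -
    consider "q = 2" | "q > 2" | "q < 2" by linarith
    then show ?thesis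
    proof cases
      case 1
      then show ?thesis using ud usub[OF K] u0 by (intro bexI[of _ u]) auto
    next
      case 2
      then have q2: "q / 2 > 1" by simp
      show ?thesis
        by (intro bexI[of _ "\<lambda>x. u x powr (q / 2)"])
          (use U.power_subharmonic[OF ud uN u0 q2 usub[OF K]] in auto)
    next
      case 3
      define N1 where "N1 = max N 0"
      \<comment> \<open>\<open>u\<close> is bounded a.e. only, whereas
        \<open>small_power_cutoff_dom\<close> assumes the bound at every point.\<close>
      define u1 where "u1 = (\<lambda>x. min (u x) N1)"
      have eq: "AE x in MU. u x = u1 x" using uN by eventually_elim (simp add: u1_def N1_def)
      have u1m: "u1 \<in> borel_measurable (Meas DU)" using U.dom_measurable[OF ud] unfolding u1_def DU_simps by measurable
      have u1: "u1 \<in> dom DU" "\<And>\<phi>. \<phi> \<in> dom DU \<Longrightarrow> form DU u1 \<phi> = form DU u \<phi>"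
        using nonneg_symmetric_DU ud eq u1m unfolding nonneg_symmetric_form_def DU_simps(1) by blast+
      have Kc: "compactin X (tsupp X \<omega>)" using \<omega> by (simp add: C_c_def)
      have "(\<lambda>x. \<omega> x * u1 x powr (q / 2)) \<in> dom DU"
      proof (rule U.small_power_cutoff_dom[where K = "tsupp X \<omega>"])
        show "form DU u1 \<phi> \<le> 0" if "\<phi> \<in> U.tests (tsupp X \<omega>)" for \<phi>
          using usub[OF Kc \<omega>(2) that] u1(2)[of \<phi>] that by (simp add: U.tests_def)
        show "\<omega> \<in> dom DU" by (rule core_dom(2)) (use \<omega> V in \<open>auto simp: core_def\<close>)
        show "u1 x \<le> N1" for x by (simp add: u1_def)
        show "AE x in MU. x \<notin> tsupp X \<omega> \<longrightarrow> \<omega> x = 0"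
          unfolding AE_MU by (rule AE_I2) (use tsupp_subset[OF openin_topspace] in \<open>auto simp: space_M\<close>)
      qed (use u1 u0 3 q \<omega> in \<open>auto simp: u1_def N1_def\<close>)
      moreover have "AE x in MU. x \<in> W \<inter> V \<longrightarrow> u x powr (q / 2) = \<omega> x * u1 x powr (q / 2)"
        using eq by eventually_elim (use \<omega>(5) in auto)
      ultimately show ?thesis using 3 by (intro bexI[of _ "\<lambda>x. \<omega> x * u1 x powr (q / 2)"]) auto
    qed
  qed
  then obtain h where h: "h \<in> dom DU" "AE x in MU. x \<in> W \<inter> V \<longrightarrow> u x powr (q / 2) = h x"
    "q \<ge> 2 \<Longrightarrow> \<phi> \<in> U.tests K \<Longrightarrow> form DU h \<phi> \<le> 0" for \<phi>
    by blast
  have zh: "zero_ext U h \<in> dom D" using h(1) by (simp add: dom_DU)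
  show ?thesis
  proof (intro exI[of _ "W \<inter> V"] exI[of _ "zero_ext U h"] conjI ballI impI zh)
    show "openin X (W \<inter> V)" using \<omega>(3) V(1) by blast
    show "K \<subseteq> W \<inter> V" using \<omega>(4) K(2) by blast
    show "AE x in M. x \<in> W \<inter> V \<longrightarrow> (max (f x - c) 0) powr (q / 2) = zero_ext U h x"
      using uV[unfolded AE_MU] h(2)[unfolded AE_MU] by eventually_elim (use V(2) in \<open>auto simp: zero_ext_def\<close>)
    fix \<phi> assume q2: "2 \<le> q" and \<phi>: "\<phi> \<in> dom D" "AE x in M. 0 \<le> \<phi> x" "AE x in M. x \<notin> K \<longrightarrow> \<phi> x = 0"
    have \<phi>d: "\<phi> \<in> dom DU" by (rule compact_support_dom[OF \<phi>(1,2) K(1) _ \<phi>(3)]) (use K V in auto)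
    have "\<phi> \<in> U.tests K"
      unfolding U.tests_def AE_MU using \<phi>d \<phi>(2,3) by (auto elim: eventually_mono)
    then have "form D (zero_ext U h) (zero_ext U \<phi>) \<le> 0" using h(3)[OF q2] by simp
    moreover have "AE x in M. \<phi> x = zero_ext U \<phi> x"
      using \<phi>(3) by eventually_elim (use K V in \<open>auto simp: zero_ext_def\<close>)
    then have "form D (zero_ext U h) (zero_ext U \<phi>) = form D (zero_ext U h) \<phi>"
      using form_congD[OF zh _ _ \<phi>(1), of "zero_ext U h" "zero_ext U \<phi>"] \<phi>d zh
      by (auto simp: dom_DU intro: L2_measurable dom_sub)
    ultimately show "form D (zero_ext U h) \<phi> \<le> 0" by simp
  qed
qed

text \<open>Two nested neighbourhoods of \<open>K\<close> are taken: the semigroup lives on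
  \<open>U\<close>, whereas the harmonic part is represented by a domain element on the smaller
  \<open>V\<close>, which still leaves room for a cutoff around \<open>K\<close>.\<close>

lemma (in sl_dirichlet) shift_defective_local_power:
  assumes smooth: "locally_smoothing D" and lam: "lam \<ge> 0" and f: "f \<in> L1_loc X M"
    and defect: "locally_shift_defective D lam f" and c: "c \<ge> 0" and q: "q > 1" and K: "compactin X K"
  shows "\<exists>W h. openin X W \<and> K \<subseteq> W \<and> h \<in> dom D \<and>
    (AE x in M. x \<in> W \<longrightarrow> (max (f x - c) 0) powr (q / 2) = h x) \<and>
    (q \<ge> 2 \<longrightarrow> (\<forall>\<phi>\<in>dom D. (AE x in M. 0 \<le> \<phi> x) \<longrightarrow> (AE x in M. x \<notin> K \<longrightarrow> \<phi> x = 0) \<longrightarrow> form D h \<phi> \<le> 0))"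
proof -
  obtain U where U: "openin X U" "K \<subseteq> U" "compactin X (X closure_of U)" "X closure_of U \<subseteq> topspace X"
    using compact_open_between[OF lc hausdorff K openin_topspace compactin_subset_topspace[OF K]] .
  obtain V where V: "openin X V" "K \<subseteq> V" "compactin X (X closure_of V)" "X closure_of V \<subseteq> U"
    using compact_open_between[OF lc hausdorff K U(1,2)] .
  have Urc: "rel_compact_open X U" using U by (simp add: rel_compact_open_def)
  interpret L: sl_dirichlet_open D U by standard (rule Urc)
  have ultra: "ultracontractive (restrict_form_space D U)" using smooth Urc by (simp add: locally_smoothing_def)
  obtain g where g: "g \<in> C_b (subtopology X U)" "weakly_harmonic (restrict_form_space D U) lam g"
    "\<forall>t>0. AE x in restrict_space M U.
       exp (- t * lam) * heat (restrict_form_space D U) t (\<lambda>y. f y - g y) x \<ge> f x - g x"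
    using defect[unfolded locally_shift_defective_def, THEN conjunct2, THEN spec[of _ U], THEN mp[OF _ Urc]]
    by (elim bexE conjE)
  obtain w N where w: "w \<in> dom (restrict_form_space D U)" "AE x in restrict_space M U. \<bar>w x\<bar> \<le> N"
    "\<forall>c\<ge>0. AE x in restrict_space M U. x \<in> V \<longrightarrow> max (f x - c) 0 = max (w x - c) 0"
    "\<forall>K \<phi>. compactin X K \<longrightarrow> K \<subseteq> V \<longrightarrow> \<phi> \<in> L.U.tests K \<longrightarrow>
      form (restrict_form_space D U) w \<phi> + lam * l2_ip (restrict_space M U) w \<phi> \<le> 0"
    using L.local_subsolution[OF lam ultra f g V(1,3,4)] by (elim bexE exE conjE)
  have "V \<subseteq> U" using V(4) closure_of_subset[OF openin_subset[OF V(1)]] by blast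
  show ?thesis
    by (rule L.local_power[OF w(1,2) lam c q w(3)[rule_format, OF c] w(4)[rule_format] V(1) \<open>V \<subseteq> U\<close> K V(2)])
qed

theorem theorem5p4:
  fixes D :: "'a form_space" and lam :: real and f :: "'a \<Rightarrow> real"
  assumes "strongly_local_dirichlet_space D"
    and "locally_smoothing D"
    and "lam \<ge> 0"
    and "f \<in> L1_loc (Top D) (Meas D)"
    and "locally_shift_defective D lam f"
  shows "\<forall>c q :: real. c \<ge> 0 \<and> q > 1 \<longrightarrow>
           (\<lambda>x. (max (f x - c) 0) powr (q / 2)) \<in> dom_loc D \<and>
           (q \<ge> 2 \<longrightarrow> weakly_subharmonic D 0 (\<lambda>x. (max (f x - c) 0) powr (q / 2)))"
proof (intro allI impI, elim conjE)
  fix c q :: real assume c: "c \<ge> 0" and q: "q > 1"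
  interpret sl_dirichlet D by standard (rule assms(1))
  define F where "F = (\<lambda>x. (max (f x - c) 0) powr (q / 2))"
  have Fm: "F \<in> borel_measurable M"
    using assms(4) unfolding F_def by (auto simp: L1_loc_def)
  have ex: "\<exists>W h. openin X W \<and> K \<subseteq> W \<and> h \<in> dom D \<and> (AE x in M. x \<in> W \<longrightarrow> F x = h x) \<and>
    (q \<ge> 2 \<longrightarrow> (\<forall>\<phi>\<in>dom D. (AE x in M. 0 \<le> \<phi> x) \<longrightarrow> (AE x in M. x \<notin> K \<longrightarrow> \<phi> x = 0) \<longrightarrow> form D h \<phi> \<le> 0))"
    if "compactin X K" for K
    unfolding F_def by (rule shift_defective_local_power[OF assms(2-5) c q that])
  have "F \<in> L2_loc X M"
    unfolding L2_loc_def
  proof (intro CollectI conjI allI impI Fm)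
    fix K assume K: "compactin X K"
    from ex[OF K] obtain W h where h: "K \<subseteq> W" "h \<in> dom D" "AE x in M. x \<in> W \<longrightarrow> F x = h x" by blast
    have Ks: "K \<in> sets M" by (rule sets_closed[OF compact_closed[OF K]])
    have hL: "h \<in> L2 M" by (rule dom_sub[OF h(2)])
    have "set_integrable M K (\<lambda>x. (h x)\<^sup>2)"
      unfolding set_integrable_def using integrable_mult_indicator[OF Ks L2_D(2)[OF hL]] .
    moreover have "set_integrable M K (\<lambda>x. (F x)\<^sup>2) \<longleftrightarrow> set_integrable M K (\<lambda>x. (h x)\<^sup>2)"
      unfolding set_integrable_def
    proof (rule integrable_cong_AE)
      show "AE x in M. indicator K x *\<^sub>R (F x)\<^sup>2 = indicator K x *\<^sub>R (h x)\<^sup>2"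
        using h(3) by eventually_elim (use h(1) in \<open>auto simp: indicator_def\<close>)
    qed (use Fm Ks L2_measurable[OF hL] in measurable)
    ultimately show "set_integrable M K (\<lambda>x. (F x)\<^sup>2)" by simp
  qed
  moreover have "\<exists>h\<in>dom D. AE x in M. x \<in> U \<longrightarrow> F x = h x" if U: "rel_compact_open X U" for U
  proof -
    \<comment> \<open>A relatively compact open set is handled through its closure, so that the
      neighbourhood \<open>W\<close> contains it.\<close>
    have "compactin X (X closure_of U)" using U by (simp add: rel_compact_open_def)
    from ex[OF this] obtain W h where h: "X closure_of U \<subseteq> W" "h \<in> dom D" "AE x in M. x \<in> W \<longrightarrow> F x = h x" by blast
    have "U \<subseteq> W" using h(1) U closure_of_subset[OF openin_subset] by (fastforce simp: rel_compact_open_def)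
    then have "AE x in M. x \<in> U \<longrightarrow> F x = h x" using h(3) by (auto elim: eventually_mono)
    then show ?thesis using h(2) by blast
  qed
  ultimately have Floc: "F \<in> dom_loc D" by (simp add: dom_loc_def)
  have "weakly_subharmonic D 0 F" if q2: "q \<ge> 2"
    unfolding weakly_subharmonic_def
  proof (intro conjI ballI impI Floc)
    fix \<phi> assume \<phi>: "\<phi> \<in> dom_c D" "AE x in M. 0 \<le> \<phi> x"
    \<comment> \<open>The representative \<open>h\<close> is taken for the support of the given test
      function; \<open>form_loc_eq\<close> shows that the extended form does not depend on this
      choice.\<close>
    define K where "K = msupp X M \<phi>"
    have \<phi>d: "\<phi> \<in> dom D" and K: "compactin X K" using \<phi>(1) by (auto simp: dom_c_def K_def)
    from ex[OF K] q2 obtain W h where h: "openin X W" "K \<subseteq> W" "h \<in> dom D" "AE x in M. x \<in> W \<longrightarrow> F x = h x"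
      "\<And>\<psi>. \<psi> \<in> dom D \<Longrightarrow> AE x in M. 0 \<le> \<psi> x \<Longrightarrow> AE x in M. x \<notin> K \<longrightarrow> \<psi> x = 0 \<Longrightarrow> form D h \<psi> \<le> 0"
      by blast
    have "form_loc D F \<phi> = form D h \<phi>"
    proof (rule form_loc_eq[OF nns _ h(3) \<phi>d h(1) _ h(4)])
      show "form D u v = 0" if "u \<in> dom D" "v \<in> dom D" "AE x in M. x \<in> msupp X M v \<longrightarrow> u x = 0" for u v
        using loc that unfolding strongly_local_form_def by blast
    qed (use h(2) in \<open>simp add: K_def\<close>)
    also have "\<dots> \<le> 0"
      by (rule h(5)[OF \<phi>d \<phi>(2)]) (use AE_msupp[OF L2_measurable[OF dom_sub[OF \<phi>d]]] in \<open>simp add: K_def\<close>)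
    finally show "form_loc_shift D 0 F \<phi> \<le> 0" by (simp add: form_loc_shift_def)
  qed
  with Floc show "(\<lambda>x. (max (f x - c) 0) powr (q / 2)) \<in> dom_loc D \<and>
      (q \<ge> 2 \<longrightarrow> weakly_subharmonic D 0 (\<lambda>x. (max (f x - c) 0) powr (q / 2)))"
    by (simp add: F_def)
qed

end
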